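(* Let $\nu>0$ and $5/6\le\alpha<5/4$, and consider the fractional Navier-Stokes system on $\mathbb{T}^3$ $$u_t+\nu\Lambda^{2\alpha}u+u\cdot\nabla u+\nabla p=0,\qquad \mathrm{div}\,u=0,\qquad u|_{t=0}=u(0),$$ with divergence-free, zero-average initial data $u(0)\in L^2(\mathbb{T}^3)$. Then there exists a constant $T^*>0$ such that the weak solutions of this system become strong solutions on $(T^*,\infty)$; that is, every weak solution $u$ of the system on $(0,\infty)$ is a strong solution on $(T^*,\infty)$.
   Context: Domain: $\Omega=\mathbb{T}^3=\mathbb{R}^3/(2\pi\mathbb{Z})^3$. All initial data and solutions have zero spatial average. For $f$ on $\mathbb{T}^3$, $\hat f(k)=\frac{1}{(2\pi)^3}\int_{\mathbb{T}^3}f(x)e^{-ik\cdot x}\,dx$, $k\in\mathbb{Z}^3$. The operator $\Lambda^{s}=(-\Delta)^{s/2}$ is defined by $\widehat{\Lambda^{s}f}(k)=|k|^{s}\hat f(k)$. $H^s=H^s(\mathbb{T}^3)$ is the Sobolev space with $\|f\|_{H^s}^2=\sum_{k}(1+|k|^2)^s|\hat f(k)|^2$; $\langle\cdot,\cdot\rangle$ is the $L^2(\mathbb{T}^3)$ inner product. Weak solution: given divergence-free $u(0)\in L^2$, $u$ is a weak solution on $(0,T)$ if (i) $u\in L^\infty((0,T);L^2)\cap L^2((0,T);H^\alpha)$ and $\mathrm{div}\,u=0$; (ii) $\int_0^T\big[\langle u,\phi_t\rangle-\nu\langle\Lambda^\alpha u,\Lambda^\alpha\phi\rangle-\langle u\cdot\nabla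 u,\phi\rangle\big]dt=-\langle u(0),\phi(0)\rangle$ for all $\phi\in C_0^\infty([0,T)\times\mathbb{T}^3)$ with $\mathrm{div}\,\phi=0$, where $\langle u\cdot\nabla u,\phi\rangle$ is understood as $-\langle u\otimes u,\nabla\phi\rangle$; (iii) (strong energy inequality) $\|u(t)\|_{L^2}^2+2\nu\int_\tau^t\|\Lambda^\alpha u(s)\|_{L^2}^2ds\le\|u(\tau)\|_{L^2}^2$ for $\tau=0$ and almost every $\tau>0$, and all $t\in[\tau,T)$. Here $u$ is modified on a null set of times so that $t\mapsto u(t)$ is weakly continuous in $L^2$. A weak solution on $(0,\infty)$ is one that is a weak solution on $(0,T)$ for every $T>0$. Strong solution on $(T^*,\infty)$ means: $u\in L^\infty((T^*,T);H^\alpha)\cap L^2((T^*,T);H^{2\alpha})$ for every $T\in(T^*,\infty)$. *)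

theory Defs
  imports "HOL-Analysis.Analysis"
begin

section \<open>Functions on the torus\<close>

text \<open>A function on the torus is a function on \<open>real^3\<close> that is \<open>2\<pi>\<close>-periodic in each
  coordinate; it is integrated over one period cell.\<close>

definition periodic :: "(real^3 \<Rightarrow> 'b) \<Rightarrow> bool" where
  "periodic f \<longleftrightarrow> (\<forall>x i. f (x + axis i (2 * pi)) = f x)"

definition torus :: "(real^3) measure" where
  "torus = lebesgue_on (cbox 0 (\<chi> i. 2 * pi))"

definition torus_inner :: "(real^3 \<Rightarrow> 'b::real_inner) \<Rightarrow> (real^3 \<Rightarrow> 'b) \<Rightarrow> real" where
  "torus_inner f g = (\<integral>x. f x \<bullet> g x \<partial>torus)"

definition torus_L2 :: "(real^3 \<Rightarrow> real^3) \<Rightarrow> bool" where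
  "torus_L2 f \<longleftrightarrow> periodic f \<and> f \<in> borel_measurable torus \<and> integrable torus (\<lambda>x. (norm (f x))\<^sup>2)"

definition L2_norm_torus :: "(real^3 \<Rightarrow> real^3) \<Rightarrow> real" where
  "L2_norm_torus f = sqrt (\<integral>x. (norm (f x))\<^sup>2 \<partial>torus)"

definition zero_average :: "(real^3 \<Rightarrow> real^3) \<Rightarrow> bool" where
  "zero_average f \<longleftrightarrow> (\<integral>x. f x \<partial>torus) = 0"

definition freq :: "int^3 \<Rightarrow> real^3" where
  "freq k = (\<chi> i. of_int (k $ i))"

definition fourier :: "(real^3 \<Rightarrow> real^3) \<Rightarrow> int^3 \<Rightarrow> complex^3" where
  "fourier f k = (\<chi> i. complex_of_real (1 / (2 * pi) ^ 3) *
     (\<integral>x. complex_of_real (f x $ i) * exp (- \<i> * complex_of_real (freq k \<bullet> x)) \<partial>torus))"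

definition in_Hs :: "real \<Rightarrow> (real^3 \<Rightarrow> real^3) \<Rightarrow> bool" where
  "in_Hs s f \<longleftrightarrow> torus_L2 f \<and>
     (\<lambda>k. (1 + (norm (freq k))\<^sup>2) powr s * (norm (fourier f k))\<^sup>2) summable_on UNIV"

definition Hs_norm :: "real \<Rightarrow> (real^3 \<Rightarrow> real^3) \<Rightarrow> real" where
  "Hs_norm s f =
     sqrt (\<Sum>\<^sub>\<infinity>k. (1 + (norm (freq k))\<^sup>2) powr s * (norm (fourier f k))\<^sup>2)"

text \<open>The operator \<open>(-\<Delta>)\<^bsup>s/2\<^esup>\<close> for \<open>s > 0\<close>, on its domain \<open>H\<^sup>s\<close>. By Riesz--Fischer the chosen
  function exists there and is unique up to null sets; outside \<open>H\<^sup>s\<close> the value is meaningless.\<close>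

definition Lam :: "real \<Rightarrow> (real^3 \<Rightarrow> real^3) \<Rightarrow> real^3 \<Rightarrow> real^3" where
  "Lam s f = (SOME g. torus_L2 g \<and> (\<forall>k. fourier g k = (norm (freq k) powr s) *\<^sub>R fourier f k))"

section \<open>Smooth functions and divergence\<close>

primrec Ck :: "nat \<Rightarrow> ('a::euclidean_space \<Rightarrow> 'b::real_normed_vector) \<Rightarrow> bool" where
  "Ck 0 f \<longleftrightarrow> continuous_on UNIV f"
| "Ck (Suc n) f \<longleftrightarrow> (\<forall>x. f differentiable at x) \<and>
     (\<forall>b\<in>Basis. Ck n (\<lambda>x. frechet_derivative f (at x) b))"

definition smooth :: "('a::euclidean_space \<Rightarrow> 'b::real_normed_vector) \<Rightarrow> bool" where
  "smooth f \<longleftrightarrow> (\<forall>n. Ck n f)"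

text \<open>Distributional divergence: \<open>frechet_derivative \<psi> (at x) (f x)\<close> is \<open>f x \<bullet> \<nabla>\<psi> x\<close>.\<close>

definition div_free :: "(real^3 \<Rightarrow> real^3) \<Rightarrow> bool" where
  "div_free f \<longleftrightarrow> (\<forall>\<psi> :: real^3 \<Rightarrow> real. smooth \<psi> \<and> periodic \<psi> \<longrightarrow>
     (\<integral>x. frechet_derivative \<psi> (at x) (f x) \<partial>torus) = 0)"

text \<open>Divergence-free \<open>C\<^sub>0\<^sup>\<infinity>([0,T) \<times> \<T>\<^sup>3)\<close> vector fields. Smoothness up to \<open>t = 0\<close> means being the
  restriction of a smooth function on all times, so nothing but smoothness and periodicity is
  asked for at \<open>t < 0\<close>.\<close>

definition test_field :: "real \<Rightarrow> (real \<Rightarrow> real^3 \<Rightarrow> real^3) \<Rightarrow> bool" where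
  "test_field T \<phi> \<longleftrightarrow> smooth (\<lambda>(t, x). \<phi> t x) \<and> (\<forall>t. periodic (\<phi> t)) \<and>
     (\<exists>T'<T. \<forall>t\<ge>T'. \<forall>x. \<phi> t x = 0) \<and>
     (\<forall>t\<in>{0..<T}. \<forall>x. trace (jacobian (\<phi> t) (at x)) = 0)"

section \<open>Bochner spaces in time\<close>

text \<open>Weak measurability in \<open>L\<^sup>2\<close>. As \<open>L\<^sup>2\<close> and \<open>H\<^sup>s\<close> are separable Hilbert spaces and \<open>L\<^sup>2\<close> is
  dense in the dual of \<open>H\<^sup>s\<close> (\<open>s \<ge> 0\<close>), Pettis' theorem makes this the same as strong
  measurability in either space for functions with values there.\<close>

definition time_measurable :: "real \<Rightarrow> real \<Rightarrow> (real \<Rightarrow> real^3 \<Rightarrow> real^3) \<Rightarrow> bool" where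
  "time_measurable a b u \<longleftrightarrow>
     (\<forall>\<psi>. torus_L2 \<psi> \<longrightarrow> (\<lambda>t. torus_inner (u t) \<psi>) \<in> borel_measurable (lebesgue_on {a<..<b}))"

definition Linf_L2 :: "real \<Rightarrow> real \<Rightarrow> (real \<Rightarrow> real^3 \<Rightarrow> real^3) \<Rightarrow> bool" where
  "Linf_L2 a b u \<longleftrightarrow> time_measurable a b u \<and>
     (\<exists>C. AE t in lebesgue_on {a<..<b}. torus_L2 (u t) \<and> L2_norm_torus (u t) \<le> C)"

definition Linf_Hs :: "real \<Rightarrow> real \<Rightarrow> real \<Rightarrow> (real \<Rightarrow> real^3 \<Rightarrow> real^3) \<Rightarrow> bool" where
  "Linf_Hs a b s u \<longleftrightarrow> time_measurable a b u \<and>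
     (\<exists>C. AE t in lebesgue_on {a<..<b}. in_Hs s (u t) \<and> Hs_norm s (u t) \<le> C)"

definition L2_Hs :: "real \<Rightarrow> real \<Rightarrow> real \<Rightarrow> (real \<Rightarrow> real^3 \<Rightarrow> real^3) \<Rightarrow> bool" where
  "L2_Hs a b s u \<longleftrightarrow> time_measurable a b u \<and>
     (AE t in lebesgue_on {a<..<b}. in_Hs s (u t)) \<and>
     integrable (lebesgue_on {a<..<b}) (\<lambda>t. (Hs_norm s (u t))\<^sup>2)"

definition weakly_continuous :: "real \<Rightarrow> (real \<Rightarrow> real^3 \<Rightarrow> real^3) \<Rightarrow> bool" where
  "weakly_continuous T u \<longleftrightarrow>
     (\<forall>t\<in>{0..<T}. torus_L2 (u t)) \<and>
     (\<forall>\<psi>. torus_L2 \<psi> \<longrightarrow> continuous_on {0..<T} (\<lambda>t. torus_inner (u t) \<psi>))"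

section \<open>Weak and strong solutions\<close>

text \<open>The sign of the nonlinear term comes from
  \<open>\<langle>u\<cdot>\<nabla>u, \<phi>\<rangle> = - \<langle>u\<otimes>u, \<nabla>\<phi>\<rangle>\<close>.\<close>

definition weak_form ::
    "real \<Rightarrow> real \<Rightarrow> (real^3 \<Rightarrow> real^3) \<Rightarrow> real \<Rightarrow> (real \<Rightarrow> real^3 \<Rightarrow> real^3) \<Rightarrow> bool" where
  "weak_form \<nu> \<alpha> u0 T u \<longleftrightarrow> (\<forall>\<phi>. test_field T \<phi> \<longrightarrow>
     (\<integral>t. (torus_inner (u t) (\<lambda>x. vector_derivative (\<lambda>s. \<phi> s x) (at t))
           - \<nu> * torus_inner (Lam \<alpha> (u t)) (Lam \<alpha> (\<phi> t))
           + torus_inner (\<lambda>x. \<chi> i j. u t x $ i * u t x $ j) (\<lambda>x. jacobian (\<phi> t) (at x)))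
        \<partial>lebesgue_on {0<..<T})
     = - torus_inner u0 (\<phi> 0))"

definition energy_ineq ::
    "real \<Rightarrow> real \<Rightarrow> (real \<Rightarrow> real^3 \<Rightarrow> real^3) \<Rightarrow> real \<Rightarrow> real \<Rightarrow> bool" where
  "energy_ineq \<nu> \<alpha> u \<tau> t \<longleftrightarrow>
     (L2_norm_torus (u t))\<^sup>2
       + 2 * \<nu> * (\<integral>s. (L2_norm_torus (Lam \<alpha> (u s)))\<^sup>2 \<partial>lebesgue_on {\<tau><..<t})
     \<le> (L2_norm_torus (u \<tau>))\<^sup>2"

definition weak_solution ::
    "real \<Rightarrow> real \<Rightarrow> (real^3 \<Rightarrow> real^3) \<Rightarrow> real \<Rightarrow> (real \<Rightarrow> real^3 \<Rightarrow> real^3) \<Rightarrow> bool" where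
  "weak_solution \<nu> \<alpha> u0 T u \<longleftrightarrow>
     (AE x in torus. u 0 x = u0 x) \<and>
     weakly_continuous T u \<and>
     (\<forall>t\<in>{0..<T}. zero_average (u t)) \<and>
     Linf_L2 0 T u \<and> L2_Hs 0 T \<alpha> u \<and> (\<forall>t\<in>{0..<T}. div_free (u t)) \<and>
     weak_form \<nu> \<alpha> u0 T u \<and>
     (\<forall>t\<in>{0..<T}. energy_ineq \<nu> \<alpha> u 0 t) \<and>
     (AE \<tau> in lebesgue_on {0<..<T}. \<forall>t\<in>{\<tau>..<T}. energy_ineq \<nu> \<alpha> u \<tau> t)"

definition global_weak_solution ::
    "real \<Rightarrow> real \<Rightarrow> (real^3 \<Rightarrow> real^3) \<Rightarrow> (real \<Rightarrow> real^3 \<Rightarrow> real^3) \<Rightarrow> bool" where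
  "global_weak_solution \<nu> \<alpha> u0 u \<longleftrightarrow> (\<forall>T>0. weak_solution \<nu> \<alpha> u0 T u)"

definition strong_after :: "real \<Rightarrow> real \<Rightarrow> (real \<Rightarrow> real^3 \<Rightarrow> real^3) \<Rightarrow> bool" where
  "strong_after \<alpha> Tstar u \<longleftrightarrow> (\<forall>T>Tstar. Linf_Hs Tstar T \<alpha> u \<and> L2_Hs Tstar T (2 * \<alpha>) u)"

end

theory Submission
  imports Defs
begin

text \<open>By the energy inequality, \<open>\<parallel>\<Lambda>\<^sup>\<alpha> u(\<tau>)\<parallel>\<close> is as small as we like at some time \<open>\<tau>\<close> that is bounded in
  terms of the data. For \<open>\<alpha> \<ge> 5/6\<close> smallness of this norm suffices for global regularity: on Fourier
  coefficients, \<open>\<parallel>v \<cdot> \<nabla>v\<parallel> \<le> C \<parallel>\<Lambda>\<^sup>\<alpha> v\<parallel> \<parallel>\<Lambda>\<^bsup>2\<alpha>\<^esup> v\<parallel>\<close> follows from a trilinear sum estimate with exponents \<open>\<alpha>\<close>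
  and \<open>2\<alpha> - 1\<close>, whose sum is at least \<open>3/2\<close>. Hence the Picard iterates started at frequency-truncated
  data \<open>u(\<tau>)\<close> stay small in \<open>L\<^sup>\<infinity>H\<^sup>\<alpha> \<inter> L\<^sup>2H\<^bsup>2\<alpha>\<^esup>\<close> and contract, so they satisfy the equation up to a small
  residual. Weak-strong comparison via the energy inequality shows that these approximations
  converge to \<open>u\<close> in \<open>L\<^sup>2\<close>, and their bounds pass to \<open>u\<close>.\<close>

section \<open>Fourier series on the torus\<close>

text \<open>At \<alpha> = 5/6 the space H^\<alpha> is scaling-critical: the critical Sobolev index
  5/2 - 2\<alpha> equals \<alpha> there. At this endpoint no estimate may lose a power of |k| or
  rely on a short time, so smallness alone has to close the argument; in return all bounds are
  independent of the length of the time interval. A weak solution cannot be tested against itself,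
  so regularity is transferred to it from smooth comparison fields. No exact strong solution is ever
  built: for data with finitely many frequencies every Picard iterate again has finitely many, hence
  solves a finite system of explicit linear ODEs, and a late iterate with small residual serves the
  comparison as well as a solution would. Its error is absorbed over the whole interval instead of
  being propagated by Gronwall's inequality. The time in the conclusion depends on the solution only
  through the energy of the data, so one constant serves all weak solutions with the same
  \<open>u0\<close>.\<close>

definition ef :: "int^3 \<Rightarrow> real^3 \<Rightarrow> complex" where
  "ef k x = cis (freq k \<bullet> x)"

definition cf :: "(real^3 \<Rightarrow> complex) \<Rightarrow> int^3 \<Rightarrow> complex" where
  "cf f k = complex_of_real (1 / (2 * pi) ^ 3) * (\<integral>x. f x * cnj (ef k x) \<partial>torus)"

text \<open>Scalar complex counterpart of \<open>torus_L2\<close>, concerned with values on the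
  period cell only; periodicity is restored when a vector field is rebuilt from its
  coefficients.\<close>

definition sq_int :: "(real^3 \<Rightarrow> complex) \<Rightarrow> bool" where
  "sq_int f \<longleftrightarrow> f \<in> borel_measurable torus \<and> integrable torus (\<lambda>x. (norm (f x))\<^sup>2)"

lemma freq_zero [simp]: "freq 0 = 0"
  by (simp add: freq_def vec_eq_iff)

lemma freq_uminus [simp]: "freq (- k) = - freq k"
  by (simp add: freq_def vec_eq_iff)

lemma freq_add: "freq (k + l) = freq k + freq l"
  by (simp add: freq_def vec_eq_iff)

lemma freq_eq_0_iff [simp]: "freq k = 0 \<longleftrightarrow> k = 0"
  by (simp add: freq_def vec_eq_iff)

lemma ef_zero [simp]: "ef 0 x = 1"
  by (simp add: ef_def)

lemma cnj_ef: "cnj (ef k x) = ef (- k) x"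
  by (simp add: ef_def cis_cnj)

lemma ef_mult: "ef k x * ef l x = ef (k + l) x"
  by (simp add: ef_def freq_add inner_add_left cis_mult)

lemma norm_ef [simp]: "norm (ef k x) = 1"
  by (simp add: ef_def)

lemma continuous_ef: "continuous_on A (ef k)"
  unfolding ef_def cis_conv_exp by (intro continuous_intros)

lemma measurable_ef [measurable]: "ef k \<in> borel_measurable borel"
  using continuous_ef[of UNIV k] by (rule borel_measurable_continuous_onI)

lemma space_torus: "space torus = cbox 0 (\<chi> i. 2 * pi)"
  by (simp add: torus_def)

lemma measurable_torus: "f \<in> borel_measurable borel \<Longrightarrow> f \<in> borel_measurable torus"
  unfolding torus_def
  by (rule measurable_restrict_space1) (auto simp: measurable_completion)

lemma measurable_ef_torus [measurable]: "ef k \<in> borel_measurable torus"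
  by (rule measurable_torus) measurable

lemma emeasure_torus: "emeasure torus (space torus) < \<infinity>"
proof -
  have "emeasure lebesgue (cbox 0 (\<chi> i. 2 * pi) :: (real^3) set) < \<infinity>"
    using emeasure_compact_finite[OF compact_cbox, of 0 "\<chi> i. 2 * pi :: real^3"] by simp
  then show ?thesis
    by (simp add: space_torus torus_def emeasure_restrict_space)
qed

lemma finite_measure_torus: "finite_measure torus"
  using emeasure_torus by (intro finite_measureI) auto

interpretation torus: finite_measure torus
  by (rule finite_measure_torus)

lemma integrable_torus_bounded:
  fixes f :: "real^3 \<Rightarrow> 'b::{banach, second_countable_topology}"
  assumes "f \<in> borel_measurable torus" "\<And>x. norm (f x) \<le> B"
  shows "integrable torus f"
  using assms by (intro torus.integrable_const_bound[where B=B]) auto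

section \<open>Orthogonality of the characters\<close>

lemma integral_interval_cis:
  fixes n :: int
  shows "(\<integral>t. indicator {0..2*pi} t *\<^sub>R cis (of_int n * t) \<partial>lborel) = (if n = 0 then 2 * pi else 0)"
proof (cases "n = 0")
  case True
  then show ?thesis by (simp add: scaleR_conv_of_real)
next
  case False
  define F where "F = (\<lambda>t. cis (of_int n * t) / (\<i> * of_int n))"
  have d: "(F has_vector_derivative cis (of_int n * t)) (at t within {0..2*pi})" for t
  proof -
    have "((\<lambda>z. exp (\<i> * of_int n * z) / (\<i> * of_int n)) has_field_derivative
       exp (\<i> * of_int n * of_real t)) (at (of_real t))"
      using False by (auto intro!: derivative_eq_intros)
    from has_vector_derivative_real_field[OF this] show ?thesis
      by (simp add: F_def cis_conv_exp mult_ac)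
  qed
  have "(\<integral>t. indicator {0..2*pi} t *\<^sub>R cis (of_int n * t) \<partial>lborel) = F (2*pi) - F 0"
    by (intro integral_FTC_Icc d) (auto simp: cis_conv_exp intro!: continuous_intros)
  also have "\<dots> = 0"
    using cis_multiple_2pi[of "of_int n"] by (simp add: F_def mult_ac)
  finally show ?thesis using False by simp
qed

lemma cis_sum: "cis (sum f A) = (\<Prod>a\<in>A. cis (f a))"
  by (induction A rule: infinite_finite_induct) (simp_all add: cis_mult[symmetric])

text \<open>On the cell the character is a product of functions of single coordinates, so the
  integral factors into three one-dimensional ones, and a nonzero entry of \<open>k\<close> makes
  one of them vanish.\<close>

lemma integral_ef: "(\<integral>x. ef k x \<partial>torus) = (if k = 0 then (2 * pi) ^ 3 else 0)"
proof -
  interpret product_sigma_finite "\<lambda>_::real^3. lborel :: real measure" ..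
  define g :: "real^3 \<Rightarrow> real \<Rightarrow> complex" where
    "g b t = indicator {0..2*pi} t *\<^sub>R cis ((freq k \<bullet> b) * t)" for b t
  have gm [measurable]: "g b \<in> borel_measurable borel" for b
    unfolding g_def cis_conv_exp
    by (intro borel_measurable_scaleR) (auto intro!: borel_measurable_continuous_onI continuous_intros)
  have gi: "integrable lborel (g b)" for b
    unfolding g_def cis_conv_exp
    by (rule borel_integrable_compact[unfolded set_integrable_def]) (auto intro!: continuous_intros)
  have prod: "indicator (cbox 0 (\<chi> i. 2 * pi)) x *\<^sub>R ef k x = (\<Prod>b\<in>Basis. g b (x \<bullet> b))" for x :: "real^3"
  proof -
    have "(\<Prod>b\<in>Basis. g b (x \<bullet> b)) = (\<Prod>b\<in>Basis. indicator {0..2*pi} (x \<bullet> b) *\<^sub>R cis ((freq k \<bullet> b) * (x \<bullet> b)))"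
      by (simp add: g_def)
    also have "\<dots> = (\<Prod>b\<in>Basis. complex_of_real (indicator {0..2*pi} (x \<bullet> b))) * (\<Prod>b\<in>Basis. cis ((freq k \<bullet> b) * (x \<bullet> b)))"
      by (simp add: scaleR_conv_of_real prod.distrib)
    also have "(\<Prod>b\<in>Basis. cis ((freq k \<bullet> b) * (x \<bullet> b))) = ef k x"
      by (simp add: ef_def euclidean_inner[of "freq k" x] cis_sum)
    also have "(\<Prod>b\<in>Basis. complex_of_real (indicator {0..2*pi} (x \<bullet> b)))
       = complex_of_real (indicator (cbox 0 (\<chi> i. 2 * pi)) x)"
    proof (cases "x \<in> cbox 0 (\<chi> i. 2 * pi)")
      case True
      then have "complex_of_real (indicator {0..2*pi} (x \<bullet> b)) = 1" if "b \<in> Basis" for b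
        using that by (auto simp: indicator_def mem_box_cart Basis_vec_def inner_axis)
      then show ?thesis using True by simp
    next
      case False
      then show ?thesis
        by (auto simp: indicator_def mem_box_cart Basis_vec_def inner_axis prod_zero_iff)
    qed
    finally show ?thesis by (simp add: scaleR_conv_of_real)
  qed
  have "(\<integral>x. ef k x \<partial>torus) = (\<integral>x. indicator (cbox 0 (\<chi> i. 2 * pi)) x *\<^sub>R ef k x \<partial>lebesgue)"
    unfolding torus_def by (subst integral_restrict_space) (auto)
  \<comment> \<open>The product structure is that of \<open>lborel\<close>; \<open>lebesgue\<close>
    is its completion and gives Borel functions the same integral.\<close>
  also have "\<dots> = (\<integral>x. indicator (cbox 0 (\<chi> i. 2 * pi)) x *\<^sub>R ef k x \<partial>lborel)"
    by (rule integral_completion) measurable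
  also have "\<dots> = (\<integral>x. (\<Prod>b\<in>Basis. g b (x \<bullet> b)) \<partial>(lborel :: (real^3) measure))"
    by (simp add: prod)
  also have "\<dots> = (\<integral>f. (\<Prod>b\<in>Basis. g b (f b)) \<partial>(\<Pi>\<^sub>M b\<in>(Basis :: (real^3) set). lborel))"
    by (subst lborel_eq, subst integral_distr) (auto intro!: Bochner_Integration.integral_cong)
  also have "\<dots> = (\<Prod>b\<in>Basis. (\<integral>t. g b t \<partial>lborel))"
    by (rule product_integral_prod) (auto intro: gi)
  also have "\<dots> = (\<Prod>b\<in>(Basis :: (real^3) set). complex_of_real (if freq k \<bullet> b = 0 then 2 * pi else 0))"
  proof (rule prod.cong)
    fix b :: "real^3" assume "b \<in> Basis"
    then obtain i where "b = axis i 1" by (auto simp: Basis_vec_def)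
    then show "(\<integral>t. g b t \<partial>lborel) = complex_of_real (if freq k \<bullet> b = 0 then 2 * pi else 0)"
      using integral_interval_cis[of "k $ i"] by (simp add: g_def inner_axis freq_def)
  qed simp
  also have "\<dots> = (if k = 0 then (2 * pi) ^ 3 else 0)"
  proof (cases "k = 0")
    case False
    then obtain i where "k $ i \<noteq> 0" by (auto simp: vec_eq_iff)
    then have "freq k \<bullet> axis i 1 \<noteq> 0" by (simp add: inner_axis freq_def)
    then show ?thesis using False by (auto simp: prod_zero_iff Basis_vec_def)
  qed simp
  finally show ?thesis .
qed

text \<open>Cubes of frequencies, symmetric under negation. Along them unordered sums over the
  lattice become limits of sequences, as measurability and the convergence theorems require, and the
  cube shape makes counting easy.\<close>

definition modes :: "nat \<Rightarrow> (int^3) set" where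
  "modes n = {k. \<forall>i. \<bar>k $ i\<bar> \<le> int n}"

lemma modes_subset: "modes n \<subseteq> (\<lambda>f. \<chi> i. f i) ` (UNIV \<rightarrow>\<^sub>E {- int n..int n})"
proof
  fix k assume "k \<in> modes n"
  then have "(\<lambda>i. k $ i) \<in> UNIV \<rightarrow>\<^sub>E {- int n..int n}"
    by (auto simp: modes_def abs_le_iff PiE_def extensional_def) (metis minus_le_iff)
  then show "k \<in> (\<lambda>f. \<chi> i. f i) ` (UNIV \<rightarrow>\<^sub>E {- int n..int n})"
    by (intro image_eqI[where x="\<lambda>i. k $ i"]) (auto simp: vec_eq_iff)
qed

lemma finite_modes [simp]: "finite (modes n)"
  by (rule finite_subset[OF modes_subset]) (intro finite_imageI finite_PiE, auto)

lemma filterlim_modes: "filterlim modes (finite_subsets_at_top UNIV) sequentially"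
  unfolding filterlim_finite_subsets_at_top
proof safe
  fix X :: "(int^3) set" assume X: "finite X"
  \<comment> \<open>A crude common bound for all coordinates of all members of
    \<open>X\<close>.\<close>
  define m where "m = (\<Sum>k\<in>X. \<Sum>i\<in>UNIV. nat \<bar>k $ i\<bar>)"
  have *: "\<bar>k $ i\<bar> \<le> int m" if "k \<in> X" for k i
  proof -
    have "nat \<bar>k $ i\<bar> \<le> (\<Sum>i\<in>UNIV. nat \<bar>k $ i\<bar>)" by (rule member_le_sum) auto
    also have "\<dots> \<le> m" unfolding m_def using X that by (intro member_le_sum) auto
    finally show ?thesis by linarith
  qed
  have "X \<subseteq> modes n" if "m \<le> n" for n
  proof
    fix k assume "k \<in> X"
    then show "k \<in> modes n"
      using * that unfolding modes_def by (smt (verit) mem_Collect_eq of_nat_le_iff)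
  qed
  then show "\<forall>\<^sub>F n in sequentially. finite (modes n) \<and> X \<subseteq> modes n \<and> modes n \<subseteq> UNIV"
    unfolding eventually_sequentially by auto
qed

lemma tendsto_sum_modes:
  assumes "(f has_sum s) UNIV"
  shows "(\<lambda>n. sum f (modes n)) \<longlonglongrightarrow> s"
  using filterlim_compose[OF assms[unfolded has_sum_def] filterlim_modes] .

lemma borel_measurable_infsum_modes:
  fixes f :: "int^3 \<Rightarrow> 'a \<Rightarrow> 'b::{banach, second_countable_topology}"
  assumes [measurable]: "\<And>k. f k \<in> borel_measurable M"
    and "\<And>x. x \<in> space M \<Longrightarrow> (\<lambda>k. f k x) summable_on UNIV"
  shows "(\<lambda>x. \<Sum>\<^sub>\<infinity>k. f k x) \<in> borel_measurable M"
  by (rule borel_measurable_LIMSEQ_metric[where f="\<lambda>n x. \<Sum>k\<in>modes n. f k x"])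
     (auto intro!: tendsto_sum_modes has_sum_infsum assms(2))

section \<open>Square-integrable functions and their inner product\<close>

lemma sq_int_borel [measurable_dest]: "sq_int f \<Longrightarrow> f \<in> borel_measurable torus"
  by (simp add: sq_int_def)

lemma sq_int_integrable_power2: "sq_int f \<Longrightarrow> integrable torus (\<lambda>x. (norm (f x))\<^sup>2)"
  by (simp add: sq_int_def)

lemma sq_int_mult_integrable:
  assumes f: "sq_int f" and g: "sq_int g"
  shows "integrable torus (\<lambda>x. f x * g x)"
proof (rule Bochner_Integration.integrable_bound)
  show "integrable torus (\<lambda>x. (norm (f x))\<^sup>2 + (norm (g x))\<^sup>2)"
    using f g by (auto simp: sq_int_def)
  show "(\<lambda>x. f x * g x) \<in> borel_measurable torus" using f g by measurable
  have "norm (f x * g x) \<le> (norm (f x))\<^sup>2 + (norm (g x))\<^sup>2" for x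
  proof -
    have "2 * (norm (f x) * norm (g x)) \<le> (norm (f x))\<^sup>2 + (norm (g x))\<^sup>2"
      using sum_squares_bound[of "norm (f x)" "norm (g x)"] by (simp add: mult_ac)
    moreover have "0 \<le> norm (f x) * norm (g x)" by simp
    ultimately show ?thesis unfolding norm_mult by linarith
  qed
  then show "AE x in torus. norm (f x * g x) \<le> norm ((norm (f x))\<^sup>2 + (norm (g x))\<^sup>2)" by simp
qed

lemma sq_int_add:
  assumes f: "sq_int f" and g: "sq_int g"
  shows "sq_int (\<lambda>x. f x + g x)"
  unfolding sq_int_def
proof
  show m: "(\<lambda>x. f x + g x) \<in> borel_measurable torus" using f g by measurable
  show "integrable torus (\<lambda>x. (norm (f x + g x))\<^sup>2)"
  proof (rule Bochner_Integration.integrable_bound)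
    show "integrable torus (\<lambda>x. 2 * (norm (f x))\<^sup>2 + 2 * (norm (g x))\<^sup>2)"
      using f g by (auto simp: sq_int_def)
    have "(norm (f x + g x))\<^sup>2 \<le> 2 * (norm (f x))\<^sup>2 + 2 * (norm (g x))\<^sup>2" for x
    proof -
      have "(norm (f x + g x))\<^sup>2 \<le> (norm (f x) + norm (g x))\<^sup>2"
        by (intro power_mono norm_triangle_ineq) auto
      also have "\<dots> \<le> 2 * (norm (f x))\<^sup>2 + 2 * (norm (g x))\<^sup>2"
        using sum_squares_bound[of "norm (f x)" "norm (g x)"] by (simp add: power2_sum)
      finally show ?thesis .
    qed
    then show "AE x in torus. norm ((norm (f x + g x))\<^sup>2) \<le> norm (2 * (norm (f x))\<^sup>2 + 2 * (norm (g x))\<^sup>2)" by simp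
    show "(\<lambda>x. (norm (f x + g x))\<^sup>2) \<in> borel_measurable torus" using m by measurable
  qed
qed

lemma sq_int_cmult: "sq_int f \<Longrightarrow> sq_int (\<lambda>x. c * f x)"
  by (auto simp: sq_int_def norm_mult power_mult_distrib)

lemma sq_int_uminus: "sq_int f \<Longrightarrow> sq_int (\<lambda>x. - f x)"
  by (auto simp: sq_int_def)

lemma sq_int_diff: "sq_int f \<Longrightarrow> sq_int g \<Longrightarrow> sq_int (\<lambda>x. f x - g x)"
  using sq_int_add[of f "\<lambda>x. - g x"] sq_int_uminus[of g] by simp

lemma sq_int_cnj: "sq_int f \<Longrightarrow> sq_int (\<lambda>x. cnj (f x))"
  unfolding sq_int_def by (auto intro: borel_measurable_continuous_on[of cnj] continuous_intros)

lemma sq_int_ef: "sq_int (ef k)"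
  by (auto simp: sq_int_def)

lemma sq_int_const: "sq_int (\<lambda>_. c)"
  using sq_int_cmult[OF sq_int_ef[of 0], of c] by simp

lemma sq_int_mult_ef: "sq_int f \<Longrightarrow> sq_int (\<lambda>x. f x * ef k x)"
  by (auto simp: sq_int_def norm_mult)

lemma sq_int_sum: "(\<And>k. k \<in> F \<Longrightarrow> sq_int (f k)) \<Longrightarrow> sq_int (\<lambda>x. \<Sum>k\<in>F. f k x)"
  by (induction F rule: infinite_finite_induct) (auto intro: sq_int_add sq_int_const)

lemma sq_int_integrable: "sq_int f \<Longrightarrow> integrable torus f"
  using sq_int_mult_integrable[OF _ sq_int_const, of f 1] by simp

text \<open>Not normalised: every character has squared norm \<open>(2 * pi) ^ 3\<close>, which is
  the factor between \<open>ip\<close> and \<open>cf\<close>.\<close>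

definition ip :: "(real^3 \<Rightarrow> complex) \<Rightarrow> (real^3 \<Rightarrow> complex) \<Rightarrow> complex" where
  "ip f g = (\<integral>x. f x * cnj (g x) \<partial>torus)"

lemma ip_integrable: "sq_int f \<Longrightarrow> sq_int g \<Longrightarrow> integrable torus (\<lambda>x. f x * cnj (g x))"
  by (intro sq_int_mult_integrable sq_int_cnj)

lemma ip_self: "ip f f = complex_of_real (\<integral>x. (norm (f x))\<^sup>2 \<partial>torus)"
proof -
  have "ip f f = (\<integral>x. complex_of_real ((norm (f x))\<^sup>2) \<partial>torus)"
    unfolding ip_def by (simp only: complex_norm_square)
  then show ?thesis by (simp only: integral_complex_of_real)
qed

lemma ip_cnj: "ip g f = cnj (ip f g)"
  unfolding ip_def by (subst Bochner_Integration.integral_cnj[symmetric]) (simp add: mult.commute)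

lemma ip_add_left: "sq_int f \<Longrightarrow> sq_int g \<Longrightarrow> sq_int h \<Longrightarrow> ip (\<lambda>x. f x + g x) h = ip f h + ip g h"
  unfolding ip_def by (simp add: distrib_right ip_integrable)

lemma ip_diff_left: "sq_int f \<Longrightarrow> sq_int g \<Longrightarrow> sq_int h \<Longrightarrow> ip (\<lambda>x. f x - g x) h = ip f h - ip g h"
  unfolding ip_def by (simp add: left_diff_distrib ip_integrable)

lemma ip_cmult_left: "ip (\<lambda>x. c * f x) h = c * ip f h"
  unfolding ip_def by (simp add: mult.assoc)

lemma ip_add_right: "sq_int f \<Longrightarrow> sq_int g \<Longrightarrow> sq_int h \<Longrightarrow> ip h (\<lambda>x. f x + g x) = ip h f + ip h g"
  by (subst (1 2 3) ip_cnj) (simp add: ip_add_left)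

lemma ip_diff_right: "sq_int f \<Longrightarrow> sq_int g \<Longrightarrow> sq_int h \<Longrightarrow> ip h (\<lambda>x. f x - g x) = ip h f - ip h g"
  by (subst (1 2 3) ip_cnj) (simp add: ip_diff_left)

lemma ip_cmult_right: "ip h (\<lambda>x. c * f x) = cnj c * ip h f"
  by (subst (1 2) ip_cnj) (simp add: ip_cmult_left)

lemma ip_sum_left: "finite F \<Longrightarrow> (\<And>k. k \<in> F \<Longrightarrow> sq_int (f k)) \<Longrightarrow> sq_int h \<Longrightarrow> ip (\<lambda>x. \<Sum>k\<in>F. f k x) h = (\<Sum>k\<in>F. ip (f k) h)"
  by (induction F rule: finite_induct) (auto simp: ip_add_left sq_int_sum, simp add: ip_def)

lemma ip_sum_right: "finite F \<Longrightarrow> (\<And>k. k \<in> F \<Longrightarrow> sq_int (f k)) \<Longrightarrow> sq_int h \<Longrightarrow> ip h (\<lambda>x. \<Sum>k\<in>F. f k x) = (\<Sum>k\<in>F. ip h (f k))"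
  by (subst ip_cnj) (simp add: ip_sum_left cnj_sum flip: ip_cnj)

lemma ip_ef: "ip f (ef k) = (2 * pi) ^ 3 * cf f k"
  unfolding ip_def cf_def by simp

lemma ip_ef_ef: "ip (ef k) (ef l) = (if k = l then (2 * pi) ^ 3 else 0)"
  unfolding ip_def cnj_ef ef_mult integral_ef by simp

lemma cf_eq_ip: "cf f k = ip f (ef k) / (2 * pi) ^ 3"
  unfolding ip_def cf_def by simp

definition trig :: "(int^3 \<Rightarrow> complex) \<Rightarrow> (int^3) set \<Rightarrow> real^3 \<Rightarrow> complex" where
  "trig a F x = (\<Sum>k\<in>F. a k * ef k x)"

lemma sq_int_trig: "sq_int (trig a F)"
  unfolding trig_def[abs_def] by (intro sq_int_sum sq_int_cmult sq_int_ef)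

lemma ip_trig_right:
  assumes "finite F" "sq_int f"
  shows "ip f (trig a F) = (2 * pi) ^ 3 * (\<Sum>k\<in>F. cf f k * cnj (a k))"
  unfolding trig_def[abs_def] using assms
  by (subst ip_sum_right) (auto simp: sq_int_cmult sq_int_ef ip_cmult_right ip_ef sum_distrib_left mult_ac)

lemma cf_trig:
  assumes "finite F"
  shows "cf (trig a F) k = (if k \<in> F then a k else 0)"
proof -
  have "ip (trig a F) (ef k) = (\<Sum>l\<in>F. a l * (if l = k then (2 * pi) ^ 3 else 0))"
    unfolding trig_def[abs_def] using assms
    by (subst ip_sum_left) (auto simp: sq_int_cmult sq_int_ef ip_cmult_left ip_ef_ef)
  also have "\<dots> = (\<Sum>l\<in>F. if l = k then a k * (2 * pi) ^ 3 else 0)"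
    by (intro sum.cong) auto
  also have "\<dots> = (if k \<in> F then a k * (2 * pi) ^ 3 else 0)"
    using assms by simp
  finally show ?thesis by (simp add: cf_eq_ip)
qed

lemma cf_add: "sq_int f \<Longrightarrow> sq_int g \<Longrightarrow> cf (\<lambda>x. f x + g x) k = cf f k + cf g k"
  by (simp add: cf_eq_ip ip_add_left sq_int_ef add_divide_distrib)

lemma cf_diff: "sq_int f \<Longrightarrow> sq_int g \<Longrightarrow> cf (\<lambda>x. f x - g x) k = cf f k - cf g k"
  by (simp add: cf_eq_ip ip_diff_left sq_int_ef diff_divide_distrib)

lemma cf_cmult: "cf (\<lambda>x. c * f x) k = c * cf f k"
  by (simp add: cf_eq_ip ip_cmult_left)

text \<open>Pythagoras: the partial Fourier sum is the orthogonal projection of \<open>f\<close>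
  onto its characters, so its product with \<open>f\<close> and its product with itself are the same
  number. Bessel's inequality is the nonnegativity of the left side.\<close>

lemma norm_diff_trig:
  assumes F: "finite F" and f: "sq_int f"
  shows "(\<integral>x. (norm (f x - trig (cf f) F x))\<^sup>2 \<partial>torus)
    = (\<integral>x. (norm (f x))\<^sup>2 \<partial>torus) - (2 * pi) ^ 3 * (\<Sum>k\<in>F. (norm (cf f k))\<^sup>2)"
proof -
  let ?S = "trig (cf f) F"
  have SS: "ip ?S ?S = complex_of_real ((2 * pi) ^ 3 * (\<Sum>k\<in>F. (norm (cf f k))\<^sup>2))"
    by (subst ip_trig_right) (auto simp: F sq_int_trig cf_trig simp flip: complex_norm_square)
  have fS: "ip f ?S = complex_of_real ((2 * pi) ^ 3 * (\<Sum>k\<in>F. (norm (cf f k))\<^sup>2))"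
    using F f by (subst ip_trig_right) (auto simp flip: complex_norm_square)
  have "ip (\<lambda>x. f x - ?S x) (\<lambda>x. f x - ?S x) = ip f f - ip f ?S - (cnj (ip f ?S) - ip ?S ?S)"
    using f sq_int_trig by (simp add: ip_diff_left ip_diff_right sq_int_diff flip: ip_cnj)
  also have "\<dots> = complex_of_real ((\<integral>x. (norm (f x))\<^sup>2 \<partial>torus) - (2 * pi) ^ 3 * (\<Sum>k\<in>F. (norm (cf f k))\<^sup>2))"
    unfolding SS fS by (simp add: SS ip_self[of f] del: of_real_mult of_real_power)
  finally show ?thesis by (simp only: ip_self of_real_eq_iff)
qed

lemma bessel:
  assumes F: "finite F" and f: "sq_int f"
  shows "(2 * pi) ^ 3 * (\<Sum>k\<in>F. (norm (cf f k))\<^sup>2) \<le> (\<integral>x. (norm (f x))\<^sup>2 \<partial>torus)"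
proof -
  have "0 \<le> (\<integral>x. (norm (f x - trig (cf f) F x))\<^sup>2 \<partial>torus)" by (rule Bochner_Integration.integral_nonneg) simp
  then show ?thesis using norm_diff_trig[OF assms] by linarith
qed

lemma norm_trig:
  assumes F: "finite F"
  shows "(\<integral>x. (norm (trig a F x))\<^sup>2 \<partial>torus) = (2 * pi) ^ 3 * (\<Sum>k\<in>F. (norm (a k))\<^sup>2)"
proof -
  have "ip (trig a F) (trig a F) = complex_of_real ((2 * pi) ^ 3 * (\<Sum>k\<in>F. (norm (a k))\<^sup>2))"
    by (subst ip_trig_right) (auto simp: F sq_int_trig cf_trig simp flip: complex_norm_square)
  then show ?thesis by (simp only: ip_self of_real_eq_iff)
qed

text \<open>Used under integrals over the cell: an L1 norm is at most a small constant plus a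
  multiple of the squared L2 norm.\<close>

lemma norm_le_power2_bound:
  fixes t d :: real
  assumes "d > 0"
  shows "t \<le> d + t\<^sup>2 / d"
proof (cases "t \<le> d")
  case True
  then show ?thesis using assms by (simp add: add_increasing2)
next
  case False
  then have "t * d \<le> t\<^sup>2" using assms by (simp add: power2_eq_square)
  then have "t \<le> t\<^sup>2 / d" using assms by (simp add: pos_le_divide_eq)
  then show ?thesis using assms by linarith
qed

lemma modes_mono:
  assumes "m \<le> n"
  shows "modes m \<subseteq> modes n"
proof -
  have "int m \<le> int n" using assms by simp
  then show "modes m \<subseteq> modes n" unfolding modes_def by (auto intro: order_trans)
qed

lemma mem_modes_eventually: "\<forall>\<^sub>F n in sequentially. k \<in> modes n"
  using filterlim_modes unfolding filterlim_finite_subsets_at_top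
  by (drule_tac spec[of _ "{k}"]) simp

lemma trig_diff_modes:
  assumes "m \<le> n"
  shows "trig a (modes n) x - trig a (modes m) x = trig a (modes n - modes m) x"
  unfolding trig_def by (rule sum_diff[OF finite_modes modes_mono[OF assms], symmetric])

text \<open>The partial sums over cubes are Cauchy in L2, hence in L1 on a finite measure space,
  hence convergent almost everywhere along a subsequence. Fatou's lemma bounds the L2 distance of
  the limit to each partial sum by the tail of the series, and coefficients and norm follow from
  that.\<close>

theorem riesz_fischer:
  fixes a :: "int^3 \<Rightarrow> complex"
  assumes sum: "(\<lambda>k. (norm (a k))\<^sup>2) summable_on UNIV"
  obtains g where "sq_int g" "\<And>k. cf g k = a k"
    "(\<integral>x. (norm (g x))\<^sup>2 \<partial>torus) = (2 * pi) ^ 3 * (\<Sum>\<^sub>\<infinity>k. (norm (a k))\<^sup>2)"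
proof -
  define S where "S n = trig a (modes n)" for n
  define s where "s n = (\<Sum>k\<in>modes n. (norm (a k))\<^sup>2)" for n
  define l where "l = (\<Sum>\<^sub>\<infinity>k. (norm (a k))\<^sup>2)"
  have sl: "s \<longlonglongrightarrow> l" unfolding s_def[abs_def] l_def
    using sum by (intro tendsto_sum_modes has_sum_infsum)
  have s_le: "s n \<le> l" for n unfolding s_def l_def
    using sum by (intro finite_sum_le_infsum) auto
  have Sq [simp]: "sq_int (S n)" for n by (simp add: S_def sq_int_trig)
  have Sdiff: "(\<integral>x. (norm (S n x - S m x))\<^sup>2 \<partial>torus) \<le> (2 * pi) ^ 3 * (l - s m)" if "m \<le> n" for m n
  proof -
    have "(\<integral>x. (norm (S n x - S m x))\<^sup>2 \<partial>torus) = (2 * pi) ^ 3 * (\<Sum>k\<in>modes n - modes m. (norm (a k))\<^sup>2)"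
      by (simp add: S_def trig_diff_modes[OF that] norm_trig)
    also have "(\<Sum>k\<in>modes n - modes m. (norm (a k))\<^sup>2) = s n - s m"
      unfolding s_def by (rule sum_diff[OF finite_modes modes_mono[OF that]])
    finally show ?thesis using s_le[of n] by (simp add: mult_left_mono)
  qed
  define V where "V = measure torus (space torus)"
  have V0: "V \<ge> 0" by (simp add: V_def)
  have L1: "\<exists>N. \<forall>i\<ge>N. \<forall>j\<ge>N. (\<integral>x. norm (S i x - S j x) \<partial>torus) < e" if e: "e > 0" for e :: real
  proof -
    \<comment> \<open>Keeps the constant part \<open>d * V\<close> below 3/4 of \<open>e\<close>;
      the quadratic part is then made smaller than e/4.\<close>
    define d where "d = e / (2 * (V + 1))"
    have d: "d > 0" "d * V < e / 2 + e/4" using e V0 by (auto simp: d_def field_simps add_pos_nonneg)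
    have "(\<lambda>n. (2 * pi) ^ 3 * (l - s n) / d) \<longlonglongrightarrow> (2 * pi) ^ 3 * (l - l) / d"
      by (intro tendsto_intros sl) (use d in auto)
    then have "\<forall>\<^sub>F n in sequentially. (2 * pi) ^ 3 * (l - s n) / d < e / 4"
      using e by (intro order_tendstoD(2)) auto
    then obtain N where N: "\<And>n. n \<ge> N \<Longrightarrow> (2 * pi) ^ 3 * (l - s n) / d < e / 4"
      by (auto simp: eventually_sequentially)
    have main: "(\<integral>x. norm (S i x - S j x) \<partial>torus) < e" if "j \<le> i" "j \<ge> N" for i j
    proof -
      have "(\<integral>x. norm (S i x - S j x) \<partial>torus) \<le> (\<integral>x. d + (norm (S i x - S j x))\<^sup>2 / d \<partial>torus)"
        using d(1) by (intro integral_mono norm_le_power2_bound)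
          (auto intro!: Bochner_Integration.integrable_add integrable_divide integrable_norm sq_int_integrable sq_int_diff sq_int_integrable_power2)
      also have "\<dots> = d * V + (\<integral>x. (norm (S i x - S j x))\<^sup>2 \<partial>torus) / d"
        by (subst Bochner_Integration.integral_add)
           (auto simp: V_def intro!: sq_int_diff sq_int_integrable_power2)
      also have "\<dots> \<le> d * V + (2 * pi) ^ 3 * (l - s j) / d"
        using Sdiff[OF that(1)] d(1) by (simp add: divide_right_mono)
      also have "\<dots> < e" using N[OF that(2)] d(2) by linarith
      finally show ?thesis .
    qed
    have "(\<integral>x. norm (S i x - S j x) \<partial>torus) < e" if "i \<ge> N" "j \<ge> N" for i j
      using main[of j i] main[of i j] that by (cases "j \<le> i") (auto simp: norm_minus_commute)
    then show ?thesis by blast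
  qed
  obtain r where r: "strict_mono r" "AE x in torus. Cauchy (\<lambda>i. S (r i) x)"
    by (rule cauchy_L1_AE_cauchy_subseq[of torus S]) (auto intro!: L1 sq_int_integrable)
  define g where "g x = lim (\<lambda>i. S (r i) x)" for x
  have [measurable]: "S n \<in> borel_measurable torus" for n using Sq by measurable
  have gm [measurable]: "g \<in> borel_measurable torus" unfolding g_def[abs_def] by measurable
  have gl: "AE x in torus. (\<lambda>i. S (r i) x) \<longlonglongrightarrow> g x"
    using r(2) by eventually_elim (auto simp: g_def Cauchy_convergent_iff convergent_LIMSEQ_iff)
  have nn: "(\<integral>\<^sup>+x. ennreal ((norm (g x - S n x))\<^sup>2) \<partial>torus) \<le> ennreal ((2 * pi) ^ 3 * (l - s n))" for n
  proof -
    have "(\<integral>\<^sup>+x. ennreal ((norm (g x - S n x))\<^sup>2) \<partial>torus)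
        = (\<integral>\<^sup>+x. liminf (\<lambda>i. ennreal ((norm (S (r i) x - S n x))\<^sup>2)) \<partial>torus)"
    proof (rule nn_integral_cong_AE)
      show "AE x in torus. ennreal ((norm (g x - S n x))\<^sup>2) = liminf (\<lambda>i. ennreal ((norm (S (r i) x - S n x))\<^sup>2))"
        using gl
      proof eventually_elim
        case (elim x)
        then have "(\<lambda>i. ennreal ((norm (S (r i) x - S n x))\<^sup>2)) \<longlonglongrightarrow> ennreal ((norm (g x - S n x))\<^sup>2)"
          by (intro tendsto_intros)
        then show ?case using lim_imp_Liminf sequentially_bot by fastforce
      qed
    qed
    also have "\<dots> \<le> liminf (\<lambda>i. \<integral>\<^sup>+x. ennreal ((norm (S (r i) x - S n x))\<^sup>2) \<partial>torus)"
      by (rule nn_integral_liminf) measurable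
    also have "\<dots> \<le> liminf (\<lambda>i::nat. ennreal ((2 * pi) ^ 3 * (l - s n)))"
    proof (rule Liminf_mono)
      have "(\<integral>\<^sup>+x. ennreal ((norm (S (r i) x - S n x))\<^sup>2) \<partial>torus) \<le> ennreal ((2 * pi) ^ 3 * (l - s n))"
        if "i \<ge> n" for i
      proof -
        have "n \<le> r i" using that seq_suble[OF r(1), of i] by linarith
        then show ?thesis
          by (subst nn_integral_eq_integral)
             (auto simp del: power_mult_distrib intro!: sq_int_diff sq_int_integrable_power2 ennreal_leI Sdiff[OF \<open>n \<le> r i\<close>, simplified])
      qed
      then show "\<forall>\<^sub>F i in sequentially. (\<integral>\<^sup>+x. ennreal ((norm (S (r i) x - S n x))\<^sup>2) \<partial>torus) \<le> ennreal ((2 * pi) ^ 3 * (l - s n))"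
        by (auto simp: eventually_sequentially)
    qed
    also have "\<dots> = ennreal ((2 * pi) ^ 3 * (l - s n))" by (simp add: Liminf_const)
    finally show ?thesis .
  qed
  have gS: "sq_int (\<lambda>x. g x - S n x)" for n
    unfolding sq_int_def
  proof
    show "integrable torus (\<lambda>x. (norm (g x - S n x))\<^sup>2)"
      by (rule integrableI_nonneg) (use nn[of n] in \<open>auto simp: le_less_trans\<close>)
  qed measurable
  have gq: "sq_int g" using sq_int_add[OF gS[of 0] Sq[of 0]] by simp
  have gdiff: "(\<integral>x. (norm (g x - S n x))\<^sup>2 \<partial>torus) \<le> (2 * pi) ^ 3 * (l - s n)" for n
  proof -
    have "ennreal (\<integral>x. (norm (g x - S n x))\<^sup>2 \<partial>torus) \<le> ennreal ((2 * pi) ^ 3 * (l - s n))"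
      using nn[of n] by (subst nn_integral_eq_integral[symmetric]) (auto intro!: sq_int_integrable_power2 gS)
    then show ?thesis using s_le[of n] by (subst (asm) ennreal_le_iff) auto
  qed
  have lim0: "(\<lambda>n. (2 * pi) ^ 3 * (l - s n)) \<longlonglongrightarrow> 0"
    using tendsto_mult[OF tendsto_const tendsto_diff[OF tendsto_const sl], of "(2*pi)^3" l] by simp
  have gcf: "cf g k = a k" for k
  proof -
    \<comment> \<open>Once \<open>k\<close> lies in the cube, the coefficient of g - S n at
      \<open>k\<close> is \<open>cf g k - a k\<close>, and Bessel's inequality with this single
      frequency bounds it by the tail.\<close>
    have "\<forall>\<^sub>F n in sequentially. (2 * pi) ^ 3 * (norm (cf g k - a k))\<^sup>2 \<le> (2 * pi) ^ 3 * (l - s n)"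
      using mem_modes_eventually[of k]
    proof eventually_elim
      case (elim n)
      have "(2 * pi) ^ 3 * (\<Sum>k\<in>{k}. (norm (cf (\<lambda>x. g x - S n x) k))\<^sup>2) \<le> (2 * pi) ^ 3 * (l - s n)"
        by (rule order_trans[OF bessel[OF _ gS[of n]] gdiff[of n]]) simp
      then show ?case using elim by (simp add: cf_diff gq) (simp add: S_def cf_trig)
    qed
    from tendsto_le[OF _ lim0 tendsto_const this]
    have "(2 * pi) ^ 3 * (norm (cf g k - a k))\<^sup>2 \<le> 0" by simp
    moreover have "(2 * pi) ^ 3 > (0::real)" by simp
    ultimately show ?thesis using pi_gt_zero by (auto simp: mult_le_0_iff)
  qed
  have "(\<lambda>n. (\<integral>x. (norm (g x))\<^sup>2 \<partial>torus) - (2 * pi) ^ 3 * s n) \<longlonglongrightarrow> 0"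
  proof (rule Lim_null_comparison[OF _ lim0])
    have "(\<integral>x. (norm (g x))\<^sup>2 \<partial>torus) - (2 * pi) ^ 3 * s n = (\<integral>x. (norm (g x - S n x))\<^sup>2 \<partial>torus)" for n
      using norm_diff_trig[OF finite_modes gq, of n] ext[of "cf g" a, OF gcf] by (simp add: S_def s_def)
    moreover have "0 \<le> (\<integral>x. (norm (g x - S n x))\<^sup>2 \<partial>torus)" for n
      by (rule Bochner_Integration.integral_nonneg) simp
    ultimately show "\<forall>\<^sub>F n in sequentially. norm ((\<integral>x. (norm (g x))\<^sup>2 \<partial>torus) - (2 * pi) ^ 3 * s n) \<le> (2 * pi) ^ 3 * (l - s n)"
      using gdiff by simp
  qed
  moreover have "(\<lambda>n. (\<integral>x. (norm (g x))\<^sup>2 \<partial>torus) - (2 * pi) ^ 3 * s n) \<longlonglongrightarrow> (\<integral>x. (norm (g x))\<^sup>2 \<partial>torus) - (2 * pi) ^ 3 * l"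
    by (intro tendsto_intros sl)
  ultimately have "(\<integral>x. (norm (g x))\<^sup>2 \<partial>torus) = (2 * pi) ^ 3 * l"
    using LIMSEQ_unique by fastforce
  with gq gcf show ?thesis using that unfolding l_def by blast
qed

section \<open>Completeness of the characters\<close>

inductive trig_poly :: "(real^3 \<Rightarrow> complex) \<Rightarrow> bool" where
  ef: "trig_poly (ef k)"
| add: "trig_poly f \<Longrightarrow> trig_poly g \<Longrightarrow> trig_poly (\<lambda>x. f x + g x)"
| cmult: "trig_poly f \<Longrightarrow> trig_poly (\<lambda>x. c * f x)"

lemma trig_poly_const: "trig_poly (\<lambda>_. c)"
  using trig_poly.cmult[OF trig_poly.ef[of 0], of c] by simp

lemma trig_poly_mult:
  assumes "trig_poly f" "trig_poly g"
  shows "trig_poly (\<lambda>x. f x * g x)"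
  using assms(1)
proof induction
  case (ef k)
  from assms(2) show ?case
  proof induction
    case (ef l)
    then show ?case by (simp add: ef_mult trig_poly.ef)
  next
    case (add f g)
    then show ?case by (simp add: distrib_left trig_poly.add)
  next
    case (cmult f c)
    then show ?case by (simp add: mult.left_commute[of _ c] trig_poly.cmult)
  qed
next
  case (add f g)
  then show ?case by (simp add: distrib_right trig_poly.add)
next
  case (cmult f c)
  then show ?case by (simp add: mult.assoc trig_poly.cmult)
qed

lemma trig_poly_sum: "(\<And>i. i \<in> I \<Longrightarrow> trig_poly (f i)) \<Longrightarrow> trig_poly (\<lambda>x. \<Sum>i\<in>I. f i x)"
  by (induction I rule: infinite_finite_induct) (auto intro: trig_poly_const trig_poly.add)

lemma trig_poly_sq_int: "trig_poly f \<Longrightarrow> sq_int f"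
  by (induction rule: trig_poly.induct) (auto intro: sq_int_ef sq_int_add sq_int_cmult)

lemma trig_poly_ip_zero:
  assumes "trig_poly g" "sq_int f" "\<And>k. cf f k = 0"
  shows "ip f g = 0"
  using assms(1)
proof induction
  case (ef k)
  then show ?case by (simp add: ip_ef assms)
qed (simp_all add: ip_add_right ip_cmult_right trig_poly_sq_int assms(2))

definition circle_map :: "real^3 \<Rightarrow> complex^3" where
  "circle_map x = (\<chi> i. cis (x $ i))"

lemma continuous_circle_map: "continuous_on A circle_map"
  unfolding circle_map_def[abs_def] cis_conv_exp
  by (intro continuous_intros)

lemma ef_axis: "ef (axis i n) x = cis (of_int n * x $ i)"
proof -
  have "freq (axis i n) = axis i (of_int n)" by (simp add: freq_def axis_def vec_eq_iff)
  then show ?thesis by (simp add: ef_def inner_axis')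
qed

text \<open>Real polynomials are generated by linear forms, and the real coordinates of a point of
  the three circles are \<open>cos (x $ i)\<close> and \<open>sin (x $ i)\<close>, each a
  combination of two characters.\<close>

lemma trig_poly_circle_map:
  assumes "real_polynomial_function p"
  shows "trig_poly (\<lambda>x. complex_of_real (p (circle_map x)))"
  using assms
proof induction
  case (linear p)
  then interpret bounded_linear p .
  have p: "p (circle_map x) = (\<Sum>b\<in>Basis. (circle_map x \<bullet> b) * p b)" for x
    by (subst euclidean_representation[of "circle_map x", symmetric]) (simp add: sum scaleR)
  have "trig_poly (\<lambda>x. complex_of_real (circle_map x \<bullet> b))" if "b \<in> Basis" for b
  proof -
    obtain i c where b: "b = axis i c" "c = 1 \<or> c = \<i>" using \<open>b \<in> Basis\<close>
      by (auto simp: Basis_vec_def Basis_complex_def)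
    have cos: "complex_of_real (cos (x $ i)) = (1/2) * ef (axis i 1) x + (1/2) * ef (axis i (-1)) x" for x
      by (simp add: ef_axis complex_eq_iff)
    have sin: "complex_of_real (sin (x $ i)) = (- \<i> / 2) * ef (axis i 1) x + (\<i>/2) * ef (axis i (-1)) x" for x
      by (simp add: ef_axis complex_eq_iff)
    have "trig_poly (\<lambda>x. complex_of_real (cos (x $ i)))" "trig_poly (\<lambda>x. complex_of_real (sin (x $ i)))"
      unfolding cos sin by (intro trig_poly.intros)+
    then show ?thesis
      using b by (auto simp: circle_map_def inner_axis inner_complex_def)
  qed
  then have "trig_poly (\<lambda>x. \<Sum>b\<in>Basis. complex_of_real (p b) * complex_of_real (circle_map x \<bullet> b))"
    by (intro trig_poly_sum trig_poly.cmult)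
  then show ?case by (simp add: p mult.commute)
qed (auto intro: trig_poly_const trig_poly.add trig_poly_mult)

text \<open>One of the points is taken in the open cell because opposite faces of the closed cell
  have the same image; an interior coordinate is determined by its point on the circle.\<close>

lemma circle_map_inj:
  assumes eq: "circle_map x = circle_map y"
    and x: "x \<in> cbox 0 (\<chi> i. 2 * pi)" and y: "y \<in> box 0 (\<chi> i. 2 * pi)"
  shows "x = y"
proof -
  have "x $ i = y $ i" for i
  proof -
    have "cis (x $ i) = cis (y $ i)" using eq by (simp add: circle_map_def vec_eq_iff)
    then have "cos (x $ i) = cos (y $ i)" "sin (x $ i) = sin (y $ i)" by (simp_all add: complex_eq_iff)
    then obtain n :: int where n: "x $ i = y $ i + 2 * pi * n"
      using sin_cos_eq_iff[of "x $ i" "y $ i"] by (auto simp: mult_ac)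
    have "0 \<le> x $ i" "x $ i \<le> 2 * pi" "0 < y $ i" "y $ i < 2 * pi"
      using x y by (auto simp: mem_box_cart)
    then have "\<bar>2 * pi * real_of_int n\<bar> < 2 * pi * 1" using n by linarith
    then have "\<bar>real_of_int n\<bar> < 1" by (simp add: abs_mult)
    then have "n = 0" by linarith
    then show ?thesis using n by simp
  qed
  then show ?thesis by (simp add: vec_eq_iff)
qed

text \<open>\<open>circle_map\<close> embeds the open cell, so Stone--Weierstrass makes trigonometric polynomials dense
  among the continuous functions that factor through it.\<close>

lemma integral_compact_zero:
  assumes f: "sq_int f" "\<And>k. cf f k = 0"
    and K: "compact K" "K \<subseteq> box 0 (\<chi> i. 2 * pi)"
  shows "(\<integral>x. indicator K x *\<^sub>R f x \<partial>torus) = 0"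
proof (cases "K = {}")
  case False
  define S where "S = circle_map ` cbox 0 (\<chi> i. 2 * pi)"
  define K' where "K' = circle_map ` K"
  have S: "compact S" unfolding S_def by (intro compact_continuous_image continuous_circle_map compact_cbox)
  have K': "compact K'" unfolding K'_def by (intro compact_continuous_image continuous_circle_map K)
  have K'ne: "K' \<noteq> {}" using False by (simp add: K'_def)
  \<comment> \<open>Continuous cutoffs on the image, equal to 1 on \<open>K'\<close> and eventually
    0 at each point off it, since \<open>K'\<close> is closed.\<close>
  define h where "h n z = max 0 (1 - real n * infdist z K')" for n z
  have "\<exists>p. real_polynomial_function p \<and> (\<forall>z\<in>S. \<bar>h n z - p z\<bar> < 1 / Suc n)" for n
  proof -
    have "continuous_on S (h n)" unfolding h_def by (intro continuous_intros)
    then obtain p where "real_polynomial_function p" "\<And>z. z \<in> S \<Longrightarrow> \<bar>h n z - p z\<bar> < 1 / Suc n"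
      by (rule Stone_Weierstrass_real_polynomial_function[OF S _, of _ "1 / Suc n"]) auto
    then show ?thesis by blast
  qed
  then obtain p where p: "\<And>n. real_polynomial_function (p n)" "\<And>n z. z \<in> S \<Longrightarrow> \<bar>h n z - p n z\<bar> < 1 / Suc n"
    by metis
  define q where "q n x = p n (circle_map x)" for n x
  have tq: "trig_poly (\<lambda>x. complex_of_real (q n x))" for n
    unfolding q_def by (rule trig_poly_circle_map[OF p(1)])
  have z: "(\<integral>x. f x * complex_of_real (q n x) \<partial>torus) = 0" for n
    using trig_poly_ip_zero[OF tq f, of n] by (simp add: ip_def)
  have fm [measurable]: "f \<in> borel_measurable torus" using f by measurable
  have [measurable]: "(\<lambda>x. complex_of_real (q n x)) \<in> borel_measurable torus" for n
    using trig_poly_sq_int[OF tq] by measurable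
  have [measurable]: "K \<in> sets borel" using K(1) by (rule borel_compact)
  have [measurable]: "(\<lambda>x. complex_of_real (indicator K x)) \<in> borel_measurable torus"
    by (rule measurable_torus) measurable
  have qlim: "(\<lambda>n. q n x) \<longlonglongrightarrow> indicator K x" if x: "x \<in> space torus" for x
  proof -
    have xS: "circle_map x \<in> S" using x by (auto simp: S_def space_torus)
    have hl: "(\<lambda>n. h n (circle_map x)) \<longlonglongrightarrow> indicator K x"
    proof (cases "x \<in> K")
      case True
      then have "circle_map x \<in> K'" by (auto simp: K'_def)
      then show ?thesis using True by (simp add: h_def infdist_zero)
    next
      case False
      have "circle_map x \<notin> K'"
      proof
        assume "circle_map x \<in> K'"
        then obtain y where y: "y \<in> K" "circle_map x = circle_map y" by (auto simp: K'_def)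
        have "x = y" by (rule circle_map_inj[OF y(2)]) (use x K(2) y(1) in \<open>auto simp: space_torus\<close>)
        then show False using False y(1) by simp
      qed
      then have pos: "infdist (circle_map x) K' > 0"
        using compact_imp_closed[OF K'] K'ne infdist_pos_not_in_closed by blast
      obtain N where N: "1 < real N * infdist (circle_map x) K'"
        using reals_Archimedean3[OF pos] by blast
      have "h n (circle_map x) = 0" if "n \<ge> N" for n
      proof -
        have "real N * infdist (circle_map x) K' \<le> real n * infdist (circle_map x) K'"
          using pos that by (intro mult_right_mono) auto
        then show ?thesis using N by (simp add: h_def)
      qed
      then show ?thesis using False
        by (intro tendsto_eventually) (auto simp: eventually_sequentially)
    qed
    have "(\<lambda>n. q n x - h n (circle_map x)) \<longlonglongrightarrow> 0"
    proof (rule Lim_null_comparison)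
      show "\<forall>\<^sub>F n in sequentially. norm (q n x - h n (circle_map x)) \<le> 1 / Suc n"
        using p(2)[OF xS] by (auto simp: q_def abs_minus_commute intro!: always_eventually less_imp_le)
      show "(\<lambda>n. 1 / real (Suc n)) \<longlonglongrightarrow> 0" using LIMSEQ_inverse_real_of_nat by (simp add: divide_inverse)
    qed
    from tendsto_add[OF this hl] show ?thesis by simp
  qed
  have qb: "\<bar>q n x\<bar> \<le> 2" if x: "x \<in> space torus" for x n
  proof -
    have xS: "circle_map x \<in> S" using x by (auto simp: S_def space_torus)
    have "0 \<le> h n (circle_map x)" "h n (circle_map x) \<le> 1" by (auto simp: h_def infdist_nonneg)
    moreover have "1 / real (Suc n) \<le> 1" by simp
    ultimately show ?thesis using p(2)[OF xS, of n] unfolding q_def by linarith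
  qed
  have "(\<lambda>n. \<integral>x. f x * complex_of_real (q n x) \<partial>torus) \<longlonglongrightarrow> (\<integral>x. f x * complex_of_real (indicator K x) \<partial>torus)"
  proof (rule integral_dominated_convergence[where w="\<lambda>x. 2 * norm (f x)"])
    show "integrable torus (\<lambda>x. 2 * norm (f x))" using sq_int_integrable[OF f(1)] by simp
    show "AE x in torus. (\<lambda>n. f x * complex_of_real (q n x)) \<longlonglongrightarrow> f x * complex_of_real (indicator K x)"
      by (rule AE_I2) (intro tendsto_intros qlim)
    show "AE x in torus. norm (f x * complex_of_real (q n x)) \<le> 2 * norm (f x)" for n
    proof (rule AE_I2)
      fix x assume "x \<in> space torus"
      then have "norm (f x) * \<bar>q n x\<bar> \<le> norm (f x) * 2" by (intro mult_left_mono qb) auto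
      then show "norm (f x * complex_of_real (q n x)) \<le> 2 * norm (f x)" by (simp add: norm_mult)
    qed
  qed measurable
  then have "(\<integral>x. f x * complex_of_real (indicator K x) \<partial>torus) = 0"
    by (simp add: z LIMSEQ_const_iff)
  then show ?thesis by (simp add: scaleR_conv_of_real mult.commute)
qed simp

lemma AE_torus_box: "AE x in torus. x \<in> box 0 (\<chi> i. 2 * pi)"
proof -
  have "negligible (cbox 0 (\<chi> i. 2 * pi) - box 0 (\<chi> i. 2 * pi) :: (real^3) set)"
    using negligible_frontier_interval .
  then have "AE x in lebesgue. x \<notin> cbox 0 (\<chi> i. 2 * pi) - (box 0 (\<chi> i. 2 * pi) :: (real^3) set)"
    unfolding negligible_iff_null_sets by (rule AE_not_in)
  then show ?thesis unfolding torus_def by (subst AE_restrict_space_iff) auto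
qed

text \<open>Inner regularity writes the set where \<open>Re (f x)\<close> is positive as an
  increasing union of compact sets up to a null set. The integral of \<open>f\<close> over each of
  them is 0, hence also over the whole set; as the real part is positive there, the set is
  null.\<close>

lemma Re_nonpos_AE:
  assumes f: "sq_int f" "\<And>k. cf f k = 0"
  shows "AE x in torus. Re (f x) \<le> 0"
proof -
  let ?B = "box 0 (\<chi> i. 2 * pi) :: (real^3) set"
  define A where "A = {x \<in> ?B. Re (f x) > 0}"
  have fm [measurable]: "f \<in> borel_measurable torus" using f by measurable
  have "{x \<in> space torus. Re (f x) > 0} \<in> sets torus" by measurable
  then have "{x \<in> space torus. Re (f x) > 0} \<in> sets lebesgue"
    unfolding torus_def by (subst (asm) sets_restrict_space_iff) auto
  moreover have "A = ?B \<inter> {x \<in> space torus. Re (f x) > 0}"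
    using box_subset_cbox by (auto simp: A_def space_torus)
  ultimately have Al: "A \<in> sets lebesgue" by auto
  obtain N C where NC: "negligible N" "\<And>n::nat. compact (C n)" "A = (\<Union>n. C n) \<union> N"
    using lebesgue_regular_inner[OF Al] by metis
  \<comment> \<open>Increasing finite unions, so that the indicators converge pointwise off
    \<open>N\<close>.\<close>
  define D where "D n = (\<Union>i\<le>n. C i)" for n
  have D: "compact (D n)" "D n \<subseteq> ?B" for n
    unfolding D_def using NC by (auto intro!: compact_UN simp: A_def)
  have [measurable]: "(\<lambda>x. indicator (D n) x :: real) \<in> borel_measurable torus" for n
    by (rule measurable_torus) (use D(1)[of n] in \<open>auto intro!: borel_measurable_indicator borel_compact\<close>)
  have [measurable]: "(\<lambda>x. indicator A x :: real) \<in> borel_measurable torus"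
    unfolding torus_def using Al by (intro measurable_restrict_space1) auto
  have "AE x in lebesgue. x \<notin> N" using NC(1) by (simp add: negligible_iff_null_sets AE_not_in)
  then have N: "AE x in torus. x \<notin> N" unfolding torus_def by (subst AE_restrict_space_iff) auto
  have "(\<lambda>n. \<integral>x. indicator (D n) x *\<^sub>R f x \<partial>torus) \<longlonglongrightarrow> (\<integral>x. indicator A x *\<^sub>R f x \<partial>torus)"
  proof (rule integral_dominated_convergence[where w="\<lambda>x. norm (f x)"])
    show "integrable torus (\<lambda>x. norm (f x))" using sq_int_integrable[OF f(1)] by simp
    show "AE x in torus. (\<lambda>n. indicator (D n) x *\<^sub>R f x) \<longlonglongrightarrow> indicator A x *\<^sub>R f x"
      using N
    proof eventually_elim
      case (elim x)
      show ?case
      proof (rule tendsto_eventually)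
        show "\<forall>\<^sub>F n in sequentially. indicator (D n) x *\<^sub>R f x = indicator A x *\<^sub>R f x"
        proof (cases "x \<in> A")
          case True
          then obtain m where "x \<in> C m" using NC elim by auto
          then have "x \<in> D n" if "n \<ge> m" for n using that by (auto simp: D_def)
          then show ?thesis using True unfolding eventually_sequentially by (intro exI[of _ m]) simp
        next
          case False
          then have "x \<notin> D n" for n using NC by (auto simp: D_def)
          then show ?thesis using False by simp
        qed
      qed
    qed
    show "(\<lambda>x. indicator A x *\<^sub>R f x) \<in> borel_measurable torus" by measurable
    show "(\<lambda>x. indicator (D n) x *\<^sub>R f x) \<in> borel_measurable torus" for n by measurable
    show "AE x in torus. norm (indicator (D n) x *\<^sub>R f x) \<le> norm (f x)" for n
      by (rule AE_I2) (simp split: split_indicator)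
  qed
  then have "(\<integral>x. indicator A x *\<^sub>R f x \<partial>torus) = 0"
    by (simp add: integral_compact_zero[OF f D] LIMSEQ_const_iff)
  moreover have int: "integrable torus (\<lambda>x. indicator A x *\<^sub>R f x)"
  proof (rule Bochner_Integration.integrable_bound[OF integrable_norm[OF sq_int_integrable[OF f(1)]]])
    show "(\<lambda>x. indicator A x *\<^sub>R f x) \<in> borel_measurable torus" by measurable
    show "AE x in torus. norm (indicator A x *\<^sub>R f x) \<le> norm (norm (f x))"
      by (rule AE_I2) (simp split: split_indicator)
  qed
  ultimately have "(\<integral>x. indicator A x * Re (f x) \<partial>torus) = 0"
    using integral_Re[OF int] by simp
  moreover have "integrable torus (\<lambda>x. indicator A x * Re (f x))" using integrable_Re[OF int] by simp
  ultimately have "AE x in torus. indicator A x * Re (f x) = 0"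
    by (subst (asm) integral_nonneg_eq_0_iff_AE) (auto simp: A_def indicator_def)
  then show ?thesis using AE_torus_box
    by eventually_elim (auto simp: A_def indicator_def not_less split: if_splits)
qed

text \<open>Multiplication by 1, -1, i and -i turns the one-sided statement into the vanishing of
  real and imaginary part.\<close>

lemma cf_zero_AE:
  assumes f: "sq_int f" "\<And>k. cf f k = 0"
  shows "AE x in torus. f x = 0"
proof -
  have "AE x in torus. Re (c * f x) \<le> 0" for c
    by (rule Re_nonpos_AE) (auto simp: sq_int_cmult f cf_cmult)
  from this[of 1] this[of "-1"] this[of \<i>] this[of "-\<i>"] show ?thesis
    by eventually_elim (auto simp: complex_eq_iff)
qed

lemma cf_eq_AE:
  assumes "sq_int f" "sq_int g" "\<And>k. cf f k = cf g k"
  shows "AE x in torus. f x = g x"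
  using cf_zero_AE[OF sq_int_diff[OF assms(1,2)]] assms by (simp add: cf_diff)

lemma summable_cf_power2:
  assumes f: "sq_int f"
  shows "(\<lambda>k. (norm (cf f k))\<^sup>2) summable_on UNIV"
proof (rule nonneg_bdd_above_summable_on)
  show "bdd_above (sum (\<lambda>k. (norm (cf f k))\<^sup>2) ` {F. F \<subseteq> UNIV \<and> finite F})"
  proof (rule bdd_aboveI2)
    fix F :: "(int^3) set" assume "F \<in> {F. F \<subseteq> UNIV \<and> finite F}"
    then show "(\<Sum>k\<in>F. (norm (cf f k))\<^sup>2) \<le> (\<integral>x. (norm (f x))\<^sup>2 \<partial>torus) / (2 * pi) ^ 3"
      using bessel[of F f] f by (simp add: pos_le_divide_eq mult.commute)
  qed
qed simp

text \<open>Riesz-Fischer yields a function with the coefficients of \<open>f\<close> and the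
  expected norm; by uniqueness it is \<open>f\<close> almost everywhere, so that Bessel's inequality
  is an equality.\<close>

theorem parseval_has_sum:
  assumes f: "sq_int f"
  shows "((\<lambda>k. (norm (cf f k))\<^sup>2) has_sum (\<integral>x. (norm (f x))\<^sup>2 \<partial>torus) / (2 * pi) ^ 3) UNIV"
proof -
  obtain g where g: "sq_int g" "\<And>k. cf g k = cf f k"
    "(\<integral>x. (norm (g x))\<^sup>2 \<partial>torus) = (2 * pi) ^ 3 * (\<Sum>\<^sub>\<infinity>k. (norm (cf f k))\<^sup>2)"
    using riesz_fischer[OF summable_cf_power2[OF f]] by blast
  have "AE x in torus. f x = g x" using g(2) by (intro cf_eq_AE f g(1)) simp
  then have "(\<integral>x. (norm (f x))\<^sup>2 \<partial>torus) = (\<integral>x. (norm (g x))\<^sup>2 \<partial>torus)"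
    using f g(1) by (intro integral_cong_AE) (auto simp: sq_int_def)
  then have "(\<integral>x. (norm (f x))\<^sup>2 \<partial>torus) / (2 * pi) ^ 3 = (\<Sum>\<^sub>\<infinity>k. (norm (cf f k))\<^sup>2)"
    unfolding g(3) by simp
  then show ?thesis using has_sum_infsum[OF summable_cf_power2[OF f]] by simp
qed

lemma polarization_complex:
  fixes a b :: complex
  shows "a * cnj b = (complex_of_real ((norm (a + b))\<^sup>2) - complex_of_real ((norm (a - b))\<^sup>2)
     + \<i> * complex_of_real ((norm (a + \<i> * b))\<^sup>2) - \<i> * complex_of_real ((norm (a - \<i> * b))\<^sup>2)) / 4"
  unfolding complex_norm_square by (simp add: algebra_simps)

text \<open>Polarisation of the norm identity, on the side of the coefficients and on the side of
  the integrals.\<close>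

theorem parseval_ip:
  assumes f: "sq_int f" and g: "sq_int g"
  shows "((\<lambda>k. cf f k * cnj (cf g k)) has_sum ip f g / (2 * pi) ^ 3) UNIV"
proof -
  note sq = sq_int_add[OF f g] sq_int_diff[OF f g]
    sq_int_add[OF f sq_int_cmult[OF g, of \<i>]] sq_int_diff[OF f sq_int_cmult[OF g, of \<i>]]
  define P where "P h = complex_of_real ((\<integral>x. (norm (h x))\<^sup>2 \<partial>torus) / (2 * pi) ^ 3)" for h :: "real^3 \<Rightarrow> complex"
  have P: "((\<lambda>k. complex_of_real ((norm (cf h k))\<^sup>2)) has_sum P h) UNIV" if "sq_int h" for h
    unfolding P_def by (intro has_sum_of_real parseval_has_sum that)
  have "((\<lambda>k. (1/4) * (complex_of_real ((norm (cf f k + cf g k))\<^sup>2) + - complex_of_real ((norm (cf f k - cf g k))\<^sup>2)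
     + \<i> * complex_of_real ((norm (cf f k + \<i> * cf g k))\<^sup>2) + - (\<i> * complex_of_real ((norm (cf f k - \<i> * cf g k))\<^sup>2))))
     has_sum (1/4) * (P (\<lambda>x. f x + g x) + - P (\<lambda>x. f x - g x) + \<i> * P (\<lambda>x. f x + \<i> * g x) + - (\<i> * P (\<lambda>x. f x - \<i> * g x)))) UNIV"
    using P[OF sq(1)] P[OF sq(2)] P[OF sq(3)] P[OF sq(4)] f g
    by (intro has_sum_cmult_right has_sum_add has_sum_uminusI)
       (simp_all add: cf_add cf_diff sq_int_cmult cf_cmult del: of_real_power)
  also have "(\<lambda>k. (1/4) * (complex_of_real ((norm (cf f k + cf g k))\<^sup>2) + - complex_of_real ((norm (cf f k - cf g k))\<^sup>2)
     + \<i> * complex_of_real ((norm (cf f k + \<i> * cf g k))\<^sup>2) + - (\<i> * complex_of_real ((norm (cf f k - \<i> * cf g k))\<^sup>2))))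
     = (\<lambda>k. cf f k * cnj (cf g k))"
    unfolding polarization_complex by (simp del: of_real_power)
  also have "(1/4) * (P (\<lambda>x. f x + g x) + - P (\<lambda>x. f x - g x) + \<i> * P (\<lambda>x. f x + \<i> * g x) + - (\<i> * P (\<lambda>x. f x - \<i> * g x))) = ip f g / (2 * pi) ^ 3"
  proof -
    have P': "P h = ip h h / (2 * pi) ^ 3" for h by (simp add: P_def ip_self)
    have ips: "ip (\<lambda>x. f x + g x) (\<lambda>x. f x + g x) = ip f f + ip f g + (ip g f + ip g g)"
      "ip (\<lambda>x. f x - g x) (\<lambda>x. f x - g x) = ip f f - ip f g - (ip g f - ip g g)"
      "ip (\<lambda>x. f x + \<i> * g x) (\<lambda>x. f x + \<i> * g x) = ip f f - \<i> * ip f g + (\<i> * ip g f + ip g g)"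
      "ip (\<lambda>x. f x - \<i> * g x) (\<lambda>x. f x - \<i> * g x) = ip f f + \<i> * ip f g - (\<i> * ip g f - ip g g)"
      using f g
      by (simp_all add: distrib_left right_diff_distrib sq_int_add sq_int_diff sq_int_cmult ip_add_left ip_add_right ip_diff_left ip_diff_right ip_cmult_left ip_cmult_right)
    define D where "D = ((2 * pi) ^ 3 :: complex)"
    show ?thesis unfolding P' ips D_def[symmetric]
      by (simp add: algebra_simps add_divide_distrib diff_divide_distrib)
  qed
  finally show ?thesis .
qed

section \<open>Trilinear estimate\<close>

lemma norm_freq_ge_1:
  assumes "k \<noteq> 0"
  shows "1 \<le> norm (freq k)"
proof -
  obtain i where "k $ i \<noteq> 0" using assms by (auto simp: vec_eq_iff)
  then have "1 \<le> \<bar>freq k $ i\<bar>" unfolding freq_def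
    by (simp del: of_int_abs add: of_int_abs[symmetric])
  then show ?thesis using component_le_norm_cart[of "freq k" i] by linarith
qed

lemma card_modes_le: "card (modes n) \<le> (2 * n + 1) ^ 3"
proof -
  have "card (modes n) \<le> card ((\<lambda>f. (\<chi> i. f i) :: int^3) ` (UNIV \<rightarrow>\<^sub>E {- int n..int n}))"
    by (intro card_mono modes_subset finite_imageI finite_PiE) auto
  also have "\<dots> \<le> card ((UNIV :: 3 set) \<rightarrow>\<^sub>E {- int n..int n})"
    by (intro card_image_le finite_PiE) auto
  also have "\<dots> = (2 * n + 1) ^ 3"
    by (simp add: card_PiE nat_add_distrib nat_mult_distrib)
  finally show ?thesis .
qed

text \<open>Induction over dyadic shells. The radius \<open>2 ^ j - 1\<close> is such that a point
  outside has a coordinate of size at least \<open>2 ^ j\<close>; the shell has at most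
  \<open>64 * 8 ^ j\<close> points, so it adds at most 64 r^j with r = 2 powr (3 - 2s) > 1. The
  divisor r - 1 makes the geometric sum close exactly: r^j + r^j / (r - 1) = r^(j+1) / (r -
  1).\<close>

lemma lattice_sum_dyadic:
  assumes s: "0 \<le> s" "2 * s < 3"
  shows "(\<Sum>p\<in>modes (2 ^ j - 1) - {0}. norm (freq p) powr (- 2 * s))
    \<le> 64 * (2 powr (3 - 2 * s)) ^ j / (2 powr (3 - 2 * s) - 1)"
proof (induction j)
  case 0
  have *: "modes 0 - {0} = {}" by (auto simp: modes_def vec_eq_iff)
  have "1 < 2 powr (3 - 2 * s)" using s by (intro gr_one_powr) auto
  then show ?case by (simp add: * del: Diff_eq_empty_iff)
next
  case (Suc j)
  define r where "r = 2 powr (3 - 2 * s)"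
  have r: "r > 1" unfolding r_def using s by (intro gr_one_powr) auto
  let ?A = "modes (2 ^ j - 1) - {0}" and ?B = "modes (2 ^ Suc j - 1) - {0}"
  have AB: "?A \<subseteq> ?B" using modes_mono[of "2^j - 1" "2 ^ Suc j - 1"]
    by (intro Diff_mono) (auto simp: diff_le_mono)
  have "norm (freq p) powr (- 2 * s) \<le> (2 ^ j) powr (- 2 * s)" if p: "p \<in> ?B - ?A" for p
  proof -
    obtain i where "\<not> \<bar>p $ i\<bar> \<le> int (2 ^ j - 1)" using p by (auto simp: modes_def)
    then have "2 ^ j \<le> \<bar>p $ i\<bar>" by (simp add: of_nat_diff)
    then have "2 ^ j \<le> \<bar>freq p $ i\<bar>" unfolding freq_def
      by (metis of_int_abs of_int_le_iff of_int_numeral of_int_power vec_lambda_beta)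
    then have "2 ^ j \<le> norm (freq p)" using component_le_norm_cart[of "freq p" i] by linarith
    then show ?thesis using s by (intro powr_mono2') auto
  qed
  then have "(\<Sum>p\<in>?B - ?A. norm (freq p) powr (- 2 * s)) \<le> real (card (?B - ?A)) * (2 ^ j) powr (- 2 * s)"
    by (rule sum_bounded_above)
  also have "\<dots> \<le> 64 * 8 ^ j * (2 ^ j) powr (- 2 * s)"
  proof (rule mult_right_mono)
    have "card (?B - ?A) \<le> card (modes (2 ^ Suc j - 1))" by (intro card_mono) auto
    also have "\<dots> \<le> (2 * (2 ^ Suc j - 1) + 1) ^ 3" by (rule card_modes_le)
    also have "\<dots> \<le> (4 * 2 ^ j) ^ 3"
    proof (rule power_mono)
      have "(1::nat) \<le> 2 ^ j" by simp
      then show "2 * (2 ^ Suc j - 1) + 1 \<le> (4 * 2 ^ j :: nat)" unfolding power_Suc by arith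
    qed simp
    also have "\<dots> = 64 * 8 ^ j"
    proof -
      have "((2::nat) ^ j) ^ 3 = (2 ^ 3) ^ j" by (metis power_mult mult.commute)
      then show ?thesis by (simp add: power_mult_distrib)
    qed
    finally have "real (card (?B - ?A)) \<le> real (64 * 8 ^ j)" by (simp only: of_nat_le_iff)
    then show "real (card (?B - ?A)) \<le> 64 * 8 ^ j" by simp
  qed simp
  also have "\<dots> = 64 * (8 ^ j * (2 ^ j) powr (- 2 * s))" by (rule mult.assoc)
  also have "8 ^ j * (2 ^ j) powr (- 2 * s) = r ^ j"
  proof -
    have 1: "8 ^ j = (2::real) powr (3 * real j)"
    proof -
      have "(8::real) ^ j = (2 powr 3) powr real j" by (simp add: powr_realpow)
      then show ?thesis by (simp only: powr_powr)
    qed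
    have 2: "(2 ^ j) powr (- 2 * s) = 2 powr (real j * (- 2 * s))"
      by (simp only: powr_realpow[symmetric] zero_less_numeral powr_powr)
    have 3: "r ^ j = 2 powr ((3 - 2 * s) * real j)"
      unfolding r_def by (simp add: powr_realpow[symmetric] powr_powr)
    show ?thesis unfolding 1 2 3 powr_add[symmetric] by (simp add: algebra_simps)
  qed
  finally have new: "(\<Sum>p\<in>?B - ?A. norm (freq p) powr (- 2 * s)) \<le> 64 * r ^ j" .
  have "(\<Sum>p\<in>?B. norm (freq p) powr (- 2 * s))
      = (\<Sum>p\<in>?B - ?A. norm (freq p) powr (- 2 * s)) + (\<Sum>p\<in>?A. norm (freq p) powr (- 2 * s))"
    using AB by (intro sum.subset_diff) auto
  also have "\<dots> \<le> 64 * r ^ j + 64 * r ^ j / (r - 1)"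
    using Suc new unfolding r_def by (intro add_mono)
  also have "\<dots> = 64 * r ^ Suc j / (r - 1)" using r by (simp add: field_simps)
  finally show ?case unfolding r_def .
qed

lemma lattice_sum:
  assumes s: "0 \<le> s" "2 * s < 3"
  obtains C where "C > 0"
    "\<And>R F. finite F \<Longrightarrow> (\<And>p. p \<in> F \<Longrightarrow> p \<noteq> 0 \<and> norm (freq p) \<le> R) \<Longrightarrow>
       (\<Sum>p\<in>F. norm (freq p) powr (- 2 * s)) \<le> C * R powr (3 - 2 * s)"
proof -
  define r where "r = 2 powr (3 - 2 * s)"
  have r: "r > 1" unfolding r_def using s by (intro gr_one_powr) auto
  show thesis
  proof (rule that[of "64 * r / (r - 1)"])
    show "64 * r / (r - 1) > 0" using r by simp
    fix R F assume F: "finite F" "\<And>p. p \<in> F \<Longrightarrow> p \<noteq> 0 \<and> norm (freq p) \<le> R"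
    show "(\<Sum>p\<in>F. norm (freq p) powr (- 2 * s)) \<le> 64 * r / (r - 1) * R powr (3 - 2 * s)"
    proof (cases "F = {}")
      case False
      then have R: "R \<ge> 1" using F(2) norm_freq_ge_1 by (metis ex_in_conv order_trans)
      \<comment> \<open>The dyadic scale with 2^j \<le> R < 2^(j+1). A nonempty \<open>F\<close>
        forces R \<ge> 1, so the logarithm is nonnegative.\<close>
      define j where "j = nat \<lfloor>log 2 R\<rfloor>"
      have l0: "0 \<le> log 2 R" using R by simp
      have j: "real j \<le> log 2 R" "log 2 R < real j + 1" unfolding j_def using l0 by linarith+
      have "2 powr real j \<le> 2 powr log 2 R" using j(1) by simp
      then have j1: "2 ^ j \<le> R" using R by (simp add: powr_realpow)
      have "2 powr log 2 R < 2 powr (real (Suc j))" using j(2) by simp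
      then have j2: "R < 2 ^ Suc j" using R by (simp add: powr_realpow del: power_Suc of_nat_Suc)
      have "F \<subseteq> modes (2 ^ Suc j - 1) - {0}"
      proof
        fix p assume p: "p \<in> F"
        have "\<bar>p $ i\<bar> \<le> int (2 ^ Suc j - 1)" for i
        proof -
          have "\<bar>freq p $ i\<bar> < 2 ^ Suc j" using component_le_norm_cart[of "freq p" i] F(2)[OF p] j2 by linarith
          then have "\<bar>p $ i\<bar> < 2 ^ Suc j" unfolding freq_def
            by (metis of_int_abs of_int_less_iff of_int_numeral of_int_power vec_lambda_beta)
          then show ?thesis by (simp add: of_nat_diff)
        qed
        then show "p \<in> modes (2 ^ Suc j - 1) - {0}" using F(2)[OF p] by (auto simp: modes_def)
      qed
      then have "(\<Sum>p\<in>F. norm (freq p) powr (- 2 * s)) \<le> (\<Sum>p\<in>modes (2 ^ Suc j - 1) - {0}. norm (freq p) powr (- 2 * s))"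
        by (intro sum_mono2) auto
      also have "\<dots> \<le> 64 * r ^ Suc j / (r - 1)" unfolding r_def by (rule lattice_sum_dyadic[OF s])
      also have "\<dots> = 64 * r / (r - 1) * r ^ j" by simp
      also have "\<dots> \<le> 64 * r / (r - 1) * R powr (3 - 2 * s)"
      proof (rule mult_left_mono)
        have "r ^ j = (2 ^ j) powr (3 - 2 * s)" unfolding r_def
          by (simp add: powr_realpow[symmetric] powr_powr mult.commute)
        also have "\<dots> \<le> R powr (3 - 2 * s)" using j1 s by (intro powr_mono2) auto
        finally show "r ^ j \<le> R powr (3 - 2 * s)" .
      qed (use r in simp)
      finally show ?thesis .
    qed (use r in simp)
  qed
qed

lemma Cauchy_Schwarz_sum_power2:
  fixes f g :: "'a \<Rightarrow> real"
  shows "(\<Sum>i\<in>A. f i * g i)\<^sup>2 \<le> (\<Sum>i\<in>A. (f i)\<^sup>2) * (\<Sum>i\<in>A. (g i)\<^sup>2)"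
proof -
  have "\<bar>\<Sum>i\<in>A. f i * g i\<bar> \<le> L2_set f A * L2_set g A"
    using sum_abs[of "\<lambda>i. f i * g i" A] L2_set_mult_ineq[of f g A] by (simp add: abs_mult)
  then have "(\<Sum>i\<in>A. f i * g i)\<^sup>2 \<le> (L2_set f A * L2_set g A)\<^sup>2"
    by (metis abs_ge_zero power2_abs power_mono)
  then show ?thesis by (simp add: L2_set_def power_mult_distrib sum_nonneg)
qed

text \<open>The trilinear estimate in a form free of convergence questions: squared l2 norms enter
  as bounds \<open>A\<close>, \<open>B\<close>, \<open>H\<close> for finite sums, and both sides are
  squared to avoid roots. \<open>m\<close> gives the frequency of the third factor; through
  injectivity in each argument it covers p + q as well as k - p. \<open>P\<close> selects a region
  of frequency pairs.\<close>

definition trilinear_bounded :: "(int^3 \<Rightarrow> int^3 \<Rightarrow> bool) \<Rightarrow> real \<Rightarrow> real \<Rightarrow> real \<Rightarrow> bool" where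
  "trilinear_bounded P s1 s2 C \<longleftrightarrow> (\<forall>F m a b h A B H.
      finite F \<longrightarrow> (\<forall>p q. (p, q) \<in> F \<longrightarrow> P p q) \<longrightarrow> (\<forall>p :: int^3. inj (m p)) \<longrightarrow> (\<forall>q :: int^3. inj (\<lambda>p. m p q)) \<longrightarrow>
      (\<forall>G. finite G \<longrightarrow> (\<Sum>p\<in>G. (a p)\<^sup>2) \<le> A) \<longrightarrow>
      (\<forall>G. finite G \<longrightarrow> (\<Sum>p\<in>G. (b p)\<^sup>2) \<le> B) \<longrightarrow>
      (\<forall>G. finite G \<longrightarrow> (\<Sum>p\<in>G. (h p)\<^sup>2) \<le> H) \<longrightarrow>
      (\<Sum>(p, q)\<in>F. norm (freq p) powr (- s1) * norm (freq q) powr (- s2) * a p * b q * h (m p q :: int^3))\<^sup>2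
        \<le> C * A * B * H)"

lemma trilinear_boundedD:
  fixes m :: "int^3 \<Rightarrow> int^3 \<Rightarrow> int^3"
  assumes "trilinear_bounded P s1 s2 C" "finite F" "\<And>p q. (p, q) \<in> F \<Longrightarrow> P p q" "\<And>p. inj (m p)" "\<And>q. inj (\<lambda>p. m p q)"
      "\<And>G. finite G \<Longrightarrow> (\<Sum>p\<in>G. (a p)\<^sup>2) \<le> A"
      "\<And>G. finite G \<Longrightarrow> (\<Sum>p\<in>G. (b p)\<^sup>2) \<le> B"
      "\<And>G. finite G \<Longrightarrow> (\<Sum>p\<in>G. (h p)\<^sup>2) \<le> H"
  shows "(\<Sum>(p, q)\<in>F. norm (freq p) powr (- s1) * norm (freq q) powr (- s2) * a p * b q * h (m p q))\<^sup>2
        \<le> C * A * B * H"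
  by (rule assms(1)[unfolded trilinear_bounded_def, rule_format]; fact assms)

text \<open>In the region \<open>\<bar>p\<bar> \<le> \<bar>q\<bar>\<close> the two weights are attached to \<open>b\<close>; Cauchy--Schwarz then only
  needs the lattice sum of \<open>\<bar>p\<bar>\<close>-weights, even at the endpoint \<open>s1 + s2 = 3/2\<close>.\<close>

lemma trilinear_half:
  assumes s: "0 \<le> s1" "2 * s1 < 3" "3 / 2 \<le> s1 + s2"
  shows "\<exists>C>0. trilinear_bounded (\<lambda>p q. p \<noteq> 0 \<and> norm (freq p) \<le> norm (freq q)) s1 s2 C"
proof -
  obtain C where C: "C > 0"
    "\<And>R F. finite F \<Longrightarrow> (\<And>p. p \<in> F \<Longrightarrow> p \<noteq> 0 \<and> norm (freq p) \<le> R) \<Longrightarrow>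
       (\<Sum>p\<in>F. norm (freq p) powr (- 2 * s1)) \<le> C * R powr (3 - 2 * s1)"
    using lattice_sum[OF s(1,2)] by blast
  have "trilinear_bounded (\<lambda>p q. p \<noteq> 0 \<and> norm (freq p) \<le> norm (freq q)) s1 s2 C"
    unfolding trilinear_bounded_def
  proof safe
    fix F :: "((int^3) \<times> (int^3)) set" and m :: "int^3 \<Rightarrow> int^3 \<Rightarrow> int^3" and a b h :: "int^3 \<Rightarrow> real" and A B H :: real
    assume F: "finite F" "\<forall>p q. (p, q) \<in> F \<longrightarrow> p \<noteq> 0 \<and> norm (freq p) \<le> norm (freq q)"
      and m: "\<forall>p. inj (m p)"
      and "\<forall>G. finite G \<longrightarrow> (\<Sum>p\<in>G. (a p)\<^sup>2) \<le> A"
      and "\<forall>G. finite G \<longrightarrow> (\<Sum>p\<in>G. (b p)\<^sup>2) \<le> B"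
      and "\<forall>G. finite G \<longrightarrow> (\<Sum>p\<in>G. (h p)\<^sup>2) \<le> H"
    then have a: "\<And>G. finite G \<Longrightarrow> (\<Sum>p\<in>G. (a p)\<^sup>2) \<le> A"
      and b: "\<And>G. finite G \<Longrightarrow> (\<Sum>p\<in>G. (b p)\<^sup>2) \<le> B"
      and h: "\<And>G. finite G \<Longrightarrow> (\<Sum>p\<in>G. (h p)\<^sup>2) \<le> H" by blast+
    define P where "P = fst ` F"
    define Q where "Q = snd ` F"
    have PQ: "finite P" "finite Q" "F \<subseteq> P \<times> Q" using F(1) by (auto simp: P_def Q_def intro: rev_image_eqI)
    have A0: "0 \<le> A" and B0: "0 \<le> B" and H0: "0 \<le> H" using a[of "{}"] b[of "{}"] h[of "{}"] by auto
    \<comment> \<open>For fixed p the frequencies \<open>m p q\<close> are distinct, so the inner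
      sum is a subsum of the squares of \<open>h\<close>.\<close>
    have 1: "(\<Sum>(p,q)\<in>F. (a p * h (m p q))\<^sup>2) \<le> A * H"
    proof -
      have "(\<Sum>(p,q)\<in>F. (a p * h (m p q))\<^sup>2) \<le> (\<Sum>(p,q)\<in>P\<times>Q. (a p * h (m p q))\<^sup>2)"
        using PQ by (intro sum_mono2) auto
      also have "\<dots> = (\<Sum>p\<in>P. (a p)\<^sup>2 * (\<Sum>q\<in>Q. (h (m p q))\<^sup>2))"
        by (simp add: sum.cartesian_product[symmetric] power_mult_distrib sum_distrib_left)
      also have "\<dots> \<le> (\<Sum>p\<in>P. (a p)\<^sup>2 * H)"
      proof (intro sum_mono mult_left_mono)
        fix p
        have "(\<Sum>q\<in>Q. (h (m p q))\<^sup>2) = (\<Sum>l\<in>m p ` Q. (h l)\<^sup>2)"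
          using m by (subst sum.reindex) (auto intro: inj_on_subset)
        also have "\<dots> \<le> H" using PQ by (intro h) auto
        finally show "(\<Sum>q\<in>Q. (h (m p q))\<^sup>2) \<le> H" .
      qed simp
      also have "\<dots> \<le> A * H" using a[OF PQ(1)] H0 by (simp add: sum_distrib_right[symmetric] mult_right_mono)
      finally show ?thesis .
    qed
    have 2: "(\<Sum>(p,q)\<in>F. (b q * (norm (freq p) powr (- s1) * norm (freq q) powr (- s2)))\<^sup>2) \<le> C * B"
    proof -
      have sq: "(x powr (- t))\<^sup>2 = x powr (- 2 * t)" for x t :: real
        by (simp add: power2_eq_square flip: powr_add)
      define P' where "P' q = {p \<in> P. p \<noteq> 0 \<and> norm (freq p) \<le> norm (freq q)}" for q
      have "F \<subseteq> (\<lambda>(q,p). (p,q)) ` (SIGMA q:Q. P' q)"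
        using PQ(3) F(2) by (force simp: P'_def)
      then have "(\<Sum>(p,q)\<in>F. (b q * (norm (freq p) powr (- s1) * norm (freq q) powr (- s2)))\<^sup>2)
        \<le> (\<Sum>(p,q)\<in>(\<lambda>(q,p). (p,q)) ` (SIGMA q:Q. P' q). (b q * (norm (freq p) powr (- s1) * norm (freq q) powr (- s2)))\<^sup>2)"
        using PQ by (intro sum_mono2) (auto simp: P'_def)
      also have "\<dots> = (\<Sum>(q,p)\<in>(SIGMA q:Q. P' q). (b q * (norm (freq p) powr (- s1) * norm (freq q) powr (- s2)))\<^sup>2)"
        by (subst sum.reindex) (auto simp: inj_on_def case_prod_unfold)
      also have "\<dots> = (\<Sum>q\<in>Q. \<Sum>p\<in>P' q. (b q * (norm (freq p) powr (- s1) * norm (freq q) powr (- s2)))\<^sup>2)"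
        using PQ by (subst sum.Sigma) (auto simp: P'_def)
      also have "\<dots> = (\<Sum>q\<in>Q. (b q)\<^sup>2 * norm (freq q) powr (- 2 * s2) * (\<Sum>p\<in>P' q. norm (freq p) powr (- 2 * s1)))"
        by (simp add: power_mult_distrib sq sum_distrib_left mult_ac)
      also have "\<dots> \<le> (\<Sum>q\<in>Q. (b q)\<^sup>2 * C)"
      proof (rule sum_mono)
        fix q assume "q \<in> Q"
        show "(b q)\<^sup>2 * norm (freq q) powr (- 2 * s2) * (\<Sum>p\<in>P' q. norm (freq p) powr (- 2 * s1)) \<le> (b q)\<^sup>2 * C"
        proof (cases "q = 0")
          case True
          then have "P' q = {}" by (auto simp: P'_def)
          then show ?thesis using C(1) by simp
        next
          case False
          \<comment> \<open>The ball of radius |q| contributes |q| to the power 3 - 2 s1. Together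
            with the weight of q the exponent is at most 0, and |q| \<ge> 1.\<close>
          have "norm (freq q) powr (- 2 * s2) * (\<Sum>p\<in>P' q. norm (freq p) powr (- 2 * s1))
             \<le> norm (freq q) powr (- 2 * s2) * (C * norm (freq q) powr (3 - 2 * s1))"
            using PQ(1) by (intro mult_left_mono C(2)) (auto simp: P'_def)
          also have "\<dots> = C * norm (freq q) powr (3 - 2 * s1 - 2 * s2)"
            by (simp add: mult_ac flip: powr_add)
          also have "\<dots> \<le> C * norm (freq q) powr 0"
            using s(3) C(1) norm_freq_ge_1[OF False] by (intro mult_left_mono powr_mono) auto
          also have "\<dots> = C" using False by simp
          finally show ?thesis unfolding mult.assoc by (rule mult_left_mono) simp
        qed
      qed
      also have "\<dots> \<le> C * B" using mult_right_mono[OF b[OF PQ(2)], of C] C(1)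
        by (simp add: sum_distrib_right mult.commute[of C])
      finally show ?thesis .
    qed
    have "(\<Sum>(p, q)\<in>F. norm (freq p) powr (- s1) * norm (freq q) powr (- s2) * a p * b q * h (m p q))\<^sup>2
      = (\<Sum>x\<in>F. (case x of (p,q) \<Rightarrow> a p * h (m p q)) * (case x of (p, q) \<Rightarrow> b q * (norm (freq p) powr (- s1) * norm (freq q) powr (- s2))))\<^sup>2"
      by (intro arg_cong[where f="\<lambda>x. x\<^sup>2"] sum.cong) (auto simp: mult_ac)
    also have "\<dots> \<le> (\<Sum>x\<in>F. (case x of (p,q) \<Rightarrow> a p * h (m p q))\<^sup>2) * (\<Sum>x\<in>F. (case x of (p, q) \<Rightarrow> b q * (norm (freq p) powr (- s1) * norm (freq q) powr (- s2)))\<^sup>2)"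
      by (rule Cauchy_Schwarz_sum_power2)
    also have "\<dots> \<le> (A * H) * (C * B)"
      using 1 2 A0 H0 by (intro mult_mono) (auto simp: case_prod_unfold intro!: sum_nonneg)
    finally show "(\<Sum>(p, q)\<in>F. norm (freq p) powr (- s1) * norm (freq q) powr (- s2) * a p * b q * h (m p q))\<^sup>2 \<le> C * A * B * H"
      by (simp add: mult_ac)
  qed
  with C(1) show ?thesis by blast
qed

text \<open>The pairs are split by which frequency is longer. On the second half the roles of p and
  q, of \<open>a\<close> and \<open>b\<close> and of the exponents are exchanged, which is why
  \<open>m\<close> is injective in both arguments. The factor 2 comes from squaring a sum of two
  terms.\<close>

lemma trilinear_bound:
  assumes s: "0 \<le> s1" "2 * s1 < 3" "0 \<le> s2" "2 * s2 < 3" "3 / 2 \<le> s1 + s2"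
  shows "\<exists>C>0. trilinear_bounded (\<lambda>p q. p \<noteq> 0 \<and> q \<noteq> 0) s1 s2 C"
proof -
  obtain C1 where C1: "C1 > 0" "trilinear_bounded (\<lambda>p q. p \<noteq> 0 \<and> norm (freq p) \<le> norm (freq q)) s1 s2 C1"
    using trilinear_half[OF s(1,2,5)] by blast
  have s': "3 / 2 \<le> s2 + s1" using s by linarith
  obtain C2 where C2: "C2 > 0" "trilinear_bounded (\<lambda>p q. p \<noteq> 0 \<and> norm (freq p) \<le> norm (freq q)) s2 s1 C2"
    using trilinear_half[OF s(3,4) s'] by blast
  have "trilinear_bounded (\<lambda>p q. p \<noteq> 0 \<and> q \<noteq> 0) s1 s2 (2 * C1 + 2 * C2)"
    unfolding trilinear_bounded_def
  proof safe
    fix F :: "((int^3) \<times> (int^3)) set" and m :: "int^3 \<Rightarrow> int^3 \<Rightarrow> int^3" and a b h :: "int^3 \<Rightarrow> real" and A B H :: real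
    assume F: "finite F" "\<forall>p q. (p, q) \<in> F \<longrightarrow> p \<noteq> 0 \<and> q \<noteq> 0"
      and "\<forall>p. inj (m p)" "\<forall>q. inj (\<lambda>p. m p q)"
      and "\<forall>G. finite G \<longrightarrow> (\<Sum>p\<in>G. (a p)\<^sup>2) \<le> A"
      and "\<forall>G. finite G \<longrightarrow> (\<Sum>p\<in>G. (b p)\<^sup>2) \<le> B"
      and "\<forall>G. finite G \<longrightarrow> (\<Sum>p\<in>G. (h p)\<^sup>2) \<le> H"
    then have m: "\<And>p. inj (m p)" "\<And>q. inj (\<lambda>p. m p q)"
      and a: "\<And>G. finite G \<Longrightarrow> (\<Sum>p\<in>G. (a p)\<^sup>2) \<le> A"
      and b: "\<And>G. finite G \<Longrightarrow> (\<Sum>p\<in>G. (b p)\<^sup>2) \<le> B"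
      and h: "\<And>G. finite G \<Longrightarrow> (\<Sum>p\<in>G. (h p)\<^sup>2) \<le> H" by blast+
    define F1 where "F1 = {x\<in>F. norm (freq (fst x)) \<le> norm (freq (snd x))}"
    define F2 where "F2 = prod.swap ` (F - F1)"
    let ?t = "\<lambda>(p, q). norm (freq p) powr (- s1) * norm (freq q) powr (- s2) * a p * b q * h (m p q)"
    have 1: "(sum ?t F1)\<^sup>2 \<le> C1 * A * B * H"
      using F by (intro trilinear_boundedD[OF C1(2)] m a b h) (auto simp: F1_def)
    have "(\<Sum>(p, q)\<in>F2. norm (freq p) powr (- s2) * norm (freq q) powr (- s1) * b p * a q * h ((\<lambda>q p. m p q) p q))\<^sup>2 \<le> C2 * B * A * H"
      using F by (intro trilinear_boundedD[OF C2(2)] m a b h) (auto simp: F1_def F2_def)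
    also have "(\<Sum>(p, q)\<in>F2. norm (freq p) powr (- s2) * norm (freq q) powr (- s1) * b p * a q * h ((\<lambda>q p. m p q) p q)) = sum ?t (F - F1)"
      unfolding F2_def by (subst sum.reindex) (auto simp: mult_ac intro!: sum.cong)
    finally have 2: "(sum ?t (F - F1))\<^sup>2 \<le> C2 * A * B * H" by (simp add: mult_ac)
    have "sum ?t F = sum ?t (F - F1) + sum ?t F1"
      using F(1) by (intro sum.subset_diff) (auto simp: F1_def)
    then have "(sum ?t F)\<^sup>2 \<le> 2 * (sum ?t (F - F1))\<^sup>2 + 2 * (sum ?t F1)\<^sup>2"
      using sum_squares_bound[of "sum ?t (F - F1)" "sum ?t F1"] by (simp add: power2_sum)
    then show "(sum ?t F)\<^sup>2 \<le> (2 * C1 + 2 * C2) * A * B * H"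
      using 1 2 by (simp add: algebra_simps)
  qed
  moreover have "2 * C1 + 2 * C2 > 0" using C1(1) C2(1) by simp
  ultimately show ?thesis by blast
qed

section \<open>The nonlinearity on Fourier coefficients\<close>

text \<open>No conjugation: up to the factor i this is the coefficient of the divergence.\<close>

definition kdot :: "int^3 \<Rightarrow> complex^3 \<Rightarrow> complex" where
  "kdot k z = (\<Sum>j\<in>UNIV. of_int (k $ j) * z $ j)"

text \<open>The Hermitian product; its real part is the inner product of \<open>complex^3\<close> as
  a real space, in which the energy estimates are written.\<close>

definition hdot :: "complex^3 \<Rightarrow> complex^3 \<Rightarrow> complex" where
  "hdot z w = (\<Sum>j\<in>UNIV. z $ j * cnj (w $ j))"

definition cnjv :: "complex^3 \<Rightarrow> complex^3" where
  "cnjv z = (\<chi> i. cnj (z $ i))"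

definition cfreq :: "int^3 \<Rightarrow> complex^3" where
  "cfreq k = (\<chi> i. of_int (k $ i))"

lemma inner_eq_Re_hdot: "z \<bullet> w = Re (hdot z w)"
  by (simp add: hdot_def inner_vec_def inner_complex_def)

lemma norm_smult_vec: "norm (c *s z) = norm c * norm z" for z :: "complex^3"
  by (simp add: norm_vec_def norm_mult L2_set_right_distrib)

lemma norm_kdot_le: "norm (kdot k z) \<le> norm (freq k) * norm z"
proof -
  have "norm (kdot k z) \<le> (\<Sum>j\<in>UNIV. \<bar>norm (freq k $ j)\<bar> * \<bar>norm (z $ j)\<bar>)"
    unfolding kdot_def by (rule sum_norm_le) (simp add: norm_mult freq_def)
  also have "\<dots> \<le> norm (freq k) * norm z"
    unfolding norm_vec_def by (rule L2_set_mult_ineq)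
  finally show ?thesis .
qed

lemma norm_hdot_le: "norm (hdot z w) \<le> norm z * norm w"
proof -
  have "norm (hdot z w) \<le> (\<Sum>j\<in>UNIV. \<bar>norm (z $ j)\<bar> * \<bar>norm (w $ j)\<bar>)"
    unfolding hdot_def by (rule sum_norm_le) (simp add: norm_mult)
  also have "\<dots> \<le> norm z * norm w"
    unfolding norm_vec_def by (rule L2_set_mult_ineq)
  finally show ?thesis .
qed

lemma hdot_smult_left: "hdot (c *s z) w = c * hdot z w"
  by (simp add: hdot_def sum_distrib_left mult.assoc)

lemma smult_inner: "(c *s z) \<bullet> w = Re (c * hdot z w)"
  by (simp add: inner_eq_Re_hdot hdot_smult_left)

lemma kdot_zero_left [simp]: "kdot 0 z = 0"
  by (simp add: kdot_def)

lemma kdot_zero_right [simp]: "kdot k 0 = 0"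
  by (simp add: kdot_def)

lemma kdot_add: "kdot k (z + w) = kdot k z + kdot k w"
  by (simp add: kdot_def distrib_left sum.distrib)

lemma kdot_diff: "kdot k (z - w) = kdot k z - kdot k w"
  by (simp add: kdot_def right_diff_distrib sum_subtractf)

lemma kdot_scaleR: "kdot k (r *\<^sub>R z) = r *\<^sub>R kdot k z"
  by (simp add: kdot_def scaleR_sum_right)

lemma kdot_smult: "kdot k (c *s z) = c * kdot k z"
  by (simp add: kdot_def sum_distrib_left mult_ac)

lemma kdot_diff_left: "kdot (k - l) z = kdot k z - kdot l z"
  by (simp add: kdot_def left_diff_distrib sum_subtractf)

lemma kdot_uminus_left: "kdot (- k) z = - kdot k z"
  by (simp add: kdot_def sum_negf)

lemma kdot_cnjv: "kdot k (cnjv z) = cnj (kdot k z)"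
  by (simp add: kdot_def cnjv_def)

lemma hdot_cnjv: "hdot (cnjv z) (cnjv w) = hdot w z"
  by (simp add: hdot_def cnjv_def mult.commute)

lemma cnjv_add: "cnjv (z + w) = cnjv z + cnjv w"
  by (simp add: cnjv_def vec_eq_iff)

lemma cnjv_diff: "cnjv (z - w) = cnjv z - cnjv w"
  by (simp add: cnjv_def vec_eq_iff)

lemma cnjv_scaleR: "cnjv (r *\<^sub>R z) = r *\<^sub>R cnjv z"
  by (simp add: cnjv_def vec_eq_iff)

lemma cnjv_smult: "cnjv (c *s z) = cnj c *s cnjv z"
  by (simp add: cnjv_def vec_eq_iff)

lemma cnjv_zero [simp]: "cnjv 0 = 0"
  by (simp add: cnjv_def vec_eq_iff)

lemma norm_cnjv [simp]: "norm (cnjv z) = norm z"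
  by (simp add: cnjv_def norm_vec_def)

lemma bounded_linear_cnjv: "bounded_linear cnjv"
  by (rule bounded_linear_intro[where K=1]) (simp_all add: cnjv_add cnjv_scaleR)

lemma kdot_cfreq: "kdot k (cfreq k) = complex_of_real ((norm (freq k))\<^sup>2)"
  by (simp add: kdot_def cfreq_def freq_def power2_norm_eq_inner inner_vec_def)

lemma hdot_cfreq: "hdot (cfreq k) w = cnj (kdot k w)"
  by (simp add: kdot_def cfreq_def hdot_def)

text \<open>Leray projection onto the complement of k. At k = 0 both the quotient and
  \<open>cfreq\<close> are 0, so it is the identity there.\<close>

definition proj :: "int^3 \<Rightarrow> complex^3 \<Rightarrow> complex^3" where
  "proj k z = z - (kdot k z / complex_of_real ((norm (freq k))\<^sup>2)) *s cfreq k"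

lemma kdot_proj [simp]: "kdot k (proj k z) = 0"
  by (cases "k = 0") (simp_all add: proj_def kdot_diff kdot_smult kdot_cfreq)

lemma proj_zero [simp]: "proj k 0 = 0"
  by (simp add: proj_def)

lemma proj_diff: "proj k (z - w) = proj k z - proj k w"
  by (simp add: proj_def kdot_diff diff_divide_distrib vector_sub_rdistrib)

lemma proj_scaleR: "proj k (r *\<^sub>R z) = r *\<^sub>R proj k z"
proof -
  have "(r *\<^sub>R x) / y = r *\<^sub>R (x / y)" for x y :: complex by (simp add: scaleR_conv_of_real)
  then show ?thesis by (simp add: proj_def kdot_scaleR scaleR_diff_right vec_eq_iff)
qed

lemma proj_add: "proj k (z + w) = proj k z + proj k w"
  by (simp add: proj_def kdot_add add_divide_distrib vec_eq_iff algebra_simps)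

text \<open>The removed part is parallel to k and hence orthogonal to solenoidal coefficients; this
  is how the pressure disappears from the energy computations.\<close>

lemma proj_inner:
  assumes "kdot k w = 0"
  shows "proj k z \<bullet> w = z \<bullet> w"
  using assms by (simp add: proj_def inner_diff_left smult_inner hdot_cfreq)

lemma proj_eq_self: "kdot k z = 0 \<Longrightarrow> proj k z = z"
  by (simp add: proj_def)

lemma proj_inner_sym: "proj k z \<bullet> w = z \<bullet> proj k w"
proof -
  have "proj k z \<bullet> proj k w = z \<bullet> proj k w" by (rule proj_inner) simp
  moreover have "proj k w \<bullet> proj k z = w \<bullet> proj k z" by (rule proj_inner) simp
  ultimately show ?thesis by (metis inner_commute)
qed

lemma norm_proj_le: "norm (proj k z) \<le> norm z"
proof -
  have "(norm (proj k z))\<^sup>2 = z \<bullet> proj k z"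
    unfolding power2_norm_eq_inner by (rule proj_inner) simp
  also have "\<dots> \<le> norm z * norm (proj k z)" by (rule norm_cauchy_schwarz)
  finally have "norm (proj k z) * norm (proj k z) \<le> norm z * norm (proj k z)" by (simp add: power2_eq_square)
  then show ?thesis by (cases "norm (proj k z) = 0") auto
qed

lemma bounded_linear_proj: "bounded_linear (proj k)"
  by (rule bounded_linear_intro[where K=1]) (simp_all add: proj_add proj_scaleR norm_proj_le)

lemma proj_cnjv: "proj (- k) (cnjv z) = cnjv (proj k z)"
proof -
  have "cfreq (- k) = - cfreq k" "cnjv (cfreq k) = cfreq k"
    by (simp_all add: cfreq_def cnjv_def vec_eq_iff)
  then show ?thesis
    by (simp add: proj_def cnjv_diff cnjv_smult kdot_uminus_left kdot_cnjv)
qed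

section \<open>Weighted sequence spaces\<close>

definition l2 :: "(int^3 \<Rightarrow> complex^3) \<Rightarrow> bool" where
  "l2 a \<longleftrightarrow> (\<lambda>k. (norm (a k))\<^sup>2) summable_on UNIV"

definition l2sum :: "(int^3 \<Rightarrow> complex^3) \<Rightarrow> real" where
  "l2sum a = (\<Sum>\<^sub>\<infinity>k. (norm (a k))\<^sup>2)"

text \<open>Homogeneous weight with \<open>r\<close> the full power of |k|: H^\<alpha> corresponds
  to r = 2\<alpha> and H^(2\<alpha>) to r = 4\<alpha>. As 0 powr r = 0, the zero mode is invisible;
  zero average accounts for it.\<close>

definition hs :: "real \<Rightarrow> (int^3 \<Rightarrow> complex^3) \<Rightarrow> bool" where
  "hs r a \<longleftrightarrow> (\<lambda>k. norm (freq k) powr r * (norm (a k))\<^sup>2) summable_on UNIV"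

definition hsum :: "real \<Rightarrow> (int^3 \<Rightarrow> complex^3) \<Rightarrow> real" where
  "hsum r a = (\<Sum>\<^sub>\<infinity>k. norm (freq k) powr r * (norm (a k))\<^sup>2)"

definition supp_in :: "(int^3) set \<Rightarrow> (int^3 \<Rightarrow> complex^3) \<Rightarrow> bool" where
  "supp_in K a \<longleftrightarrow> (\<forall>k. k \<notin> K \<longrightarrow> a k = 0)"

definition real_seq :: "(int^3 \<Rightarrow> complex^3) \<Rightarrow> bool" where
  "real_seq a \<longleftrightarrow> (\<forall>k. a (- k) = cnjv (a k))"

definition solenoidal :: "(int^3 \<Rightarrow> complex^3) \<Rightarrow> bool" where
  "solenoidal a \<longleftrightarrow> a 0 = 0 \<and> (\<forall>k. kdot k (a k) = 0)"

lemma infsum_supp: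
  fixes f :: "'a \<Rightarrow> 'b::{topological_comm_monoid_add, t2_space}"
  assumes "finite K" "\<And>k. k \<notin> K \<Longrightarrow> f k = 0"
  shows "f summable_on UNIV" "infsum f UNIV = sum f K"
proof -
  have "(f has_sum sum f K) UNIV"
    using assms by (intro has_sum_finite_neutralI) auto
  then show "f summable_on UNIV" "infsum f UNIV = sum f K"
    by (auto simp: has_sum_imp_summable infsumI)
qed

lemma supp_in_l2: "finite K \<Longrightarrow> supp_in K a \<Longrightarrow> l2 a"
  unfolding l2_def supp_in_def by (rule infsum_supp(1)[of K]) auto

lemma supp_in_hs: "finite K \<Longrightarrow> supp_in K a \<Longrightarrow> hs r a"
  unfolding hs_def supp_in_def by (rule infsum_supp(1)[of K]) auto

lemma hsum_supp: "finite K \<Longrightarrow> supp_in K a \<Longrightarrow> hsum r a = (\<Sum>k\<in>K. norm (freq k) powr r * (norm (a k))\<^sup>2)"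
  unfolding hsum_def supp_in_def by (rule infsum_supp(2)) auto

lemma l2sum_nonneg: "0 \<le> l2sum a"
  unfolding l2sum_def by (rule infsum_nonneg) simp

lemma hsum_nonneg: "0 \<le> hsum r a"
  unfolding hsum_def by (rule infsum_nonneg) simp

lemma sum_le_l2sum: "l2 a \<Longrightarrow> finite G \<Longrightarrow> (\<Sum>k\<in>G. (norm (a k))\<^sup>2) \<le> l2sum a"
  unfolding l2sum_def l2_def by (rule finite_sum_le_infsum) auto

lemma sum_le_hsum: "hs r a \<Longrightarrow> finite G \<Longrightarrow> (\<Sum>k\<in>G. norm (freq k) powr r * (norm (a k))\<^sup>2) \<le> hsum r a"
  unfolding hsum_def hs_def by (rule finite_sum_le_infsum) auto

lemma summable_norm_add_power2:
  fixes f g :: "'a \<Rightarrow> 'b::real_normed_vector" and c :: "'a \<Rightarrow> real"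
  assumes c: "\<And>k. 0 \<le> c k"
    and f: "(\<lambda>k. c k * (norm (f k))\<^sup>2) summable_on A" and g: "(\<lambda>k. c k * (norm (g k))\<^sup>2) summable_on A"
  shows "(\<lambda>k. c k * (norm (f k + g k))\<^sup>2) summable_on A"
proof (rule summable_on_comparison_test)
  show "(\<lambda>k. 2 * (c k * (norm (f k))\<^sup>2) + 2 * (c k * (norm (g k))\<^sup>2)) summable_on A"
    using f g by (intro summable_on_add summable_on_cmult_right)
  fix k
  have "(norm (f k + g k))\<^sup>2 \<le> (norm (f k) + norm (g k))\<^sup>2"
    by (intro power_mono norm_triangle_ineq) auto
  also have "\<dots> \<le> 2 * (norm (f k))\<^sup>2 + 2 * (norm (g k))\<^sup>2"
    using sum_squares_bound[of "norm (f k)" "norm (g k)"] by (simp add: power2_sum)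
  finally have "c k * (norm (f k + g k))\<^sup>2 \<le> c k * (2 * (norm (f k))\<^sup>2 + 2 * (norm (g k))\<^sup>2)"
    using c by (rule mult_left_mono)
  then show "c k * (norm (f k + g k))\<^sup>2 \<le> 2 * (c k * (norm (f k))\<^sup>2) + 2 * (c k * (norm (g k))\<^sup>2)"
    by (simp add: algebra_simps)
qed (use c in auto)

lemma l2_uminus: "l2 a \<Longrightarrow> l2 (\<lambda>k. - a k)"
  by (simp add: l2_def)

lemma l2_add: "l2 a \<Longrightarrow> l2 b \<Longrightarrow> l2 (\<lambda>k. a k + b k)"
  unfolding l2_def using summable_norm_add_power2[of "\<lambda>_. 1" a UNIV b] by simp

lemma l2_diff: "l2 a \<Longrightarrow> l2 b \<Longrightarrow> l2 (\<lambda>k. a k - b k)"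
  using l2_add[of a "\<lambda>k. - b k"] l2_uminus[of b] by simp

lemma hs_diff: "hs r a \<Longrightarrow> hs r b \<Longrightarrow> hs r (\<lambda>k. a k - b k)"
  unfolding hs_def using summable_norm_add_power2[of "\<lambda>k. norm (freq k) powr r" a UNIV "\<lambda>k. - b k"] by simp

text \<open>Coefficients of div (a \<otimes> b): the derivative stays outside as the output
  frequency k, so that the series converges for square-summable sequences. For solenoidal
  \<open>a\<close> it is a . grad b, because k . a(p) = (k - p) . a(p).\<close>

definition adv :: "(int^3 \<Rightarrow> complex^3) \<Rightarrow> (int^3 \<Rightarrow> complex^3) \<Rightarrow> int^3 \<Rightarrow> complex^3" where
  "adv a b k = (\<Sum>\<^sub>\<infinity>p. (\<i> * kdot k (a p)) *s b (k - p))"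

lemma bij_reflect: "bij (\<lambda>p. k - p :: int^3)"
  by (rule bij_betw_byWitness[where f'="\<lambda>p. k - p"]) auto

lemma conv_summable:
  assumes "l2 a" "l2 b"
  shows "(\<lambda>p. norm (a p) * norm (b (k - p))) summable_on UNIV"
proof (rule summable_on_comparison_test)
  have "(\<lambda>p. (norm (b (k - p)))\<^sup>2) summable_on UNIV"
    using assms(2) summable_on_reindex_bij_betw[OF bij_reflect[of k], of "\<lambda>p. (norm (b p))\<^sup>2"]
    by (simp add: l2_def)
  then show "(\<lambda>p. (norm (a p))\<^sup>2 + (norm (b (k - p)))\<^sup>2) summable_on UNIV"
    using assms(1) by (intro summable_on_add) (auto simp: l2_def)
  show "norm (a p) * norm (b (k - p)) \<le> (norm (a p))\<^sup>2 + (norm (b (k - p)))\<^sup>2" for p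
  proof -
    have "0 \<le> norm (a p) * norm (b (k - p))" by simp
    then show ?thesis using sum_squares_bound[of "norm (a p)" "norm (b (k - p))"] by linarith
  qed
qed simp

lemma adv_abs_summable:
  assumes "l2 a" "l2 b"
  shows "(\<lambda>p. norm ((\<i> * kdot k (a p)) *s b (k - p))) summable_on UNIV"
proof (rule summable_on_comparison_test)
  show "(\<lambda>p. norm (freq k) * (norm (a p) * norm (b (k - p)))) summable_on UNIV"
    by (intro summable_on_cmult_right conv_summable assms)
  show "norm ((\<i> * kdot k (a p)) *s b (k - p)) \<le> norm (freq k) * (norm (a p) * norm (b (k - p)))" for p
    using mult_right_mono[OF norm_kdot_le[of k "a p"], of "norm (b (k - p))"]
    by (simp add: norm_smult_vec norm_mult mult.assoc)
qed simp

lemma adv_summable: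
  assumes "l2 a" "l2 b"
  shows "(\<lambda>p. (\<i> * kdot k (a p)) *s b (k - p)) summable_on UNIV"
  using adv_abs_summable[OF assms] by (rule abs_summable_summable)

lemma adv_zero [simp]: "adv a b 0 = 0"
  by (simp add: adv_def)

lemma infsum_minus:
  fixes f g :: "'a \<Rightarrow> 'b::real_normed_vector"
  assumes "f summable_on A" "g summable_on A"
  shows "infsum (\<lambda>x. f x - g x) A = infsum f A - infsum g A"
proof -
  have g: "(\<lambda>x. - g x) summable_on A" using assms(2) by (simp only: summable_on_uminus)
  show ?thesis using infsum_add[OF assms(1) g] infsum_uminus[of g A] by (simp only: add_uminus_conv_diff)
qed

lemma adv_diff_left:
  assumes "l2 a" "l2 a'" "l2 b"
  shows "adv (\<lambda>k. a k - a' k) b k = adv a b k - adv a' b k"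
  unfolding adv_def using assms
  by (subst infsum_minus[symmetric]) (auto intro!: adv_summable simp: kdot_diff right_diff_distrib vector_sub_rdistrib)

lemma adv_diff_right:
  assumes "l2 a" "l2 b" "l2 b'"
  shows "adv a (\<lambda>k. b k - b' k) k = adv a b k - adv a b' k"
  unfolding adv_def using assms
  by (subst infsum_minus[symmetric]) (auto intro!: adv_summable simp: vector_ssub_ldistrib)

lemma adv_real:
  assumes "l2 a" "l2 b" "real_seq a" "real_seq b"
  shows "adv a b (- k) = cnjv (adv a b k)"
proof -
  have "bij (uminus :: int^3 \<Rightarrow> int^3)" by (rule bij_uminus)
  then have "adv a b (- k) = (\<Sum>\<^sub>\<infinity>p. (\<i> * kdot (- k) (a (- p))) *s b (- k - (- p)))"
    unfolding adv_def by (subst infsum_reindex_bij_betw[symmetric, of uminus UNIV UNIV]) auto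
  also have "\<dots> = (\<Sum>\<^sub>\<infinity>p. cnjv ((\<i> * kdot k (a p)) *s b (k - p)))"
  proof (rule infsum_cong)
    fix p
    have "b (- k - (- p)) = cnjv (b (k - p))" using assms(4) unfolding real_seq_def by (metis minus_diff_eq diff_minus_eq_add add.commute diff_conv_add_uminus)
    then show "(\<i> * kdot (- k) (a (- p))) *s b (- k - (- p)) = cnjv ((\<i> * kdot k (a p)) *s b (k - p))"
      using assms(3) by (simp add: real_seq_def kdot_uminus_left kdot_cnjv cnjv_smult)
  qed
  also have "\<dots> = cnjv (adv a b k)"
    using infsumI[OF has_sum_bounded_linear[OF bounded_linear_cnjv has_sum_infsum[OF adv_summable[OF assms(1,2), of k]]]]
    by (simp add: o_def adv_def)
  finally show ?thesis .
qed

lemma adv_supp: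
  assumes "finite K" "supp_in K a"
  shows "adv a b k = (\<Sum>p\<in>K. (\<i> * kdot k (a p)) *s b (k - p))"
  unfolding adv_def using assms by (intro infsum_supp(2)) (auto simp: supp_in_def)

lemma adv_supp_in:
  assumes "finite K" "supp_in K a" "supp_in K b"
  shows "supp_in ((\<lambda>(p, q). p + q) ` (K \<times> K)) (adv a b)"
  unfolding supp_in_def
proof safe
  fix k assume k: "k \<notin> (\<lambda>(p, q). p + q) ` (K \<times> K)"
  have "b (k - p) = 0" if "p \<in> K" for p
  proof -
    have "k - p \<notin> K" using k that by (auto simp: image_iff) (metis add.commute diff_add_cancel)
    then show ?thesis using assms(3) by (simp add: supp_in_def)
  qed
  then show "adv a b k = 0" unfolding adv_supp[OF assms(1,2)] by (simp add: sum.neutral)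
qed

text \<open>Summand of <a . grad b, c>, kept as a function of the pair so that the double sum can be
  reindexed.\<close>

definition trip :: "(int^3 \<Rightarrow> complex^3) \<Rightarrow> (int^3 \<Rightarrow> complex^3) \<Rightarrow> (int^3 \<Rightarrow> complex^3) \<Rightarrow> (int^3) \<times> (int^3) \<Rightarrow> real" where
  "trip a b c = (\<lambda>(k, p). Re ((\<i> * kdot k (a p)) * hdot (b (k - p)) (c k)))"

text \<open>Integration by parts. The substitution (k, p) to (p - k, p) exchanges b and c up to
  conjugations, which reality of both undoes; it replaces k by p - k, whose product with a(p) is -k
  . a(p) since p . a(p) = 0.\<close>

lemma trip_antisym:
  assumes a: "\<And>p. kdot p (a p) = 0" and b: "real_seq b" and c: "real_seq c"
  shows "infsum (trip a c b) UNIV = - infsum (trip a b c) UNIV"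
proof -
  have bij: "bij (\<lambda>(k, p). (p - k, p :: int^3))"
    by (rule bij_betw_byWitness[where f'="\<lambda>(k, p). (p - k, p)"]) auto
  have *: "trip a c b (p - k, p) = - trip a b c (k, p)" for k p
  proof -
    have "p - k - p = - k" by simp
    then have 1: "c (p - k - p) = cnjv (c k)" using c unfolding real_seq_def by metis
    have "b (- (k - p)) = cnjv (b (k - p))" using b unfolding real_seq_def by (rule spec)
    then have 2: "b (p - k) = cnjv (b (k - p))" by simp
    have 3: "kdot (p - k) (a p) = - kdot k (a p)" by (simp add: kdot_diff_left a)
    show ?thesis unfolding trip_def prod.case 1 2 3 hdot_cnjv by simp
  qed
  have "infsum (trip a c b) UNIV = infsum (\<lambda>x. trip a c b (case x of (k, p) \<Rightarrow> (p - k, p))) UNIV"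
    by (rule infsum_reindex_bij_betw[OF bij, symmetric])
  also have "\<dots> = infsum (\<lambda>x. - trip a b c x) UNIV"
  proof (rule infsum_cong)
    fix x :: "(int^3) \<times> (int^3)"
    show "trip a c b (case x of (k, p) \<Rightarrow> (p - k, p)) = - trip a b c x"
      by (cases x) (simp only: prod.case *)
  qed
  also have "\<dots> = - infsum (trip a b c) UNIV" by (rule infsum_uminus)
  finally show ?thesis .
qed

lemma adv_inner_has_sum:
  assumes "l2 a" "l2 b"
  shows "((\<lambda>p. trip a b c (k, p)) has_sum adv a b k \<bullet> c k) UNIV"
proof -
  have "((\<lambda>p. ((\<i> * kdot k (a p)) *s b (k - p)) \<bullet> c k) has_sum adv a b k \<bullet> c k) UNIV"
    using has_sum_bounded_linear[OF bounded_linear_inner_left has_sum_infsum[OF adv_summable[OF assms, of k]], of "c k"]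
    by (simp add: o_def adv_def)
  then show ?thesis by (simp add: trip_def smult_inner)
qed

text \<open>Fubini: finitely many k remain, each with an absolutely convergent series in p.
  Hypothesis \<open>z\<close> lets any of the three factors be the one that vanishes outside
  \<open>K\<close>, according to which argument is finitely supported.\<close>

lemma sum_adv_inner:
  assumes K: "finite K" and ab: "l2 a" "l2 b"
    and z: "\<And>k p. k \<notin> K \<Longrightarrow> kdot k (a p) = 0 \<or> b (k - p) = 0 \<or> c k = 0"
  shows "(\<Sum>k\<in>K. adv a b k \<bullet> c k) = infsum (trip a b c) UNIV"
proof -
  have sm: "(\<lambda>p. norm (trip a b c (k, p))) summable_on UNIV" for k
    using has_sum_imp_summable[OF adv_inner_has_sum[OF ab, of c k]]
    by (rule summable_on_iff_abs_summable_on_real[THEN iffD1])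
  have "(\<lambda>x. norm (trip a b c x)) summable_on (SIGMA k:K. UNIV)"
  proof (subst Infinite_Sum.abs_summable_on_Sigma_iff, intro conjI ballI)
    show "(\<lambda>p. norm (trip a b c (k, p))) summable_on UNIV" for k by (rule sm)
  qed (rule summable_on_finite[OF K])
  then have S: "trip a b c summable_on (SIGMA k:K. UNIV)" by (rule Infinite_Sum.abs_summable_summable)
  have "infsum (trip a b c) UNIV = infsum (trip a b c) (SIGMA k:K. UNIV)"
  proof (rule infsum_cong_neutral)
    fix x :: "(int^3) \<times> (int^3)" assume "x \<in> UNIV - (SIGMA k:K. UNIV)"
    then obtain k p where x: "x = (k, p)" "k \<notin> K" by (cases x) auto
    then consider "kdot k (a p) = 0" | "b (k - p) = 0" | "c k = 0" using z by blast
    then show "trip a b c x = 0"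
    proof cases
      case 1
      then show ?thesis by (simp only: x trip_def prod.case) simp
    qed (simp_all only: x trip_def prod.case, simp_all add: hdot_def)
  qed auto
  also have "\<dots> = (\<Sum>\<^sub>\<infinity>k\<in>K. \<Sum>\<^sub>\<infinity>p. trip a b c (k, p))"
    by (rule infsum_Sigma_banach[OF S, symmetric])
  also have "\<dots> = (\<Sum>k\<in>K. adv a b k \<bullet> c k)"
    using K infsumI[OF adv_inner_has_sum[OF ab]] by simp
  finally show ?thesis by simp
qed

lemma supp_in_mono: "supp_in K a \<Longrightarrow> K \<subseteq> L \<Longrightarrow> supp_in L a"
  by (auto simp: supp_in_def)

lemma real_seq_diff: "real_seq a \<Longrightarrow> real_seq b \<Longrightarrow> real_seq (\<lambda>k. a k - b k)"
  by (simp add: real_seq_def cnjv_diff)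

lemma solenoidal_diff: "solenoidal a \<Longrightarrow> solenoidal b \<Longrightarrow> solenoidal (\<lambda>k. a k - b k)"
  by (simp add: solenoidal_def kdot_diff)

text \<open>With b(x, y, z) = <x . grad y, z> and u = v + w, expanding b(u, u, v) gives four terms;
  b(w, v, v) and b(v, v, v) vanish by antisymmetry, and b(v, w, v) cancels b(v, v, w). What remains
  is quadratic in w and carries the smooth factor v.\<close>

lemma comparison_identity:
  assumes K: "finite K" "supp_in K v" "supp_in K (adv v v)"
    and u: "l2 u" "real_seq u" "solenoidal u" and v: "real_seq v" "solenoidal v"
  defines "w \<equiv> (\<lambda>k. u k - v k)"
  shows "(\<Sum>k\<in>K. adv u u k \<bullet> v k) + (\<Sum>k\<in>K. adv v v k \<bullet> w k) = (\<Sum>k\<in>K. adv w w k \<bullet> v k)"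
proof -
  have l2: "l2 v" "l2 w" using K u(1) by (auto simp: w_def supp_in_l2 intro!: l2_diff)
  have w: "real_seq w" "solenoidal w" unfolding w_def by (intro real_seq_diff solenoidal_diff u v)+
  have vK: "v k = 0" if "k \<notin> K" for k using K(2) that by (simp add: supp_in_def)
  have T: "(\<Sum>k\<in>K. adv a b k \<bullet> v k) = infsum (trip a b v) UNIV" if "l2 a" "l2 b" for a b
    using K(1) that vK by (intro sum_adv_inner) auto
  have adv_u: "adv u u k = adv w w k + adv w v k + adv v w k + adv v v k" for k
  proof -
    have "adv w w k = adv u u k - adv v u k - (adv u v k - adv v v k)"
      unfolding w_def using u(1) l2 by (simp add: adv_diff_left adv_diff_right l2_diff)
    moreover have "adv w v k = adv u v k - adv v v k" unfolding w_def using u(1) l2 by (simp add: adv_diff_left)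
    moreover have "adv v w k = adv v u k - adv v v k" unfolding w_def using u(1) l2 by (simp add: adv_diff_right)
    ultimately show ?thesis by simp
  qed
  have 1: "(\<Sum>k\<in>K. adv w v k \<bullet> v k) = 0"
    using T[OF l2(2,1)] trip_antisym[of w v v] w v by (simp add: solenoidal_def)
  have 2: "(\<Sum>k\<in>K. adv v v k \<bullet> v k) = 0"
    using T[OF l2(1,1)] trip_antisym[of v v v] v by (simp add: solenoidal_def)
  \<comment> \<open>The sum over pairs paired with \<open>w\<close>, whose support is infinite, has
    to cover every k that two frequencies of \<open>v\<close> can produce.\<close>
  define L where "L = K \<union> (\<lambda>(p, q). p + q) ` (K \<times> K)"
  have L: "finite L" "K \<subseteq> L" using K by (auto simp: L_def)
  have "(\<Sum>k\<in>K. adv v v k \<bullet> w k) = (\<Sum>k\<in>L. adv v v k \<bullet> w k)"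
    using L K(3) by (intro sum.mono_neutral_left) (auto simp: supp_in_def)
  also have "\<dots> = infsum (trip v v w) UNIV"
  proof (rule sum_adv_inner[OF L(1) l2(1) l2(1)])
    fix k p assume "k \<notin> L"
    show "kdot k (v p) = 0 \<or> v (k - p) = 0 \<or> w k = 0"
    proof (cases "p \<in> K")
      case True
      have "k - p \<notin> K" using \<open>k \<notin> L\<close> True unfolding L_def by (auto simp: image_iff) (metis add.commute diff_add_cancel)
      then show ?thesis using vK by simp
    qed (simp add: vK)
  qed
  finally have 3: "(\<Sum>k\<in>K. adv v v k \<bullet> w k) = - (\<Sum>k\<in>K. adv v w k \<bullet> v k)"
    using T[OF l2] trip_antisym[of v w v] w v by (simp add: solenoidal_def)
  have "(\<Sum>k\<in>K. adv u u k \<bullet> v k) = (\<Sum>k\<in>K. adv w w k \<bullet> v k) + (\<Sum>k\<in>K. adv w v k \<bullet> v k)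
     + (\<Sum>k\<in>K. adv v w k \<bullet> v k) + (\<Sum>k\<in>K. adv v v k \<bullet> v k)"
    by (simp add: adv_u inner_add_left sum.distrib)
  then show ?thesis using 1 2 3 by simp
qed

text \<open>The cancellations by which the weights \<alpha> and 2\<alpha> enter a product. In the
  second a factor |k| is left for the derivative, and this is the origin of the exponent 2\<alpha> -
  1.\<close>

lemma powr_split:
  assumes "k \<noteq> 0"
  shows "norm (freq k) powr (- s) * (norm (freq k) powr s * x) = x"
    "norm (freq k) powr (- (2 * s - 1)) * (norm (freq k) powr (2 * s) * x) = norm (freq k) * x"
proof -
  have "norm (freq k) > 0" using assms by simp
  then show "norm (freq k) powr (- s) * (norm (freq k) powr s * x) = x"
    "norm (freq k) powr (- (2 * s - 1)) * (norm (freq k) powr (2 * s) * x) = norm (freq k) * x"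
    by (simp_all add: mult.assoc[symmetric] powr_add[symmetric])
qed

lemma sum_le_hsum':
  assumes "hs (2 * s) a" "finite G"
  shows "(\<Sum>k\<in>G. (norm (freq k) powr s * norm (a k))\<^sup>2) \<le> hsum (2 * s) a"
proof -
  have "(x powr s)\<^sup>2 = x powr (2 * s)" for x :: real
    by (simp add: power2_eq_square flip: powr_add)
  then show ?thesis using sum_le_hsum[OF assms] by (simp add: power_mult_distrib)
qed

text \<open>Duality: pairing \<open>adv a b\<close> on \<open>G\<close> with its own norms turns S
  into a trilinear sum whose square is at most a constant times S, and one factor S cancels.\<close>

lemma adv_bound:
  assumes C: "C > 0" "trilinear_bounded (\<lambda>p q. p \<noteq> 0 \<and> q \<noteq> 0) \<alpha> (2 * \<alpha> - 1) C"
    and K: "finite K" "supp_in K a" "supp_in K b" and a: "solenoidal a" and G: "finite G"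
  shows "(\<Sum>k\<in>G. (norm (adv a b k))\<^sup>2) \<le> C * hsum (2 * \<alpha>) a * hsum (4 * \<alpha>) b"
proof -
  define n where "n k = norm (adv a b k)" for k
  define S where "S = (\<Sum>k\<in>G. (n k)\<^sup>2)"
  define h where "h k = (if k \<in> G then n k else 0)" for k
  have n0: "n k \<ge> 0" for k by (simp add: n_def)
  have hS: "(\<Sum>k\<in>G'. (h k)\<^sup>2) \<le> S" if "finite G'" for G'
  proof -
    have "(\<Sum>k\<in>G'. (h k)\<^sup>2) = (\<Sum>k\<in>G' \<inter> G. (n k)\<^sup>2)"
      using that by (intro sum.mono_neutral_cong_right) (auto simp: h_def)
    also have "\<dots> \<le> S" unfolding S_def using G by (intro sum_mono2) auto
    finally show ?thesis .
  qed
  have n_le: "n k \<le> (\<Sum>p\<in>K. norm (a p) * (norm (freq (k - p)) * norm (b (k - p))))" for k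
  proof -
    have "n k \<le> (\<Sum>p\<in>K. norm ((\<i> * kdot k (a p)) *s b (k - p)))"
      unfolding n_def adv_supp[OF K(1,2)] by (rule norm_sum)
    also have "\<dots> \<le> (\<Sum>p\<in>K. norm (a p) * (norm (freq (k - p)) * norm (b (k - p))))"
    proof (rule sum_mono)
      fix p
      \<comment> \<open>The derivative moves from the output frequency onto b, which carries the
        higher norm.\<close>
      have "kdot k (a p) = kdot (k - p) (a p)" using a by (simp add: kdot_diff_left solenoidal_def)
      then have "norm (kdot k (a p)) \<le> norm (freq (k - p)) * norm (a p)" using norm_kdot_le by metis
      from mult_right_mono[OF this, of "norm (b (k - p))"]
      show "norm ((\<i> * kdot k (a p)) *s b (k - p)) \<le> norm (a p) * (norm (freq (k - p)) * norm (b (k - p)))"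
        by (simp add: norm_smult_vec norm_mult mult_ac)
    qed
    finally show ?thesis .
  qed
  define t where "t k p = n k * (norm (a p) * (norm (freq (k - p)) * norm (b (k - p))))" for k p
  define F where "F = {(p, q) \<in> (K - {0}) \<times> (K - {0}). p + q \<in> G}"
  have finF: "finite F" unfolding F_def using K(1) by (intro finite_subset[OF _ finite_cartesian_product[of K K]]) auto
  have "S = (\<Sum>k\<in>G. n k * n k)" by (simp add: S_def power2_eq_square)
  also have "\<dots> \<le> (\<Sum>k\<in>G. n k * (\<Sum>p\<in>K. norm (a p) * (norm (freq (k - p)) * norm (b (k - p)))))"
    by (intro sum_mono mult_left_mono n_le n0)
  also have "\<dots> = (\<Sum>(k, p)\<in>G \<times> K. t k p)"
    by (simp add: sum_distrib_left t_def sum.cartesian_product)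
  \<comment> \<open>Pairs with p = 0 contribute nothing because \<open>a 0 = 0\<close>, those with k
    = p because of the derivative on b.\<close>
  also have "\<dots> = (\<Sum>(k, p)\<in>{(k, p) \<in> G \<times> K. p \<noteq> 0 \<and> k - p \<noteq> 0 \<and> k - p \<in> K}. t k p)"
    using G K a by (intro sum.mono_neutral_right) (auto simp: t_def supp_in_def solenoidal_def)
  also have "\<dots> = (\<Sum>(p, q)\<in>F. t (p + q) p)"
    by (rule sum.reindex_bij_witness[of _ "\<lambda>(p, q). (p + q, p)" "\<lambda>(k, p). (p, k - p)"]) (auto simp: F_def)
  also have "\<dots> = (\<Sum>(p, q)\<in>F. norm (freq p) powr (- \<alpha>) * norm (freq q) powr (- (2 * \<alpha> - 1))
      * (norm (freq p) powr \<alpha> * norm (a p)) * (norm (freq q) powr (2 * \<alpha>) * norm (b q)) * h (p + q))" (is "_ = ?R")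
  proof (rule sum.cong)
    fix x assume "x \<in> F"
    then obtain p q where x: "x = (p, q)" "p \<noteq> 0" "q \<noteq> 0" "p + q \<in> G" by (auto simp: F_def)
    have "norm (freq p) powr (- \<alpha>) * norm (freq q) powr (- (2 * \<alpha> - 1))
      * (norm (freq p) powr \<alpha> * norm (a p)) * (norm (freq q) powr (2 * \<alpha>) * norm (b q)) * h (p + q)
      = (norm (freq p) powr (- \<alpha>) * (norm (freq p) powr \<alpha> * norm (a p)))
       * (norm (freq q) powr (- (2 * \<alpha> - 1)) * (norm (freq q) powr (2 * \<alpha>) * norm (b q))) * n (p + q)"
      using x by (simp add: h_def mult_ac)
    also have "\<dots> = t (p + q) p" unfolding powr_split[OF x(2)] powr_split[OF x(3)] by (simp add: t_def mult_ac)
    finally show "(case x of (p, q) \<Rightarrow> t (p + q) p) = (case x of (p, q) \<Rightarrow> norm (freq p) powr (- \<alpha>) * norm (freq q) powr (- (2 * \<alpha> - 1))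
      * (norm (freq p) powr \<alpha> * norm (a p)) * (norm (freq q) powr (2 * \<alpha>) * norm (b q)) * h (p + q))"
      by (simp add: x(1))
  qed simp
  finally have SR: "S \<le> ?R" .
  have b4: "(\<Sum>q\<in>G'. (norm (freq q) powr (2 * \<alpha>) * norm (b q))\<^sup>2) \<le> hsum (4 * \<alpha>) b" if "finite G'" for G'
    using sum_le_hsum'[OF supp_in_hs[OF K(1,3)] that, of "2 * \<alpha>"] by simp
  have R: "?R\<^sup>2 \<le> C * hsum (2 * \<alpha>) a * hsum (4 * \<alpha>) b * S"
    by (rule trilinear_boundedD[OF C(2) finF])
       (auto simp: F_def inj_def intro!: hS sum_le_hsum' b4 supp_in_hs[OF K(1,2)])
  have S0: "S \<ge> 0" by (simp add: S_def sum_nonneg)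
  have "S * S \<le> ?R\<^sup>2" using SR S0 by (simp add: power2_eq_square mult_mono)
  with R have le: "S * S \<le> (C * hsum (2 * \<alpha>) a * hsum (4 * \<alpha>) b) * S" by simp
  have "S \<le> C * hsum (2 * \<alpha>) a * hsum (4 * \<alpha>) b"
  proof (cases "S = 0")
    case True
    then show ?thesis using C(1) hsum_nonneg by simp
  next
    case False
    then show ?thesis using le S0 by simp
  qed
  then show ?thesis by (simp add: S_def n_def)
qed

text \<open>Here \<open>w\<close> has infinite support and only \<alpha> derivatives, so the
  derivative is left on \<open>v\<close>: the weight 2\<alpha> sits at k and the third frequency is
  k - p. Finite sums over p are bounded uniformly and then completed along the cubes.\<close>

lemma adv_inner_bound:
  assumes C: "C > 0" "trilinear_bounded (\<lambda>p q. p \<noteq> 0 \<and> q \<noteq> 0) \<alpha> (2 * \<alpha> - 1) C"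
    and K: "finite K" "supp_in K v" and w: "l2 w" "hs (2 * \<alpha>) w" "w 0 = 0"
  shows "(\<Sum>k\<in>K. adv w w k \<bullet> v k)\<^sup>2 \<le> C * hsum (2 * \<alpha>) w * hsum (4 * \<alpha>) v * l2sum w"
proof -
  let ?B = "C * hsum (2 * \<alpha>) w * hsum (4 * \<alpha>) v * l2sum w"
  have v4: "(\<Sum>q\<in>G'. (norm (freq q) powr (2 * \<alpha>) * norm (v q))\<^sup>2) \<le> hsum (4 * \<alpha>) v" if "finite G'" for G'
    using sum_le_hsum'[OF supp_in_hs[OF K] that, of "2 * \<alpha>"] by simp
  have fin: "(\<Sum>k\<in>K. \<Sum>p\<in>P. trip w w v (k, p))\<^sup>2 \<le> ?B" if P: "finite P" for P
  proof -
    define F where "F = (P - {0}) \<times> (K - {0})"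
    let ?R = "(\<Sum>(p, k)\<in>F. norm (freq p) powr (- \<alpha>) * norm (freq k) powr (- (2 * \<alpha> - 1))
      * (norm (freq p) powr \<alpha> * norm (w p)) * (norm (freq k) powr (2 * \<alpha>) * norm (v k)) * norm (w (k - p)))"
    have "\<bar>\<Sum>k\<in>K. \<Sum>p\<in>P. trip w w v (k, p)\<bar> \<le> (\<Sum>k\<in>K. \<Sum>p\<in>P. \<bar>trip w w v (k, p)\<bar>)"
      by (intro order_trans[OF sum_abs] sum_mono sum_abs)
    also have "\<dots> = (\<Sum>(p, k)\<in>P \<times> K. \<bar>trip w w v (k, p)\<bar>)"
      by (subst sum.swap) (simp add: sum.cartesian_product)
    also have "\<dots> = (\<Sum>(p, k)\<in>F. \<bar>trip w w v (k, p)\<bar>)"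
      using P K w(3) by (intro sum.mono_neutral_right) (auto simp: F_def trip_def)
    also have "\<dots> \<le> ?R"
    proof (rule sum_mono)
      fix x assume "x \<in> F"
      then obtain p k where x: "x = (p, k)" "p \<noteq> 0" "k \<noteq> 0" by (auto simp: F_def)
      have "\<bar>trip w w v (k, p)\<bar> \<le> norm (kdot k (w p) * hdot (w (k - p)) (v k))"
        unfolding trip_def using abs_Re_le_cmod[of "\<i> * kdot k (w p) * hdot (w (k - p)) (v k)"]
        by (simp add: norm_mult)
      also have "\<dots> \<le> (norm (freq k) * norm (w p)) * (norm (w (k - p)) * norm (v k))"
        unfolding norm_mult by (intro mult_mono norm_kdot_le norm_hdot_le) auto
      also have "\<dots> = norm (w p) * (norm (freq k) * norm (v k)) * norm (w (k - p))" by (simp add: mult_ac)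
      also have "\<dots> = (norm (freq p) powr (- \<alpha>) * (norm (freq p) powr \<alpha> * norm (w p)))
       * (norm (freq k) powr (- (2 * \<alpha> - 1)) * (norm (freq k) powr (2 * \<alpha>) * norm (v k))) * norm (w (k - p))"
        unfolding powr_split[OF x(2)] powr_split[OF x(3)] ..
      finally show "(case x of (p, k) \<Rightarrow> \<bar>trip w w v (k, p)\<bar>) \<le> (case x of (p, k) \<Rightarrow> norm (freq p) powr (- \<alpha>) * norm (freq k) powr (- (2 * \<alpha> - 1))
      * (norm (freq p) powr \<alpha> * norm (w p)) * (norm (freq k) powr (2 * \<alpha>) * norm (v k)) * norm (w (k - p)))"
        by (simp add: x(1) mult_ac)
    qed
    finally have "\<bar>\<Sum>k\<in>K. \<Sum>p\<in>P. trip w w v (k, p)\<bar>\<^sup>2 \<le> ?R\<^sup>2" by (intro power_mono) auto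
    also have "?R\<^sup>2 \<le> ?B"
      by (rule trilinear_boundedD[OF C(2), where m="\<lambda>p k. k - p"])
         (use P K(1) in \<open>auto simp: F_def inj_def intro!: sum_le_l2sum sum_le_hsum' v4 w\<close>)
    finally show ?thesis by simp
  qed
  have "(\<lambda>n. (\<Sum>k\<in>K. \<Sum>p\<in>modes n. trip w w v (k, p))\<^sup>2) \<longlonglongrightarrow> (\<Sum>k\<in>K. adv w w k \<bullet> v k)\<^sup>2"
    by (intro tendsto_power tendsto_sum tendsto_sum_modes adv_inner_has_sum w)
  then show ?thesis by (rule LIMSEQ_le_const2) (use fin in auto)
qed

section \<open>Approximate solutions\<close>

lemma bounded_linear_kdot: "bounded_linear (kdot k)"
proof (rule bounded_linear_intro[where K="norm (freq k)"])
  show "norm (kdot k z) \<le> norm z * norm (freq k)" for z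
    using norm_kdot_le[of k z] by (simp add: mult.commute)
qed (simp_all add: kdot_add kdot_scaleR)

lemma continuous_on_smult [continuous_intros]:
  fixes z :: "'a::topological_space \<Rightarrow> complex^3"
  assumes "continuous_on S c" "continuous_on S z"
  shows "continuous_on S (\<lambda>t. c t *s z t)"
  unfolding vector_scalar_mult_def using assms by (intro continuous_intros)

lemma continuous_on_kdot [continuous_intros]:
  "continuous_on S z \<Longrightarrow> continuous_on S (\<lambda>t. kdot k (z t))"
  by (rule bounded_linear.continuous_on[OF bounded_linear_kdot])

lemma continuous_on_proj [continuous_intros]:
  "continuous_on S z \<Longrightarrow> continuous_on S (\<lambda>t. proj k (z t))"
  by (rule bounded_linear.continuous_on[OF bounded_linear_proj])

lemma continuous_on_adv:
  assumes "finite L" "\<And>t. t \<in> S \<Longrightarrow> supp_in L (z t)" "\<And>k. continuous_on S (\<lambda>t. z t k)" "\<And>k. continuous_on S (\<lambda>t. y t k)"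
  shows "continuous_on S (\<lambda>t. adv (z t) (y t) k)"
proof -
  have "continuous_on S (\<lambda>t. \<Sum>p\<in>L. (\<i> * kdot k (z t p)) *s y t (k - p))"
    by (intro continuous_intros assms)
  then show ?thesis
    by (rule continuous_on_eq) (simp add: adv_supp[OF assms(1,2)])
qed

lemma continuous_on_hsum:
  assumes "finite L" "\<And>t. t \<in> S \<Longrightarrow> supp_in L (z t)" "\<And>k. continuous_on S (\<lambda>t. z t k)"
  shows "continuous_on S (\<lambda>t. hsum r (z t))"
proof -
  have "continuous_on S (\<lambda>t. \<Sum>k\<in>L. norm (freq k) powr r * (norm (z t k))\<^sup>2)"
    by (intro continuous_intros assms)
  then show ?thesis
    by (rule continuous_on_eq) (simp add: hsum_supp[OF assms(1,2)])
qed

section \<open>The linear equation with a given forcing\<close>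

definition duhamel :: "real \<Rightarrow> real \<Rightarrow> complex^3 \<Rightarrow> (real \<Rightarrow> complex^3) \<Rightarrow> real \<Rightarrow> complex^3" where
  "duhamel l \<tau> y f t = exp (- l * (t - \<tau>)) *\<^sub>R (y + integral {\<tau>..t} (\<lambda>s. exp (l * (s - \<tau>)) *\<^sub>R f s))"

lemma duhamel_init: "duhamel l \<tau> y f \<tau> = y"
  by (simp add: duhamel_def)

lemma duhamel_deriv:
  assumes f: "continuous_on {\<tau>..T} f" and t: "t \<in> {\<tau>..T}"
  shows "(duhamel l \<tau> y f has_vector_derivative - l *\<^sub>R duhamel l \<tau> y f t + f t) (at t within {\<tau>..T})"
proof -
  define G where "G t = integral {\<tau>..t} (\<lambda>s. exp (l * (s - \<tau>)) *\<^sub>R f s)" for t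
  have G: "(G has_vector_derivative exp (l * (t - \<tau>)) *\<^sub>R f t) (at t within {\<tau>..T})"
    unfolding G_def using f t
    by (intro integral_has_vector_derivative) (auto intro!: continuous_intros)
  have e: "((\<lambda>t. exp (- l * (t - \<tau>))) has_real_derivative - l * exp (- l * (t - \<tau>))) (at t within {\<tau>..T})"
    by (auto intro!: derivative_eq_intros)
  have yG: "((\<lambda>t. y + G t) has_vector_derivative exp (l * (t - \<tau>)) *\<^sub>R f t) (at t within {\<tau>..T})"
    using has_vector_derivative_add[OF has_vector_derivative_const G] by simp
  have "((\<lambda>t. exp (- l * (t - \<tau>)) *\<^sub>R (y + G t)) has_vector_derivative
     exp (- l * (t - \<tau>)) *\<^sub>R (exp (l * (t - \<tau>)) *\<^sub>R f t) + (- l * exp (- l * (t - \<tau>))) *\<^sub>R (y + G t)) (at t within {\<tau>..T})"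
    by (rule has_vector_derivative_scaleR[OF e yG])
  moreover have "exp (- l * (t - \<tau>)) *\<^sub>R (exp (l * (t - \<tau>)) *\<^sub>R f t) = f t"
    by (simp add: exp_add[symmetric])
  moreover have "duhamel l \<tau> y f = (\<lambda>t. exp (- l * (t - \<tau>)) *\<^sub>R (y + G t))"
    by (simp add: fun_eq_iff duhamel_def G_def)
  ultimately show ?thesis by (simp add: add.commute)
qed

text \<open>A linear map passes through the solution formula; in this way the divergence constraint
  and reality are inherited by the iterates.\<close>

lemma duhamel_bounded_linear:
  assumes h: "bounded_linear h" and f: "continuous_on {\<tau>..t} f"
  shows "h (duhamel l \<tau> y f t) = exp (- l * (t - \<tau>)) *\<^sub>R (h y + integral {\<tau>..t} (\<lambda>s. exp (l * (s - \<tau>)) *\<^sub>R h (f s)))"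
proof -
  interpret bounded_linear h by fact
  have "(\<lambda>s. exp (l * (s - \<tau>)) *\<^sub>R f s) integrable_on {\<tau>..t}"
    using f by (intro integrable_continuous_real continuous_intros) auto
  from integral_linear[OF this h] show ?thesis
    by (simp add: duhamel_def scaleR add o_def)
qed

text \<open>A finite linear system with arbitrary forcing \<open>g\<close>, so that the same
  estimates apply to an iterate, to a difference of iterates and to an approximate solution, whose
  \<open>g\<close> is merely close to its own nonlinearity.\<close>

definition heat_sol where
  "heat_sol \<nu> \<alpha> \<tau> T L z g \<longleftrightarrow> finite L \<and> (\<forall>t\<in>{\<tau>..T}. supp_in L (z t) \<and> supp_in L (g t)) \<and>
     (\<forall>k. continuous_on {\<tau>..T} (\<lambda>t. g t k)) \<and>
     (\<forall>k. \<forall>t\<in>{\<tau>..T}. ((\<lambda>s. z s k) has_vector_derivative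
        (- (\<nu> * norm (freq k) powr (2 * \<alpha>)) *\<^sub>R z t k + g t k)) (at t within {\<tau>..T}))"

lemma heat_sol_continuous:
  assumes "heat_sol \<nu> \<alpha> \<tau> T L z g"
  shows "continuous_on {\<tau>..T} (\<lambda>t. z t k)"
  using assms unfolding heat_sol_def
  by (meson continuous_on_eq_continuous_within has_vector_derivative_continuous)

lemma heat_sol_diff:
  assumes z: "heat_sol \<nu> \<alpha> \<tau> T L z g" and y: "heat_sol \<nu> \<alpha> \<tau> T L y h"
  shows "heat_sol \<nu> \<alpha> \<tau> T L (\<lambda>t k. z t k - y t k) (\<lambda>t k. g t k - h t k)"
  unfolding heat_sol_def
proof (intro conjI ballI allI)
  show "finite L" using z by (simp add: heat_sol_def)
  fix t assume t: "t \<in> {\<tau>..T}"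
  show "supp_in L (\<lambda>k. z t k - y t k)" "supp_in L (\<lambda>k. g t k - h t k)"
    using z y t by (auto simp: heat_sol_def supp_in_def)
next
  fix k
  show "continuous_on {\<tau>..T} (\<lambda>t. g t k - h t k)"
    using z y by (auto simp: heat_sol_def intro!: continuous_intros)
next
  fix k t assume t: "t \<in> {\<tau>..T}"
  have "((\<lambda>s. z s k - y s k) has_vector_derivative
     (- (\<nu> * norm (freq k) powr (2 * \<alpha>)) *\<^sub>R z t k + g t k) - (- (\<nu> * norm (freq k) powr (2 * \<alpha>)) *\<^sub>R y t k + h t k)) (at t within {\<tau>..T})"
    using z y t unfolding heat_sol_def by (intro has_vector_derivative_diff) auto
  then show "((\<lambda>s. z s k - y s k) has_vector_derivative
     (- (\<nu> * norm (freq k) powr (2 * \<alpha>)) *\<^sub>R (z t k - y t k) + (g t k - h t k))) (at t within {\<tau>..T})"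
    by (simp add: algebra_simps)
qed

lemma heat_sol_mono:
  assumes "heat_sol \<nu> \<alpha> \<tau> T L z g" "L \<subseteq> L'" "finite L'"
  shows "heat_sol \<nu> \<alpha> \<tau> T L' z g"
  using assms unfolding heat_sol_def by (meson supp_in_mono)

lemma norm_power2_FTC:
  fixes y :: "real \<Rightarrow> complex^3"
  assumes d: "\<And>s. s \<in> {\<tau>..t} \<Longrightarrow> (y has_vector_derivative y' s) (at s within {\<tau>..t})" and "\<tau> \<le> t"
  shows "((\<lambda>s. 2 * (y s \<bullet> y' s)) has_integral (norm (y t))\<^sup>2 - (norm (y \<tau>))\<^sup>2) {\<tau>..t}"
proof -
  have "((\<lambda>s. y s \<bullet> y s) has_vector_derivative 2 * (y s \<bullet> y' s)) (at s within {\<tau>..t})" if "s \<in> {\<tau>..t}" for s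
  proof -
    have "((\<lambda>s. y s \<bullet> y s) has_derivative (\<lambda>h. y s \<bullet> (h *\<^sub>R y' s) + (h *\<^sub>R y' s) \<bullet> y s)) (at s within {\<tau>..t})"
      using d[OF that] unfolding has_vector_derivative_def by (intro has_derivative_inner)
    then show ?thesis unfolding has_vector_derivative_def
      by (simp add: inner_commute algebra_simps)
  qed
  from fundamental_theorem_of_calculus[OF assms(2) this] show ?thesis
    by (simp add: power2_norm_eq_inner)
qed

text \<open>With \<kappa> = |k|^(2\<alpha>) the left side is the derivative of \<kappa> |y|^2 along
  the equation. Young's inequality, obtained from the square of \<nu> \<kappa> |y| - |f| divided by
  \<nu>, uses half of the dissipation.\<close>

lemma heat_energy_pointwise:
  fixes y f :: "complex^3" and \<nu> \<kappa> :: real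
  assumes "\<nu> > 0" "\<kappa> \<ge> 0"
  shows "\<kappa> * (2 * (y \<bullet> (- (\<nu> * \<kappa>) *\<^sub>R y + f))) \<le> - (\<nu> * (\<kappa>\<^sup>2 * (norm y)\<^sup>2)) + (norm f)\<^sup>2 / \<nu>"
proof -
  have "y \<bullet> f \<le> norm y * norm f" by (rule norm_cauchy_schwarz)
  then have "2 * \<kappa> * (y \<bullet> f) \<le> 2 * \<kappa> * (norm y * norm f)" using assms by (intro mult_left_mono) auto
  also have "\<dots> \<le> \<nu> * (\<kappa>\<^sup>2 * (norm y)\<^sup>2) + (norm f)\<^sup>2 / \<nu>"
  proof -
    have "0 \<le> (\<nu> * (\<kappa> * norm y) - norm f)\<^sup>2 / \<nu>" using assms by simp
    also have "\<dots> = \<nu> * (\<kappa>\<^sup>2 * (norm y)\<^sup>2) + (norm f)\<^sup>2 / \<nu> - 2 * \<kappa> * (norm y * norm f)"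
      using assms by (simp add: power2_diff field_simps power2_eq_square)
    finally show ?thesis by simp
  qed
  finally show ?thesis
    by (simp add: inner_add_right power2_norm_eq_inner[of y] power2_eq_square[of \<kappa>] algebra_simps)
qed

text \<open>Estimate in H^\<alpha> with dissipation in H^(2\<alpha>). The forcing is measured in L2
  only, which is what the bound for the nonlinearity provides.\<close>

lemma heat_energy:
  assumes z: "heat_sol \<nu> \<alpha> \<tau> T L z g" and \<nu>: "\<nu> > 0" and t: "t \<in> {\<tau>..T}"
  shows "hsum (2 * \<alpha>) (z t) + \<nu> * integral {\<tau>..t} (\<lambda>s. hsum (4 * \<alpha>) (z s))
    \<le> hsum (2 * \<alpha>) (z \<tau>) + integral {\<tau>..t} (\<lambda>s. \<Sum>k\<in>L. (norm (g s k))\<^sup>2) / \<nu>"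
proof -
  have L: "finite L" and supp: "\<And>s. s \<in> {\<tau>..T} \<Longrightarrow> supp_in L (z s)"
    and gc: "\<And>k. continuous_on {\<tau>..T} (\<lambda>s. g s k)" using z by (auto simp: heat_sol_def)
  have zc: "continuous_on {\<tau>..T} (\<lambda>s. z s k)" for k by (rule heat_sol_continuous[OF z])
  have sub: "{\<tau>..t} \<subseteq> {\<tau>..T}" using t by auto
  have gc': "continuous_on {\<tau>..t} (\<lambda>s. g s k)" and zc': "continuous_on {\<tau>..t} (\<lambda>s. z s k)" for k
    using gc zc sub by (blast intro: continuous_on_subset)+
  let ?w = "\<lambda>k. norm (freq k) powr (2 * \<alpha>)"
  have w2: "(?w k)\<^sup>2 = norm (freq k) powr (4 * \<alpha>)" for k
    by (simp add: power2_eq_square flip: powr_add)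
  have "?w k * (norm (z t k))\<^sup>2 + \<nu> * integral {\<tau>..t} (\<lambda>s. norm (freq k) powr (4 * \<alpha>) * (norm (z s k))\<^sup>2)
    \<le> ?w k * (norm (z \<tau> k))\<^sup>2 + integral {\<tau>..t} (\<lambda>s. (norm (g s k))\<^sup>2) / \<nu>" for k
  proof -
    have d: "((\<lambda>s. z s k) has_vector_derivative (- (\<nu> * ?w k) *\<^sub>R z s k + g s k)) (at s within {\<tau>..t})"
      if "s \<in> {\<tau>..t}" for s
      using z that sub unfolding heat_sol_def by (meson has_vector_derivative_within_subset subsetD)
    have i1: "((\<lambda>s. ?w k * (2 * (z s k \<bullet> (- (\<nu> * ?w k) *\<^sub>R z s k + g s k)))) has_integral
        ?w k * ((norm (z t k))\<^sup>2 - (norm (z \<tau> k))\<^sup>2)) {\<tau>..t}"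
      using t by (intro has_integral_mult_right norm_power2_FTC d) auto
    have i2: "((\<lambda>s. - (\<nu> * ((?w k)\<^sup>2 * (norm (z s k))\<^sup>2)) + (norm (g s k))\<^sup>2 / \<nu>) has_integral
        - (\<nu> * integral {\<tau>..t} (\<lambda>s. (?w k)\<^sup>2 * (norm (z s k))\<^sup>2)) + integral {\<tau>..t} (\<lambda>s. (norm (g s k))\<^sup>2) / \<nu>) {\<tau>..t}"
      by (intro has_integral_add has_integral_neg has_integral_mult_right has_integral_divide integrable_integral
            integrable_continuous_real continuous_intros zc' gc')
    have "?w k * ((norm (z t k))\<^sup>2 - (norm (z \<tau> k))\<^sup>2) \<le> - (\<nu> * integral {\<tau>..t} (\<lambda>s. (?w k)\<^sup>2 * (norm (z s k))\<^sup>2)) + integral {\<tau>..t} (\<lambda>s. (norm (g s k))\<^sup>2) / \<nu>"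
      by (rule has_integral_le[OF i1 i2]) (intro heat_energy_pointwise \<nu>, simp)
    then show ?thesis unfolding w2 right_diff_distrib by linarith
  qed
  then have "(\<Sum>k\<in>L. ?w k * (norm (z t k))\<^sup>2 + \<nu> * integral {\<tau>..t} (\<lambda>s. norm (freq k) powr (4 * \<alpha>) * (norm (z s k))\<^sup>2))
    \<le> (\<Sum>k\<in>L. ?w k * (norm (z \<tau> k))\<^sup>2 + integral {\<tau>..t} (\<lambda>s. (norm (g s k))\<^sup>2) / \<nu>)"
    by (rule sum_mono)
  moreover have "integral {\<tau>..t} (\<lambda>s. hsum (4 * \<alpha>) (z s)) = (\<Sum>k\<in>L. integral {\<tau>..t} (\<lambda>s. norm (freq k) powr (4 * \<alpha>) * (norm (z s k))\<^sup>2))"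
  proof -
    have "integral {\<tau>..t} (\<lambda>s. hsum (4 * \<alpha>) (z s)) = integral {\<tau>..t} (\<lambda>s. \<Sum>k\<in>L. norm (freq k) powr (4 * \<alpha>) * (norm (z s k))\<^sup>2)"
      using sub by (intro integral_cong hsum_supp[OF L supp]) auto
    also have "\<dots> = (\<Sum>k\<in>L. integral {\<tau>..t} (\<lambda>s. norm (freq k) powr (4 * \<alpha>) * (norm (z s k))\<^sup>2))"
      by (intro integral_sum L integrable_continuous_real continuous_intros zc')
    finally show ?thesis .
  qed
  moreover have "integral {\<tau>..t} (\<lambda>s. \<Sum>k\<in>L. (norm (g s k))\<^sup>2) = (\<Sum>k\<in>L. integral {\<tau>..t} (\<lambda>s. (norm (g s k))\<^sup>2))"
    by (intro integral_sum L integrable_continuous_real continuous_intros gc')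
  moreover have "\<tau> \<in> {\<tau>..T}" using t by auto
  ultimately show ?thesis
    by (simp add: hsum_supp[OF L supp[OF t]] hsum_supp[OF L supp] sum.distrib sum_distrib_left sum_divide_distrib)
qed

lemma heat_bounds:
  assumes z: "heat_sol \<nu> \<alpha> \<tau> T L z g" and \<nu>: "\<nu> > 0" and T: "\<tau> \<le> T"
    and X: "hsum (2 * \<alpha>) (z \<tau>) + integral {\<tau>..T} (\<lambda>s. \<Sum>k\<in>L. (norm (g s k))\<^sup>2) / \<nu> \<le> X"
  shows "t \<in> {\<tau>..T} \<Longrightarrow> hsum (2 * \<alpha>) (z t) \<le> X" "integral {\<tau>..T} (\<lambda>s. hsum (4 * \<alpha>) (z s)) \<le> X / \<nu>"
proof -
  have gc: "\<And>k. continuous_on {\<tau>..T} (\<lambda>s. g s k)" using z by (auto simp: heat_sol_def)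
  show "hsum (2 * \<alpha>) (z t) \<le> X" if t: "t \<in> {\<tau>..T}"
  proof -
    \<comment> \<open>Holds in either case: a function that is not integrable has integral 0 by
      default.\<close>
    have "0 \<le> integral {\<tau>..t} (\<lambda>s. hsum (4 * \<alpha>) (z s))"
      by (cases "(\<lambda>s. hsum (4 * \<alpha>) (z s)) integrable_on {\<tau>..t}")
         (auto intro: integral_nonneg hsum_nonneg simp: not_integrable_integral)
    moreover have "integral {\<tau>..t} (\<lambda>s. \<Sum>k\<in>L. (norm (g s k))\<^sup>2) \<le> integral {\<tau>..T} (\<lambda>s. \<Sum>k\<in>L. (norm (g s k))\<^sup>2)"
      using t by (intro integral_subset_le integrable_continuous_real continuous_intros continuous_on_subset[OF gc])
         (auto intro: sum_nonneg)
    then have "integral {\<tau>..t} (\<lambda>s. \<Sum>k\<in>L. (norm (g s k))\<^sup>2) / \<nu> \<le> integral {\<tau>..T} (\<lambda>s. \<Sum>k\<in>L. (norm (g s k))\<^sup>2) / \<nu>"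
      using \<nu> by (simp add: divide_right_mono)
    moreover have "0 \<le> \<nu> * integral {\<tau>..t} (\<lambda>s. hsum (4 * \<alpha>) (z s))" using calculation(1) \<nu> by simp
    ultimately show ?thesis using heat_energy[OF z \<nu> t] X by linarith
  qed
  have "T \<in> {\<tau>..T}" using T by simp
  from heat_energy[OF z \<nu> this] X have "\<nu> * integral {\<tau>..T} (\<lambda>s. hsum (4 * \<alpha>) (z s)) \<le> X"
    using hsum_nonneg[of "2 * \<alpha>" "z T"] by linarith
  then show "integral {\<tau>..T} (\<lambda>s. hsum (4 * \<alpha>) (z s)) \<le> X / \<nu>"
    using \<nu> by (simp add: pos_le_divide_eq mult.commute)
qed

section \<open>Picard iteration\<close>

definition forcing :: "(real \<Rightarrow> int^3 \<Rightarrow> complex^3) \<Rightarrow> real \<Rightarrow> int^3 \<Rightarrow> complex^3" where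
  "forcing v t k = - proj k (adv (v t) (v t) k)"

definition admissible where
  "admissible \<tau> T L v \<longleftrightarrow> finite L \<and> (\<forall>k. continuous_on {\<tau>..T} (\<lambda>t. v t k)) \<and>
     (\<forall>t\<in>{\<tau>..T}. supp_in L (v t) \<and> solenoidal (v t) \<and> real_seq (v t))"

text \<open>Contains \<open>L\<close> itself, so that the supports of successive iterates increase
  and two iterates can be compared on one set.\<close>

definition sumset :: "(int^3) set \<Rightarrow> (int^3) set" where
  "sumset L = L \<union> (\<lambda>(p, q). p + q) ` (L \<times> L)"

lemma finite_sumset: "finite L \<Longrightarrow> finite (sumset L)"
  by (simp add: sumset_def)

lemma admissible_forcing:
  assumes v: "admissible \<tau> T L v"
  shows "continuous_on {\<tau>..T} (\<lambda>t. forcing v t k)"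
    and "t \<in> {\<tau>..T} \<Longrightarrow> supp_in (sumset L) (forcing v t)"
    and "t \<in> {\<tau>..T} \<Longrightarrow> supp_in (sumset L) (adv (v t) (v t))"
    and "kdot k (forcing v t k) = 0" and "forcing v t 0 = 0"
    and "t \<in> {\<tau>..T} \<Longrightarrow> forcing v t (- k) = cnjv (forcing v t k)"
proof -
  have L: "finite L" "\<And>k. continuous_on {\<tau>..T} (\<lambda>t. v t k)" and vt: "\<And>t. t \<in> {\<tau>..T} \<Longrightarrow> supp_in L (v t)"
      "\<And>t. t \<in> {\<tau>..T} \<Longrightarrow> real_seq (v t)"
    using v by (auto simp: admissible_def)
  show "continuous_on {\<tau>..T} (\<lambda>t. forcing v t k)"
    unfolding forcing_def by (intro continuous_intros continuous_on_adv[OF L(1) vt(1)] L)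
  show A: "supp_in (sumset L) (adv (v t) (v t))" if "t \<in> {\<tau>..T}" for t
    by (rule supp_in_mono[OF adv_supp_in[OF L(1) vt(1)[OF that] vt(1)[OF that]]]) (simp add: sumset_def)
  then show "t \<in> {\<tau>..T} \<Longrightarrow> supp_in (sumset L) (forcing v t)"
    by (simp add: supp_in_def forcing_def)
  show "kdot k (forcing v t k) = 0"
    using kdot_diff[of k 0 "proj k (adv (v t) (v t) k)"] by (simp add: forcing_def)
  show "forcing v t 0 = 0" by (simp add: forcing_def)
  show "forcing v t (- k) = cnjv (forcing v t k)" if "t \<in> {\<tau>..T}"
  proof -
    have "adv (v t) (v t) (- k) = cnjv (adv (v t) (v t) k)"
      by (intro adv_real supp_in_l2[OF L(1) vt(1)[OF that]] vt(2)[OF that])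
    then show ?thesis using cnjv_diff[of 0 "proj k (adv (v t) (v t) k)"]
      by (simp add: forcing_def proj_cnjv)
  qed
qed

text \<open>The invariants survive because the forcing is solenoidal and real and the solution
  formula is linear in each mode; the support grows to where products of two fields live.\<close>

lemma picard_step:
  fixes y0 :: "int^3 \<Rightarrow> complex^3" and \<nu> \<alpha> :: real
  assumes v: "admissible \<tau> T L v" and y0: "supp_in L y0" "solenoidal y0" "real_seq y0"
  defines "z \<equiv> (\<lambda>t k. duhamel (\<nu> * norm (freq k) powr (2 * \<alpha>)) \<tau> (y0 k) (\<lambda>s. forcing v s k) t)"
  shows "heat_sol \<nu> \<alpha> \<tau> T (sumset L) z (forcing v)" and "admissible \<tau> T (sumset L) z"
proof -
  note f = admissible_forcing[OF v]
  have L: "finite L" using v by (simp add: admissible_def)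
  have fc: "continuous_on {\<tau>..t} (\<lambda>s. forcing v s k)" if "t \<in> {\<tau>..T}" for t k
    by (rule continuous_on_subset[OF f(1)]) (use that in auto)
  have zs: "supp_in (sumset L) (z t)" if t: "t \<in> {\<tau>..T}" for t
    unfolding supp_in_def
  proof safe
    fix k assume k: "k \<notin> sumset L"
    then have "y0 k = 0" using y0(1) by (auto simp: sumset_def supp_in_def)
    moreover have "integral {\<tau>..t} (\<lambda>s. exp (\<nu> * norm (freq k) powr (2 * \<alpha>) * (s - \<tau>)) *\<^sub>R forcing v s k) = integral {\<tau>..t} (\<lambda>s. 0)"
      using f(2) k t by (intro integral_cong) (auto simp: supp_in_def)
    ultimately show "z t k = 0" by (simp add: z_def duhamel_def)
  qed
  show hs: "heat_sol \<nu> \<alpha> \<tau> T (sumset L) z (forcing v)"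
    unfolding heat_sol_def z_def using zs f(1,2) finite_sumset[OF L] duhamel_deriv[OF f(1)]
    by (auto simp: z_def)
  have sol: "kdot k (z t k) = 0" "z t 0 = 0" if t: "t \<in> {\<tau>..T}" for t k
  proof -
    show "kdot k (z t k) = 0"
      unfolding z_def using duhamel_bounded_linear[OF bounded_linear_kdot fc[OF t]] y0(2)
      by (simp add: f(4) solenoidal_def)
    show "z t 0 = 0" using y0(2) by (simp add: z_def duhamel_def f(5) solenoidal_def)
  qed
  have re: "z t (- k) = cnjv (z t k)" if t: "t \<in> {\<tau>..T}" for t k
  proof -
    have "integral {\<tau>..t} (\<lambda>s. exp (\<nu> * norm (freq k) powr (2 * \<alpha>) * (s - \<tau>)) *\<^sub>R forcing v s (- k))
       = integral {\<tau>..t} (\<lambda>s. exp (\<nu> * norm (freq k) powr (2 * \<alpha>) * (s - \<tau>)) *\<^sub>R cnjv (forcing v s k))"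
      using f(6) t by (intro integral_cong) auto
    then show ?thesis
      unfolding z_def using y0(3) duhamel_bounded_linear[OF bounded_linear_cnjv fc[OF t]]
      by (simp add: real_seq_def) (simp add: duhamel_def)
  qed
  show "admissible \<tau> T (sumset L) z"
    unfolding admissible_def solenoidal_def real_seq_def
    using finite_sumset[OF L] heat_sol_continuous[OF hs] zs sol re by blast
qed

text \<open>B(v, v) - B(v', v') = B(v - v', v) + B(v', v - v'), and the Leray projection does not
  increase norms. In each product the second argument takes the norm with 2\<alpha>
  derivatives.\<close>

lemma forcing_diff_le:
  assumes C: "C > 0" "trilinear_bounded (\<lambda>p q. p \<noteq> 0 \<and> q \<noteq> 0) \<alpha> (2 * \<alpha> - 1) C"
    and L: "finite L" "supp_in L (v t)" "supp_in L (v' t)" and s: "solenoidal (v t)" "solenoidal (v' t)" and G: "finite G"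
  shows "(\<Sum>k\<in>G. (norm (forcing v t k - forcing v' t k))\<^sup>2) \<le>
    2 * C * (hsum (2 * \<alpha>) (\<lambda>k. v t k - v' t k) * hsum (4 * \<alpha>) (v t) + hsum (2 * \<alpha>) (v' t) * hsum (4 * \<alpha>) (\<lambda>k. v t k - v' t k))"
proof -
  define d where "d = (\<lambda>k. v t k - v' t k)"
  have d: "supp_in L d" "solenoidal d" using L s by (auto simp: d_def supp_in_def solenoidal_diff)
  note l2 = supp_in_l2[OF L(1) L(2)] supp_in_l2[OF L(1) L(3)] supp_in_l2[OF L(1) d(1)]
  have "(norm (forcing v t k - forcing v' t k))\<^sup>2 \<le> 2 * (norm (adv d (v t) k))\<^sup>2 + 2 * (norm (adv (v' t) d k))\<^sup>2" for k
  proof -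
    have "adv d (v t) k + adv (v' t) d k = adv (v t) (v t) k - adv (v' t) (v' t) k"
      unfolding d_def using l2 by (simp add: adv_diff_left adv_diff_right)
    then have "forcing v t k - forcing v' t k = - proj k (adv d (v t) k + adv (v' t) d k)"
      by (simp add: forcing_def proj_diff)
    then have "norm (forcing v t k - forcing v' t k) \<le> norm (adv d (v t) k) + norm (adv (v' t) d k)"
      using norm_proj_le[of k "adv d (v t) k + adv (v' t) d k"] norm_triangle_ineq[of "adv d (v t) k" "adv (v' t) d k"] by simp
    then have "(norm (forcing v t k - forcing v' t k))\<^sup>2 \<le> (norm (adv d (v t) k) + norm (adv (v' t) d k))\<^sup>2"
      by (rule power_mono) simp
    also have "\<dots> \<le> 2 * (norm (adv d (v t) k))\<^sup>2 + 2 * (norm (adv (v' t) d k))\<^sup>2"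
      using sum_squares_bound[of "norm (adv d (v t) k)" "norm (adv (v' t) d k)"] by (simp add: power2_sum)
    finally show ?thesis .
  qed
  then have "(\<Sum>k\<in>G. (norm (forcing v t k - forcing v' t k))\<^sup>2) \<le> (\<Sum>k\<in>G. 2 * (norm (adv d (v t) k))\<^sup>2 + 2 * (norm (adv (v' t) d k))\<^sup>2)"
    by (rule sum_mono)
  also have "\<dots> = 2 * (\<Sum>k\<in>G. (norm (adv d (v t) k))\<^sup>2) + 2 * (\<Sum>k\<in>G. (norm (adv (v' t) d k))\<^sup>2)"
    by (simp add: sum.distrib sum_distrib_left)
  also have "\<dots> \<le> 2 * (C * hsum (2 * \<alpha>) d * hsum (4 * \<alpha>) (v t)) + 2 * (C * hsum (2 * \<alpha>) (v' t) * hsum (4 * \<alpha>) d)"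
    using adv_bound[OF C L(1) d(1) L(2) d(2) G] adv_bound[OF C L(1) L(3) d(1) s(2) G] by linarith
  finally show ?thesis by (simp add: d_def algebra_simps)
qed

text \<open>The supremum in time of the lower norm meets the time integral of the higher one: no
  power of T - \<tau> appears, which makes the iteration global.\<close>

lemma integral_forcing_diff:
  assumes C: "C > 0" "trilinear_bounded (\<lambda>p q. p \<noteq> 0 \<and> q \<noteq> 0) \<alpha> (2 * \<alpha> - 1) C"
    and v: "admissible \<tau> T L v" and v': "admissible \<tau> T L v'" and G: "finite G"
    and M: "integral {\<tau>..T} (\<lambda>t. hsum (4 * \<alpha>) (v t)) \<le> M4" "\<And>t. t \<in> {\<tau>..T} \<Longrightarrow> hsum (2 * \<alpha>) (v' t) \<le> M2"
    and X: "integral {\<tau>..T} (\<lambda>t. hsum (4 * \<alpha>) (\<lambda>k. v t k - v' t k)) \<le> X4" "\<And>t. t \<in> {\<tau>..T} \<Longrightarrow> hsum (2 * \<alpha>) (\<lambda>k. v t k - v' t k) \<le> X2"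
    and T: "\<tau> \<le> T"
  shows "integral {\<tau>..T} (\<lambda>t. \<Sum>k\<in>G. (norm (forcing v t k - forcing v' t k))\<^sup>2) \<le> 2 * C * (X2 * M4 + M2 * X4)"
proof -
  have L: "finite L" and vc: "\<And>k. continuous_on {\<tau>..T} (\<lambda>t. v t k)" "\<And>k. continuous_on {\<tau>..T} (\<lambda>t. v' t k)"
    and vs: "\<And>t. t \<in> {\<tau>..T} \<Longrightarrow> supp_in L (v t)" "\<And>t. t \<in> {\<tau>..T} \<Longrightarrow> supp_in L (v' t)"
    and sol: "\<And>t. t \<in> {\<tau>..T} \<Longrightarrow> solenoidal (v t)" "\<And>t. t \<in> {\<tau>..T} \<Longrightarrow> solenoidal (v' t)"
    using v v' by (auto simp: admissible_def)
  have ds: "\<And>t. t \<in> {\<tau>..T} \<Longrightarrow> supp_in L (\<lambda>k. v t k - v' t k)" using vs by (auto simp: supp_in_def)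
  have c4: "continuous_on {\<tau>..T} (\<lambda>t. hsum (4 * \<alpha>) (v t))" "continuous_on {\<tau>..T} (\<lambda>t. hsum (4 * \<alpha>) (\<lambda>k. v t k - v' t k))"
    by (intro continuous_on_hsum[OF L] vs ds vc continuous_intros; assumption)+
  have tT: "\<tau> \<in> {\<tau>..T}" using T by simp
  have X20: "0 \<le> X2" "0 \<le> M2" using X(2)[OF tT] M(2)[OF tT] hsum_nonneg order_trans by blast+
  have "integral {\<tau>..T} (\<lambda>t. \<Sum>k\<in>G. (norm (forcing v t k - forcing v' t k))\<^sup>2)
    \<le> integral {\<tau>..T} (\<lambda>t. 2 * C * (X2 * hsum (4 * \<alpha>) (v t) + M2 * hsum (4 * \<alpha>) (\<lambda>k. v t k - v' t k)))"
  proof (rule integral_le)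
    show "(\<lambda>t. \<Sum>k\<in>G. (norm (forcing v t k - forcing v' t k))\<^sup>2) integrable_on {\<tau>..T}"
      by (intro integrable_continuous_real continuous_intros admissible_forcing(1)[OF v] admissible_forcing(1)[OF v'])
    show "(\<lambda>t. 2 * C * (X2 * hsum (4 * \<alpha>) (v t) + M2 * hsum (4 * \<alpha>) (\<lambda>k. v t k - v' t k))) integrable_on {\<tau>..T}"
      by (intro integrable_continuous_real continuous_intros c4)
    fix t assume t: "t \<in> {\<tau>..T}"
    have "(\<Sum>k\<in>G. (norm (forcing v t k - forcing v' t k))\<^sup>2) \<le>
      2 * C * (hsum (2 * \<alpha>) (\<lambda>k. v t k - v' t k) * hsum (4 * \<alpha>) (v t) + hsum (2 * \<alpha>) (v' t) * hsum (4 * \<alpha>) (\<lambda>k. v t k - v' t k))"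
      by (rule forcing_diff_le[where v=v and v'=v' and t=t, OF C L vs(1)[OF t] vs(2)[OF t] sol(1)[OF t] sol(2)[OF t] G])
    also have "\<dots> \<le> 2 * C * (X2 * hsum (4 * \<alpha>) (v t) + M2 * hsum (4 * \<alpha>) (\<lambda>k. v t k - v' t k))"
      using C(1) by (intro mult_left_mono add_mono mult_right_mono X(2)[OF t] M(2)[OF t] hsum_nonneg) auto
    finally show "(\<Sum>k\<in>G. (norm (forcing v t k - forcing v' t k))\<^sup>2) \<le> 2 * C * (X2 * hsum (4 * \<alpha>) (v t) + M2 * hsum (4 * \<alpha>) (\<lambda>k. v t k - v' t k))" .
  qed
  also have "\<dots> = 2 * C * (X2 * integral {\<tau>..T} (\<lambda>t. hsum (4 * \<alpha>) (v t)) + M2 * integral {\<tau>..T} (\<lambda>t. hsum (4 * \<alpha>) (\<lambda>k. v t k - v' t k)))"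
    by (rule integral_unique) (intro has_integral_mult_right has_integral_add integrable_integral integrable_continuous_real c4)
  also have "\<dots> \<le> 2 * C * (X2 * M4 + M2 * X4)"
    using C(1) X20 by (intro mult_left_mono add_mono M(1) X(1)) auto
  finally show ?thesis .
qed

text \<open>Starting from 0 makes the first iterate the linear evolution of the data; from there on
  all iterates have initial value \<open>y0\<close>.\<close>

primrec picard :: "real \<Rightarrow> real \<Rightarrow> real \<Rightarrow> (int^3 \<Rightarrow> complex^3) \<Rightarrow> nat \<Rightarrow> real \<Rightarrow> int^3 \<Rightarrow> complex^3" where
  "picard \<nu> \<alpha> \<tau> y0 0 = (\<lambda>t k. 0)"
| "picard \<nu> \<alpha> \<tau> y0 (Suc n) = (\<lambda>t k. duhamel (\<nu> * norm (freq k) powr (2 * \<alpha>)) \<tau> (y0 k) (\<lambda>s. forcing (picard \<nu> \<alpha> \<tau> y0 n) s k) t)"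

lemma hsum_zero [simp]: "hsum r (\<lambda>k. 0) = 0"
  by (simp add: hsum_def)

text \<open>Existence of global approximate solutions: the data are small in the critical norm, so that
  the Picard iterates stay bounded and their differences contract, both uniformly in time.\<close>

lemma approximate_solution:
  fixes y0 :: "int^3 \<Rightarrow> complex^3"
  assumes C: "C > 0" "trilinear_bounded (\<lambda>p q. p \<noteq> 0 \<and> q \<noteq> 0) \<alpha> (2 * \<alpha> - 1) C"
    and \<nu>: "\<nu> > 0" and T: "\<tau> \<le> T"
    and y0: "finite K" "supp_in K y0" "solenoidal y0" "real_seq y0"
    and e: "e > 0" "hsum (2 * \<alpha>) y0 \<le> e" "16 * C * e \<le> \<nu>\<^sup>2" and \<eta>: "\<eta> > 0"
  obtains v g L where "heat_sol \<nu> \<alpha> \<tau> T L v g" "admissible \<tau> T L v" "v \<tau> = y0"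
    "\<And>t. t \<in> {\<tau>..T} \<Longrightarrow> supp_in L (adv (v t) (v t))"
    "\<And>t. t \<in> {\<tau>..T} \<Longrightarrow> hsum (2 * \<alpha>) (v t) \<le> 2 * e"
    "integral {\<tau>..T} (\<lambda>t. hsum (4 * \<alpha>) (v t)) \<le> 2 * e / \<nu>"
    "integral {\<tau>..T} (\<lambda>t. \<Sum>k\<in>L. (norm (g t k - forcing v t k))\<^sup>2) \<le> \<eta>"
proof -
  define v where "v = picard \<nu> \<alpha> \<tau> y0"
  define L where "L n = (sumset ^^ n) K" for n
  have L0: "L 0 = K" and LS: "L (Suc n) = sumset (L n)" for n by (simp_all add: L_def)
  have LK: "K \<subseteq> L n" for n by (induction n) (auto simp: L0 LS sumset_def)
  have LSn: "L n \<subseteq> L (Suc n)" for n by (auto simp: LS sumset_def)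
  have finL: "finite (L n)" for n by (induction n) (simp_all add: L0 LS finite_sumset y0(1))
  have adm: "admissible \<tau> T (L n) (v n)" for n
  proof (induction n)
    case 0
    show ?case using y0(1) by (simp add: v_def L0 admissible_def supp_in_def solenoidal_def real_seq_def)
  next
    case (Suc n)
    show ?case using picard_step(2)[OF Suc supp_in_mono[OF y0(2) LK] y0(3,4), of \<nu> \<alpha>]
      by (simp add: v_def LS)
  qed
  have sol: "heat_sol \<nu> \<alpha> \<tau> T (L (Suc n)) (v (Suc n)) (forcing (v n))" for n
    using picard_step(1)[OF adm[of n] supp_in_mono[OF y0(2) LK] y0(3,4), where \<nu>=\<nu> and \<alpha>=\<alpha>]
    by (simp add: v_def LS)
  have init: "v (Suc n) \<tau> = y0" for n by (simp add: v_def duhamel_init)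
  have adm_mono: "admissible \<tau> T (L (Suc n)) (v n)" for n
    using adm[of n] finL[of "Suc n"] supp_in_mono[OF _ LSn[of n]] unfolding admissible_def by blast
  have zf: "forcing (\<lambda>t k. 0) t k = 0" for t k
    by (simp add: forcing_def adv_def)
  \<comment> \<open>The data account for \<open>e\<close>. The nonlinearity adds at most
    2C(2e)(2e/\<nu>)/\<nu>, which 16 C e \<le> \<nu>^2 keeps below \<open>e\<close>.\<close>
  have bnd: "(\<forall>t\<in>{\<tau>..T}. hsum (2 * \<alpha>) (v n t) \<le> 2 * e) \<and> integral {\<tau>..T} (\<lambda>t. hsum (4 * \<alpha>) (v n t)) \<le> 2 * e / \<nu>" for n
  proof (induction n)
    case 0
    show ?case using e(1) \<nu> by (simp add: v_def)
  next
    case (Suc n)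
    let ?z = "\<lambda>t::real. \<lambda>k::int^3. 0::complex^3"
    \<comment> \<open>Comparison with the zero field turns the estimate for differences into one for
      a single iterate.\<close>
    have az: "admissible \<tau> T (L n) ?z" using finL by (simp add: admissible_def supp_in_def solenoidal_def real_seq_def)
    have "integral {\<tau>..T} (\<lambda>t. \<Sum>k\<in>L (Suc n). (norm (forcing (v n) t k - forcing ?z t k))\<^sup>2)
      \<le> 2 * C * (2 * e * (2 * e / \<nu>) + 0 * (2 * e / \<nu>))"
      using Suc by (intro integral_forcing_diff[OF C adm az finL _ _ _ _ T]) auto
    then have "integral {\<tau>..T} (\<lambda>t. \<Sum>k\<in>L (Suc n). (norm (forcing (v n) t k))\<^sup>2) \<le> 2 * C * (2 * e * (2 * e / \<nu>))"
      by (simp only: zf diff_zero mult_zero_left add_0_right)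
    from divide_right_mono[OF this, of \<nu>]
    have "integral {\<tau>..T} (\<lambda>t. \<Sum>k\<in>L (Suc n). (norm (forcing (v n) t k))\<^sup>2) / \<nu> \<le> 2 * C * (2 * e * (2 * e / \<nu>)) / \<nu>"
      using \<nu> by simp
    also have "\<dots> = (16 * C * e) * e / (2 * \<nu>\<^sup>2)" by (simp add: power2_eq_square)
    also have "\<dots> \<le> \<nu>\<^sup>2 * e / (2 * \<nu>\<^sup>2)" using e by (intro divide_right_mono mult_right_mono) auto
    also have "\<dots> \<le> e" using \<nu> e(1) by simp
    finally have X: "hsum (2 * \<alpha>) (v (Suc n) \<tau>) + integral {\<tau>..T} (\<lambda>t. \<Sum>k\<in>L (Suc n). (norm (forcing (v n) t k))\<^sup>2) / \<nu> \<le> 2 * e"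
      using e(2) by (simp add: init)
    show ?case using heat_bounds[OF sol \<nu> T X] by blast
  qed
  \<comment> \<open>Each step halves the distance: the contraction factor is 8 C e / \<nu>^2, which
    is at most 1/2.\<close>
  define X where "X n = 2 * e / 2 ^ n" for n :: nat
  have contract: "integral {\<tau>..T} (\<lambda>t. \<Sum>k\<in>G. (norm (forcing (v (Suc n)) t k - forcing (v n) t k))\<^sup>2) / \<nu> \<le> X (Suc n)"
    if "\<forall>t\<in>{\<tau>..T}. hsum (2 * \<alpha>) (\<lambda>k. v (Suc n) t k - v n t k) \<le> X n"
      "integral {\<tau>..T} (\<lambda>t. hsum (4 * \<alpha>) (\<lambda>k. v (Suc n) t k - v n t k)) \<le> X n / \<nu>" "finite G" for n G
  proof -
    have X0: "X n \<ge> 0" using e(1) by (simp add: X_def)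
    have "integral {\<tau>..T} (\<lambda>t. \<Sum>k\<in>G. (norm (forcing (v (Suc n)) t k - forcing (v n) t k))\<^sup>2)
      \<le> 2 * C * (X n * (2 * e / \<nu>) + 2 * e * (X n / \<nu>))"
      using that bnd by (intro integral_forcing_diff[OF C adm adm_mono _ _ _ _ _ T]) auto
    from divide_right_mono[OF this, of \<nu>]
    have "integral {\<tau>..T} (\<lambda>t. \<Sum>k\<in>G. (norm (forcing (v (Suc n)) t k - forcing (v n) t k))\<^sup>2) / \<nu>
      \<le> 2 * C * (X n * (2 * e / \<nu>) + 2 * e * (X n / \<nu>)) / \<nu>"
      using \<nu> by simp
    also have "\<dots> = (16 * C * e) * X n / (2 * \<nu>\<^sup>2)" using \<nu> by (simp add: power2_eq_square field_simps)
    also have "\<dots> \<le> \<nu>\<^sup>2 * X n / (2 * \<nu>\<^sup>2)" using e X0 by (intro divide_right_mono mult_right_mono) auto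
    also have "\<dots> = X (Suc n)" using \<nu> by (simp add: X_def)
    finally show ?thesis .
  qed
  have diff: "(\<forall>t\<in>{\<tau>..T}. hsum (2 * \<alpha>) (\<lambda>k. v (Suc n) t k - v n t k) \<le> X n) \<and>
     integral {\<tau>..T} (\<lambda>t. hsum (4 * \<alpha>) (\<lambda>k. v (Suc n) t k - v n t k)) \<le> X n / \<nu>" for n
  proof (induction n)
    case 0
    show ?case using bnd[of "Suc 0"] by (simp add: X_def) (simp add: v_def)
  next
    case (Suc n)
    have "heat_sol \<nu> \<alpha> \<tau> T (L (Suc (Suc n))) (\<lambda>t k. v (Suc (Suc n)) t k - v (Suc n) t k) (\<lambda>t k. forcing (v (Suc n)) t k - forcing (v n) t k)"
      by (rule heat_sol_diff[OF sol heat_sol_mono[OF sol LSn finL]])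
    from heat_bounds[OF this \<nu> T, of "X (Suc n)"] show ?case
      using contract[of n "L (Suc (Suc n))"] Suc finL by (simp add: init)
  qed
  have "(\<lambda>n. \<nu> * (2 * e) * (1/2) ^ n) \<longlonglongrightarrow> \<nu> * (2 * e) * 0"
    by (intro tendsto_intros LIMSEQ_power_zero) simp
  then have "\<forall>\<^sub>F n in sequentially. \<nu> * (2 * e) * (1/2) ^ n < \<eta>" using \<eta> by (intro order_tendstoD(2)) auto
  then obtain n where n: "\<nu> * (2 * e) * (1/2) ^ n < \<eta>" by (auto simp: eventually_sequentially)
  let ?L = "L (Suc (Suc n))"
  show thesis
  \<comment> \<open>The iterate \<open>v (Suc n)\<close> is driven by the nonlinearity of its
    predecessor, so its residual is a difference of consecutive forcings, small by
    contraction.\<close>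
  proof (rule that[of ?L "v (Suc n)" "forcing (v n)"])
    show "heat_sol \<nu> \<alpha> \<tau> T ?L (v (Suc n)) (forcing (v n))" by (rule heat_sol_mono[OF sol LSn finL])
    show "admissible \<tau> T ?L (v (Suc n))" by (rule adm_mono)
    show "v (Suc n) \<tau> = y0" by (rule init)
    show "supp_in ?L (adv (v (Suc n) t) (v (Suc n) t))" if "t \<in> {\<tau>..T}" for t
      using admissible_forcing(3)[OF adm[of "Suc n"] that] by (simp add: LS)
    show "hsum (2 * \<alpha>) (v (Suc n) t) \<le> 2 * e" if "t \<in> {\<tau>..T}" for t using bnd that by blast
    show "integral {\<tau>..T} (\<lambda>t. hsum (4 * \<alpha>) (v (Suc n) t)) \<le> 2 * e / \<nu>" using bnd by blast
    have "integral {\<tau>..T} (\<lambda>t. \<Sum>k\<in>?L. (norm (forcing (v (Suc n)) t k - forcing (v n) t k))\<^sup>2) / \<nu> \<le> X (Suc n)"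
      using diff[of n] finL by (intro contract) auto
    then have "integral {\<tau>..T} (\<lambda>t. \<Sum>k\<in>?L. (norm (forcing (v (Suc n)) t k - forcing (v n) t k))\<^sup>2) \<le> X (Suc n) * \<nu>"
      using \<nu> by (simp add: pos_divide_le_eq)
    also have "\<dots> \<le> \<nu> * (2 * e) * (1/2) ^ n" using \<nu> e(1) by (simp add: X_def power_divide field_simps)
    also have "\<dots> \<le> \<eta>" using n by simp
    finally show "integral {\<tau>..T} (\<lambda>t. \<Sum>k\<in>?L. (norm (forcing (v n) t k - forcing (v (Suc n)) t k))\<^sup>2) \<le> \<eta>"
      by (simp add: norm_minus_commute)
  qed
qed

section \<open>Weak-strong comparison\<close>

text \<open>A function with \<open>\<bar>H t - H s\<bar> = O((t - s)\<^sup>2)\<close> is constant; this replaces the product rule for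
  absolutely continuous functions.\<close>

lemma quadratic_modulus_constant:
  fixes H :: "real \<Rightarrow> real"
  assumes H: "\<And>s t. a \<le> s \<Longrightarrow> s \<le> t \<Longrightarrow> t \<le> b \<Longrightarrow> \<bar>H t - H s\<bar> \<le> K * (t - s)\<^sup>2" and t: "t \<in> {a..b}"
  shows "H t = H a"
proof -
  have "(H has_real_derivative 0) (at s within {a..b})" if s: "s \<in> {a..b}" for s
    unfolding has_field_derivative_iff
  proof (rule Lim_null_comparison)
    show "\<forall>\<^sub>F y in at s within {a..b}. norm ((H y - H s) / (y - s)) \<le> K * \<bar>y - s\<bar>"
      unfolding eventually_at_filter
    proof (intro always_eventually allI impI)
      fix y assume y: "y \<noteq> s" "y \<in> {a..b}"
      have "\<bar>H y - H s\<bar> \<le> K * (y - s)\<^sup>2"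
        using H[of s y] H[of y s] s y by (cases "s \<le> y") (auto simp: abs_minus_commute power2_commute)
      then have "\<bar>H y - H s\<bar> \<le> K * \<bar>y - s\<bar> * \<bar>y - s\<bar>" by (simp add: power2_eq_square abs_mult_self_eq mult.assoc)
      then show "norm ((H y - H s) / (y - s)) \<le> K * \<bar>y - s\<bar>"
        using y by (simp add: abs_divide pos_divide_le_eq)
    qed
    have "((\<lambda>y. K * \<bar>y - s\<bar>) \<longlongrightarrow> K * \<bar>s - s\<bar>) (at s within {a..b})" by (intro tendsto_intros)
    then show "((\<lambda>y. K * \<bar>y - s\<bar>) \<longlongrightarrow> 0) (at s within {a..b})" by simp
  qed
  then have "\<exists>c. \<forall>s\<in>{a..b}. H s = c"
    by (intro has_field_derivative_zero_constant) auto
  moreover have "a \<in> {a..b}" using t by auto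
  ultimately show ?thesis using t by metis
qed

lemma bounded_measurable_integrable_on:
  fixes f :: "real \<Rightarrow> 'a::euclidean_space"
  assumes "f \<in> borel_measurable (lebesgue_on {a..b})" "\<And>t. t \<in> {a..b} \<Longrightarrow> norm (f t) \<le> B"
  shows "f integrable_on {a..b}"
  using assms by (intro measurable_bounded_by_integrable_imp_integrable[of f "{a..b}" "\<lambda>_. B"]) auto

lemma measurable_lebesgue_on_continuous:
  fixes f :: "real \<Rightarrow> 'a::euclidean_space"
  assumes "continuous_on {a..b} f"
  shows "f \<in> borel_measurable (lebesgue_on {a..b})"
  using continuous_imp_measurable_on_sets_lebesgue[OF assms] by simp

text \<open>The product rule for U merely Lipschitz, as the integral of a bounded function, and V
  continuously differentiable. The defect H has quadratic modulus and is therefore constant.\<close>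

lemma integration_by_parts_inner:
  fixes U V :: "real \<Rightarrow> 'a::euclidean_space"
  assumes g: "g \<in> borel_measurable (lebesgue_on {a..b})" "\<And>t. t \<in> {a..b} \<Longrightarrow> norm (g t) \<le> B"
    and U: "\<And>t. t \<in> {a..b} \<Longrightarrow> U t = U a + integral {a..t} g"
    and V: "\<And>t. t \<in> {a..b} \<Longrightarrow> (V has_vector_derivative V' t) (at t within {a..b})" "continuous_on {a..b} V'"
    and t: "t \<in> {a..b}"
  shows "((\<lambda>s. g s \<bullet> V s + U s \<bullet> V' s) has_integral U t \<bullet> V t - U a \<bullet> V a) {a..t}"
proof -
  have gi: "g integrable_on {a..b}" by (rule bounded_measurable_integrable_on[OF g])
  have B0: "B \<ge> 0" using g(2)[OF t] norm_ge_zero order_trans by blast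
  have Vc: "continuous_on {a..b} V"
    using V(1) by (meson continuous_on_eq_continuous_within has_vector_derivative_continuous)
  have Uc: "continuous_on {a..b} U"
    by (rule continuous_on_eq[of _ "\<lambda>t. U a + integral {a..t} g"])
       (auto simp: U[symmetric] intro!: continuous_intros indefinite_integral_continuous_1 gi)
  have "compact (V' ` {a..b})" by (intro compact_continuous_image V(2)) simp
  then obtain B' where B': "\<And>t. t \<in> {a..b} \<Longrightarrow> norm (V' t) \<le> B'"
    using compact_imp_bounded bounded_iff by (metis imageI)
  have B'0: "B' \<ge> 0" using B'[OF t] norm_ge_zero order_trans by blast
  have sub: "{s..t} \<subseteq> {a..b}" if "a \<le> s" "t \<le> b" for s t using that by auto
  have Ui: "U t - U s = integral {s..t} g" "norm (U t - U s) \<le> B * (t - s)" if "a \<le> s" "s \<le> t" "t \<le> b" for s t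
  proof -
    have "integral {a..s} g + integral {s..t} g = integral {a..t} g"
      using that by (intro Henstock_Kurzweil_Integration.integral_combine integrable_on_subinterval[OF gi]) auto
    then show eq: "U t - U s = integral {s..t} g" using U[of t] U[of s] that by (auto simp: algebra_simps)
    have "norm (integral {s..t} g) \<le> integral {s..t} (\<lambda>_. B)"
      using that g(2) by (intro integral_norm_bound_integral integrable_on_subinterval[OF gi]) auto
    then show "norm (U t - U s) \<le> B * (t - s)" using that by (simp add: eq mult.commute)
  qed
  have Vi: "(V' has_integral V t - V s) {s..t}" "norm (V t - V s) \<le> B' * (t - s)" if "a \<le> s" "s \<le> t" "t \<le> b" for s t
  proof -
    show h: "(V' has_integral V t - V s) {s..t}"
      using that by (intro fundamental_theorem_of_calculus has_vector_derivative_within_subset[OF V(1)] sub) auto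
    have "norm (integral {s..t} V') \<le> integral {s..t} (\<lambda>_. B')"
      using that B' by (intro integral_norm_bound_integral integrable_continuous_real continuous_on_subset[OF V(2)]) auto
    then show "norm (V t - V s) \<le> B' * (t - s)" using that integral_unique[OF h] by (simp add: mult.commute)
  qed
  define f where "f s = g s \<bullet> V s + U s \<bullet> V' s" for s
  obtain BV where BV: "\<And>t. t \<in> {a..b} \<Longrightarrow> norm (V t) \<le> BV"
    using compact_imp_bounded[OF compact_continuous_image[OF Vc]] bounded_iff by (metis compact_Icc imageI)
  have gVi: "(\<lambda>s. g s \<bullet> V s) integrable_on {a..b}"
  proof (rule bounded_measurable_integrable_on)
    show "(\<lambda>s. g s \<bullet> V s) \<in> borel_measurable (lebesgue_on {a..b})"
      by (intro borel_measurable_inner g measurable_lebesgue_on_continuous Vc)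
    show "norm (g s \<bullet> V s) \<le> B * BV" if "s \<in> {a..b}" for s
      using Cauchy_Schwarz_ineq2[of "g s" "V s"] mult_mono[OF g(2)[OF that] BV[OF that] B0] by simp
  qed
  have fi: "f integrable_on {a..b}"
    unfolding f_def by (intro integrable_add gVi integrable_continuous_real continuous_intros Uc V(2))
  define H where "H t = U t \<bullet> V t - integral {a..t} f" for t
  have "\<bar>H t - H s\<bar> \<le> 2 * (B * B') * (t - s)\<^sup>2" if st: "a \<le> s" "s \<le> t" "t \<le> b" for s t
  proof -
    have "integral {a..s} f + integral {s..t} f = integral {a..t} f"
      using st by (intro Henstock_Kurzweil_Integration.integral_combine integrable_on_subinterval[OF fi]) auto
    then have 1: "H t - H s = U t \<bullet> V t - U s \<bullet> V s - integral {s..t} f" by (simp add: H_def)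
    have gst: "g integrable_on {s..t}" using st by (intro integrable_on_subinterval[OF gi]) auto
    have "((\<lambda>r. g r \<bullet> V t) has_integral (U t - U s) \<bullet> V t) {s..t}"
      using has_integral_linear[OF integrable_integral[OF gst] bounded_linear_inner_left[of "V t"]] Ui(1)[OF st] by (simp add: o_def)
    moreover have "((\<lambda>r. U s \<bullet> V' r) has_integral U s \<bullet> (V t - V s)) {s..t}"
      using has_integral_linear[OF Vi(1)[OF st] bounded_linear_inner_right[of "U s"]] by (simp add: o_def)
    moreover have "(f has_integral integral {s..t} f) {s..t}"
      using st by (intro integrable_integral integrable_on_subinterval[OF fi]) auto
    ultimately have "((\<lambda>r. g r \<bullet> V t + U s \<bullet> V' r - f r) has_integral (U t - U s) \<bullet> V t + U s \<bullet> (V t - V s) - integral {s..t} f) {s..t}"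
      by (intro has_integral_add has_integral_diff)
    moreover have "(U t - U s) \<bullet> V t + U s \<bullet> (V t - V s) - integral {s..t} f = H t - H s"
      by (simp add: 1 inner_diff_left inner_diff_right)
    ultimately have hi: "((\<lambda>r. g r \<bullet> V t + U s \<bullet> V' r - f r) has_integral H t - H s) {s..t}" by simp
    have bd: "norm (g r \<bullet> V t + U s \<bullet> V' r - f r) \<le> 2 * (B * B') * (t - s)" if r: "r \<in> {s..t}" for r
    proof -
      have rr: "a \<le> s" "s \<le> r" "r \<le> b" "a \<le> r" "r \<le> t" "t \<le> b" using r st by auto
      have "g r \<bullet> V t + U s \<bullet> V' r - f r = g r \<bullet> (V t - V r) - (U r - U s) \<bullet> V' r"
        by (simp add: f_def inner_diff_left inner_diff_right)
      also have "norm \<dots> \<le> norm (g r) * norm (V t - V r) + norm (U r - U s) * norm (V' r)"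
        using Cauchy_Schwarz_ineq2[of "g r" "V t - V r"] Cauchy_Schwarz_ineq2[of "U r - U s" "V' r"] unfolding real_norm_def by linarith
      also have "\<dots> \<le> B * (B' * (t - r)) + (B * (r - s)) * B'"
        using rr B0 B'0 by (intro add_mono mult_mono g(2) Vi(2) Ui(2) B') auto
      also have "\<dots> = (B * B') * (t - s)" by (simp add: algebra_simps)
      also have "\<dots> \<le> 2 * (B * B') * (t - s)" using rr B0 B'0 by (intro mult_right_mono) auto
      finally show ?thesis .
    qed
    have "norm (H t - H s) \<le> (2 * (B * B') * (t - s)) * measure lborel {s..t}"
      using st B0 B'0 bd by (intro has_integral_bound_real[OF _ finite.emptyI hi]) auto
    then show ?thesis using st by (simp add: power2_eq_square)
  qed
  from quadratic_modulus_constant[of a b H, OF this t] have "H t = H a" .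
  then have "integral {a..t} f = U t \<bullet> V t - U a \<bullet> V a" by (simp add: H_def)
  moreover have "f integrable_on {a..t}" using t by (intro integrable_on_subinterval[OF fi]) auto
  ultimately show ?thesis unfolding f_def[symmetric] by (metis integrable_integral)
qed

section \<open>Difference of a weak and an approximate solution\<close>

lemma norm_diff_power2: "(norm (a - b))\<^sup>2 = (norm a)\<^sup>2 + ((norm b)\<^sup>2 - 2 * (a \<bullet> b))" for a b :: "'a::real_inner"
  by (simp add: power2_norm_eq_inner inner_diff_left inner_diff_right inner_commute)

text \<open>Finite support of v makes the cross terms a finite sum, so their evolution can be
  followed mode by mode.\<close>

lemma hsum_diff_supp:
  assumes u: "hs r u" and L: "finite L" "supp_in L v"
  shows "hsum r (\<lambda>k. u k - v k) = hsum r u + (\<Sum>k\<in>L. norm (freq k) powr r * ((norm (v k))\<^sup>2 - 2 * (u k \<bullet> v k)))"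
proof -
  let ?f = "\<lambda>k. norm (freq k) powr r * ((norm (v k))\<^sup>2 - 2 * (u k \<bullet> v k))"
  have f: "?f summable_on UNIV" "infsum ?f UNIV = sum ?f L"
    using L(2) by (intro infsum_supp[OF L(1)]; simp add: supp_in_def)+
  have "hsum r (\<lambda>k. u k - v k) = (\<Sum>\<^sub>\<infinity>k. norm (freq k) powr r * (norm (u k))\<^sup>2 + ?f k)"
    unfolding hsum_def by (simp only: norm_diff_power2 distrib_left)
  also have "\<dots> = hsum r u + infsum ?f UNIV"
    unfolding hsum_def using u f(1) by (intro infsum_add) (auto simp: hs_def)
  finally show ?thesis by (simp add: f)
qed

lemma l2sum_diff_supp:
  assumes u: "l2 u" and L: "finite L" "supp_in L v"
  shows "l2sum (\<lambda>k. u k - v k) = l2sum u + (\<Sum>k\<in>L. (norm (v k))\<^sup>2 - 2 * (u k \<bullet> v k))"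
proof -
  let ?f = "\<lambda>k. (norm (v k))\<^sup>2 - 2 * (u k \<bullet> v k)"
  have f: "?f summable_on UNIV" "infsum ?f UNIV = sum ?f L"
    using L(2) by (intro infsum_supp[OF L(1)]; simp add: supp_in_def)+
  have "l2sum (\<lambda>k. u k - v k) = (\<Sum>\<^sub>\<infinity>k. (norm (u k))\<^sup>2 + ?f k)"
    unfolding l2sum_def by (simp only: norm_diff_power2)
  also have "\<dots> = l2sum u + infsum ?f UNIV"
    unfolding l2sum_def using u f(1) by (intro infsum_add) (auto simp: l2_def)
  finally show ?thesis by (simp add: f)
qed

text \<open>AM-GM for 2\<nu>D and P/(2\<nu>), whose product is PD. The weight is such that the first
  term can be the whole dissipation of the difference.\<close>

lemma two_le_of_square_le:
  fixes x P D \<nu> :: real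
  assumes "x\<^sup>2 \<le> P * D" "0 \<le> P" "0 \<le> D" "\<nu> > 0"
  shows "2 * x \<le> 2 * \<nu> * D + P / (2 * \<nu>)"
proof (rule power2_le_imp_le)
  define a where "a = 2 * \<nu> * D"
  define b where "b = P / (2 * \<nu>)"
  have ab: "a * b = P * D" using assms(4) by (simp add: a_def b_def)
  have "(a + b)\<^sup>2 = (a - b)\<^sup>2 + 4 * (a * b)" by (simp add: power2_eq_square algebra_simps)
  then have "4 * (P * D) \<le> (a + b)\<^sup>2" by (simp add: ab)
  moreover have "(2 * x)\<^sup>2 = 4 * x\<^sup>2" by (simp add: power2_eq_square)
  ultimately show "(2 * x)\<^sup>2 \<le> (2 * \<nu> * D + P / (2 * \<nu>))\<^sup>2"
    using assms(1) unfolding a_def b_def by linarith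
  show "0 \<le> 2 * \<nu> * D + P / (2 * \<nu>)"
    using assms by (intro add_nonneg_nonneg mult_nonneg_nonneg divide_nonneg_nonneg) auto
qed

definition mode_rhs where
  "mode_rhs \<nu> \<alpha> u k s = - (\<nu> * norm (freq k) powr (2 * \<alpha>)) *\<^sub>R u s k - proj k (adv (u s) (u s) k)"

text \<open>What the comparison takes from a weak solution. The equation is in integrated form,
  since the coefficients are only Lipschitz in time, and membership in H^\<alpha> is asked off a
  null set of times.\<close>

definition mode_solution :: "real \<Rightarrow> real \<Rightarrow> real \<Rightarrow> real \<Rightarrow> (real \<Rightarrow> int^3 \<Rightarrow> complex^3) \<Rightarrow> bool" where
  "mode_solution \<nu> \<alpha> \<tau> T u \<longleftrightarrow>
     (\<forall>t\<in>{\<tau>..T}. l2 (u t) \<and> solenoidal (u t) \<and> real_seq (u t)) \<and>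
     (\<exists>N. negligible N \<and> (\<forall>t\<in>{\<tau>..T} - N. hs (2 * \<alpha>) (u t))) \<and>
     (\<lambda>s. hsum (2 * \<alpha>) (u s)) integrable_on {\<tau>..T} \<and>
     (\<forall>t\<in>{\<tau>..T}. l2sum (u t) + 2 * \<nu> * integral {\<tau>..t} (\<lambda>s. hsum (2 * \<alpha>) (u s)) \<le> l2sum (u \<tau>)) \<and>
     (\<forall>k. mode_rhs \<nu> \<alpha> u k \<in> borel_measurable (lebesgue_on {\<tau>..T}) \<and>
        (\<exists>B. \<forall>t\<in>{\<tau>..T}. norm (mode_rhs \<nu> \<alpha> u k t) \<le> B) \<and>
        (\<forall>t\<in>{\<tau>..T}. u t k = u \<tau> k + integral {\<tau>..t} (mode_rhs \<nu> \<alpha> u k)))"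

text \<open>The left side is the formal time derivative of |u - v|^2, with the energy inequality
  standing in for the part |u|^2. It equals -2\<nu>|\<Lambda>^\<alpha> w|^2 + 2 <w . grad w, v> - 2
  <w, \<rho>>, where \<rho> is the residual of v. The trilinear term uses up the dissipation;
  \<open>l\<close> is to be the length of the time interval and balances the residual term.\<close>

lemma comparison_pointwise:
  assumes C: "C > 0" "trilinear_bounded (\<lambda>p q. p \<noteq> 0 \<and> q \<noteq> 0) \<alpha> (2 * \<alpha> - 1) C"
    and \<nu>: "\<nu> > 0" and l: "l > 0"
    and L: "finite L" "supp_in L v" "supp_in L (adv v v)" "solenoidal v" "real_seq v"
    and u: "l2 u" "solenoidal u" "real_seq u" "hs (2 * \<alpha>) u"
  defines "\<kappa> \<equiv> \<lambda>k. norm (freq k) powr (2 * \<alpha>)" and "w \<equiv> \<lambda>k. u k - v k"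
  shows "- (2 * \<nu> * hsum (2 * \<alpha>) u) + (\<Sum>k\<in>L. 2 * (v k \<bullet> (- (\<nu> * \<kappa> k) *\<^sub>R v k + g k))
      - 2 * ((- (\<nu> * \<kappa> k) *\<^sub>R u k - proj k (adv u u k)) \<bullet> v k + u k \<bullet> (- (\<nu> * \<kappa> k) *\<^sub>R v k + g k)))
    \<le> (C / (2 * \<nu>) * hsum (4 * \<alpha>) v + 1 / (4 * l)) * l2sum w + 4 * l * (\<Sum>k\<in>L. (norm (g k + proj k (adv v v k)))\<^sup>2)"
proof -
  define \<rho> where "\<rho> k = g k + proj k (adv v v k)" for k
  have kd: "kdot k (v k) = 0" "kdot k (u k) = 0" "kdot k (w k) = 0" for k
    using L(4) u(2) by (auto simp: solenoidal_def w_def kdot_diff)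
  have lw: "l2 w" unfolding w_def by (intro l2_diff u supp_in_l2[OF L(1,2)])
  have hw: "hs (2 * \<alpha>) w" unfolding w_def by (intro hs_diff u supp_in_hs[OF L(1,2)])
  have w0: "w 0 = 0" using L(4) u(2) by (simp add: w_def solenoidal_def)
  have t: "2 * (v k \<bullet> (- (\<nu> * \<kappa> k) *\<^sub>R v k + g k))
      - 2 * ((- (\<nu> * \<kappa> k) *\<^sub>R u k - proj k (adv u u k)) \<bullet> v k + u k \<bullet> (- (\<nu> * \<kappa> k) *\<^sub>R v k + g k))
     = - 2 * \<nu> * (\<kappa> k * ((norm (v k))\<^sup>2 - 2 * (u k \<bullet> v k))) + 2 * (adv u u k \<bullet> v k + adv v v k \<bullet> w k) - 2 * (w k \<bullet> \<rho> k)" for k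
  proof -
    have 1: "proj k (adv u u k) \<bullet> v k = adv u u k \<bullet> v k" by (rule proj_inner[OF kd(1)])
    have 2: "proj k (adv v v k) \<bullet> w k = adv v v k \<bullet> w k" by (rule proj_inner[OF kd(3)])
    have 3: "w k \<bullet> \<rho> k = w k \<bullet> g k + adv v v k \<bullet> w k"
      using 2 by (simp add: \<rho>_def inner_add_right inner_commute)
    have 4: "w k \<bullet> g k = u k \<bullet> g k - v k \<bullet> g k" by (simp add: w_def inner_diff_left)
    show ?thesis unfolding 3 4
      by (simp add: inner_add_right inner_diff_left 1 power2_norm_eq_inner algebra_simps)
  qed
  define x where "x = (\<Sum>k\<in>L. adv w w k \<bullet> v k)"
  have "(\<Sum>k\<in>L. adv u u k \<bullet> v k + adv v v k \<bullet> w k) = x"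
    using comparison_identity[OF L(1-3) u(1,3,2) L(5,4)] by (simp add: w_def x_def sum.distrib)
  moreover have "hsum (2 * \<alpha>) w = hsum (2 * \<alpha>) u + (\<Sum>k\<in>L. \<kappa> k * ((norm (v k))\<^sup>2 - 2 * (u k \<bullet> v k)))"
    unfolding w_def \<kappa>_def by (rule hsum_diff_supp[OF u(4) L(1,2)])
  ultimately have eq: "- (2 * \<nu> * hsum (2 * \<alpha>) u) + (\<Sum>k\<in>L. 2 * (v k \<bullet> (- (\<nu> * \<kappa> k) *\<^sub>R v k + g k))
      - 2 * ((- (\<nu> * \<kappa> k) *\<^sub>R u k - proj k (adv u u k)) \<bullet> v k + u k \<bullet> (- (\<nu> * \<kappa> k) *\<^sub>R v k + g k)))
     = - (2 * \<nu> * hsum (2 * \<alpha>) w) + 2 * x - 2 * (\<Sum>k\<in>L. w k \<bullet> \<rho> k)"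
    unfolding t by (simp only: sum_subtractf sum.distrib sum_distrib_left[symmetric]) (simp add: algebra_simps)
  have "x\<^sup>2 \<le> (C * hsum (4 * \<alpha>) v * l2sum w) * hsum (2 * \<alpha>) w"
    unfolding x_def using adv_inner_bound[OF C L(1,2) lw hw w0] by (simp add: mult_ac)
  then have xx: "2 * x \<le> 2 * \<nu> * hsum (2 * \<alpha>) w + (C * hsum (4 * \<alpha>) v * l2sum w) / (2 * \<nu>)"
    using C(1) \<nu> by (intro two_le_of_square_le) (auto simp: hsum_nonneg l2sum_nonneg)
  have "- 2 * (w k \<bullet> \<rho> k) \<le> 1 / (4 * l) * (norm (w k))\<^sup>2 + 4 * l * (norm (\<rho> k))\<^sup>2" for k
  proof -
    have "- 2 * (w k \<bullet> \<rho> k) \<le> 2 * (norm (w k) * norm (\<rho> k))"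
      using Cauchy_Schwarz_ineq2[of "w k" "\<rho> k"] by linarith
    also have "\<dots> \<le> 1 / (4 * l) * (norm (w k))\<^sup>2 + 4 * l * (norm (\<rho> k))\<^sup>2"
      using two_le_of_square_le[of "norm (w k) * norm (\<rho> k)" "(norm (w k))\<^sup>2" "(norm (\<rho> k))\<^sup>2" "2 * l"] l
      by (simp add: power_mult_distrib)
    finally show ?thesis .
  qed
  then have "(\<Sum>k\<in>L. - 2 * (w k \<bullet> \<rho> k)) \<le> (\<Sum>k\<in>L. 1 / (4 * l) * (norm (w k))\<^sup>2 + 4 * l * (norm (\<rho> k))\<^sup>2)"
    by (rule sum_mono)
  also have "\<dots> = 1 / (4 * l) * (\<Sum>k\<in>L. (norm (w k))\<^sup>2) + 4 * l * (\<Sum>k\<in>L. (norm (\<rho> k))\<^sup>2)"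
    by (simp add: sum.distrib sum_distrib_left)
  also have "\<dots> \<le> 1 / (4 * l) * l2sum w + 4 * l * (\<Sum>k\<in>L. (norm (\<rho> k))\<^sup>2)"
    using sum_le_l2sum[OF lw L(1)] l by (intro add_right_mono mult_left_mono) auto
  finally have rr: "- 2 * (\<Sum>k\<in>L. w k \<bullet> \<rho> k) \<le> 1 / (4 * l) * l2sum w + 4 * l * (\<Sum>k\<in>L. (norm (\<rho> k))\<^sup>2)"
    by (simp add: sum_distrib_left)
  have "(C / (2 * \<nu>) * hsum (4 * \<alpha>) v + 1 / (4 * l)) * l2sum w = (C * hsum (4 * \<alpha>) v * l2sum w) / (2 * \<nu>) + 1 / (4 * l) * l2sum w"
    by (simp add: distrib_right)
  then show ?thesis unfolding eq \<rho>_def[symmetric] using xx rr by linarith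
qed

text \<open>Instead of Gronwall's inequality the supremum S of the squared distance is absorbed: the
  time integral of the factor \<open>h\<close> is at most 1/16, from the small norm of v, plus 1/4,
  from the weight 1/(4l). Hence S \<le> E(\<tau>) + S/2 + 4 l \<eta>.\<close>

lemma comparison:
  assumes C: "C > 0" "trilinear_bounded (\<lambda>p q. p \<noteq> 0 \<and> q \<noteq> 0) \<alpha> (2 * \<alpha> - 1) C"
    and \<nu>: "\<nu> > 0" and T: "\<tau> < T" and e: "16 * C * e \<le> \<nu>\<^sup>2" and u: "mode_solution \<nu> \<alpha> \<tau> T u"
    and v: "heat_sol \<nu> \<alpha> \<tau> T L v g" "admissible \<tau> T L v"
    and vL: "\<And>t. t \<in> {\<tau>..T} \<Longrightarrow> supp_in L (adv (v t) (v t))"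
    and v4: "integral {\<tau>..T} (\<lambda>t. hsum (4 * \<alpha>) (v t)) \<le> 2 * e / \<nu>"
    and \<rho>: "integral {\<tau>..T} (\<lambda>t. \<Sum>k\<in>L. (norm (g t k - forcing v t k))\<^sup>2) \<le> \<eta>"
    and t: "t \<in> {\<tau>..T}"
  shows "l2sum (\<lambda>k. u t k - v t k) \<le> 2 * l2sum (\<lambda>k. u \<tau> k - v \<tau> k) + 8 * (T - \<tau>) * \<eta>"
proof -
  define l where "l = T - \<tau>"
  have l: "l > 0" using T by (simp add: l_def)
  define \<kappa> where "\<kappa> k = norm (freq k) powr (2 * \<alpha>)" for k
  define E where "E t = l2sum (\<lambda>k. u t k - v t k)" for t
  define v' where "v' k s = - (\<nu> * \<kappa> k) *\<^sub>R v s k + g s k" for k s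
  have L: "finite L" and vs: "\<And>t. t \<in> {\<tau>..T} \<Longrightarrow> supp_in L (v t) \<and> solenoidal (v t) \<and> real_seq (v t)"
    and vc: "\<And>k. continuous_on {\<tau>..T} (\<lambda>t. v t k)" using v(2) by (auto simp: admissible_def)
  have gc: "\<And>k. continuous_on {\<tau>..T} (\<lambda>t. g t k)"
    and vd: "\<And>k t. t \<in> {\<tau>..T} \<Longrightarrow> ((\<lambda>s. v s k) has_vector_derivative v' k t) (at t within {\<tau>..T})"
    using v(1) by (auto simp: heat_sol_def v'_def \<kappa>_def)
  have v'c: "continuous_on {\<tau>..T} (v' k)" for k unfolding v'_def by (intro continuous_intros vc gc)
  note U = u[unfolded mode_solution_def]
  note U2 = U[THEN conjunct2] note U3 = U2[THEN conjunct2] note U4 = U3[THEN conjunct2]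
  have us: "\<And>t. t \<in> {\<tau>..T} \<Longrightarrow> l2 (u t) \<and> solenoidal (u t) \<and> real_seq (u t)"
    using U[THEN conjunct1] by (rule bspec)
  have Di: "(\<lambda>s. hsum (2 * \<alpha>) (u s)) integrable_on {\<tau>..T}" by (rule U3[THEN conjunct1])
  have en: "\<And>t. t \<in> {\<tau>..T} \<Longrightarrow> l2sum (u t) + 2 * \<nu> * integral {\<tau>..t} (\<lambda>s. hsum (2 * \<alpha>) (u s)) \<le> l2sum (u \<tau>)"
    using U4[THEN conjunct1] by (rule bspec)
  have mr: "\<And>k. mode_rhs \<nu> \<alpha> u k \<in> borel_measurable (lebesgue_on {\<tau>..T})"
    by (rule U4[THEN conjunct2, THEN spec, THEN conjunct1])
  have mB: "\<And>k. \<exists>B. \<forall>t\<in>{\<tau>..T}. norm (mode_rhs \<nu> \<alpha> u k t) \<le> B"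
    by (rule U4[THEN conjunct2, THEN spec, THEN conjunct2, THEN conjunct1])
  have mu: "\<And>k t. t \<in> {\<tau>..T} \<Longrightarrow> u t k = u \<tau> k + integral {\<tau>..t} (mode_rhs \<nu> \<alpha> u k)"
    by (rule U4[THEN conjunct2, THEN spec, THEN conjunct2, THEN conjunct2, THEN bspec])
  obtain N where N: "negligible N" "\<forall>t\<in>{\<tau>..T} - N. hs (2 * \<alpha>) (u t)"
    using U2[THEN conjunct1] by (elim exE conjE)
  have \<tau>T: "\<tau> \<in> {\<tau>..T}" using T by simp
  have Et: "E t = l2sum (u t) + (\<Sum>k\<in>L. (norm (v t k))\<^sup>2 - 2 * (u t k \<bullet> v t k))" if "t \<in> {\<tau>..T}" for t
    unfolding E_def using us[OF that] vs[OF that] by (intro l2sum_diff_supp L) auto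
  define J where "J s = - (2 * \<nu> * hsum (2 * \<alpha>) (u s)) + (\<Sum>k\<in>L. 2 * (v s k \<bullet> v' k s) - 2 * (mode_rhs \<nu> \<alpha> u k s \<bullet> v s k + u s k \<bullet> v' k s))" for s
  define h where "h s = C / (2 * \<nu>) * hsum (4 * \<alpha>) (v s) + 1 / (4 * l)" for s
  define P where "P s = (\<Sum>k\<in>L. (norm (g s k - forcing v s k))\<^sup>2)" for s
  have h4c: "continuous_on {\<tau>..T} (\<lambda>s. hsum (4 * \<alpha>) (v s))" using vs vc by (intro continuous_on_hsum[OF L]) auto
  have hc: "continuous_on {\<tau>..T} h" unfolding h_def using l by (intro continuous_intros h4c)  auto
  have Pc: "continuous_on {\<tau>..T} P" unfolding P_def by (intro continuous_intros gc admissible_forcing(1)[OF v(2)])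
  have h0: "0 \<le> h s" "0 \<le> P s" for s using C(1) \<nu> l by (auto simp: h_def P_def hsum_nonneg intro!: add_nonneg_nonneg sum_nonneg)
  have Jle: "J s \<le> h s * E s + 4 * l * P s" if s: "s \<in> {\<tau>..T} - N" for s
  proof -
    have "J s \<le> (C / (2 * \<nu>) * hsum (4 * \<alpha>) (v s) + 1 / (4 * l)) * l2sum (\<lambda>k. u s k - v s k) + 4 * l * (\<Sum>k\<in>L. (norm (g s k + proj k (adv (v s) (v s) k)))\<^sup>2)"
      unfolding J_def v'_def \<kappa>_def mode_rhs_def
      using s vs us vL N(2) by (intro comparison_pointwise[OF C \<nu> l L]) auto
    then show ?thesis by (simp add: h_def E_def P_def forcing_def)
  qed
  \<comment> \<open>The dissipation of u comes with the energy inequality; the increments of |v|^2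
    and of the cross terms are exact, the latter by the product rule for Lipschitz
    coefficients.\<close>
  have Jint: "(J has_integral - (2 * \<nu> * integral {\<tau>..t} (\<lambda>s. hsum (2 * \<alpha>) (u s)))
     + (\<Sum>k\<in>L. ((norm (v t k))\<^sup>2 - (norm (v \<tau> k))\<^sup>2) - 2 * (u t k \<bullet> v t k - u \<tau> k \<bullet> v \<tau> k))) {\<tau>..t}"
    if t: "t \<in> {\<tau>..T}" for t
    unfolding J_def
  proof (intro has_integral_add has_integral_neg has_integral_mult_right has_integral_sum L has_integral_diff)
    show "((\<lambda>s. hsum (2 * \<alpha>) (u s)) has_integral integral {\<tau>..t} (\<lambda>s. hsum (2 * \<alpha>) (u s))) {\<tau>..t}"
      using t by (intro integrable_integral integrable_on_subinterval[OF Di]) auto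
    fix k assume "k \<in> L"
    show "((\<lambda>s. 2 * (v s k \<bullet> v' k s)) has_integral (norm (v t k))\<^sup>2 - (norm (v \<tau> k))\<^sup>2) {\<tau>..t}"
      using t by (intro norm_power2_FTC has_vector_derivative_within_subset[OF vd]) auto
    obtain B where B: "\<And>t. t \<in> {\<tau>..T} \<Longrightarrow> norm (mode_rhs \<nu> \<alpha> u k t) \<le> B" using mB[of k] by blast
    show "((\<lambda>s. mode_rhs \<nu> \<alpha> u k s \<bullet> v s k + u s k \<bullet> v' k s) has_integral u t k \<bullet> v t k - u \<tau> k \<bullet> v \<tau> k) {\<tau>..t}"
      by (rule integration_by_parts_inner[where U="\<lambda>s. u s k" and V="\<lambda>s. v s k", OF mr B mu vd v'c t])
  qed
  have main: "E t \<le> E \<tau> + (S / 2 + 4 * l * \<eta>)" if S: "\<And>s. s \<in> {\<tau>..T} \<Longrightarrow> E s \<le> S" and t: "t \<in> {\<tau>..T}" for S t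
  proof -
    have S0: "S \<ge> 0" using S[OF t] l2sum_nonneg[of "\<lambda>k. u t k - v t k"] by (simp add: E_def)
    \<comment> \<open>The pointwise bound is available off the null set \<open>N\<close>; setting J
      to 0 there keeps the integral and extends the bound.\<close>
    define J' where "J' s = (if s \<in> N then 0 else J s)" for s
    have "(J' has_integral - (2 * \<nu> * integral {\<tau>..t} (\<lambda>s. hsum (2 * \<alpha>) (u s)))
     + (\<Sum>k\<in>L. ((norm (v t k))\<^sup>2 - (norm (v \<tau> k))\<^sup>2) - 2 * (u t k \<bullet> v t k - u \<tau> k \<bullet> v \<tau> k))) {\<tau>..t}"
      by (rule has_integral_spike[OF N(1) _ Jint[OF t]]) (simp add: J'_def)
    moreover have "((\<lambda>s. S * h s + 4 * l * P s) has_integral S * integral {\<tau>..t} h + 4 * l * integral {\<tau>..t} P) {\<tau>..t}"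
      using t by (intro has_integral_add has_integral_mult_right integrable_integral integrable_continuous_real
          continuous_on_subset[OF hc] continuous_on_subset[OF Pc]) auto
    ultimately have le: "- (2 * \<nu> * integral {\<tau>..t} (\<lambda>s. hsum (2 * \<alpha>) (u s)))
     + (\<Sum>k\<in>L. ((norm (v t k))\<^sup>2 - (norm (v \<tau> k))\<^sup>2) - 2 * (u t k \<bullet> v t k - u \<tau> k \<bullet> v \<tau> k)) \<le> S * integral {\<tau>..t} h + 4 * l * integral {\<tau>..t} P"
    proof (rule has_integral_le)
      fix s assume s: "s \<in> {\<tau>..t}"
      show "J' s \<le> S * h s + 4 * l * P s"
      proof (cases "s \<in> N")
        case True
        then show ?thesis using S0 h0 l by (simp add: J'_def)
      next
        case False
        have "J s \<le> h s * E s + 4 * l * P s" using s t False by (intro Jle) auto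
        also have "h s * E s \<le> h s * S" using s t by (intro mult_left_mono S h0) auto
        finally show ?thesis using False by (simp add: J'_def mult.commute)
      qed
    qed
    have "integral {\<tau>..t} h \<le> integral {\<tau>..T} h"
      using t by (intro integral_subset_le integrable_continuous_real continuous_on_subset[OF hc]) (auto simp: h0)
    also have "\<dots> = C / (2 * \<nu>) * integral {\<tau>..T} (\<lambda>s. hsum (4 * \<alpha>) (v s)) + 1 / 4"
    proof (rule integral_unique)
      have "((\<lambda>s. C / (2 * \<nu>) * hsum (4 * \<alpha>) (v s) + 1 / (4 * l)) has_integral
        C / (2 * \<nu>) * integral {\<tau>..T} (\<lambda>s. hsum (4 * \<alpha>) (v s)) + measure lborel {\<tau>..T} *\<^sub>R (1 / (4 * l))) {\<tau>..T}"
        by (intro has_integral_add has_integral_mult_right integrable_integral integrable_continuous_real h4c has_integral_const_real)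
      moreover have "measure lborel {\<tau>..T} = l" using T by (simp add: l_def)
      then have "measure lborel {\<tau>..T} *\<^sub>R (1 / (4 * l)) = 1 / 4" using l by simp
      ultimately show "(h has_integral C / (2 * \<nu>) * integral {\<tau>..T} (\<lambda>s. hsum (4 * \<alpha>) (v s)) + 1 / 4) {\<tau>..T}"
        unfolding h_def by (simp only:)
    qed
    also have "\<dots> \<le> C / (2 * \<nu>) * (2 * e / \<nu>) + 1 / 4"
      using C(1) \<nu> by (intro add_right_mono mult_left_mono v4) auto
    also have "\<dots> = (16 * C * e) / (16 * \<nu>\<^sup>2) + 1 / 4" by (simp add: power2_eq_square)
    also have "\<dots> \<le> \<nu>\<^sup>2 / (16 * \<nu>\<^sup>2) + 1 / 4" using e \<nu> by (intro add_right_mono divide_right_mono) auto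
    also have "\<dots> \<le> 1 / 2" using \<nu> by simp
    finally have "S * integral {\<tau>..t} h \<le> S * (1 / 2)" using S0 by (rule mult_left_mono)
    moreover have "integral {\<tau>..t} P \<le> integral {\<tau>..T} P"
      using t by (intro integral_subset_le integrable_continuous_real continuous_on_subset[OF Pc]) (auto simp: h0)
    then have "4 * l * integral {\<tau>..t} P \<le> 4 * l * \<eta>" using \<rho> l unfolding P_def by (intro mult_left_mono) auto
    ultimately show ?thesis using le en[OF t] unfolding Et[OF t] Et[OF \<tau>T]
      by (simp add: sum_subtractf sum_distrib_left[symmetric] right_diff_distrib)
  qed
  \<comment> \<open>E must be bounded before S/2 can be subtracted: the energy inequality bounds u,
    and compactness of the time interval bounds the finitely many modes of v.\<close>
  obtain M where M: "\<And>s. s \<in> {\<tau>..T} \<Longrightarrow> E s \<le> M"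
  proof -
    have "continuous_on {\<tau>..T} (\<lambda>s. \<Sum>k\<in>L. (norm (v s k))\<^sup>2)" by (intro continuous_intros vc)
    then have "compact ((\<lambda>s. \<Sum>k\<in>L. (norm (v s k))\<^sup>2) ` {\<tau>..T})" by (intro compact_continuous_image) auto
    then have "bounded ((\<lambda>s. \<Sum>k\<in>L. (norm (v s k))\<^sup>2) ` {\<tau>..T})" by (rule compact_imp_bounded)
    then obtain V where V: "\<forall>x\<in>(\<lambda>s. \<Sum>k\<in>L. (norm (v s k))\<^sup>2) ` {\<tau>..T}. norm x \<le> V"
      unfolding bounded_iff by (rule exE)
    have "E s \<le> 2 * l2sum (u \<tau>) + 2 * V" if s: "s \<in> {\<tau>..T}" for s
    proof -
      have "(\<Sum>k\<in>L. (norm (v s k))\<^sup>2 - 2 * (u s k \<bullet> v s k)) \<le> (\<Sum>k\<in>L. 2 * (norm (v s k))\<^sup>2 + (norm (u s k))\<^sup>2)"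
      proof (rule sum_mono)
        fix k
        have "0 \<le> (norm (u s k + v s k))\<^sup>2" by simp
        also have "\<dots> = (norm (u s k))\<^sup>2 + (norm (v s k))\<^sup>2 + 2 * (u s k \<bullet> v s k)"
          by (simp add: power2_norm_eq_inner inner_add_left inner_add_right inner_commute)
        finally show "(norm (v s k))\<^sup>2 - 2 * (u s k \<bullet> v s k) \<le> 2 * (norm (v s k))\<^sup>2 + (norm (u s k))\<^sup>2" by simp
      qed
      also have "\<dots> = 2 * (\<Sum>k\<in>L. (norm (v s k))\<^sup>2) + (\<Sum>k\<in>L. (norm (u s k))\<^sup>2)" by (simp add: sum.distrib sum_distrib_left)
      also have "\<dots> \<le> 2 * V + l2sum (u s)"
      proof -
        have "(\<Sum>k\<in>L. (norm (v s k))\<^sup>2) \<le> V" using V[THEN bspec, OF imageI[OF s]] unfolding real_norm_def by linarith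
        moreover have "(\<Sum>k\<in>L. (norm (u s k))\<^sup>2) \<le> l2sum (u s)"
          by (rule sum_le_l2sum[OF us[OF s, THEN conjunct1] L])
        ultimately show ?thesis by linarith
      qed
      finally have "E s \<le> 2 * V + 2 * l2sum (u s)" unfolding Et[OF s] by simp
      moreover have "0 \<le> integral {\<tau>..s} (\<lambda>s. hsum (2 * \<alpha>) (u s))"
        using s by (intro integral_nonneg integrable_on_subinterval[OF Di]) (auto simp: hsum_nonneg)
      then have "0 \<le> 2 * \<nu> * integral {\<tau>..s} (\<lambda>s. hsum (2 * \<alpha>) (u s))" using \<nu> by simp
      ultimately show ?thesis using en[OF s] by linarith
    qed
    then show thesis by (rule that)
  qed
  define S where "S = Sup (E ` {\<tau>..T})"
  have bdd: "bdd_above (E ` {\<tau>..T})" by (rule bdd_aboveI2[OF M])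
  have S: "E s \<le> S" if "s \<in> {\<tau>..T}" for s unfolding S_def by (rule cSUP_upper[OF that bdd])
  have "S \<le> E \<tau> + (S / 2 + 4 * l * \<eta>)"
    unfolding S_def
  proof (rule cSUP_least)
    show "{\<tau>..T} \<noteq> {}" using \<tau>T by blast
    show "E s \<le> E \<tau> + (Sup (E ` {\<tau>..T}) / 2 + 4 * l * \<eta>)" if "s \<in> {\<tau>..T}" for s
      using main[OF S that] unfolding S_def .
  qed
  then have "S \<le> 2 * E \<tau> + 8 * l * \<eta>" by simp
  with S[OF t] show ?thesis by (simp add: E_def l_def)
qed

lemma uminus_modes: "- k \<in> modes n \<longleftrightarrow> k \<in> modes n"
  by (simp add: modes_def)

text \<open>Approximations with data cut off to cubes and residual 1/(n+1) converge to u in every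
  mode, uniformly in time. Their bounds do not depend on n and are read on finitely many modes, so
  they pass to the limit.\<close>

lemma mode_regularity:
  assumes C: "C > 0" "trilinear_bounded (\<lambda>p q. p \<noteq> 0 \<and> q \<noteq> 0) \<alpha> (2 * \<alpha> - 1) C"
    and \<nu>: "\<nu> > 0" and T: "\<tau> < T" and e: "e > 0" "16 * C * e \<le> \<nu>\<^sup>2" and u: "mode_solution \<nu> \<alpha> \<tau> T u"
    and init: "hs (2 * \<alpha>) (u \<tau>)" "hsum (2 * \<alpha>) (u \<tau>) \<le> e" and F: "finite F"
  shows "t \<in> {\<tau>..T} \<Longrightarrow> (\<Sum>k\<in>F. norm (freq k) powr (2 * \<alpha>) * (norm (u t k))\<^sup>2) \<le> 2 * e"
    and "integral {\<tau>..T} (\<lambda>t. \<Sum>k\<in>F. norm (freq k) powr (4 * \<alpha>) * (norm (u t k))\<^sup>2) \<le> 2 * e / \<nu>"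
proof -
  have us: "l2 (u t)" "solenoidal (u t)" "real_seq (u t)" if "t \<in> {\<tau>..T}" for t
    using u[unfolded mode_solution_def, THEN conjunct1, THEN bspec, OF that] by auto
  have \<tau>T: "\<tau> \<in> {\<tau>..T}" using T by simp
  note u\<tau> = us[OF \<tau>T]
  define y where "y n k = (if k \<in> modes n then u \<tau> k else 0)" for n k
  have y: "supp_in (modes n) (y n)" "solenoidal (y n)" "real_seq (y n)" for n
    using u\<tau>(2,3) by (auto simp: y_def supp_in_def solenoidal_def real_seq_def uminus_modes)
  have ye: "hsum (2 * \<alpha>) (y n) \<le> e" for n
  proof -
    have "hsum (2 * \<alpha>) (y n) = (\<Sum>k\<in>modes n. norm (freq k) powr (2 * \<alpha>) * (norm (u \<tau> k))\<^sup>2)"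
      unfolding hsum_supp[OF finite_modes y(1)] by (intro sum.cong) (simp_all add: y_def)
    also have "\<dots> \<le> hsum (2 * \<alpha>) (u \<tau>)" by (rule sum_le_hsum[OF init(1) finite_modes])
    finally show ?thesis using init(2) by simp
  qed
  \<comment> \<open>The comparison bound at stage n: twice the tail of the data, and the
    contribution of the residual.\<close>
  define d where "d n = 2 * (l2sum (u \<tau>) - (\<Sum>k\<in>modes n. (norm (u \<tau> k))\<^sup>2)) + 8 * (T - \<tau>) * inverse (real (Suc n))" for n
  have d0: "d \<longlonglongrightarrow> 0"
  proof -
    have "(\<lambda>n. \<Sum>k\<in>modes n. (norm (u \<tau> k))\<^sup>2) \<longlonglongrightarrow> l2sum (u \<tau>)"
      unfolding l2sum_def using u\<tau>(1) by (intro tendsto_sum_modes has_sum_infsum) (simp add: l2_def)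
    then have "(\<lambda>n. 2 * (l2sum (u \<tau>) - (\<Sum>k\<in>modes n. (norm (u \<tau> k))\<^sup>2)) + 8 * (T - \<tau>) * inverse (real (Suc n)))
       \<longlonglongrightarrow> 2 * (l2sum (u \<tau>) - l2sum (u \<tau>)) + 8 * (T - \<tau>) * 0"
      by (intro tendsto_intros LIMSEQ_inverse_real_of_nat)
    then show ?thesis by (simp add: d_def[abs_def])
  qed
  define P where "P n v \<longleftrightarrow> (\<forall>k. continuous_on {\<tau>..T} (\<lambda>t. v t k)) \<and>
     (\<forall>t\<in>{\<tau>..T}. \<forall>F. finite F \<longrightarrow> (\<Sum>k\<in>F. norm (freq k) powr (2 * \<alpha>) * (norm (v t k))\<^sup>2) \<le> 2 * e) \<and>
     integral {\<tau>..T} (\<lambda>t. \<Sum>k\<in>F. norm (freq k) powr (4 * \<alpha>) * (norm (v t k))\<^sup>2) \<le> 2 * e / \<nu> \<and>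
     (\<forall>t\<in>{\<tau>..T}. \<forall>k. (norm (u t k - v t k))\<^sup>2 \<le> d n)" for n and v :: "real \<Rightarrow> int^3 \<Rightarrow> complex^3"
  have "\<exists>v. P n v" for n
  proof -
    have ip: "inverse (real (Suc n)) > 0" by simp
    obtain v g L where v: "heat_sol \<nu> \<alpha> \<tau> T L v g" "admissible \<tau> T L v" "v \<tau> = y n"
      "\<And>t. t \<in> {\<tau>..T} \<Longrightarrow> supp_in L (adv (v t) (v t))"
      "\<And>t. t \<in> {\<tau>..T} \<Longrightarrow> hsum (2 * \<alpha>) (v t) \<le> 2 * e"
      "integral {\<tau>..T} (\<lambda>t. hsum (4 * \<alpha>) (v t)) \<le> 2 * e / \<nu>"
      "integral {\<tau>..T} (\<lambda>t. \<Sum>k\<in>L. (norm (g t k - forcing v t k))\<^sup>2) \<le> inverse (real (Suc n))"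
      by (rule approximate_solution[OF C \<nu> less_imp_le[OF T] finite_modes y(1)[of n] y(2)[of n] y(3)[of n] e(1) ye[of n] e(2) ip]) (rule that)
    have vL: "finite L" "\<And>k. continuous_on {\<tau>..T} (\<lambda>t. v t k)" and vs: "\<And>t. t \<in> {\<tau>..T} \<Longrightarrow> supp_in L (v t)"
      using v(2) by (auto simp: admissible_def)
    have s2: "(\<Sum>k\<in>F. norm (freq k) powr (2 * \<alpha>) * (norm (v t k))\<^sup>2) \<le> 2 * e" if "t \<in> {\<tau>..T}" "finite F" for t F
      by (rule order_trans[OF sum_le_hsum[OF supp_in_hs[OF vL(1) vs[OF that(1)]] that(2)] v(5)[OF that(1)]])
    have "integral {\<tau>..T} (\<lambda>t. \<Sum>k\<in>F. norm (freq k) powr (4 * \<alpha>) * (norm (v t k))\<^sup>2) \<le> integral {\<tau>..T} (\<lambda>t. hsum (4 * \<alpha>) (v t))"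
    proof (rule integral_le)
      show "(\<lambda>t. \<Sum>k\<in>F. norm (freq k) powr (4 * \<alpha>) * (norm (v t k))\<^sup>2) integrable_on {\<tau>..T}"
        by (intro integrable_continuous_real continuous_intros vL)
      show "(\<lambda>t. hsum (4 * \<alpha>) (v t)) integrable_on {\<tau>..T}"
        by (intro integrable_continuous_real continuous_on_hsum[OF vL(1) vs] vL)
      show "(\<Sum>k\<in>F. norm (freq k) powr (4 * \<alpha>) * (norm (v t k))\<^sup>2) \<le> hsum (4 * \<alpha>) (v t)" if "t \<in> {\<tau>..T}" for t
        by (rule sum_le_hsum[OF supp_in_hs[OF vL(1) vs[OF that]] F])
    qed
    then have s4: "integral {\<tau>..T} (\<lambda>t. \<Sum>k\<in>F. norm (freq k) powr (4 * \<alpha>) * (norm (v t k))\<^sup>2) \<le> 2 * e / \<nu>"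
      using v(6) by linarith
    have "l2sum (\<lambda>k. u \<tau> k - y n k) = l2sum (u \<tau>) + (\<Sum>k\<in>modes n. (norm (y n k))\<^sup>2 - 2 * (u \<tau> k \<bullet> y n k))"
      by (rule l2sum_diff_supp[OF u\<tau>(1) finite_modes y(1)])
    also have "(\<Sum>k\<in>modes n. (norm (y n k))\<^sup>2 - 2 * (u \<tau> k \<bullet> y n k)) = - (\<Sum>k\<in>modes n. (norm (u \<tau> k))\<^sup>2)"
      unfolding sum_negf[symmetric] by (intro sum.cong) (simp_all add: y_def power2_norm_eq_inner)
    finally have ly: "l2sum (\<lambda>k. u \<tau> k - y n k) = l2sum (u \<tau>) - (\<Sum>k\<in>modes n. (norm (u \<tau> k))\<^sup>2)" by simp
    have df: "(norm (u t k - v t k))\<^sup>2 \<le> d n" if t: "t \<in> {\<tau>..T}" for t k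
    proof -
      have "(\<Sum>k\<in>{k}. (norm (u t k - v t k))\<^sup>2) \<le> l2sum (\<lambda>k. u t k - v t k)"
        by (rule sum_le_l2sum[OF l2_diff[OF us(1)[OF t] supp_in_l2[OF vL(1) vs[OF t]]]]) simp
      also have "\<dots> \<le> 2 * l2sum (\<lambda>k. u \<tau> k - v \<tau> k) + 8 * (T - \<tau>) * inverse (real (Suc n))"
        by (rule comparison[OF C \<nu> T e(2) u v(1,2,4,6,7) t])
      finally show ?thesis by (simp add: v(3) ly d_def)
    qed
    have "P n v" unfolding P_def by (intro conjI allI ballI impI) (rule vL(2) s2 s4 df; assumption)+
    then show ?thesis by (rule exI[of "P n" v])
  qed
  then have "\<forall>n. \<exists>v. P n v" by (rule allI)
  from choice[OF this] obtain v where "\<forall>n. P n (v n)" by (rule exE)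
  then have Pv: "P n (v n)" for n by (rule spec)
  have vc: "continuous_on {\<tau>..T} (\<lambda>t. v n t k)" for n k
    by (rule Pv[of n, unfolded P_def, THEN conjunct1, THEN spec])
  have v2: "(\<Sum>k\<in>F. norm (freq k) powr (2 * \<alpha>) * (norm (v n t k))\<^sup>2) \<le> 2 * e" if "t \<in> {\<tau>..T}" "finite F" for n t F
    by (rule Pv[of n, unfolded P_def, THEN conjunct2, THEN conjunct1, THEN bspec, OF that(1), THEN spec, THEN mp, OF that(2)])
  have v4: "integral {\<tau>..T} (\<lambda>t. \<Sum>k\<in>F. norm (freq k) powr (4 * \<alpha>) * (norm (v n t k))\<^sup>2) \<le> 2 * e / \<nu>" for n
    by (rule Pv[of n, unfolded P_def, THEN conjunct2, THEN conjunct2, THEN conjunct1])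
  have vd: "(norm (u t k - v n t k))\<^sup>2 \<le> d n" if "t \<in> {\<tau>..T}" for n t k
    by (rule Pv[of n, unfolded P_def, THEN conjunct2, THEN conjunct2, THEN conjunct2, THEN bspec, OF that, THEN spec])
  have vu: "(\<lambda>n. v n t k) \<longlonglongrightarrow> u t k" if t: "t \<in> {\<tau>..T}" for t k
  proof -
    have "norm (v n t k - u t k) \<le> sqrt (d n)" for n
    proof -
      have "norm (u t k - v n t k) \<le> sqrt (d n)" by (rule real_le_rsqrt[OF vd[OF t]])
      then show ?thesis by (subst norm_minus_commute)
    qed
    moreover have "(\<lambda>n. sqrt (d n)) \<longlonglongrightarrow> 0" using tendsto_real_sqrt[OF d0] by simp
    ultimately have "(\<lambda>n. v n t k - u t k) \<longlonglongrightarrow> 0"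
      by (rule Lim_null_comparison[OF always_eventually[OF allI]])
    then show ?thesis by (rule LIM_zero_cancel)
  qed
  show "(\<Sum>k\<in>F. norm (freq k) powr (2 * \<alpha>) * (norm (u t k))\<^sup>2) \<le> 2 * e" if t: "t \<in> {\<tau>..T}"
  proof (rule LIMSEQ_le_const2)
    show "(\<lambda>n. \<Sum>k\<in>F. norm (freq k) powr (2 * \<alpha>) * (norm (v n t k))\<^sup>2) \<longlonglongrightarrow> (\<Sum>k\<in>F. norm (freq k) powr (2 * \<alpha>) * (norm (u t k))\<^sup>2)"
      by (intro tendsto_intros vu t)
    have "(\<Sum>k\<in>F. norm (freq k) powr (2 * \<alpha>) * (norm (v n t k))\<^sup>2) \<le> 2 * e" for n
      by (rule v2[OF t F])
    then show "\<exists>N. \<forall>n\<ge>N. (\<Sum>k\<in>F. norm (freq k) powr (2 * \<alpha>) * (norm (v n t k))\<^sup>2) \<le> 2 * e" by blast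
  qed
  \<comment> \<open>A constant majorant for dominated convergence: 4\<alpha> = 2\<alpha> +
    2\<alpha>, and one of the two weights is absorbed by the H^\<alpha> bound for a single
    mode.\<close>
  define B where "B = (\<Sum>k\<in>F. norm (freq k) powr (2 * \<alpha>) * (2 * e))"
  have "(\<lambda>n. integral {\<tau>..T} (\<lambda>t. \<Sum>k\<in>F. norm (freq k) powr (4 * \<alpha>) * (norm (v n t k))\<^sup>2))
    \<longlonglongrightarrow> integral {\<tau>..T} (\<lambda>t. \<Sum>k\<in>F. norm (freq k) powr (4 * \<alpha>) * (norm (u t k))\<^sup>2)"
  proof (rule dominated_convergence(2)[where h="\<lambda>_. B"])
    show "(\<lambda>t. \<Sum>k\<in>F. norm (freq k) powr (4 * \<alpha>) * (norm (v n t k))\<^sup>2) integrable_on {\<tau>..T}" for n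
      by (intro integrable_continuous_real continuous_intros vc)
    show "norm (\<Sum>k\<in>F. norm (freq k) powr (4 * \<alpha>) * (norm (v n t k))\<^sup>2) \<le> B" if t: "t \<in> {\<tau>..T}" for n t
    proof -
      have "norm (freq k) powr (4 * \<alpha>) * (norm (v n t k))\<^sup>2 \<le> norm (freq k) powr (2 * \<alpha>) * (2 * e)" for k
      proof -
        have "(\<Sum>k\<in>{k}. norm (freq k) powr (2 * \<alpha>) * (norm (v n t k))\<^sup>2) \<le> 2 * e"
          by (rule v2[OF t]) simp
        then have "norm (freq k) powr (2 * \<alpha>) * (norm (freq k) powr (2 * \<alpha>) * (norm (v n t k))\<^sup>2) \<le> norm (freq k) powr (2 * \<alpha>) * (2 * e)"
          by (intro mult_left_mono) auto
        then show ?thesis by (simp add: mult.assoc[symmetric] powr_add[symmetric])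
      qed
      then show ?thesis unfolding B_def by (subst real_norm_def, subst abs_of_nonneg) (auto intro!: sum_nonneg sum_mono)
    qed
    show "(\<lambda>n. \<Sum>k\<in>F. norm (freq k) powr (4 * \<alpha>) * (norm (v n t k))\<^sup>2) \<longlonglongrightarrow> (\<Sum>k\<in>F. norm (freq k) powr (4 * \<alpha>) * (norm (u t k))\<^sup>2)"
      if "t \<in> {\<tau>..T}" for t by (intro tendsto_intros vu that)
  qed auto
  then show "integral {\<tau>..T} (\<lambda>t. \<Sum>k\<in>F. norm (freq k) powr (4 * \<alpha>) * (norm (u t k))\<^sup>2) \<le> 2 * e / \<nu>"
    by (rule LIMSEQ_le_const2) (intro exI[of _ 0] allI impI v4)
qed

section \<open>Test functions in time\<close>

text \<open>Spares the computation of higher derivatives: it is enough to exhibit a family closed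
  under directional differentiation.\<close>

lemma Ck_closed_class:
  assumes d: "\<And>f x. f \<in> S \<Longrightarrow> f differentiable at x"
    and c: "\<And>f b. f \<in> S \<Longrightarrow> b \<in> Basis \<Longrightarrow> (\<lambda>x. frechet_derivative f (at x) b) \<in> S"
  shows "f \<in> S \<Longrightarrow> Ck n f"
proof (induction n arbitrary: f)
  case 0
  then show ?case using d by (auto intro!: differentiable_imp_continuous_on simp: differentiable_on_def differentiable_at_withinI)
next
  case (Suc n)
  then show ?case using d c by simp
qed

lemma smooth_closed_class:
  assumes "f \<in> S" "\<And>f x. f \<in> S \<Longrightarrow> f differentiable at x"
    "\<And>f b. f \<in> S \<Longrightarrow> b \<in> Basis \<Longrightarrow> (\<lambda>x. frechet_derivative f (at x) b) \<in> S"
  shows "smooth f"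
  unfolding smooth_def using Ck_closed_class[of S f] assms by blast

text \<open>The polynomial factor and the power make the family closed under differentiation.\<close>

definition bump :: "real \<Rightarrow> real \<Rightarrow> real poly \<Rightarrow> nat \<Rightarrow> real \<Rightarrow> real" where
  "bump a b P m t = (if a < t \<and> t < b then poly P t / ((t - a) * (b - t)) ^ m * exp (- 1 / ((t - a) * (b - t))) else 0)"

text \<open>From (1 + x/n)^n \<le> exp x with x = 1/q and n = m + 2. The two powers beyond m make
  the bump vanish quadratically at its ends.\<close>

lemma exp_inverse_le:
  fixes q :: real
  assumes "q > 0"
  shows "exp (- 1 / q) / q ^ m \<le> real (m + 2) ^ (m + 2) * q\<^sup>2"
proof -
  let ?n = "m + 2"
  have "(1 / (q * real ?n)) ^ ?n \<le> (1 + (1 / q) / real ?n) ^ ?n"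
    using assms by (intro power_mono) auto
  also have "\<dots> \<le> exp (1 / q)"
    by (rule exp_ge_one_plus_x_over_n_power_n) (use assms in \<open>auto intro: order_trans[of _ 0]\<close>)
  finally have "1 / (q * real ?n) ^ ?n \<le> exp (1 / q)" by (simp add: power_divide)
  then have "1 \<le> exp (1 / q) * (q * real ?n) ^ ?n" using assms by (simp add: pos_divide_le_eq)
  then have "exp (- 1 / q) * 1 \<le> exp (- 1 / q) * (exp (1 / q) * (q * real ?n) ^ ?n)"
    by (intro mult_left_mono) auto
  also have "\<dots> = (q * real ?n) ^ ?n" by (simp add: mult.assoc[symmetric] exp_add[symmetric])
  finally have "exp (- 1 / q) / q ^ m \<le> (q * real ?n) ^ ?n / q ^ m"
    using assms by (intro divide_right_mono) auto
  also have "\<dots> = real ?n ^ ?n * q\<^sup>2"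
    using assms by (simp only: power_mult_distrib power_add) simp
  finally show ?thesis .
qed

lemma bump_deriv:
  assumes "a < b"
  shows "\<exists>P' m'. \<forall>t. (bump a b P m has_real_derivative bump a b P' m' t) (at t)"
proof -
  define Q where "Q = [:-a, 1:] * [:b, -1:]"
  have Q: "poly Q t = (t - a) * (b - t)" for t by (simp add: Q_def algebra_simps)
  \<comment> \<open>Numerator of the derivative of P Q^(-m) exp(-1/Q) over the common denominator
    Q^(m+2).\<close>
  define P' where "P' = pderiv P * Q ^ 2 - smult (real m) (P * pderiv Q * Q) + P * pderiv Q"
  have "(bump a b P m has_real_derivative bump a b P' (m + 2) t) (at t)" for t
  proof (cases "a < t \<and> t < b")
    case True
    let ?q = "poly Q t"
    have q: "?q > 0" using True by (simp add: Q)
    have "((\<lambda>t. poly P t * inverse (poly Q t ^ m) * exp (- inverse (poly Q t))) has_real_derivative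
       (poly (pderiv P) t * inverse (?q ^ m) + poly P t * (- (inverse (?q ^ m) * (real m * (poly (pderiv Q) t * ?q ^ (m - 1))) * inverse (?q ^ m)))) * exp (- inverse ?q)
       + poly P t * inverse (?q ^ m) * (exp (- inverse ?q) * (inverse ?q * poly (pderiv Q) t * inverse ?q))) (at t)"
      using q by (auto intro!: derivative_eq_intros poly_DERIV simp: algebra_simps)
    also have "(poly (pderiv P) t * inverse (?q ^ m) + poly P t * (- (inverse (?q ^ m) * (real m * (poly (pderiv Q) t * ?q ^ (m - 1))) * inverse (?q ^ m)))) * exp (- inverse ?q)
       + poly P t * inverse (?q ^ m) * (exp (- inverse ?q) * (inverse ?q * poly (pderiv Q) t * inverse ?q))
       = bump a b P' (m + 2) t"
    proof -
      have m: "real m * ?q ^ (m - 1) = real m * ?q ^ m / ?q" using q by (cases m) auto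
      have "inverse (?q ^ m) * (real m * (poly (pderiv Q) t * ?q ^ (m - 1))) * inverse (?q ^ m)
         = inverse (?q ^ m) * poly (pderiv Q) t * (real m * ?q ^ (m - 1)) * inverse (?q ^ m)" by (simp only: mult_ac)
      also have "\<dots> = real m * poly (pderiv Q) t * ?q / (?q ^ m * ?q\<^sup>2)"
        unfolding m using q by (simp add: field_simps power2_eq_square)
      finally have 1: "inverse (?q ^ m) * (real m * (poly (pderiv Q) t * ?q ^ (m - 1))) * inverse (?q ^ m) = real m * poly (pderiv Q) t * ?q / (?q ^ m * ?q\<^sup>2)" .
      have 2: "bump a b P' (m + 2) t = poly P' t / (?q ^ m * ?q\<^sup>2) * exp (- inverse ?q)"
        using True by (simp add: bump_def Q power_add inverse_eq_divide power2_eq_square)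
      have 3: "poly P' t = poly (pderiv P) t * ?q\<^sup>2 - real m * (poly P t * poly (pderiv Q) t * ?q) + poly P t * poly (pderiv Q) t"
        by (simp add: P'_def)
      show ?thesis unfolding 1 2 3 using q by (simp add: field_simps power2_eq_square)
    qed
    finally have D: "((\<lambda>t. poly P t * inverse (poly Q t ^ m) * exp (- inverse (poly Q t))) has_real_derivative bump a b P' (m + 2) t) (at t)" .
    show ?thesis
    proof (rule has_field_derivative_transform_within_open[OF D])
      show "open {a<..<b}" "t \<in> {a<..<b}" using True by auto
      show "poly P s * inverse (poly Q s ^ m) * exp (- inverse (poly Q s)) = bump a b P m s" if "s \<in> {a<..<b}" for s
        using that by (simp add: bump_def Q divide_inverse)
    qed
  next
    case False
    obtain M where M: "\<And>s. s \<in> {a..b} \<Longrightarrow> \<bar>poly P s\<bar> \<le> M"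
    proof -
      have "bounded (poly P ` {a..b})" by (intro compact_imp_bounded compact_continuous_image continuous_intros) auto
      then obtain M where "\<forall>x\<in>poly P ` {a..b}. norm x \<le> M" unfolding bounded_iff by (rule exE)
      then show thesis using that[of M] by auto
    qed
    have M0: "M \<ge> 0" using M[of a] assms by force
    define K where "K = M * (real (m + 2) ^ (m + 2) * (b - a)\<^sup>2)"
    \<comment> \<open>At a point outside the open interval the function and its claimed derivative
      are both 0, so a quadratic bound around that point suffices.\<close>
    have le: "\<bar>bump a b P m y\<bar> \<le> K * (y - t)\<^sup>2" for y
    proof (cases "a < y \<and> y < b")
      case True
      let ?q = "(y - a) * (b - y)"
      have q: "?q > 0" using True by simp
      have "?q \<le> (b - a) * \<bar>y - t\<bar>"
      proof (cases "t \<le> a")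
        case True
        then have "(b - y) * (y - a) \<le> (b - a) * \<bar>y - t\<bar>" using \<open>a < y \<and> y < b\<close> by (intro mult_mono) auto
        then show ?thesis by (simp add: mult.commute)
      next
        case False
        then show ?thesis using \<open>a < y \<and> y < b\<close> \<open>\<not> (a < t \<and> t < b)\<close> by (intro mult_mono) auto
      qed
      then have q2: "?q\<^sup>2 \<le> ((b - a) * \<bar>y - t\<bar>)\<^sup>2" using q by (intro power_mono) auto
      have "\<bar>bump a b P m y\<bar> = \<bar>poly P y\<bar> * (exp (- 1 / ?q) / ?q ^ m)"
        using True q by (simp add: bump_def abs_mult)
      also have "\<dots> \<le> M * (real (m + 2) ^ (m + 2) * ?q\<^sup>2)"
        using True q M M0 by (intro mult_mono exp_inverse_le) auto
      also have "\<dots> \<le> M * (real (m + 2) ^ (m + 2) * ((b - a) * \<bar>y - t\<bar>)\<^sup>2)"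
        using q2 M0 by (intro mult_left_mono) auto
      also have "\<dots> = K * (y - t)\<^sup>2" by (simp add: K_def power_mult_distrib)
      finally show ?thesis .
    next
      case False
      have "K \<ge> 0" using M0 by (simp add: K_def)
      then show ?thesis using False by (auto simp: bump_def)
    qed
    have z: "bump a b P m t = 0" "bump a b P' (m + 2) t = 0" using False by (auto simp: bump_def)
    show ?thesis unfolding has_field_derivative_iff z
    proof (rule Lim_null_comparison)
      show "\<forall>\<^sub>F y in at t. norm ((bump a b P m y - 0) / (y - t)) \<le> K * \<bar>y - t\<bar>"
        unfolding eventually_at_filter
      proof (intro always_eventually allI impI)
        fix y assume y: "y \<noteq> t"
        have "\<bar>bump a b P m y\<bar> \<le> K * \<bar>y - t\<bar> * \<bar>y - t\<bar>"
          using le[of y] by (simp add: power2_eq_square abs_mult_self_eq mult.assoc)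
        then show "norm ((bump a b P m y - 0) / (y - t)) \<le> K * \<bar>y - t\<bar>"
          using y by (simp add: abs_divide pos_divide_le_eq)
      qed
      have "((\<lambda>y. K * \<bar>y - t\<bar>) \<longlongrightarrow> K * \<bar>t - t\<bar>) (at t)" by (intro tendsto_intros)
      then show "((\<lambda>y. K * \<bar>y - t\<bar>) \<longlongrightarrow> 0) (at t)" by simp
    qed
  qed
  then show ?thesis by blast
qed

text \<open>A smooth, unnormalised switch: constant up to \<open>a\<close>, decreasing between
  \<open>a\<close> and \<open>b\<close>, and 0 after \<open>b\<close>. The lower limit a - 1 lies
  left of the support, so that at every t either the fundamental theorem applies at an interior
  point or the integral vanishes near t.\<close>

definition step :: "real \<Rightarrow> real \<Rightarrow> real \<Rightarrow> real" where
  "step a b t = integral {a - 1..b} (bump a b 1 0) - integral {a - 1..t} (bump a b 1 0)"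

lemma bump_continuous: "a < b \<Longrightarrow> continuous_on A (bump a b P m)"
  using bump_deriv[of a b P m] by (meson DERIV_isCont continuous_at_imp_continuous_on)

lemma step_deriv:
  assumes "a < b"
  shows "(step a b has_real_derivative bump a b (- 1) 0 t) (at t)"
proof -
  have neg: "bump a b (- 1) 0 t = - bump a b 1 0 t" by (simp add: bump_def)
  have "((\<lambda>t. integral {a - 1..t} (bump a b 1 0)) has_real_derivative bump a b 1 0 t) (at t)"
  proof (cases "t > a - 1")
    case True
    have "((\<lambda>t. integral {a - 1..t} (bump a b 1 0)) has_real_derivative bump a b 1 0 t) (at t within {a - 1..t + 1})"
      using True by (intro integral_has_real_derivative bump_continuous assms) auto
    moreover have "at t within {a - 1..t + 1} = at t" using True by (intro at_within_interior) (auto simp: interior_atLeastAtMost_real)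
    ultimately show ?thesis by simp
  next
    case False
    have z: "integral {a - 1..s} (bump a b 1 0) = 0" if "s < a" for s
      using that by (intro integral_unique has_integral_is_0) (auto simp: bump_def)
    have "((\<lambda>t. 0) has_real_derivative 0) (at t)" by simp
    then have "((\<lambda>t. integral {a - 1..t} (bump a b 1 0)) has_real_derivative 0) (at t)"
      by (rule has_field_derivative_transform_within_open[where S="{..<a}"]) (use False z in auto)
    moreover have "bump a b 1 0 t = 0" using False by (simp add: bump_def)
    ultimately show ?thesis by simp
  qed
  then have "(step a b has_real_derivative 0 - bump a b 1 0 t) (at t)"
    unfolding step_def[abs_def] by (intro derivative_intros) auto
  then show ?thesis by (simp add: neg)
qed

lemma step_after:
  assumes "a < b" "b \<le> t"
  shows "step a b t = 0"
proof -
  have i: "bump a b 1 0 integrable_on {a - 1..t}" by (intro integrable_continuous_real bump_continuous assms)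
  have "integral {a - 1..b} (bump a b 1 0) + integral {b..t} (bump a b 1 0) = integral {a - 1..t} (bump a b 1 0)"
    using assms by (intro Henstock_Kurzweil_Integration.integral_combine i) auto
  moreover have "integral {b..t} (bump a b 1 0) = 0" by (intro integral_unique has_integral_is_0) (auto simp: bump_def)
  ultimately show ?thesis by (simp add: step_def)
qed

text \<open>Du Bois-Reymond: smoothed step functions are enough for testing, since their derivatives have one
  sign and concentrate at a point.\<close>

lemma weak_derivative_integral:
  fixes U g :: "real \<Rightarrow> real"
  assumes U: "continuous_on {0..<T} U" and g: "\<And>b. b < T \<Longrightarrow> g \<in> borel_measurable (lebesgue_on {0..b})"
    "\<And>t. t \<in> {0..<T} \<Longrightarrow> norm (g t) \<le> B"
    and weak: "\<And>a b. 0 < a \<Longrightarrow> a < b \<Longrightarrow> b < T \<Longrightarrow>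
      integral {0..b} (\<lambda>t. bump a b (- 1) 0 t * U t + step a b t * g t) = - step a b 0 * U 0"
    and t: "t \<in> {0..<T}"
  shows "U t = U 0 + integral {0..t} g"
proof (cases "t = 0")
  case False
  define G where "G t = integral {0..t} g" for t
  define W where "W t = U t - G t - U 0" for t
  have gi: "g integrable_on {0..b}" if "b < T" for b
    using that g by (intro bounded_measurable_integrable_on[where B=B]) auto
  have Gc: "continuous_on {0..b} G" if "b < T" for b
    unfolding G_def by (intro indefinite_integral_continuous_1 gi that)
  have Wc: "continuous_on {0..b} W" if "b < T" for b
    unfolding W_def using that by (intro continuous_intros Gc continuous_on_subset[OF U]) auto
  \<comment> \<open>Integrating G by parts against the step removes \<open>g\<close> from the weak
    equation. The boundary term at 0 is accounted for by the constant U 0 in W, and W is left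
    orthogonal to every bump.\<close>
  have ortho: "integral {0..b} (\<lambda>t. bump a b (- 1) 0 t * W t) = 0" if ab: "0 < a" "a < b" "b < T" for a b
  proof -
    have "((\<lambda>s. g s \<bullet> step a b s + G s \<bullet> bump a b (- 1) 0 s) has_integral G b \<bullet> step a b b - G 0 \<bullet> step a b 0) {0..b}"
    proof (rule integration_by_parts_inner)
      show "g \<in> borel_measurable (lebesgue_on {0..b})" by (rule g(1)[OF ab(3)])
      show "norm (g t) \<le> B" if "t \<in> {0..b}" for t using that ab by (intro g(2)) auto
      show "G t = G 0 + integral {0..t} g" for t by (simp add: G_def)
      show "(step a b has_vector_derivative bump a b (- 1) 0 t) (at t within {0..b})" for t
        using step_deriv[OF ab(2), of t] by (simp add: has_real_derivative_iff_has_vector_derivative has_vector_derivative_at_within)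
    qed (use ab bump_continuous in auto)
    then have 1: "((\<lambda>s. g s * step a b s + G s * bump a b (- 1) 0 s) has_integral 0) {0..b}"
      using ab by (simp add: step_after) (simp add: G_def)
    have step_d: "((\<lambda>s. bump a b (- 1) 0 s) has_integral step a b b - step a b 0) {0..b}"
      using ab step_deriv[OF ab(2)]
      by (intro fundamental_theorem_of_calculus) (auto simp: has_real_derivative_iff_has_vector_derivative[symmetric] intro: has_field_derivative_at_within)
    have 2: "((\<lambda>s. bump a b (- 1) 0 s * U s) has_integral integral {0..b} (\<lambda>s. bump a b (- 1) 0 s * U s)) {0..b}"
      using ab by (intro integrable_integral integrable_continuous_real continuous_intros bump_continuous continuous_on_subset[OF U]) auto
    have 3: "((\<lambda>s. G s * bump a b (- 1) 0 s) has_integral integral {0..b} (\<lambda>s. G s * bump a b (- 1) 0 s)) {0..b}"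
      using ab by (intro integrable_integral integrable_continuous_real continuous_intros bump_continuous Gc) auto
    have 4: "((\<lambda>s. g s * step a b s) has_integral 0 - integral {0..b} (\<lambda>s. G s * bump a b (- 1) 0 s)) {0..b}"
      using has_integral_diff[OF 1 3] by simp
    have "integral {0..b} (\<lambda>s. bump a b (- 1) 0 s * U s) + (0 - integral {0..b} (\<lambda>s. G s * bump a b (- 1) 0 s)) = - step a b 0 * U 0"
      using integral_unique[OF has_integral_add[OF 2 4]] weak[OF ab] by (simp add: mult.commute)
    moreover have "((\<lambda>s. bump a b (- 1) 0 s * U s - G s * bump a b (- 1) 0 s - bump a b (- 1) 0 s * U 0) has_integral
      integral {0..b} (\<lambda>s. bump a b (- 1) 0 s * U s) - integral {0..b} (\<lambda>s. G s * bump a b (- 1) 0 s) - (step a b b - step a b 0) * U 0) {0..b}"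
      by (intro has_integral_diff 2 3 has_integral_mult_left step_d)
    ultimately have "((\<lambda>s. bump a b (- 1) 0 s * U s - G s * bump a b (- 1) 0 s - bump a b (- 1) 0 s * U 0) has_integral 0) {0..b}"
      using ab by (simp add: step_after)
    moreover have "(\<lambda>s. bump a b (- 1) 0 s * U s - G s * bump a b (- 1) 0 s - bump a b (- 1) 0 s * U 0) = (\<lambda>s. bump a b (- 1) 0 s * W s)"
      by (simp add: W_def fun_eq_iff algebra_simps)
    ultimately show ?thesis by (simp add: integral_unique)
  qed
  have "W t = 0"
  proof (rule ccontr)
    assume nz: "W t \<noteq> 0"
    have tT: "0 < t" "t < T" using t False by auto
    define b0 where "b0 = (t + T) / 2"
    have b0: "t < b0" "b0 < T" using tT by (auto simp: b0_def)
    have "continuous (at t) W"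
      using continuous_on_interior[OF Wc[OF b0(2)]] tT b0 by (simp add: interior_atLeastAtMost_real)
    then have "(W \<longlongrightarrow> W t) (at t)" by (simp add: isCont_def)
    then have "\<forall>\<^sub>F s in at t. \<bar>W s - W t\<bar> < \<bar>W t\<bar>"
      using nz tendstoD[of W "W t" "at t" "\<bar>W t\<bar>"] by (simp add: dist_real_def)
    then obtain \<delta> where \<delta>: "\<delta> > 0" "\<And>s. s \<noteq> t \<Longrightarrow> \<bar>s - t\<bar> < \<delta> \<Longrightarrow> \<bar>W s - W t\<bar> < \<bar>W t\<bar>"
      unfolding eventually_at by (auto simp: dist_real_def)
    have near: "W s * W t > 0" if "\<bar>s - t\<bar> < \<delta>" for s
    proof -
      have "\<bar>W s - W t\<bar> < \<bar>W t\<bar>" using \<delta>(2)[of s] that nz by (cases "s = t") auto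
      then show ?thesis using nz by (auto simp: zero_less_mult_iff abs_if split: if_splits)
    qed
    define h where "h = min (\<delta> / 2) (min (t / 2) ((T - t) / 2))"
    have h: "h > 0" "h < \<delta>" "h < t" "h < T - t" using \<delta>(1) tT by (auto simp: h_def min_less_iff_disj)
    let ?a = "t - h" and ?b = "t + h"
    have ab: "0 < ?a" "?a < ?b" "?b < T" using h by auto
    \<comment> \<open>The bump with polynomial -1 is negative and W keeps the sign of
      \<open>W t\<close> on its support, so this integrand is nonnegative; with integral 0 it would
      have to vanish at t.\<close>
    let ?f = "\<lambda>s. bump ?a ?b (- 1) 0 s * W s * (- W t)"
    have "integral {0..?b} ?f = 0" using ortho[OF ab] by simp
    moreover have fc: "continuous_on {0..?b} ?f"
      by (intro continuous_intros bump_continuous ab(2) Wc[OF ab(3)])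
    moreover have f0: "?f s \<ge> 0" for s
    proof (cases "?a < s \<and> s < ?b")
      case True
      then have "W s * W t > 0" using h by (intro near) auto
      then have "exp (- 1 / ((s - ?a) * (?b - s))) * (W s * W t) \<ge> 0" by simp
      then show ?thesis using True by (simp add: bump_def mult_ac)
    qed (auto simp: bump_def)
    ultimately have "\<forall>s\<in>{0..?b}. ?f s = 0" using integral_eq_0_iff[OF fc] ab f0 by auto
    then have "?f t = 0" using ab h by auto
    then show False using nz h by (simp add: bump_def)
  qed
  then show ?thesis by (simp add: W_def G_def)
qed simp

section \<open>Fourier coefficients of vector fields\<close>

text \<open>Rests on completeness of Lebesgue measure. It serves for quantities such as Sobolev
  norms, which are known to be limits of measurable partial sums only almost everywhere.\<close>

lemma AE_lebesgue_on_measurable: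
  fixes f g :: "'a::euclidean_space \<Rightarrow> 'b::euclidean_space"
  assumes f: "f \<in> borel_measurable (lebesgue_on S)" and S: "S \<in> sets lebesgue"
    and ae: "AE x in lebesgue_on S. f x = g x"
  shows "g \<in> borel_measurable (lebesgue_on S)"
proof -
  have "(\<lambda>x. if x \<in> S then f x else 0) \<in> borel_measurable lebesgue"
    using f borel_measurable_if[OF S, of f] by simp
  moreover have "AE x in lebesgue. (if x \<in> S then f x else 0) = (if x \<in> S then g x else 0)"
    using ae S by (subst (asm) AE_restrict_space_iff) (auto elim!: eventually_mono)
  ultimately have "(\<lambda>x. if x \<in> S then g x else 0) \<in> borel_measurable lebesgue"
    by (rule borel_measurable_AE)
  then show ?thesis using borel_measurable_if[OF S, of g] by simp
qed

definition comp :: "(real^3 \<Rightarrow> real^3) \<Rightarrow> 3 \<Rightarrow> real^3 \<Rightarrow> complex" where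
  "comp f i x = complex_of_real (f x $ i)"

lemma fourier_comp: "fourier f k $ i = cf (comp f i) k"
proof -
  have "exp (- \<i> * complex_of_real (freq k \<bullet> x)) = cnj (ef k x)" for x
    by (simp add: ef_def cis_cnj) (simp add: cis_conv_exp)
  then show ?thesis unfolding fourier_def cf_def comp_def by simp
qed

lemma measurable_comp: "f \<in> borel_measurable torus \<Longrightarrow> (\<lambda>x. f x $ i) \<in> borel_measurable torus"
  by (rule measurable_compose[where N=borel, of f torus "\<lambda>y. y $ i"])
     (auto intro!: borel_measurable_continuous_onI continuous_intros)

lemma sq_int_comp:
  assumes "torus_L2 f"
  shows "sq_int (comp f i)"
  unfolding sq_int_def comp_def
proof
  have m: "(\<lambda>x. f x $ i) \<in> borel_measurable torus" using assms by (intro measurable_comp) (simp add: torus_L2_def)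
  then show "(\<lambda>x. complex_of_real (f x $ i)) \<in> borel_measurable torus" by measurable
  show "integrable torus (\<lambda>x. (norm (complex_of_real (f x $ i)))\<^sup>2)"
  proof (rule Bochner_Integration.integrable_bound)
    show "integrable torus (\<lambda>x. (norm (f x))\<^sup>2)" using assms by (simp add: torus_L2_def)
    show "AE x in torus. norm ((norm (complex_of_real (f x $ i)))\<^sup>2) \<le> norm ((norm (f x))\<^sup>2)"
      using component_le_norm_cart by (auto intro!: AE_I2 power_mono simp: abs_le_square_iff[symmetric])
    show "(\<lambda>x. (norm (complex_of_real (f x $ i)))\<^sup>2) \<in> borel_measurable torus" using m by measurable
  qed
qed

lemma cf_real_uminus: "cf (\<lambda>x. complex_of_real (f x)) (- k) = cnj (cf (\<lambda>x. complex_of_real (f x)) k)"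
proof -
  have "(\<integral>x. complex_of_real (f x) * cnj (ef (- k) x) \<partial>torus) = (\<integral>x. cnj (complex_of_real (f x) * cnj (ef k x)) \<partial>torus)"
    by (simp add: cnj_ef)
  also have "\<dots> = cnj (\<integral>x. complex_of_real (f x) * cnj (ef k x) \<partial>torus)"
    by (rule Bochner_Integration.integral_cnj)
  finally show ?thesis by (simp add: cf_def)
qed

lemma real_seq_fourier: "real_seq (fourier f)"
  unfolding real_seq_def cnjv_def vec_eq_iff
  using cf_real_uminus by (simp add: fourier_comp comp_def[abs_def])

lemma torus_inner_has_sum:
  assumes f: "torus_L2 f" and g: "torus_L2 g"
  shows "((\<lambda>k. fourier f k \<bullet> fourier g k) has_sum torus_inner f g / (2 * pi) ^ 3) UNIV"
proof -
  have h: "((\<lambda>k. Re (cf (comp f i) k * cnj (cf (comp g i) k))) has_sum Re (ip (comp f i) (comp g i) / (2 * pi) ^ 3)) UNIV" for i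
    by (intro has_sum_Re parseval_ip sq_int_comp f g)
  have "((\<lambda>k. \<Sum>i\<in>UNIV. Re (cf (comp f i) k * cnj (cf (comp g i) k))) has_sum (\<Sum>i\<in>UNIV. Re (ip (comp f i) (comp g i) / (2 * pi) ^ 3))) UNIV"
    unfolding sum_3 by (intro has_sum_add h)
  moreover have "(\<Sum>i\<in>UNIV. Re (cf (comp f i) k * cnj (cf (comp g i) k))) = fourier f k \<bullet> fourier g k" for k
    by (simp add: inner_vec_def inner_complex_def fourier_comp)
  moreover have "(\<Sum>i\<in>UNIV. Re (ip (comp f i) (comp g i) / (2 * pi) ^ 3)) = torus_inner f g / (2 * pi) ^ 3"
  proof -
    have int: "integrable torus (\<lambda>x. f x $ i * g x $ i)" for i
      using integrable_Re[OF sq_int_mult_integrable[OF sq_int_comp[OF f] sq_int_comp[OF g], of i i]]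
      by (simp add: comp_def)
    have c: "ip (comp f i) (comp g i) = complex_of_real (\<integral>x. f x $ i * g x $ i \<partial>torus)" for i
      unfolding ip_def comp_def by (simp flip: of_real_mult)
    have "Re (complex_of_real r / (2 * complex_of_real pi) ^ 3) = r / (2 * pi) ^ 3" for r
      by (metis Re_complex_of_real of_real_divide of_real_mult of_real_numeral of_real_power)
    then have "(\<Sum>i\<in>UNIV. Re (ip (comp f i) (comp g i) / (2 * pi) ^ 3)) = (\<Sum>i\<in>UNIV. \<integral>x. f x $ i * g x $ i \<partial>torus) / (2 * pi) ^ 3"
      unfolding c sum_divide_distrib by simp
    also have "(\<Sum>i\<in>UNIV. \<integral>x. f x $ i * g x $ i \<partial>torus) = torus_inner f g"
      unfolding torus_inner_def inner_vec_def using int by (subst Bochner_Integration.integral_sum[symmetric]) auto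
    finally show ?thesis .
  qed
  ultimately show ?thesis by simp
qed

lemma L2_norm_torus_power2: "(L2_norm_torus f)\<^sup>2 = torus_inner f f"
  unfolding L2_norm_torus_def torus_inner_def power2_norm_eq_inner
  by (rule real_sqrt_pow2) (rule Bochner_Integration.integral_nonneg, simp)

lemma
  assumes f: "torus_L2 f"
  shows l2_fourier: "l2 (fourier f)" and l2sum_fourier: "(L2_norm_torus f)\<^sup>2 = (2 * pi) ^ 3 * l2sum (fourier f)"
proof -
  have h: "((\<lambda>k. (norm (fourier f k))\<^sup>2) has_sum (L2_norm_torus f)\<^sup>2 / (2 * pi) ^ 3) UNIV"
    using torus_inner_has_sum[OF f f] by (simp only: L2_norm_torus_power2 power2_norm_eq_inner)
  then show "l2 (fourier f)" unfolding l2_def by (rule has_sum_imp_summable)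
  have "l2sum (fourier f) = (L2_norm_torus f)\<^sup>2 / (2 * pi) ^ 3" unfolding l2sum_def by (rule infsumI[OF h])
  then show "(L2_norm_torus f)\<^sup>2 = (2 * pi) ^ 3 * l2sum (fourier f)" by simp
qed

lemma cf_cong_AE:
  assumes f: "f \<in> borel_measurable torus" and g: "g \<in> borel_measurable torus" and ae: "AE x in torus. f x = g x"
  shows "cf f k = cf g k"
proof -
  have "(\<integral>x. f x * cnj (ef k x) \<partial>torus) = (\<integral>x. g x * cnj (ef k x) \<partial>torus)"
  proof (rule integral_cong_AE)
    show "(\<lambda>x. f x * cnj (ef k x)) \<in> borel_measurable torus" unfolding cnj_ef using f by measurable
    show "(\<lambda>x. g x * cnj (ef k x)) \<in> borel_measurable torus" unfolding cnj_ef using g by measurable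
    show "AE x in torus. f x * cnj (ef k x) = g x * cnj (ef k x)" using ae by eventually_elim simp
  qed
  then show ?thesis by (simp add: cf_def)
qed

lemma fourier_cong_AE:
  assumes "torus_L2 f" "torus_L2 g" "AE x in torus. f x = g x"
  shows "fourier f = fourier g"
proof -
  have "cf (comp f i) k = cf (comp g i) k" for i k
    by (rule cf_cong_AE[OF sq_int_borel[OF sq_int_comp[OF assms(1)]] sq_int_borel[OF sq_int_comp[OF assms(2)]]])
       (use assms(3) in \<open>eventually_elim, simp add: comp_def\<close>)
  then show ?thesis by (simp add: fun_eq_iff vec_eq_iff fourier_comp)
qed

text \<open>Extends functions on the open cell periodically; the boundary of the cell is null.\<close>

definition fold_cell :: "real^3 \<Rightarrow> real^3" where
  "fold_cell x = (\<chi> i. x $ i - 2 * pi * of_int \<lfloor>x $ i / (2 * pi)\<rfloor>)"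

lemma fold_cell_periodic: "fold_cell (x + axis i (2 * pi)) = fold_cell x"
proof -
  have "\<lfloor>(x $ i + 2 * pi) / (2 * pi)\<rfloor> = \<lfloor>x $ i / (2 * pi)\<rfloor> + 1"
    by (simp add: add_divide_distrib)
  then show ?thesis by (auto simp: fold_cell_def vec_eq_iff axis_def algebra_simps)
qed

lemma fold_cell_box:
  assumes "x \<in> cbox 0 (\<chi> i. 2 * pi)"
  shows "x \<in> box 0 (\<chi> i. 2 * pi) \<Longrightarrow> fold_cell x = x"
    and "x \<notin> box 0 (\<chi> i. 2 * pi) \<Longrightarrow> fold_cell x \<notin> box 0 (\<chi> i. 2 * pi)"
proof -
  have b: "0 \<le> x $ i" "x $ i \<le> 2 * pi" for i using assms by (auto simp: mem_box_cart)
  have fl: "\<lfloor>x $ i / (2 * pi)\<rfloor> = 0" if "x $ i < 2 * pi" for i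
    using b[of i] that by (simp add: floor_eq_iff)
  show "fold_cell x = x" if "x \<in> box 0 (\<chi> i. 2 * pi)"
    using that fl by (simp add: fold_cell_def vec_eq_iff mem_box_cart)
  show "fold_cell x \<notin> box 0 (\<chi> i. 2 * pi)" if nb: "x \<notin> box 0 (\<chi> i. 2 * pi)"
  proof -
    obtain i where "\<not> (0 < x $ i \<and> x $ i < 2 * pi)" using nb by (auto simp: mem_box_cart)
    then have "x $ i = 0 \<or> x $ i = 2 * pi" using b[of i] by linarith
    then have "fold_cell x $ i = 0" by (auto simp: fold_cell_def)
    then show ?thesis by (auto simp: mem_box_cart intro!: exI[of _ i])
  qed
qed

text \<open>Riesz-Fischer in each component gives complex functions; the symmetry of
  \<open>a\<close> ensures that their real parts have the same coefficients. Folding the argument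
  into the cell makes the result periodic, with value 0 off the open cell, a null set.\<close>

lemma ex_fourier:
  assumes a: "l2 a" "real_seq a"
  shows "\<exists>g. torus_L2 g \<and> (\<forall>k. fourier g k = a k)"
proof -
  have "\<exists>h. sq_int h \<and> (\<forall>k. cf h k = a k $ i)" for i
  proof -
    have "(\<lambda>k. (norm (a k $ i))\<^sup>2) summable_on UNIV"
      using a(1) unfolding l2_def
      by (rule summable_on_comparison_test) (auto intro!: power_mono Finite_Cartesian_Product.norm_nth_le)
    then show ?thesis by (elim riesz_fischer) blast
  qed
  then obtain h where h: "\<And>i. sq_int (h i)" "\<And>i k. cf (h i) k = a k $ i" by metis
  let ?B = "box 0 (\<chi> i. 2 * pi) :: (real^3) set"
  define g where "g x = (\<chi> i. if fold_cell x \<in> ?B then Re (h i (fold_cell x)) else 0)" for x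
  have gx: "g x $ i = (if x \<in> ?B then Re (h i x) else 0)" if "x \<in> space torus" for x i
    using that fold_cell_box[of x] by (cases "x \<in> ?B") (auto simp: g_def space_torus)
  have hm: "(\<lambda>x. Re (h i x)) \<in> borel_measurable torus" for i using h(1)[of i] by measurable
  have Bm: "Measurable.pred torus (\<lambda>x. x \<in> ?B)"
  proof -
    have "?B \<inter> space torus \<in> sets torus" unfolding torus_def by (auto simp: sets_restrict_space)
    then show ?thesis by (simp add: pred_def Int_def conj_commute)
  qed
  have gm: "(\<lambda>x. g x $ i) \<in> borel_measurable torus" for i
    by (subst measurable_cong[OF gx]) (use hm[of i] Bm in \<open>auto intro!: measurable_If\<close>)
  have gv: "g \<in> borel_measurable torus"
  proof (subst borel_measurable_euclidean_space, rule ballI)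
    fix b :: "real^3" assume "b \<in> Basis"
    then obtain i where "b = axis i 1" by (auto simp: Basis_vec_def)
    then show "(\<lambda>x. g x \<bullet> b) \<in> borel_measurable torus" using gm[of i] by (simp add: inner_axis)
  qed
  have bound: "(norm (g x))\<^sup>2 \<le> (\<Sum>i\<in>UNIV. (norm (h i x))\<^sup>2)" if x: "x \<in> space torus" for x
  proof -
    have "(norm (g x))\<^sup>2 = (\<Sum>i\<in>UNIV. (g x $ i)\<^sup>2)"
      unfolding power2_norm_eq_inner inner_vec_def by (simp add: power2_eq_square)
    also have "\<dots> \<le> (\<Sum>i\<in>UNIV. (norm (h i x))\<^sup>2)"
      using gx[OF x] abs_Re_le_cmod by (intro sum_mono) (auto simp: abs_le_square_iff[symmetric])
    finally show ?thesis .
  qed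
  have gL2: "torus_L2 g"
    unfolding torus_L2_def
  proof (intro conjI gv)
    show "periodic g" unfolding periodic_def g_def fold_cell_periodic by simp
    show "integrable torus (\<lambda>x. (norm (g x))\<^sup>2)"
    proof (rule Bochner_Integration.integrable_bound)
      show "integrable torus (\<lambda>x. \<Sum>i\<in>UNIV. (norm (h i x))\<^sup>2)"
        by (intro Bochner_Integration.integrable_sum sq_int_integrable_power2 h)
      show "(\<lambda>x. (norm (g x))\<^sup>2) \<in> borel_measurable torus" using gv by measurable
      show "AE x in torus. norm ((norm (g x))\<^sup>2) \<le> norm (\<Sum>i\<in>UNIV. (norm (h i x))\<^sup>2)"
        using bound by (intro AE_I2) (simp add: sum_nonneg)
    qed
  qed
  have "fourier g k $ i = a k $ i" for k i
  proof -
    have sq: "sq_int (\<lambda>x. (1/2) * (h i x + cnj (h i x)))" by (intro sq_int_cmult sq_int_add sq_int_cnj h)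
    have ae: "AE x in torus. comp g i x = (1/2) * (h i x + cnj (h i x))"
      using AE_torus_box AE_space by eventually_elim (simp add: comp_def gx complex_add_cnj)
    have "cf (comp g i) k = cf (\<lambda>x. (1/2) * (h i x + cnj (h i x))) k"
      by (rule cf_cong_AE[OF sq_int_borel[OF sq_int_comp[OF gL2]] sq_int_borel[OF sq] ae])
    also have "\<dots> = (1/2) * (cf (h i) k + cf (\<lambda>x. cnj (h i x)) k)"
      by (simp only: cf_cmult cf_add[OF h(1) sq_int_cnj[OF h(1)]])
    also have "cf (\<lambda>x. cnj (h i x)) k = cnj (cf (h i) (- k))"
    proof -
      have "(\<integral>x. cnj (h i x) * cnj (ef k x) \<partial>torus) = (\<integral>x. cnj (h i x * cnj (ef (- k) x)) \<partial>torus)"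
        by (simp add: cnj_ef)
      also have "\<dots> = cnj (\<integral>x. h i x * cnj (ef (- k) x) \<partial>torus)" by (rule Bochner_Integration.integral_cnj)
      finally show ?thesis by (simp add: cf_def)
    qed
    also have "\<dots> = cnj (a (- k) $ i)" by (simp add: h)
    also have "\<dots> = a k $ i" using a(2) by (simp add: real_seq_def cnjv_def)
    finally show ?thesis by (simp add: fourier_comp h)
  qed
  then show ?thesis using gL2 by (auto simp: vec_eq_iff)
qed

section \<open>Sobolev norms and \<open>Lam\<close> on the coefficients\<close>

lemma powr_le_one_plus:
  assumes "\<alpha> > 0"
  shows "norm (freq k) powr (2 * \<alpha>) \<le> (1 + (norm (freq k))\<^sup>2) powr \<alpha>"
proof -
  have "norm (freq k) powr (2 * \<alpha>) = ((norm (freq k))\<^sup>2) powr \<alpha>"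
    by (cases "k = 0") (simp_all add: powr_powr flip: powr_numeral)
  also have "\<dots> \<le> (1 + (norm (freq k))\<^sup>2) powr \<alpha>" using assms by (intro powr_mono2) auto
  finally show ?thesis .
qed

lemma in_Hs_hs:
  assumes "in_Hs \<alpha> f" "\<alpha> > 0"
  shows "hs (2 * \<alpha>) (fourier f)" "hsum (2 * \<alpha>) (fourier f) \<le> (Hs_norm \<alpha> f)\<^sup>2"
proof -
  have s: "(\<lambda>k. (1 + (norm (freq k))\<^sup>2) powr \<alpha> * (norm (fourier f k))\<^sup>2) summable_on UNIV"
    using assms(1) by (simp add: in_Hs_def)
  have le: "norm (freq k) powr (2 * \<alpha>) * (norm (fourier f k))\<^sup>2 \<le> (1 + (norm (freq k))\<^sup>2) powr \<alpha> * (norm (fourier f k))\<^sup>2" for k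
    by (intro mult_right_mono powr_le_one_plus assms) simp
  show h: "hs (2 * \<alpha>) (fourier f)"
    unfolding hs_def by (rule summable_on_comparison_test[OF s le]) simp
  have "(Hs_norm \<alpha> f)\<^sup>2 = (\<Sum>\<^sub>\<infinity>k. (1 + (norm (freq k))\<^sup>2) powr \<alpha> * (norm (fourier f k))\<^sup>2)"
    unfolding Hs_norm_def by (rule real_sqrt_pow2) (rule infsum_nonneg, simp)
  then show "hsum (2 * \<alpha>) (fourier f) \<le> (Hs_norm \<alpha> f)\<^sup>2"
    unfolding hsum_def using h s le by (auto simp: hs_def intro!: infsum_mono)
qed

text \<open>The existence that gives the choice in \<open>Lam\<close> its meaning.\<close>

lemma Lam_spec:
  assumes "hs (2 * \<alpha>) (fourier f)"
  shows "torus_L2 (Lam \<alpha> f)" "fourier (Lam \<alpha> f) k = norm (freq k) powr \<alpha> *\<^sub>R fourier f k"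
proof -
  have sq: "(x powr \<alpha>)\<^sup>2 = x powr (2 * \<alpha>)" for x :: real
    by (simp add: power2_eq_square flip: powr_add)
  have "l2 (\<lambda>k. norm (freq k) powr \<alpha> *\<^sub>R fourier f k)"
    using assms by (simp add: l2_def hs_def power_mult_distrib sq)
  moreover have "real_seq (\<lambda>k. norm (freq k) powr \<alpha> *\<^sub>R fourier f k)"
    using real_seq_fourier[of f] by (simp add: real_seq_def cnjv_scaleR)
  ultimately have "\<exists>g. torus_L2 g \<and> (\<forall>k. fourier g k = norm (freq k) powr \<alpha> *\<^sub>R fourier f k)"
    by (rule ex_fourier)
  from someI_ex[OF this] show "torus_L2 (Lam \<alpha> f)" "fourier (Lam \<alpha> f) k = norm (freq k) powr \<alpha> *\<^sub>R fourier f k"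
    by (simp_all add: Lam_def)
qed

lemma L2_norm_Lam:
  assumes "hs (2 * \<alpha>) (fourier f)"
  shows "(L2_norm_torus (Lam \<alpha> f))\<^sup>2 = (2 * pi) ^ 3 * hsum (2 * \<alpha>) (fourier f)"
proof -
  have sq: "(x powr \<alpha>)\<^sup>2 = x powr (2 * \<alpha>)" for x :: real
    by (simp add: power2_eq_square flip: powr_add)
  have "l2sum (fourier (Lam \<alpha> f)) = hsum (2 * \<alpha>) (fourier f)"
    unfolding l2sum_def hsum_def Lam_spec(2)[OF assms] by (simp add: power_mult_distrib sq)
  then show ?thesis by (simp only: l2sum_fourier[OF Lam_spec(1)[OF assms]])
qed

lemma zero_average_fourier: "torus_L2 f \<Longrightarrow> zero_average f \<Longrightarrow> fourier f 0 = 0"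
proof -
  assume f: "torus_L2 f" and z: "zero_average f"
  have int: "integrable torus f"
  proof (rule Bochner_Integration.integrable_bound)
    show "integrable torus (\<lambda>x. 1 + (norm (f x))\<^sup>2)"
      using f torus.integrable_const[of "1::real"] by (auto simp: torus_L2_def)
    show "f \<in> borel_measurable torus" using f by (simp add: torus_L2_def)
    show "AE x in torus. norm (f x) \<le> norm (1 + (norm (f x))\<^sup>2)"
      using norm_le_power2_bound[of 1] by (intro AE_I2) simp
  qed
  have "(\<integral>x. f x $ i \<partial>torus) = 0" for i
  proof -
    have "(\<integral>x. f x $ i \<partial>torus) = (\<integral>x. f x \<partial>torus) $ i"
      by (rule integral_bounded_linear[OF bounded_linear_vec_nth int])
    then show ?thesis using z by (simp add: zero_average_def)
  qed
  then show ?thesis by (simp add: vec_eq_iff fourier_comp cf_def comp_def)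
qed

section \<open>Real fields of a single frequency\<close>

definition wave :: "int^3 \<Rightarrow> 'a::real_normed_vector \<Rightarrow> 'a \<Rightarrow> real^3 \<Rightarrow> 'a" where
  "wave k a b x = cos (freq k \<bullet> x) *\<^sub>R a + sin (freq k \<bullet> x) *\<^sub>R b"

lemma periodic_wave: "periodic (wave k a b)"
proof -
  have "cis (freq k \<bullet> (x + axis i (2 * pi))) = cis (freq k \<bullet> x)" for x i
  proof -
    have "freq k \<bullet> (x + axis i (2 * pi)) = freq k \<bullet> x + 2 * pi * of_int (k $ i)"
      by (simp add: inner_add_right inner_axis freq_def)
    then show ?thesis by (simp add: cis_multiple_2pi flip: cis_mult)
  qed
  then show ?thesis unfolding periodic_def wave_def by (simp add: complex_eq_iff)
qed

lemma wave_has_derivative: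
  "(wave k a b has_derivative (\<lambda>h. (freq k \<bullet> h) *\<^sub>R wave k b (- a) x)) (at x)"
proof -
  have c: "((\<lambda>x. cos (freq k \<bullet> x)) has_derivative (\<lambda>h. - ((freq k \<bullet> h) * sin (freq k \<bullet> x)))) (at x)"
    by (auto intro!: derivative_eq_intros)
  have s: "((\<lambda>x. sin (freq k \<bullet> x)) has_derivative (\<lambda>h. (freq k \<bullet> h) * cos (freq k \<bullet> x))) (at x)"
    by (auto intro!: derivative_eq_intros)
  have "(wave k a b has_derivative (\<lambda>h. (- ((freq k \<bullet> h) * sin (freq k \<bullet> x))) *\<^sub>R a + ((freq k \<bullet> h) * cos (freq k \<bullet> x)) *\<^sub>R b)) (at x)"
    unfolding wave_def[abs_def] by (intro has_derivative_add has_derivative_scaleR_left c s)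
  then show ?thesis by (simp add: wave_def scaleR_add_right scaleR_diff_right)
qed

lemma frechet_wave: "frechet_derivative (wave k a b) (at x) h = (freq k \<bullet> h) *\<^sub>R wave k b (- a) x"
  using frechet_derivative_at[OF wave_has_derivative[of k a b x]] by metis

lemma scaleR_wave: "c *\<^sub>R wave k a b x = wave k (c *\<^sub>R a) (c *\<^sub>R b) x"
  by (simp add: wave_def scaleR_add_right mult.commute)

text \<open>Differentiation sends the pair (a, b) to a multiple of (b, -a), so the waves of one
  frequency are closed under it.\<close>

lemma smooth_wave: "smooth (wave k a b)"
proof (rule smooth_closed_class[where S="{wave k a b |a b. True}"])
  fix f :: "real^3 \<Rightarrow> 'a" and x assume "f \<in> {wave k a b |a b. True}"
  then obtain a b where f: "f = wave k a b" by blast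
  show "f differentiable at x" unfolding f using wave_has_derivative by (rule differentiableI)
  show "(\<lambda>x. frechet_derivative f (at x) d) \<in> {wave k a b |a b. True}" for d
    unfolding f frechet_wave scaleR_wave by blast
qed blast

lemma continuous_wave: "continuous_on A (wave k a b)"
  unfolding wave_def[abs_def] by (intro continuous_intros)

lemma kdot_fourier:
  assumes "torus_L2 f"
  shows "kdot k (fourier f k) = complex_of_real (1 / (2 * pi) ^ 3) * (\<integral>x. complex_of_real (freq k \<bullet> f x) * cnj (ef k x) \<partial>torus)"
proof -
  have int: "integrable torus (\<lambda>x. of_int (k $ j) * (comp f j x * cnj (ef k x)))" for j
    by (intro integrable_mult_right ip_integrable sq_int_comp sq_int_ef assms)
  have "kdot k (fourier f k) = (\<Sum>j\<in>UNIV. complex_of_real (1 / (2 * pi) ^ 3) * (\<integral>x. of_int (k $ j) * (comp f j x * cnj (ef k x)) \<partial>torus))"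
    unfolding kdot_def fourier_comp cf_def
    by (rule sum.cong[OF refl], subst integral_mult_right_zero, rule mult.left_commute)
  also have "\<dots> = complex_of_real (1 / (2 * pi) ^ 3) * (\<integral>x. (\<Sum>j\<in>UNIV. of_int (k $ j) * (comp f j x * cnj (ef k x))) \<partial>torus)"
    by (subst Bochner_Integration.integral_sum) (auto simp: sum_distrib_left int)
  also have "(\<lambda>x. \<Sum>j\<in>UNIV. of_int (k $ j) * (comp f j x * cnj (ef k x))) = (\<lambda>x. complex_of_real (freq k \<bullet> f x) * cnj (ef k x))"
    by (simp add: fun_eq_iff comp_def freq_def inner_vec_def sum_distrib_right mult.assoc)
  finally show ?thesis .
qed

lemma torus_L2_integrable_inner:
  assumes "torus_L2 f"
  shows "integrable torus (\<lambda>x. freq k \<bullet> f x)"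
proof -
  have "integrable torus (\<lambda>x. Re (of_int (k $ j) * comp f j x))" for j
    by (intro integrable_Re integrable_mult_right sq_int_integrable sq_int_comp assms)
  then have "integrable torus (\<lambda>x. \<Sum>j\<in>UNIV. freq k $ j * f x $ j)"
    by (intro Bochner_Integration.integrable_sum) (simp add: comp_def freq_def)
  then show ?thesis by (simp add: inner_vec_def)
qed

text \<open>The distributional divergence is tested with the cosine and the sine of k . x, which
  yield the two parts of the complex integral.\<close>

lemma div_free_kdot:
  assumes f: "torus_L2 f" and d: "div_free f"
  shows "kdot k (fourier f k) = 0"
proof -
  have z: "(\<integral>x. (freq k \<bullet> f x) * wave k b (- a) x \<partial>torus) = 0" for a b :: real
    using d[unfolded div_free_def, rule_format, OF conjI[OF smooth_wave periodic_wave], of k a b]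
    by (simp add: frechet_wave)
  have c: "(\<integral>x. (freq k \<bullet> f x) * cos (freq k \<bullet> x) \<partial>torus) = 0" using z[of 1 0] by (simp add: wave_def)
  have s: "(\<integral>x. (freq k \<bullet> f x) * sin (freq k \<bullet> x) \<partial>torus) = 0" using z[of 0 "-1"] by (simp add: wave_def)
  have m: "(\<lambda>x. wave k a b x) \<in> borel_measurable torus" for a b :: real
    by (intro measurable_torus borel_measurable_continuous_onI continuous_wave)
  have mi: "(\<lambda>x. freq k \<bullet> f x) \<in> borel_measurable torus"
    using torus_L2_integrable_inner[OF f] by measurable
  have int: "integrable torus (\<lambda>x. (freq k \<bullet> f x) * t (freq k \<bullet> x))" if t: "t = cos \<or> t = sin" for t :: "real \<Rightarrow> real"
  proof (rule Bochner_Integration.integrable_bound[OF torus_L2_integrable_inner[OF f, of k]])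
    have "(\<lambda>x. t (freq k \<bullet> x)) \<in> borel_measurable torus"
      using t m[of 1 0] m[of 0 1] by (auto simp: wave_def)
    then show "(\<lambda>x. (freq k \<bullet> f x) * t (freq k \<bullet> x)) \<in> borel_measurable torus" using mi by measurable
    have "\<bar>t y\<bar> \<le> 1" for y using t by (auto simp: abs_le_iff)
    then show "AE x in torus. norm ((freq k \<bullet> f x) * t (freq k \<bullet> x)) \<le> norm (freq k \<bullet> f x)"
      by (intro AE_I2) (simp add: abs_mult mult_left_le)
  qed
  have "(\<lambda>x. complex_of_real (freq k \<bullet> f x) * cnj (ef k x)) = (\<lambda>x. complex_of_real ((freq k \<bullet> f x) * cos (freq k \<bullet> x)) - \<i> * complex_of_real ((freq k \<bullet> f x) * sin (freq k \<bullet> x)))"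
    by (simp add: fun_eq_iff ef_def complex_eq_iff)
  moreover have "(\<integral>x. complex_of_real ((freq k \<bullet> f x) * cos (freq k \<bullet> x)) - \<i> * complex_of_real ((freq k \<bullet> f x) * sin (freq k \<bullet> x)) \<partial>torus) = 0"
  proof -
    have i1: "integrable torus (\<lambda>x. complex_of_real ((freq k \<bullet> f x) * cos (freq k \<bullet> x)))"
      by (rule integrable_of_real[OF int]) simp
    have i2: "integrable torus (\<lambda>x. \<i> * complex_of_real ((freq k \<bullet> f x) * sin (freq k \<bullet> x)))"
      by (rule integrable_mult_right[OF integrable_of_real[OF int]]) simp
    show ?thesis
      unfolding Bochner_Integration.integral_diff[OF i1 i2] integral_mult_right_zero integral_complex_of_real c s by simp
  qed
  ultimately show ?thesis unfolding kdot_fourier[OF f] by simp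
qed

lemma solenoidal_fourier:
  assumes "torus_L2 f" "div_free f" "zero_average f"
  shows "solenoidal (fourier f)"
  unfolding solenoidal_def using div_free_kdot zero_average_fourier assms by blast

text \<open>Convolution theorem as Parseval for the component j and the component i times
  \<open>ef k\<close>: the latter has at p the coefficient of component i at p - k, whose conjugate
  is the one at k - p by reality.\<close>

lemma cf_mult_has_sum:
  assumes f: "torus_L2 f"
  shows "((\<lambda>p. fourier f p $ j * fourier f (k - p) $ i) has_sum cf (\<lambda>x. comp f j x * comp f i x) k) UNIV"
proof -
  have g: "sq_int (\<lambda>x. comp f i x * ef k x)" by (intro sq_int_mult_ef sq_int_comp f)
  have "ip (comp f j) (\<lambda>x. comp f i x * ef k x) / (2 * pi) ^ 3 = cf (\<lambda>x. comp f j x * comp f i x) k"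
    unfolding ip_def cf_def by (simp add: comp_def mult.assoc)
  moreover have "cnj (cf (\<lambda>x. comp f i x * ef k x) p) = fourier f (k - p) $ i" for p
  proof -
    have "cf (\<lambda>x. comp f i x * ef k x) p = cf (comp f i) (p - k)"
      unfolding cf_def cnj_ef by (simp add: mult.assoc ef_mult)
    also have "cnj \<dots> = cf (comp f i) (k - p)"
      using cf_real_uminus[of "\<lambda>x. f x $ i" "p - k"] by (simp add: comp_def[abs_def])
    finally show ?thesis by (simp add: fourier_comp)
  qed
  ultimately show ?thesis using parseval_ip[OF sq_int_comp[OF f, of j] g] by (simp add: fourier_comp)
qed

text \<open>Ties \<open>adv\<close> to physical space: it is the divergence of the tensor product of
  the field with itself, the form in which the weak equation sees the nonlinearity.\<close>

lemma adv_fourier: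
  assumes f: "torus_L2 f"
  shows "adv (fourier f) (fourier f) k $ i = (\<Sum>j\<in>UNIV. \<i> * of_int (k $ j) * cf (\<lambda>x. comp f j x * comp f i x) k)"
proof -
  have 1: "((\<lambda>p. ((\<i> * kdot k (fourier f p)) *s fourier f (k - p)) $ i) has_sum adv (fourier f) (fourier f) k $ i) UNIV"
    using has_sum_bounded_linear[OF bounded_linear_vec_nth has_sum_infsum[OF adv_summable[OF l2_fourier[OF f] l2_fourier[OF f], of k]], of i]
    by (simp add: o_def adv_def)
  have 2: "((\<lambda>p. \<Sum>j\<in>UNIV. \<i> * of_int (k $ j) * (fourier f p $ j * fourier f (k - p) $ i)) has_sum
     (\<Sum>j\<in>UNIV. \<i> * of_int (k $ j) * cf (\<lambda>x. comp f j x * comp f i x) k)) UNIV"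
    unfolding sum_3 by (intro has_sum_add has_sum_cmult_right cf_mult_has_sum f)
  have "(\<lambda>p. ((\<i> * kdot k (fourier f p)) *s fourier f (k - p)) $ i) = (\<lambda>p. \<Sum>j\<in>UNIV. \<i> * of_int (k $ j) * (fourier f p $ j * fourier f (k - p) $ i))"
    by (simp add: fun_eq_iff kdot_def sum_distrib_left sum_distrib_right mult_ac)
  then show ?thesis using has_sum_unique[OF 1] 2 by simp
qed

definition re_vec :: "complex^3 \<Rightarrow> real^3" where "re_vec c = (\<chi> i. Re (c $ i))"
definition im_vec :: "complex^3 \<Rightarrow> real^3" where "im_vec c = (\<chi> i. Im (c $ i))"

text \<open>The real part of c exp(i k . x). Pairing a real field with it reads off the real inner
  product of its coefficient at k with c, so letting c vary recovers the complex
  coefficient.\<close>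

definition mode_field :: "int^3 \<Rightarrow> complex^3 \<Rightarrow> real^3 \<Rightarrow> real^3" where
  "mode_field k c = wave k (re_vec c) (- im_vec c)"

lemma mode_field_nth: "mode_field k c x $ i = Re (c $ i * ef k x)"
  by (simp add: mode_field_def wave_def re_vec_def im_vec_def ef_def mult.commute)

lemma torus_L2_mode_field: "torus_L2 (\<lambda>x. s *\<^sub>R mode_field k c x)"
  unfolding torus_L2_def mode_field_def scaleR_wave
proof (intro conjI periodic_wave)
  show m: "wave k a b \<in> borel_measurable torus" for a b :: "real^3"
    by (intro measurable_torus borel_measurable_continuous_onI continuous_wave)
  have "norm (wave k a b x) \<le> norm a + norm b" for a b :: "real^3" and x
  proof -
    have "norm (wave k a b x) \<le> \<bar>cos (freq k \<bullet> x)\<bar> * norm a + \<bar>sin (freq k \<bullet> x)\<bar> * norm b"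
      unfolding wave_def by (rule order_trans[OF norm_triangle_ineq]) simp
    also have "\<dots> \<le> 1 * norm a + 1 * norm b" by (intro add_mono mult_right_mono) auto
    finally show ?thesis by simp
  qed
  then show "integrable torus (\<lambda>x. (norm (wave k a b x))\<^sup>2)" for a b :: "real^3"
    using m[of a b] by (intro integrable_torus_bounded[where B="(norm a + norm b)\<^sup>2"]) (auto intro!: power_mono)
qed

lemma fourier_scaleR: "fourier (\<lambda>x. s *\<^sub>R f x) k = s *\<^sub>R fourier f k"
proof -
  have "cf (comp (\<lambda>x. s *\<^sub>R f x) i) k = s *\<^sub>R cf (comp f i) k" for i
    using cf_cmult[of "complex_of_real s" "comp f i" k]
    by (simp add: comp_def[abs_def] scaleR_conv_of_real[where 'a=complex])
  then show ?thesis by (simp add: vec_eq_iff fourier_comp)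
qed

lemma fourier_mode_field_zero:
  assumes "l \<noteq> k" "l \<noteq> - k"
  shows "fourier (mode_field k c) l = 0"
proof -
  have "cf (comp (mode_field k c) i) l = 0" for i
  proof -
    have e: "comp (mode_field k c) i = (\<lambda>x. c $ i / 2 * ef k x + cnj (c $ i) / 2 * ef (- k) x)"
    proof
      fix x
      have "complex_of_real (Re z) = (z + cnj z) / 2" for z by (simp add: complex_eq_iff)
      then have "comp (mode_field k c) i x = (c $ i * ef k x + cnj (c $ i * ef k x)) / 2"
        unfolding comp_def mode_field_nth .
      then show "comp (mode_field k c) i x = c $ i / 2 * ef k x + cnj (c $ i) / 2 * ef (- k) x"
        by (simp only: complex_cnj_mult cnj_ef add_divide_distrib times_divide_eq_left)
    qed
    have "cf (ef m) l = (if m = l then 1 else 0)" for m by (simp add: cf_eq_ip ip_ef_ef)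
    then show ?thesis unfolding e cf_add[OF sq_int_cmult[OF sq_int_ef] sq_int_cmult[OF sq_int_ef]] cf_cmult
      using assms by auto
  qed
  then show ?thesis by (simp add: vec_eq_iff fourier_comp)
qed

lemma torus_inner_mode_field:
  assumes f: "torus_L2 f"
  shows "torus_inner f (\<lambda>x. s *\<^sub>R mode_field k c x) = s * ((2 * pi) ^ 3 * (fourier f k \<bullet> c))"
proof -
  have int: "integrable torus (\<lambda>x. cnj (c $ i) * (comp f i x * cnj (ef k x)))" for i
    by (intro integrable_mult_right ip_integrable sq_int_comp sq_int_ef f)
  have "torus_inner f (\<lambda>x. s *\<^sub>R mode_field k c x) = s * (\<integral>x. f x \<bullet> mode_field k c x \<partial>torus)"
    by (simp add: torus_inner_def)
  also have "(\<lambda>x. f x \<bullet> mode_field k c x) = (\<lambda>x. Re (\<Sum>i\<in>UNIV. cnj (c $ i) * (comp f i x * cnj (ef k x))))"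
    by (simp add: fun_eq_iff inner_vec_def mode_field_nth comp_def algebra_simps)
  also have "(\<integral>x. Re (\<Sum>i\<in>UNIV. cnj (c $ i) * (comp f i x * cnj (ef k x))) \<partial>torus) = Re (\<Sum>i\<in>UNIV. cnj (c $ i) * (\<integral>x. comp f i x * cnj (ef k x) \<partial>torus))"
    using int by (subst integral_Re) (auto simp: Bochner_Integration.integral_sum)
  also have "(\<Sum>i\<in>UNIV. cnj (c $ i) * (\<integral>x. comp f i x * cnj (ef k x) \<partial>torus)) = (\<Sum>i\<in>UNIV. complex_of_real ((2 * pi) ^ 3) * (fourier f k $ i * cnj (c $ i)))"
    using ip_ef[of "comp f _" k] by (simp add: ip_def fourier_comp mult_ac)
  also have "Re \<dots> = (2 * pi) ^ 3 * (fourier f k \<bullet> c)"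
    unfolding sum_distrib_left[symmetric] inner_eq_Re_hdot hdot_def Re_complex_of_real by (subst Re_complex_of_real[symmetric]) (simp only: times_complex.sel, simp)
  finally show ?thesis .
qed

lemma jacobian_mode_field:
  "jacobian (\<lambda>x. s *\<^sub>R mode_field k c x) (at x) $ i $ j = s * Re (\<i> * of_int (k $ j) * c $ i * ef k x)"
proof -
  have "jacobian (\<lambda>x. s *\<^sub>R mode_field k c x) (at x) $ i $ j = frechet_derivative (\<lambda>x. s *\<^sub>R mode_field k c x) (at x) (axis j 1) $ i"
    by (simp add: jacobian_def matrix_def)
  also have "\<dots> = s * (freq k \<bullet> axis j 1) * (wave k (- im_vec c) (- re_vec c) x $ i)"
    unfolding mode_field_def scaleR_wave frechet_wave by (simp add: wave_def algebra_simps)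
  also have "\<dots> = s * Re (\<i> * of_int (k $ j) * c $ i * ef k x)"
    by (simp add: inner_axis freq_def wave_def re_vec_def im_vec_def ef_def algebra_simps)
  finally show ?thesis .
qed

lemma test_field_mode:
  assumes k: "kdot k c = 0" and ab: "a < b" "b < T"
  shows "test_field T (\<lambda>t x. step a b t *\<^sub>R mode_field k c x)"
  unfolding test_field_def
proof (intro conjI allI ballI)
  \<comment> \<open>A family of time factors closed under differentiation: the step, whose
    derivative is a bump, and all bumps.\<close>
  define \<Theta> where "\<Theta> = insert (step a b) {bump a b P m |P m. True}"
  have \<Theta>: "\<exists>\<theta>'\<in>\<Theta>. \<forall>t. (\<theta> has_real_derivative \<theta>' t) (at t)" if th: "\<theta> \<in> \<Theta>" for \<theta>
  proof (cases "\<theta> = step a b")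
    case True
    then show ?thesis using step_deriv[OF ab(1)] by (intro bexI[of _ "bump a b (- 1) 0"]) (auto simp: \<Theta>_def)
  next
    case False
    then obtain P m where \<theta>: "\<theta> = bump a b P m" using th by (auto simp: \<Theta>_def)
    obtain P' m' where "\<forall>t. (bump a b P m has_real_derivative bump a b P' m' t) (at t)"
      using bump_deriv[OF ab(1), of P m] by blast
    then show ?thesis unfolding \<theta> by (intro bexI[of _ "bump a b P' m'"]) (auto simp: \<Theta>_def)
  qed
  define S :: "(real \<times> (real^3) \<Rightarrow> real^3) set" where "S = {(\<lambda>(t, x). \<theta> t *\<^sub>R wave k p q x) |\<theta> p q. \<theta> \<in> \<Theta>}"
  have D: "((\<lambda>(t, x). \<theta> t *\<^sub>R wave k p q x) has_derivative (\<lambda>(s, h). (s * \<theta>' t) *\<^sub>R wave k p q x + \<theta> t *\<^sub>R (freq k \<bullet> h) *\<^sub>R wave k q (- p) x)) (at (t, x))"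
    if "(\<theta> has_real_derivative \<theta>' t) (at t)" for \<theta> \<theta>' t x and p q :: "real^3"
  proof -
    have t: "(\<theta> has_derivative (\<lambda>h. h * \<theta>' t)) (at t)"
      using that unfolding has_field_derivative_def by (simp add: mult_commute_abs)
    have 1: "((\<lambda>z. \<theta> (fst z)) has_derivative (\<lambda>z. fst z * \<theta>' t)) (at (t, x))"
      using has_derivative_compose[OF has_derivative_fst[OF has_derivative_ident], where g=\<theta> and g'="\<lambda>h. h * \<theta>' t" and x="(t, x)" and s=UNIV] t
      by simp
    have 2: "((\<lambda>z. wave k p q (snd z)) has_derivative (\<lambda>z. (freq k \<bullet> snd z) *\<^sub>R wave k q (- p) x)) (at (t, x))"
      using has_derivative_compose[OF has_derivative_snd[OF has_derivative_ident], where g="wave k p q" and x="(t, x)" and s=UNIV] wave_has_derivative[of k p q x]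
      by simp
    show ?thesis using has_derivative_scaleR[OF 1 2] by (simp add: case_prod_unfold add.commute)
  qed
  show "smooth (\<lambda>(t, x). step a b t *\<^sub>R mode_field k c x)"
  proof (rule smooth_closed_class[where S=S])
    show "(\<lambda>(t, x). step a b t *\<^sub>R mode_field k c x) \<in> S" by (auto simp: S_def \<Theta>_def mode_field_def)
    fix f :: "real \<times> (real^3) \<Rightarrow> real^3" assume "f \<in> S"
    then obtain \<theta> p q where f: "f = (\<lambda>(t, x). \<theta> t *\<^sub>R wave k p q x)" "\<theta> \<in> \<Theta>" by (auto simp: S_def)
    obtain \<theta>' where \<theta>': "\<theta>' \<in> \<Theta>" "\<And>t. (\<theta> has_real_derivative \<theta>' t) (at t)" using \<Theta>[OF f(2)] by blast
    have Df: "(f has_derivative (\<lambda>(s, h). (s * \<theta>' (fst z)) *\<^sub>R wave k p q (snd z) + \<theta> (fst z) *\<^sub>R (freq k \<bullet> h) *\<^sub>R wave k q (- p) (snd z))) (at z)" for z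
      using D[where \<theta>=\<theta> and \<theta>'=\<theta>' and t="fst z" and x="snd z" and p=p and q=q, OF \<theta>'(2)] by (simp add: f(1))
    show "f differentiable at z" for z using Df by (rule differentiableI)
    have fr: "(\<lambda>z. frechet_derivative f (at z) (s, h)) = (\<lambda>(t, x). (s * \<theta>' t) *\<^sub>R wave k p q x + \<theta> t *\<^sub>R (freq k \<bullet> h) *\<^sub>R wave k q (- p) x)" for s h
      using frechet_derivative_at[OF Df, symmetric] by (simp add: fun_eq_iff)
    fix d :: "real \<times> (real^3)" assume "d \<in> Basis"
    then consider "d = (1, 0)" | h where "d = (0, h)" by (auto simp: Basis_prod_def)
    then show "(\<lambda>z. frechet_derivative f (at z) d) \<in> S"
    proof cases
      case 1
      have "(\<lambda>z. frechet_derivative f (at z) d) = (\<lambda>(t, x). \<theta>' t *\<^sub>R wave k p q x)"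
        unfolding 1 fr by (simp add: fun_eq_iff)
      then show ?thesis using \<theta>'(1) by (auto simp: S_def)
    next
      case 2
      have "(\<lambda>z. frechet_derivative f (at z) d) = (\<lambda>(t, x). \<theta> t *\<^sub>R wave k ((freq k \<bullet> h) *\<^sub>R q) ((freq k \<bullet> h) *\<^sub>R (- p)) x)"
        unfolding 2 fr scaleR_wave[symmetric] by (simp add: fun_eq_iff)
      then show ?thesis using f(2) by (auto simp: S_def)
    qed
  qed
  show "periodic (\<lambda>x. step a b t *\<^sub>R mode_field k c x)" for t
    unfolding mode_field_def scaleR_wave by (rule periodic_wave)
  show "\<exists>T'<T. \<forall>t\<ge>T'. \<forall>x. step a b t *\<^sub>R mode_field k c x = 0"
    using ab step_after[OF ab(1)] by (intro exI[of _ b]) simp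
  show "trace (jacobian (\<lambda>x. step a b t *\<^sub>R mode_field k c x) (at x)) = 0" for t x
  proof -
    have "trace (jacobian (\<lambda>x. step a b t *\<^sub>R mode_field k c x) (at x)) = step a b t * (\<Sum>i\<in>UNIV. Re (\<i> * of_int (k $ i) * c $ i * ef k x))"
      by (simp add: trace_def jacobian_mode_field sum_distrib_left)
    also have "(\<Sum>i\<in>UNIV. Re (\<i> * of_int (k $ i) * c $ i * ef k x)) = Re (\<i> * kdot k c * ef k x)"
      by (simp only: Re_sum[symmetric] kdot_def sum_distrib_left sum_distrib_right mult.assoc)
    finally show ?thesis by (simp add: k)
  qed
qed

text \<open>The minus sign is that of the integration by parts contained in pairing the tensor with
  the gradient of the test field.\<close>

lemma torus_inner_jacobian:
  assumes f: "torus_L2 f"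
  shows "torus_inner (\<lambda>x. \<chi> i j. f x $ i * f x $ j) (\<lambda>x. jacobian (\<lambda>x. s *\<^sub>R mode_field k c x) (at x))
    = - s * ((2 * pi) ^ 3 * (adv (fourier f) (fourier f) k \<bullet> c))"
proof -
  \<comment> \<open>Conjugated against the entries of the jacobian in order to match
    \<open>adv_fourier\<close>; the real part is the same.\<close>
  define F where "F i j x = - \<i> * of_int (k $ j) * cnj (c $ i) * (comp f j x * comp f i x * cnj (ef k x))" for i j x
  have int: "integrable torus (F i j)" for i j
  proof -
    have "integrable torus (\<lambda>x. comp f j x * (comp f i x * ef (- k) x))"
      by (intro sq_int_mult_integrable sq_int_mult_ef sq_int_comp f)
    then show ?thesis unfolding F_def[abs_def] cnj_ef by (intro integrable_mult_right) (simp add: mult.assoc)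
  qed
  have "torus_inner (\<lambda>x. \<chi> i j. f x $ i * f x $ j) (\<lambda>x. jacobian (\<lambda>x. s *\<^sub>R mode_field k c x) (at x))
    = (\<integral>x. s * Re (\<Sum>i\<in>UNIV. \<Sum>j\<in>UNIV. F i j x) \<partial>torus)"
    unfolding torus_inner_def
  proof (rule Bochner_Integration.integral_cong)
    fix x
    have "Re (F i j x) = f x $ i * f x $ j * Re (\<i> * of_int (k $ j) * c $ i * ef k x)" for i j
    proof -
      have "F i j x = cnj (complex_of_real (f x $ i * f x $ j) * (\<i> * of_int (k $ j) * c $ i * ef k x))"
        by (simp add: F_def comp_def mult_ac)
      moreover have "Re (cnj (complex_of_real r * z)) = r * Re z" for r z by simp
      ultimately show ?thesis by (simp only:)
    qed
    then show "(\<chi> i j. f x $ i * f x $ j) \<bullet> jacobian (\<lambda>x. s *\<^sub>R mode_field k c x) (at x) = s * Re (\<Sum>i\<in>UNIV. \<Sum>j\<in>UNIV. F i j x)"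
      by (simp only: inner_vec_def vec_lambda_beta jacobian_mode_field Re_sum sum_distrib_left inner_real_def) (simp only: mult_ac)
  qed simp
  also have "\<dots> = s * Re (\<integral>x. (\<Sum>i\<in>UNIV. \<Sum>j\<in>UNIV. F i j x) \<partial>torus)"
    by (subst integral_Re[symmetric]) (auto intro!: Bochner_Integration.integrable_sum int)
  also have "(\<integral>x. (\<Sum>i\<in>UNIV. \<Sum>j\<in>UNIV. F i j x) \<partial>torus) = (\<Sum>i\<in>UNIV. \<Sum>j\<in>UNIV. (\<integral>x. F i j x \<partial>torus))"
    using int by (simp add: Bochner_Integration.integral_sum Bochner_Integration.integrable_sum)
  also have "\<dots> = (\<Sum>i\<in>UNIV. - complex_of_real ((2 * pi) ^ 3) * (adv (fourier f) (fourier f) k $ i * cnj (c $ i)))"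
  proof (rule sum.cong[OF refl])
    fix i
    have "(\<integral>x. F i j x \<partial>torus) = - \<i> * of_int (k $ j) * cnj (c $ i) * (complex_of_real ((2 * pi) ^ 3) * cf (\<lambda>x. comp f j x * comp f i x) k)" for j
      unfolding F_def[abs_def] cf_def by simp
    then show "(\<Sum>j\<in>UNIV. (\<integral>x. F i j x \<partial>torus)) = - complex_of_real ((2 * pi) ^ 3) * (adv (fourier f) (fourier f) k $ i * cnj (c $ i))"
      by (simp only: adv_fourier[OF f] sum_distrib_left sum_distrib_right) (simp add: mult_ac)
  qed
  also have "Re \<dots> = - ((2 * pi) ^ 3 * (adv (fourier f) (fourier f) k \<bullet> c))"
  proof -
    have "Re (- complex_of_real r * z) = - (r * Re z)" for r z by simp
    then show ?thesis by (simp only: sum_distrib_left[symmetric] inner_eq_Re_hdot hdot_def)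
  qed
  finally show ?thesis by simp
qed

text \<open>The test field has only the frequencies k and -k, on which the symbol of
  \<open>Lam\<close> is one constant; Parseval on both sides takes it out of the product.\<close>

lemma torus_inner_Lam:
  assumes f: "torus_L2 f" "hs (2 * \<alpha>) (fourier f)"
  shows "torus_inner (Lam \<alpha> f) (Lam \<alpha> (\<lambda>x. s *\<^sub>R mode_field k c x)) = s * (norm (freq k) powr (2 * \<alpha>) * ((2 * pi) ^ 3 * (fourier f k \<bullet> c)))"
proof -
  let ?\<phi> = "\<lambda>x. s *\<^sub>R mode_field k c x"
  have \<phi>0: "fourier ?\<phi> l = 0" if "l \<noteq> k" "l \<noteq> - k" for l using that by (simp add: fourier_scaleR fourier_mode_field_zero)
  have h\<phi>: "hs (2 * \<alpha>) (fourier ?\<phi>)"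
    by (rule supp_in_hs[of "{k, - k}"]) (auto simp: supp_in_def \<phi>0)
  have h1: "((\<lambda>l. fourier (Lam \<alpha> f) l \<bullet> fourier (Lam \<alpha> ?\<phi>) l) has_sum torus_inner (Lam \<alpha> f) (Lam \<alpha> ?\<phi>) / (2 * pi) ^ 3) UNIV"
    by (intro torus_inner_has_sum Lam_spec f h\<phi>)
  have eq: "fourier (Lam \<alpha> f) l \<bullet> fourier (Lam \<alpha> ?\<phi>) l = norm (freq k) powr (2 * \<alpha>) * (fourier f l \<bullet> fourier ?\<phi> l)" for l
  proof (cases "l = k \<or> l = - k")
    case True
    then have n: "norm (freq l) = norm (freq k)" by auto
    have sq: "x powr \<alpha> * (x powr \<alpha> * y) = x powr (2 * \<alpha>) * y" for x y :: real
      by (simp add: mult.assoc[symmetric] powr_add[symmetric])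
    show ?thesis unfolding Lam_spec(2)[OF f(2)] Lam_spec(2)[OF h\<phi>] by (simp add: n sq)
  next
    case False
    then show ?thesis unfolding Lam_spec(2)[OF h\<phi>] using \<phi>0 by simp
  qed
  have h2: "((\<lambda>l. norm (freq k) powr (2 * \<alpha>) * (fourier f l \<bullet> fourier ?\<phi> l)) has_sum norm (freq k) powr (2 * \<alpha>) * (torus_inner f ?\<phi> / (2 * pi) ^ 3)) UNIV"
    by (intro has_sum_cmult_right torus_inner_has_sum f torus_L2_mode_field)
  have "torus_inner (Lam \<alpha> f) (Lam \<alpha> ?\<phi>) / (2 * pi) ^ 3 = norm (freq k) powr (2 * \<alpha>) * (torus_inner f ?\<phi> / (2 * pi) ^ 3)"
    by (rule has_sum_unique[OF h1[unfolded eq] h2])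
  then have "torus_inner (Lam \<alpha> f) (Lam \<alpha> ?\<phi>) = norm (freq k) powr (2 * \<alpha>) * torus_inner f ?\<phi>"
    by (simp add: field_simps)
  then show ?thesis unfolding torus_inner_mode_field[OF f(1)] by simp
qed

section \<open>Equations for the Fourier modes\<close>

text \<open>Crude in k but uniform on bounded sets of l2: along a weak solution each mode has a
  bounded right side and is therefore Lipschitz in time.\<close>

lemma norm_adv_le:
  assumes "l2 a" "l2 b"
  shows "norm (adv a b k) \<le> norm (freq k) * (l2sum a + l2sum b)"
proof (rule LIMSEQ_le_const2)
  show "(\<lambda>n. norm (\<Sum>p\<in>modes n. (\<i> * kdot k (a p)) *s b (k - p))) \<longlonglongrightarrow> norm (adv a b k)"
    unfolding adv_def by (intro tendsto_norm tendsto_sum_modes has_sum_infsum adv_summable assms)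
  have "norm (\<Sum>p\<in>F. (\<i> * kdot k (a p)) *s b (k - p)) \<le> norm (freq k) * (l2sum a + l2sum b)" if F: "finite F" for F
  proof -
    have "norm (\<Sum>p\<in>F. (\<i> * kdot k (a p)) *s b (k - p)) \<le> (\<Sum>p\<in>F. norm (freq k) * ((norm (a p))\<^sup>2 + (norm (b (k - p)))\<^sup>2))"
    proof (rule sum_norm_le)
      fix p
      have "norm ((\<i> * kdot k (a p)) *s b (k - p)) \<le> (norm (freq k) * norm (a p)) * norm (b (k - p))"
        using mult_right_mono[OF norm_kdot_le[of k "a p"], of "norm (b (k - p))"] by (simp add: norm_smult_vec norm_mult)
      also have "\<dots> = norm (freq k) * (norm (a p) * norm (b (k - p)))" by (rule mult.assoc)
      also have "\<dots> \<le> norm (freq k) * ((norm (a p))\<^sup>2 + (norm (b (k - p)))\<^sup>2)"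
      proof (rule mult_left_mono)
        have "0 \<le> norm (a p) * norm (b (k - p))" by simp
        then show "norm (a p) * norm (b (k - p)) \<le> (norm (a p))\<^sup>2 + (norm (b (k - p)))\<^sup>2"
          using sum_squares_bound[of "norm (a p)" "norm (b (k - p))"] by linarith
      qed simp
      finally show "norm ((\<i> * kdot k (a p)) *s b (k - p)) \<le> norm (freq k) * ((norm (a p))\<^sup>2 + (norm (b (k - p)))\<^sup>2)" .
    qed
    also have "\<dots> = norm (freq k) * ((\<Sum>p\<in>F. (norm (a p))\<^sup>2) + (\<Sum>p\<in>F. (norm (b (k - p)))\<^sup>2))"
      by (simp add: sum_distrib_left sum.distrib distrib_left)
    also have "(\<Sum>p\<in>F. (norm (b (k - p)))\<^sup>2) = (\<Sum>q\<in>(\<lambda>p. k - p) ` F. (norm (b q))\<^sup>2)"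
      by (subst sum.reindex) (auto simp: inj_on_def)
    also have "norm (freq k) * ((\<Sum>p\<in>F. (norm (a p))\<^sup>2) + (\<Sum>q\<in>(\<lambda>p. k - p) ` F. (norm (b q))\<^sup>2)) \<le> norm (freq k) * (l2sum a + l2sum b)"
      using F by (intro mult_left_mono add_mono sum_le_l2sum assms) auto
    finally show ?thesis .
  qed
  then show "\<exists>N. \<forall>n\<ge>N. norm (\<Sum>p\<in>modes n. (\<i> * kdot k (a p)) *s b (k - p)) \<le> norm (freq k) * (l2sum a + l2sum b)"
    by simp
qed

lemma integrable_lebesgue_on_subset:
  fixes f :: "real \<Rightarrow> real"
  assumes "integrable (lebesgue_on S) f" "S \<in> sets lebesgue" "S' \<in> sets lebesgue" "S' \<subseteq> S"
  shows "integrable (lebesgue_on S') f"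
proof -
  have "set_integrable lebesgue S f"
    using assms(1,2) unfolding set_integrable_def by (subst (asm) integrable_restrict_space) auto
  then have "set_integrable lebesgue S' f" by (rule set_integrable_subset[OF _ assms(3,4)])
  then show ?thesis
    using assms(3) unfolding set_integrable_def by (subst integrable_restrict_space) auto
qed

lemma AE_lebesgue_on_subset:
  assumes "AE x in lebesgue_on S. P x" "S \<in> sets lebesgue" "S' \<in> sets lebesgue" "S' \<subseteq> S"
  shows "AE x in lebesgue_on S'. P x"
proof -
  have "AE x in lebesgue. x \<in> S \<longrightarrow> P x" using assms(1,2) by (subst (asm) AE_restrict_space_iff) auto
  then have "AE x in lebesgue. x \<in> S' \<longrightarrow> P x" by eventually_elim (use assms(4) in blast)
  then show ?thesis using assms(3) by (subst AE_restrict_space_iff) auto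
qed

section \<open>Fourier modes of a weak solution\<close>

lemma
  assumes w: "weak_solution \<nu> \<alpha> u0 T u" and t: "t \<in> {0..<T}"
  shows weak_solution_L2: "torus_L2 (u t)" and weak_solution_solenoidal: "solenoidal (fourier (u t))"
proof -
  show L2: "torus_L2 (u t)" using w t by (auto simp: weak_solution_def weakly_continuous_def)
  show "solenoidal (fourier (u t))"
    by (rule solenoidal_fourier[OF L2]) (use w t in \<open>auto simp: weak_solution_def\<close>)
qed

text \<open>Weak continuity, tested with the fields of a single frequency.\<close>

lemma weak_solution_continuous:
  assumes w: "weak_solution \<nu> \<alpha> u0 T u"
  shows "continuous_on {0..<T} (\<lambda>t. fourier (u t) k)"
proof (subst continuous_on_componentwise, rule ballI)
  fix d :: "complex^3"
  have "continuous_on {0..<T} (\<lambda>t. torus_inner (u t) (\<lambda>x. 1 *\<^sub>R mode_field k d x))"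
    using w torus_L2_mode_field unfolding weak_solution_def weakly_continuous_def by blast
  then have "continuous_on {0..<T} (\<lambda>t. torus_inner (u t) (\<lambda>x. 1 *\<^sub>R mode_field k d x) / (2 * pi) ^ 3)"
    by (intro continuous_intros) auto
  then show "continuous_on {0..<T} (\<lambda>t. fourier (u t) k \<bullet> d)"
  proof (rule continuous_on_eq)
    fix t assume t: "t \<in> {0..<T}"
    show "torus_inner (u t) (\<lambda>x. 1 *\<^sub>R mode_field k d x) / (2 * pi) ^ 3 = fourier (u t) k \<bullet> d"
      unfolding torus_inner_mode_field[OF weak_solution_L2[OF w t]] by simp
  qed
qed

lemma energy_ineq_l2sum:
  assumes w: "weak_solution \<nu> \<alpha> u0 T u" and \<nu>: "\<nu> > 0" and \<tau>: "\<tau> \<in> {0..<T}" and t: "t \<in> {0..<T}"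
    and e: "energy_ineq \<nu> \<alpha> u \<tau> t"
  shows "l2sum (fourier (u t)) \<le> l2sum (fourier (u \<tau>))"
proof -
  have "0 \<le> (\<integral>s. (L2_norm_torus (Lam \<alpha> (u s)))\<^sup>2 \<partial>lebesgue_on {\<tau><..<t})"
    by (rule Bochner_Integration.integral_nonneg) simp
  then have "0 \<le> 2 * \<nu> * (\<integral>s. (L2_norm_torus (Lam \<alpha> (u s)))\<^sup>2 \<partial>lebesgue_on {\<tau><..<t})" using \<nu> by simp
  then have "(L2_norm_torus (u t))\<^sup>2 \<le> (L2_norm_torus (u \<tau>))\<^sup>2"
    using e unfolding energy_ineq_def by linarith
  then show ?thesis
    unfolding l2sum_fourier[OF weak_solution_L2[OF w \<tau>]] l2sum_fourier[OF weak_solution_L2[OF w t]] by simp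
qed

lemma weak_solution_mode_rhs:
  assumes w: "weak_solution \<nu> \<alpha> u0 T u" and \<nu>: "\<nu> > 0" and T: "T > 0"
  shows "S \<subseteq> {0..<T} \<Longrightarrow> S \<in> sets lebesgue \<Longrightarrow> mode_rhs \<nu> \<alpha> (\<lambda>t. fourier (u t)) k \<in> borel_measurable (lebesgue_on S)"
    and "\<exists>B. \<forall>t\<in>{0..<T}. norm (mode_rhs \<nu> \<alpha> (\<lambda>t. fourier (u t)) k t) \<le> B"
proof -
  note L2 = weak_solution_L2[OF w]
  show "mode_rhs \<nu> \<alpha> (\<lambda>t. fourier (u t)) k \<in> borel_measurable (lebesgue_on S)"
    if S: "S \<subseteq> {0..<T}" "S \<in> sets lebesgue"
  proof -
    have c: "continuous_on S (\<lambda>t. fourier (u t) p)" for p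
      by (rule continuous_on_subset[OF weak_solution_continuous[OF w] S(1)])
    have adv: "(\<lambda>t. adv (fourier (u t)) (fourier (u t)) k) \<in> borel_measurable (lebesgue_on S)"
      unfolding adv_def
    proof (rule borel_measurable_infsum_modes)
      show "(\<lambda>t. (\<i> * kdot k (fourier (u t) p)) *s fourier (u t) (k - p)) \<in> borel_measurable (lebesgue_on S)" for p
        by (intro continuous_imp_measurable_on_sets_lebesgue S(2) continuous_intros c)
      show "(\<lambda>p. (\<i> * kdot k (fourier (u t) p)) *s fourier (u t) (k - p)) summable_on UNIV" if "t \<in> space (lebesgue_on S)" for t
        using that S by (intro adv_summable l2_fourier L2) auto
    qed
    have "(\<lambda>t. proj k (adv (fourier (u t)) (fourier (u t)) k)) \<in> borel_measurable (lebesgue_on S)"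
      by (rule measurable_compose[OF adv])
         (intro borel_measurable_continuous_onI linear_continuous_on bounded_linear_proj)
    moreover have "(\<lambda>t. - (\<nu> * norm (freq k) powr (2 * \<alpha>)) *\<^sub>R fourier (u t) k) \<in> borel_measurable (lebesgue_on S)"
      by (intro continuous_imp_measurable_on_sets_lebesgue S(2) continuous_intros c)
    ultimately show ?thesis unfolding mode_rhs_def by (intro borel_measurable_diff)
  qed
  define E where "E = l2sum (fourier (u 0))"
  have "norm (mode_rhs \<nu> \<alpha> (\<lambda>t. fourier (u t)) k t) \<le> \<nu> * norm (freq k) powr (2 * \<alpha>) * sqrt E + norm (freq k) * (E + E)"
    if t: "t \<in> {0..<T}" for t
  proof -
    have en: "l2sum (fourier (u t)) \<le> E"
      unfolding E_def by (rule energy_ineq_l2sum[OF w \<nu> _ t]) (use w t T in \<open>auto simp: weak_solution_def\<close>)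
    have l2: "l2 (fourier (u t))" by (rule l2_fourier[OF L2[OF t]])
    have "(\<Sum>k\<in>{k}. (norm (fourier (u t) k))\<^sup>2) \<le> E" using order_trans[OF sum_le_l2sum[OF l2] en] by blast
    then have 1: "norm (fourier (u t) k) \<le> sqrt E" by (simp add: real_le_rsqrt)
    have 2: "norm (adv (fourier (u t)) (fourier (u t)) k) \<le> norm (freq k) * (E + E)"
      by (rule order_trans[OF norm_adv_le[OF l2 l2]]) (intro mult_left_mono add_mono en, simp)
    have "norm (mode_rhs \<nu> \<alpha> (\<lambda>t. fourier (u t)) k t) \<le> norm ((\<nu> * norm (freq k) powr (2 * \<alpha>)) *\<^sub>R fourier (u t) k) + norm (proj k (adv (fourier (u t)) (fourier (u t)) k))"
      unfolding mode_rhs_def using norm_triangle_ineq4[of "- (\<nu> * norm (freq k) powr (2 * \<alpha>)) *\<^sub>R fourier (u t) k"] by simp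
    also have "\<dots> \<le> \<nu> * norm (freq k) powr (2 * \<alpha>) * sqrt E + norm (freq k) * (E + E)"
      using \<nu> by (intro add_mono order_trans[OF norm_proj_le 2]) (auto simp: abs_mult intro!: mult_left_mono 1)
    finally show ?thesis .
  qed
  then show "\<exists>B. \<forall>t\<in>{0..<T}. norm (mode_rhs \<nu> \<alpha> (\<lambda>t. fourier (u t)) k t) \<le> B" by blast
qed

lemma weak_solution_AE_hs:
  assumes w: "weak_solution \<nu> \<alpha> u0 T u" and \<alpha>: "\<alpha> > 0"
  shows "AE t in lebesgue_on {0<..<T}. hs (2 * \<alpha>) (fourier (u t))"
proof -
  have "AE t in lebesgue_on {0<..<T}. in_Hs \<alpha> (u t)" using w by (simp add: weak_solution_def L2_Hs_def)
  then show ?thesis by eventually_elim (rule in_Hs_hs(1)[OF _ \<alpha>])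
qed

text \<open>The weak formulation tested with a step in time times a field of frequency k; every term
  then becomes a product with the coefficient at k.\<close>

lemma weak_form_mode:
  fixes k :: "int^3" and d :: "complex^3"
  assumes w: "weak_solution \<nu> \<alpha> u0 T u" and \<nu>: "\<nu> > 0" and \<alpha>: "\<alpha> > 0" and u0: "torus_L2 u0"
    and ab: "0 < a" "a < b" "b < T" and d: "d \<in> Basis"
  defines "U \<equiv> \<lambda>t. fourier (u t) k \<bullet> d" and "g \<equiv> \<lambda>t. mode_rhs \<nu> \<alpha> (\<lambda>t. fourier (u t)) k t \<bullet> d"
  shows "integral {0..b} (\<lambda>t. bump a b (- 1) 0 t * U t + step a b t * g t) = - step a b 0 * U 0"
proof -
  have T: "T > 0" using ab by linarith
  \<comment> \<open>The direction is projected to give a solenoidal test field. On the coefficient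
    of u this changes nothing, and on the nonlinearity the symmetric projection moves over and
    yields the Leray term of \<open>mode_rhs\<close>.\<close>
  define e where "e = proj k d"
  have ke: "kdot k e = 0" by (simp add: e_def)
  define \<phi> where "\<phi> t x = step a b t *\<^sub>R mode_field k e x" for t x
  let ?D = "(2 * pi) ^ 3 :: real"
  note L2 = weak_solution_L2[OF w]
  have Ue: "fourier (u t) k \<bullet> e = U t" if "t \<in> {0..<T}" for t
    using weak_solution_solenoidal[OF w that] unfolding U_def e_def proj_inner_sym[symmetric]
    by (simp add: proj_eq_self solenoidal_def)
  have ge: "g t = - (\<nu> * norm (freq k) powr (2 * \<alpha>)) * U t - adv (fourier (u t)) (fourier (u t)) k \<bullet> e" for t
    unfolding g_def U_def e_def mode_rhs_def by (simp add: inner_diff_left proj_inner_sym)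
  have test: "test_field T \<phi>" unfolding \<phi>_def[abs_def] by (rule test_field_mode[OF ke ab(2,3)])
  define F where "F t = torus_inner (u t) (\<lambda>x. vector_derivative (\<lambda>s. \<phi> s x) (at t))
           - \<nu> * torus_inner (Lam \<alpha> (u t)) (Lam \<alpha> (\<phi> t))
           + torus_inner (\<lambda>x. \<chi> i j. u t x $ i * u t x $ j) (\<lambda>x. jacobian (\<phi> t) (at x))" for t
  define h where "h t = ?D * (bump a b (- 1) 0 t * U t + step a b t * g t)" for t
  have "(\<integral>t. F t \<partial>lebesgue_on {0<..<T}) = - torus_inner u0 (\<phi> 0)"
    using w test unfolding weak_solution_def weak_form_def F_def by blast
  also have "fourier u0 = fourier (u 0)"
    using w T by (intro fourier_cong_AE u0 L2) (auto simp: weak_solution_def elim!: eventually_mono)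
  then have "torus_inner u0 (\<phi> 0) = step a b 0 * (?D * U 0)"
    unfolding \<phi>_def torus_inner_mode_field[OF u0] using Ue[of 0] T by simp
  finally have F: "(\<integral>t. F t \<partial>lebesgue_on {0<..<T}) = - (step a b 0 * (?D * U 0))" by simp
  \<comment> \<open>Almost everywhere, because \<open>Lam\<close> has a meaning at times where u
    lies in H^\<alpha>.\<close>
  have "AE t in lebesgue_on {0<..<T}. h t = F t"
    using weak_solution_AE_hs[OF w \<alpha>] AE_space
  proof eventually_elim
    case (elim t)
    then have t: "t \<in> {0..<T}" by simp
    have "((\<lambda>s. step a b s *\<^sub>R z) has_vector_derivative bump a b (- 1) 0 t *\<^sub>R z) (at t)" for z :: "real^3"
      using bounded_linear.has_vector_derivative[OF bounded_linear_scaleR_left step_deriv[OF ab(2), unfolded has_real_derivative_iff_has_vector_derivative]] .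
    then have vd: "vector_derivative (\<lambda>s. \<phi> s x) (at t) = bump a b (- 1) 0 t *\<^sub>R mode_field k e x" for x
      unfolding \<phi>_def by (rule vector_derivative_at)
    have "F t = bump a b (- 1) 0 t * (?D * U t) - \<nu> * (step a b t * (norm (freq k) powr (2 * \<alpha>) * (?D * U t)))
       + - step a b t * (?D * (adv (fourier (u t)) (fourier (u t)) k \<bullet> e))"
      unfolding F_def vd unfolding \<phi>_def torus_inner_mode_field[OF L2[OF t]] torus_inner_Lam[OF L2[OF t] elim(1)]
        torus_inner_jacobian[OF L2[OF t]] Ue[OF t] ..
    also have "\<dots> = h t" unfolding h_def ge by (simp add: algebra_simps)
    finally show ?case by simp
  qed
  moreover have I: "{0<..<T} \<in> sets lebesgue" "{0<..<T} \<subseteq> {0..<T}" by auto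
  have contS: "continuous_on S (step a b)" for S
    using step_deriv[OF ab(2)] by (meson DERIV_isCont continuous_at_imp_continuous_on)
  have contU: "continuous_on S U" if "S \<subseteq> {0..<T}" for S
    unfolding U_def by (intro continuous_intros continuous_on_subset[OF weak_solution_continuous[OF w] that])
  note cont = bump_continuous[OF ab(2)] contS contU[OF I(2)]
  have gm: "g \<in> borel_measurable (lebesgue_on S)" if "S \<subseteq> {0..<T}" "S \<in> sets lebesgue" for S
    unfolding g_def using weak_solution_mode_rhs(1)[OF w \<nu> T that] by measurable
  have hm: "h \<in> borel_measurable (lebesgue_on {0<..<T})"
    unfolding h_def[abs_def]
    by (intro borel_measurable_times borel_measurable_add borel_measurable_const gm I continuous_imp_measurable_on_sets_lebesgue cont)
  ultimately have "(\<integral>t. h t \<partial>lebesgue_on {0<..<T}) = (\<integral>t. F t \<partial>lebesgue_on {0<..<T})"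
    using AE_lebesgue_on_measurable[OF hm I(1)] by (intro integral_cong_AE) auto
  then have hF: "(\<integral>t. h t \<partial>lebesgue_on {0<..<T}) = - (step a b 0 * (?D * U 0))" by (simp only: F)
  obtain B where B: "\<forall>t\<in>{0..<T}. norm (mode_rhs \<nu> \<alpha> (\<lambda>t. fourier (u t)) k t) \<le> B"
    using weak_solution_mode_rhs(2)[OF w \<nu> T] by blast
  have gB: "\<bar>g t\<bar> \<le> B" if "t \<in> {0..<T}" for t
  proof -
    have "\<bar>g t\<bar> \<le> norm (mode_rhs \<nu> \<alpha> (\<lambda>t. fourier (u t)) k t)" unfolding g_def by (rule Basis_le_norm[OF d])
    then show ?thesis using B that by force
  qed
  have h0: "h t = 0" if "t \<ge> b" for t using that ab by (simp add: h_def step_after bump_def)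
  have c0: "continuous_on {0..b} (bump a b (- 1) 0)" "continuous_on {0..b} (step a b)" "continuous_on {0..b} U"
    using ab by (intro bump_continuous contS contU; auto)+
  have hc: "\<exists>M. \<forall>t\<in>{0..b}. norm (f t) \<le> M" if "continuous_on {0..b} f" for f :: "real \<Rightarrow> real"
    using compact_imp_bounded[OF compact_continuous_image[OF that]] unfolding bounded_iff by auto
  obtain M1 M2 M3 where M: "\<forall>t\<in>{0..b}. norm (bump a b (- 1) 0 t) \<le> M1" "\<forall>t\<in>{0..b}. norm (step a b t) \<le> M2" "\<forall>t\<in>{0..b}. norm (U t) \<le> M3"
    using hc[OF c0(1)] hc[OF c0(2)] hc[OF c0(3)] by blast
  have hB: "norm (h t) \<le> ?D * (M1 * M3 + M2 * B)" if t: "t \<in> {0..b}" for t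
  proof -
    have m: "\<bar>bump a b (- 1) 0 t\<bar> \<le> M1" "\<bar>step a b t\<bar> \<le> M2" "\<bar>U t\<bar> \<le> M3" using M t by auto
    have m0: "0 \<le> M1" "0 \<le> M2" using m by linarith+
    have "norm (h t) = ?D * \<bar>bump a b (- 1) 0 t * U t + step a b t * g t\<bar>" by (simp add: h_def abs_mult)
    also have "\<dots> \<le> ?D * (\<bar>bump a b (- 1) 0 t\<bar> * \<bar>U t\<bar> + \<bar>step a b t\<bar> * \<bar>g t\<bar>)"
      by (intro mult_left_mono order_trans[OF abs_triangle_ineq]) (simp_all add: abs_mult)
    also have "\<dots> \<le> ?D * (M1 * M3 + M2 * B)"
      using m m0 gB t ab by (intro mult_left_mono add_mono mult_mono) auto
    finally show ?thesis .
  qed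
  have "integrable (lebesgue_on {0<..<T}) h"
  proof (rule integrableI_bounded_set[where A="{0<..<T}" and B="?D * (M1 * M3 + M2 * B)"])
    show "AE t in lebesgue_on {0<..<T}. t \<in> {0<..<T} \<longrightarrow> norm (h t) \<le> ?D * (M1 * M3 + M2 * B)"
    proof (intro AE_I2 impI)
      fix t assume t: "t \<in> {0<..<T}"
      have "0 \<le> ?D * (M1 * M3 + M2 * B)" using hB[of b] ab norm_ge_zero order_trans by (metis atLeastAtMost_iff less_imp_le order_refl less_trans)
      then show "norm (h t) \<le> ?D * (M1 * M3 + M2 * B)" using hB[of t] h0[of t] t by (cases "t \<le> b") auto
    qed
  qed (use hm T in \<open>auto simp: emeasure_restrict_space\<close>)
  then have "(\<integral>t. h t \<partial>lebesgue_on {0<..<T}) = integral {0<..<T} h"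
    by (rule lebesgue_integral_eq_integral) simp
  also have "\<dots> = integral UNIV (\<lambda>t. if t \<in> {0<..<T} then h t else 0)" by (rule integral_restrict_UNIV[symmetric])
  \<comment> \<open>The range shrinks to [0, b] since the integrand vanishes from b on; the added
    endpoint 0 is a null set.\<close>
  also have "\<dots> = integral UNIV (\<lambda>t. if t \<in> {0..b} then h t else 0)"
    by (rule integral_spike[of "{0}"]) (use ab h0 in auto)
  also have "\<dots> = integral {0..b} h" by (rule integral_restrict_UNIV)
  also have "\<dots> = ?D * integral {0..b} (\<lambda>t. bump a b (- 1) 0 t * U t + step a b t * g t)"
    unfolding h_def by (rule integral_mult_right)
  finally have "?D * integral {0..b} (\<lambda>t. bump a b (- 1) 0 t * U t + step a b t * g t) = ?D * (- step a b 0 * U 0)"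
    using hF by simp
  then show ?thesis by (subst (asm) mult_cancel_left) simp
qed

text \<open>Du Bois-Reymond applied to each real coordinate of the coefficient.\<close>

lemma weak_solution_mode_equation:
  assumes w: "weak_solution \<nu> \<alpha> u0 T u" and \<nu>: "\<nu> > 0" and \<alpha>: "\<alpha> > 0" and u0: "torus_L2 u0" and t: "t \<in> {0..<T}"
  shows "fourier (u t) k = fourier (u 0) k + integral {0..t} (mode_rhs \<nu> \<alpha> (\<lambda>t. fourier (u t)) k)"
proof (rule euclidean_eqI)
  fix d :: "complex^3" assume d: "d \<in> Basis"
  have T: "T > 0" using t by auto
  let ?r = "mode_rhs \<nu> \<alpha> (\<lambda>t. fourier (u t)) k"
  note rm = weak_solution_mode_rhs(1)[OF w \<nu> T, of _ k]
  obtain B where B: "\<forall>t\<in>{0..<T}. norm (?r t) \<le> B" using weak_solution_mode_rhs(2)[OF w \<nu> T] by blast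
  have "fourier (u t) k \<bullet> d = fourier (u 0) k \<bullet> d + integral {0..t} (\<lambda>t. ?r t \<bullet> d)"
  proof (rule weak_derivative_integral[where B=B and T=T])
    show "continuous_on {0..<T} (\<lambda>t. fourier (u t) k \<bullet> d)"
      by (intro continuous_intros weak_solution_continuous[OF w])
    show "(\<lambda>t. ?r t \<bullet> d) \<in> borel_measurable (lebesgue_on {0..b})" if "b < T" for b
    proof -
      have "?r \<in> borel_measurable (lebesgue_on {0..b})" using that by (intro rm) auto
      then show ?thesis by measurable
    qed
    show "norm (?r t \<bullet> d) \<le> B" if "t \<in> {0..<T}" for t
      using Basis_le_norm[OF d, of "?r t"] B that by force
    show "integral {0..b} (\<lambda>t. bump a b (- 1) 0 t * (fourier (u t) k \<bullet> d) + step a b t * (?r t \<bullet> d)) = - step a b 0 * (fourier (u 0) k \<bullet> d)"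
      if "0 < a" "a < b" "b < T" for a b
      by (rule weak_form_mode[OF w \<nu> \<alpha> u0 that d])
  qed (rule t)
  moreover have "?r integrable_on {0..t}"
    using t B by (intro bounded_measurable_integrable_on[where B=B] rm) auto
  from integral_linear[OF this bounded_linear_inner_left[of d]]
  have "integral {0..t} (\<lambda>t. ?r t \<bullet> d) = integral {0..t} ?r \<bullet> d" by (simp add: o_def)
  ultimately show "fourier (u t) k \<bullet> d = (fourier (u 0) k + integral {0..t} ?r) \<bullet> d"
    by (simp add: inner_add_left)
qed

text \<open>The Sobolev norm dominates. Measurability comes from the partial sums over cubes,
  continuous in time, whose limit is the sum at every time where it converges.\<close>

lemma weak_solution_hsum_integrable:
  assumes w: "weak_solution \<nu> \<alpha> u0 T u" and \<alpha>: "\<alpha> > 0"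
  shows "integrable (lebesgue_on {0<..<T}) (\<lambda>t. hsum (2 * \<alpha>) (fourier (u t)))"
proof (rule Bochner_Integration.integrable_bound)
  show "integrable (lebesgue_on {0<..<T}) (\<lambda>t. (Hs_norm \<alpha> (u t))\<^sup>2)" using w by (simp add: weak_solution_def L2_Hs_def)
  let ?G = "\<lambda>n t. \<Sum>k\<in>modes n. norm (freq k) powr (2 * \<alpha>) * (norm (fourier (u t) k))\<^sup>2"
  have I: "{0<..<T} \<in> sets lebesgue" "{0<..<T} \<subseteq> {0..<T}" by auto
  have "?G n \<in> borel_measurable (lebesgue_on {0<..<T})" for n
    by (intro continuous_imp_measurable_on_sets_lebesgue I continuous_intros continuous_on_subset[OF weak_solution_continuous[OF w]])
  then have Gm: "(\<lambda>t. lim (\<lambda>n. ?G n t)) \<in> borel_measurable (lebesgue_on {0<..<T})" by (rule borel_measurable_lim_metric)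
  show "(\<lambda>t. hsum (2 * \<alpha>) (fourier (u t))) \<in> borel_measurable (lebesgue_on {0<..<T})"
  proof (rule AE_lebesgue_on_measurable[OF Gm I(1)])
    show "AE t in lebesgue_on {0<..<T}. lim (\<lambda>n. ?G n t) = hsum (2 * \<alpha>) (fourier (u t))"
      using weak_solution_AE_hs[OF w \<alpha>]
      by eventually_elim (unfold hs_def hsum_def, intro limI tendsto_sum_modes has_sum_infsum)
  qed
  have "AE t in lebesgue_on {0<..<T}. in_Hs \<alpha> (u t)" using w by (simp add: weak_solution_def L2_Hs_def)
  then show "AE t in lebesgue_on {0<..<T}. norm (hsum (2 * \<alpha>) (fourier (u t))) \<le> norm ((Hs_norm \<alpha> (u t))\<^sup>2)"
    by eventually_elim (use in_Hs_hs(2)[OF _ \<alpha>] hsum_nonneg in \<open>simp\<close>)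
qed

text \<open>By Parseval all terms acquire the common factor (2\<pi>)^3, which cancels. The second
  part passes to the gauge integral that \<open>mode_solution\<close> uses.\<close>

lemma energy_ineq_modes:
  assumes w: "weak_solution \<nu> \<alpha> u0 T u" and \<alpha>: "\<alpha> > 0" and \<tau>: "0 \<le> \<tau>" "\<tau> \<le> t" "t < T"
    and e: "energy_ineq \<nu> \<alpha> u \<tau> t"
  shows "l2sum (fourier (u t)) + 2 * \<nu> * (\<integral>s. hsum (2 * \<alpha>) (fourier (u s)) \<partial>lebesgue_on {\<tau><..<t}) \<le> l2sum (fourier (u \<tau>))"
    and "(\<integral>s. hsum (2 * \<alpha>) (fourier (u s)) \<partial>lebesgue_on {\<tau><..<t}) = integral {\<tau>..t} (\<lambda>s. hsum (2 * \<alpha>) (fourier (u s)))"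
proof -
  let ?D = "(2 * pi) ^ 3 :: real"
  let ?H = "\<lambda>s. hsum (2 * \<alpha>) (fourier (u s))"
  have I: "{0<..<T} \<in> sets lebesgue" "{\<tau><..<t} \<in> sets lebesgue" "{\<tau><..<t} \<subseteq> {0<..<T}" using \<tau> by auto
  have int: "integrable (lebesgue_on {\<tau><..<t}) ?H"
    by (rule integrable_lebesgue_on_subset[OF weak_solution_hsum_integrable[OF w \<alpha>] I])
  have ae: "AE s in lebesgue_on {\<tau><..<t}. ?D * ?H s = (L2_norm_torus (Lam \<alpha> (u s)))\<^sup>2"
    using AE_lebesgue_on_subset[OF weak_solution_AE_hs[OF w \<alpha>] I]
    by eventually_elim (rule L2_norm_Lam[symmetric])
  have m: "(\<lambda>s. ?D * ?H s) \<in> borel_measurable (lebesgue_on {\<tau><..<t})" using int by measurable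
  have "(\<integral>s. (L2_norm_torus (Lam \<alpha> (u s)))\<^sup>2 \<partial>lebesgue_on {\<tau><..<t}) = (\<integral>s. ?D * ?H s \<partial>lebesgue_on {\<tau><..<t})"
    using ae by (intro integral_cong_AE m AE_lebesgue_on_measurable[OF m I(2) ae]) (auto elim!: eventually_mono)
  also have "\<dots> = ?D * (\<integral>s. ?H s \<partial>lebesgue_on {\<tau><..<t})" by (rule integral_mult_right_zero)
  finally have eq: "(\<integral>s. (L2_norm_torus (Lam \<alpha> (u s)))\<^sup>2 \<partial>lebesgue_on {\<tau><..<t}) = ?D * (\<integral>s. ?H s \<partial>lebesgue_on {\<tau><..<t})" .
  have \<tau>T: "\<tau> \<in> {0..<T}" and tT: "t \<in> {0..<T}" using \<tau> by auto
  have "?D * (l2sum (fourier (u t)) + 2 * \<nu> * (\<integral>s. ?H s \<partial>lebesgue_on {\<tau><..<t})) \<le> ?D * l2sum (fourier (u \<tau>))"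
    using e unfolding energy_ineq_def eq l2sum_fourier[OF weak_solution_L2[OF w \<tau>T]] l2sum_fourier[OF weak_solution_L2[OF w tT]]
    by (simp only: distrib_left mult.left_commute[of ?D] mult.assoc)
  then show "l2sum (fourier (u t)) + 2 * \<nu> * (\<integral>s. ?H s \<partial>lebesgue_on {\<tau><..<t}) \<le> l2sum (fourier (u \<tau>))"
    by (subst (asm) mult_le_cancel_left_pos) auto
  show "(\<integral>s. ?H s \<partial>lebesgue_on {\<tau><..<t}) = integral {\<tau>..t} ?H"
    using lebesgue_integral_eq_integral[OF int I(2)] integral_open_interval_real[of \<tau> t ?H] by simp
qed

text \<open>The energy inequality started at \<tau> is a hypothesis, since it is granted for almost
  every starting time only.\<close>

lemma weak_solution_mode_solution:
  assumes w: "weak_solution \<nu> \<alpha> u0 T u" and \<nu>: "\<nu> > 0" and \<alpha>: "\<alpha> > 0" and u0: "torus_L2 u0"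
    and \<tau>: "0 < \<tau>" "\<tau> \<le> T'" "T' < T" and e: "\<And>t. t \<in> {\<tau>..<T} \<Longrightarrow> energy_ineq \<nu> \<alpha> u \<tau> t"
  shows "mode_solution \<nu> \<alpha> \<tau> T' (\<lambda>t. fourier (u t))"
  unfolding mode_solution_def
proof (intro conjI ballI allI)
  have T: "T > 0" using \<tau> by linarith
  have sub: "{\<tau>..T'} \<subseteq> {0<..<T}" "{\<tau>..T'} \<subseteq> {0..<T}" using \<tau> by auto
  show "l2 (fourier (u t))" "solenoidal (fourier (u t))" "real_seq (fourier (u t))" if "t \<in> {\<tau>..T'}" for t
    using l2_fourier[OF weak_solution_L2[OF w]] weak_solution_solenoidal[OF w] real_seq_fourier that sub by auto
  have "AE t in lebesgue. t \<in> {0<..<T} \<longrightarrow> hs (2 * \<alpha>) (fourier (u t))"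
    using weak_solution_AE_hs[OF w \<alpha>] by (subst (asm) AE_restrict_space_iff) auto
  then obtain N where N: "{t \<in> space lebesgue. \<not> (t \<in> {0<..<T} \<longrightarrow> hs (2 * \<alpha>) (fourier (u t)))} \<subseteq> N"
     "emeasure lebesgue N = 0" "N \<in> sets lebesgue" by (rule AE_E)
  have "negligible N" unfolding negligible_iff_null_sets using N by auto
  moreover have "\<forall>t\<in>{\<tau>..T'} - N. hs (2 * \<alpha>) (fourier (u t))"
  proof
    fix t assume t: "t \<in> {\<tau>..T'} - N"
    then have "t \<in> {0<..<T}" using sub(1) by blast
    then show "hs (2 * \<alpha>) (fourier (u t))" using t N(1) by auto
  qed
  ultimately show "\<exists>N. negligible N \<and> (\<forall>t\<in>{\<tau>..T'} - N. hs (2 * \<alpha>) (fourier (u t)))" by blast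
  have "integrable (lebesgue_on {\<tau>..T'}) (\<lambda>t. hsum (2 * \<alpha>) (fourier (u t)))"
    by (rule integrable_lebesgue_on_subset[OF weak_solution_hsum_integrable[OF w \<alpha>] _ _ sub(1)]) auto
  then show "(\<lambda>t. hsum (2 * \<alpha>) (fourier (u t))) integrable_on {\<tau>..T'}"
    by (rule integrable_on_lebesgue_on) simp
  show "l2sum (fourier (u t)) + 2 * \<nu> * integral {\<tau>..t} (\<lambda>s. hsum (2 * \<alpha>) (fourier (u s))) \<le> l2sum (fourier (u \<tau>))"
    if t: "t \<in> {\<tau>..T'}" for t
  proof -
    have tt: "0 \<le> \<tau>" "\<tau> \<le> t" "t < T" "t \<in> {\<tau>..<T}" using t \<tau> by auto
    show ?thesis using energy_ineq_modes[OF w \<alpha> tt(1-3) e[OF tt(4)]] by simp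
  qed
  fix k
  let ?r = "mode_rhs \<nu> \<alpha> (\<lambda>t. fourier (u t)) k"
  note rm = weak_solution_mode_rhs(1)[OF w \<nu> T, of _ k]
  show "?r \<in> borel_measurable (lebesgue_on {\<tau>..T'})" by (rule rm[OF sub(2)]) simp
  obtain B where B: "\<forall>t\<in>{0..<T}. norm (?r t) \<le> B" using weak_solution_mode_rhs(2)[OF w \<nu> T] by blast
  show "\<exists>B. \<forall>t\<in>{\<tau>..T'}. norm (?r t) \<le> B" using B sub(2) by blast
  show "fourier (u t) k = fourier (u \<tau>) k + integral {\<tau>..t} ?r" if t: "t \<in> {\<tau>..T'}" for t
  proof -
    have "?r integrable_on {0..t}" using t \<tau> B by (intro bounded_measurable_integrable_on[where B=B] rm) auto
    then have "integral {0..\<tau>} ?r + integral {\<tau>..t} ?r = integral {0..t} ?r"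
      using t \<tau> by (intro Henstock_Kurzweil_Integration.integral_combine) auto
    moreover have "fourier (u t) k = fourier (u 0) k + integral {0..t} ?r" "fourier (u \<tau>) k = fourier (u 0) k + integral {0..\<tau>} ?r"
      using t \<tau> by (intro weak_solution_mode_equation[OF w \<nu> \<alpha> u0]; auto)+
    ultimately show ?thesis by (simp add: add.assoc)
  qed
qed

section \<open>Eventual regularity\<close>

lemma one_plus_power2_powr_le:
  assumes "k \<noteq> 0" "s \<ge> 0"
  shows "(1 + (norm (freq k))\<^sup>2) powr s \<le> 2 powr s * norm (freq k) powr (2 * s)"
proof -
  have n: "1 \<le> norm (freq k)" by (rule norm_freq_ge_1[OF assms(1)])
  then have "1\<^sup>2 \<le> (norm (freq k))\<^sup>2" by (intro power_mono) auto
  then have "(1 + (norm (freq k))\<^sup>2) powr s \<le> (2 * (norm (freq k))\<^sup>2) powr s"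
    using assms(2) by (intro powr_mono2) auto
  also have "\<dots> = 2 powr s * ((norm (freq k))\<^sup>2) powr s" by (rule powr_mult)
  also have "((norm (freq k))\<^sup>2) powr s = norm (freq k) powr (2 * s)"
    using n by (simp add: powr_powr flip: powr_numeral)
  finally show ?thesis .
qed

text \<open>Zero average removes k = 0, and for |k| \<ge> 1 the weight 1 + |k|^2 is at most
  2|k|^2.\<close>

lemma inhomogeneous_sum_le:
  assumes z: "a 0 = 0" and s: "s \<ge> 0" and F: "finite F"
    and le: "(\<Sum>k\<in>F. norm (freq k) powr (2 * s) * (norm (a k))\<^sup>2) \<le> A"
  shows "(\<Sum>k\<in>F. (1 + (norm (freq k))\<^sup>2) powr s * (norm (a k :: complex^3))\<^sup>2) \<le> 2 powr s * A"
proof -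
  have "(\<Sum>k\<in>F. (1 + (norm (freq k))\<^sup>2) powr s * (norm (a k))\<^sup>2) \<le> (\<Sum>k\<in>F. 2 powr s * (norm (freq k) powr (2 * s) * (norm (a k))\<^sup>2))"
  proof (rule sum_mono)
    fix k
    show "(1 + (norm (freq k))\<^sup>2) powr s * (norm (a k))\<^sup>2 \<le> 2 powr s * (norm (freq k) powr (2 * s) * (norm (a k))\<^sup>2)"
    proof (cases "k = 0")
      case False
      then show ?thesis unfolding mult.assoc[symmetric] by (intro mult_right_mono one_plus_power2_powr_le s) auto
    qed (simp add: z)
  qed
  also have "\<dots> = 2 powr s * (\<Sum>k\<in>F. norm (freq k) powr (2 * s) * (norm (a k))\<^sup>2)" by (simp add: sum_distrib_left)
  also have "\<dots> \<le> 2 powr s * A" by (intro mult_left_mono le) simp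
  finally show ?thesis .
qed

lemma in_Hs_of_bounded_sums:
  assumes f: "torus_L2 f" and b: "\<And>F. finite F \<Longrightarrow> (\<Sum>k\<in>F. (1 + (norm (freq k))\<^sup>2) powr s * (norm (fourier f k))\<^sup>2) \<le> A"
  shows "in_Hs s f" "(Hs_norm s f)\<^sup>2 \<le> A"
    "(\<lambda>n. \<Sum>k\<in>modes n. (1 + (norm (freq k))\<^sup>2) powr s * (norm (fourier f k))\<^sup>2) \<longlonglongrightarrow> (Hs_norm s f)\<^sup>2"
proof -
  let ?f = "\<lambda>k. (1 + (norm (freq k))\<^sup>2) powr s * (norm (fourier f k))\<^sup>2"
  have s: "?f summable_on UNIV"
  proof (rule nonneg_bdd_above_summable_on)
    show "bdd_above (sum ?f ` {F. F \<subseteq> UNIV \<and> finite F})" by (rule bdd_aboveI2[where M=A]) (use b in auto)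
  qed simp
  then show "in_Hs s f" using f by (simp add: in_Hs_def)
  have H: "(Hs_norm s f)\<^sup>2 = infsum ?f UNIV"
    unfolding Hs_norm_def by (rule real_sqrt_pow2) (rule infsum_nonneg, simp)
  show "(Hs_norm s f)\<^sup>2 \<le> A" unfolding H by (rule infsum_le_finite_sums[OF s b])
  show "(\<lambda>n. sum ?f (modes n)) \<longlonglongrightarrow> (Hs_norm s f)\<^sup>2"
    unfolding H by (rule tendsto_sum_modes[OF has_sum_infsum[OF s]])
qed

lemma weak_solution_time_measurable:
  assumes w: "weak_solution \<nu> \<alpha> u0 T u" and "{a<..<b} \<subseteq> {0..<T}"
  shows "time_measurable a b u"
  unfolding time_measurable_def
proof (intro allI impI)
  fix \<psi> assume "torus_L2 \<psi>"
  then have "continuous_on {0..<T} (\<lambda>t. torus_inner (u t) \<psi>)"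
    using w by (simp add: weak_solution_def weakly_continuous_def)
  then have "continuous_on {a<..<b} (\<lambda>t. torus_inner (u t) \<psi>)" by (rule continuous_on_subset[OF _ assms(2)])
  then show "(\<lambda>t. torus_inner (u t) \<psi>) \<in> borel_measurable (lebesgue_on {a<..<b})"
    by (rule continuous_imp_measurable_on_sets_lebesgue) simp
qed

text \<open>Monotone convergence over the cubes: the integrals of the partial sums are bounded
  uniformly, so their supremum is finite at almost every time, which gives membership in H^s there.
  The limit of the partial sums also makes the norm measurable.\<close>

lemma L2_Hs_of_bounded_sums:
  assumes w: "weak_solution \<nu> \<alpha> u0 T u" and I: "{a..b} \<subseteq> {0..<T}" "a \<le> a'" and s: "s \<ge> 0"
    and bnd: "\<And>F. finite F \<Longrightarrow> integral {a..b} (\<lambda>t. \<Sum>k\<in>F. norm (freq k) powr (2 * s) * (norm (fourier (u t) k))\<^sup>2) \<le> A"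
  shows "L2_Hs a' b s u"
proof -
  let ?I = "{a'<..<b}"
  have I': "?I \<subseteq> {a..b}" "?I \<in> sets lebesgue" "?I \<subseteq> {0..<T}" using I by auto
  define G where "G n t = (\<Sum>k\<in>modes n. (1 + (norm (freq k))\<^sup>2) powr s * (norm (fourier (u t) k))\<^sup>2)" for n t
  have Gc: "continuous_on S (G n)" if "S \<subseteq> {0..<T}" for S n
    unfolding G_def by (intro continuous_intros continuous_on_subset[OF weak_solution_continuous[OF w] that])
  have Gm [measurable]: "G n \<in> borel_measurable (lebesgue_on ?I)" for n
    by (intro continuous_imp_measurable_on_sets_lebesgue Gc I')
  have G0: "G n t \<ge> 0" for n t unfolding G_def by (intro sum_nonneg) auto
  have Gle: "integral {a..b} (G n) \<le> 2 powr s * A" for n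
  proof -
    let ?h = "\<lambda>t. \<Sum>k\<in>modes n. norm (freq k) powr (2 * s) * (norm (fourier (u t) k))\<^sup>2"
    have hi: "?h integrable_on {a..b}"
      by (intro integrable_continuous_real continuous_intros continuous_on_subset[OF weak_solution_continuous[OF w] I(1)])
    have "integral {a..b} (G n) \<le> integral {a..b} (\<lambda>t. 2 powr s * ?h t)"
    proof (rule integral_le)
      show "G n integrable_on {a..b}" by (intro integrable_continuous_real Gc I(1))
      show "(\<lambda>t. 2 powr s * ?h t) integrable_on {a..b}" using hi by (rule integrable_on_mult_right)
      show "G n t \<le> 2 powr s * ?h t" if "t \<in> {a..b}" for t
        unfolding G_def
        by (rule inhomogeneous_sum_le[OF _ s finite_modes order_refl])
           (use weak_solution_solenoidal[OF w subsetD[OF I(1) that]] in \<open>simp add: solenoidal_def\<close>)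
    qed
    also have "\<dots> = 2 powr s * integral {a..b} ?h" by (rule integral_mult_right)
    also have "\<dots> \<le> 2 powr s * A" by (intro mult_left_mono bnd) auto
    finally show ?thesis .
  qed
  have nn: "(\<integral>\<^sup>+t. ennreal (G n t) \<partial>lebesgue_on ?I) \<le> ennreal (2 powr s * A)" for n
  proof -
    have ab: "integrable (lebesgue_on {a..b}) (G n)"
      using Gc[OF I(1)] by (rule continuous_imp_integrable_real)
    have int: "integrable (lebesgue_on ?I) (G n)"
      by (rule integrable_lebesgue_on_subset[OF ab _ I'(2) I'(1)]) simp
    have "(\<integral>\<^sup>+t. ennreal (G n t) \<partial>lebesgue_on ?I) = ennreal (\<integral>t. G n t \<partial>lebesgue_on ?I)"
      by (rule nn_integral_eq_integral[OF int]) (simp add: G0)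
    also have "(\<integral>t. G n t \<partial>lebesgue_on ?I) = integral ?I (G n)"
      by (rule lebesgue_integral_eq_integral[OF int I'(2)])
    also have "\<dots> \<le> integral {a..b} (G n)"
      using G0 by (intro integral_subset_le I' integrable_on_lebesgue_on[OF int I'(2)] integrable_continuous_real Gc I(1)) auto
    also have "\<dots> \<le> 2 powr s * A" by (rule Gle)
    finally show ?thesis by (simp add: ennreal_leI)
  qed
  have inc: "incseq (\<lambda>n t. ennreal (G n t))"
    unfolding incseq_def le_fun_def G_def by (auto intro!: ennreal_leI sum_mono2 modes_mono)
  have "(\<integral>\<^sup>+t. (SUP n. ennreal (G n t)) \<partial>lebesgue_on ?I) = (SUP n. \<integral>\<^sup>+t. ennreal (G n t) \<partial>lebesgue_on ?I)"
    by (rule nn_integral_monotone_convergence_SUP[OF inc]) measurable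
  also have "\<dots> \<le> ennreal (2 powr s * A)" by (rule SUP_least) (rule nn)
  finally have SUPle: "(\<integral>\<^sup>+t. (SUP n. ennreal (G n t)) \<partial>lebesgue_on ?I) \<le> ennreal (2 powr s * A)" .
  then have "(\<integral>\<^sup>+t. (SUP n. ennreal (G n t)) \<partial>lebesgue_on ?I) \<noteq> \<infinity>" by (auto simp: top_unique)
  then have ae: "AE t in lebesgue_on ?I. (SUP n. ennreal (G n t)) \<noteq> \<infinity>"
    by (intro nn_integral_PInf_AE) auto
  have good: "in_Hs s (u t) \<and> ennreal ((Hs_norm s (u t))\<^sup>2) \<le> (SUP n. ennreal (G n t)) \<and> lim (\<lambda>n. G n t) = (Hs_norm s (u t))\<^sup>2"
    if t: "t \<in> ?I" and fin: "(SUP n. ennreal (G n t)) \<noteq> \<infinity>" for t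
  proof -
    obtain r where r: "r \<ge> 0" "(SUP n. ennreal (G n t)) = ennreal r" using fin by (cases "SUP n. ennreal (G n t)") auto
    have Gr: "G n t \<le> r" for n
    proof -
      have "ennreal (G n t) \<le> ennreal r" unfolding r(2)[symmetric] by (rule SUP_upper) simp
      then show ?thesis using r(1) by simp
    qed
    have b: "(\<Sum>k\<in>F. (1 + (norm (freq k))\<^sup>2) powr s * (norm (fourier (u t) k))\<^sup>2) \<le> r" if F: "finite F" for F
    proof -
      have "\<forall>\<^sub>F n in sequentially. F \<subseteq> modes n"
        using filterlim_modes F unfolding filterlim_finite_subsets_at_top by (auto elim!: eventually_mono)
      then obtain n where "F \<subseteq> modes n" by (auto simp: eventually_sequentially)
      then have "(\<Sum>k\<in>F. (1 + (norm (freq k))\<^sup>2) powr s * (norm (fourier (u t) k))\<^sup>2) \<le> G n t"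
        unfolding G_def by (intro sum_mono2) auto
      then show ?thesis using Gr[of n] by linarith
    qed
    note H = in_Hs_of_bounded_sums[OF weak_solution_L2[OF w subsetD[OF I'(3) t]] b]
    have "lim (\<lambda>n. G n t) = (Hs_norm s (u t))\<^sup>2" using H(3) unfolding G_def by (rule limI)
    moreover have "ennreal ((Hs_norm s (u t))\<^sup>2) \<le> ennreal r" using H(2) by (rule ennreal_leI)
    ultimately show ?thesis using H(1) r(2) by simp
  qed
  have ae1: "AE t in lebesgue_on ?I. in_Hs s (u t) \<and> ennreal ((Hs_norm s (u t))\<^sup>2) \<le> (SUP n. ennreal (G n t)) \<and> lim (\<lambda>n. G n t) = (Hs_norm s (u t))\<^sup>2"
    using ae AE_space
  proof eventually_elim
    case (elim t)
    then have "t \<in> ?I" by simp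
    then show ?case using elim(1) by (rule good)
  qed
  have "(\<lambda>t. lim (\<lambda>n. G n t)) \<in> borel_measurable (lebesgue_on ?I)" by (rule borel_measurable_lim_metric) measurable
  then have Hm: "(\<lambda>t. (Hs_norm s (u t))\<^sup>2) \<in> borel_measurable (lebesgue_on ?I)"
    by (rule AE_lebesgue_on_measurable[OF _ I'(2)]) (use ae1 in eventually_elim, simp)
  have "integrable (lebesgue_on ?I) (\<lambda>t. (Hs_norm s (u t))\<^sup>2)"
  proof (rule integrableI_nonneg[OF Hm])
    have "(\<integral>\<^sup>+t. ennreal ((Hs_norm s (u t))\<^sup>2) \<partial>lebesgue_on ?I) \<le> (\<integral>\<^sup>+t. (SUP n. ennreal (G n t)) \<partial>lebesgue_on ?I)"
      by (rule nn_integral_mono_AE) (use ae1 in eventually_elim, simp)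
    also have "\<dots> < \<infinity>" using SUPle by (simp add: le_less_trans)
    finally show "(\<integral>\<^sup>+t. ennreal ((Hs_norm s (u t))\<^sup>2) \<partial>lebesgue_on ?I) < \<infinity>" .
  qed simp
  moreover have "AE t in lebesgue_on ?I. in_Hs s (u t)" using ae1 by eventually_elim simp
  ultimately show ?thesis
    unfolding L2_Hs_def using weak_solution_time_measurable[OF w I'(3)] by simp
qed

text \<open>If the dissipation rate stayed above \<open>e\<close> at almost every time before
  \<open>Ts\<close>, more energy would be dissipated than there is initially.\<close>

lemma exists_small_time:
  assumes w: "\<And>T. T > 0 \<Longrightarrow> weak_solution \<nu> \<alpha> u0 T u" and \<nu>: "\<nu> > 0" and \<alpha>: "\<alpha> > 0" and u0: "torus_L2 u0"
    and e: "e > 0" and Ts: "Ts > 0" "l2sum (fourier u0) < 2 * \<nu> * e * Ts"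
  obtains \<tau> where "0 < \<tau>" "\<tau> < Ts" "hs (2 * \<alpha>) (fourier (u \<tau>))" "hsum (2 * \<alpha>) (fourier (u \<tau>)) \<le> e"
    "\<And>t. t \<ge> \<tau> \<Longrightarrow> energy_ineq \<nu> \<alpha> u \<tau> t"
proof -
  define Q where "Q \<tau> \<longleftrightarrow> hs (2 * \<alpha>) (fourier (u \<tau>)) \<and> (\<forall>t\<ge>\<tau>. energy_ineq \<nu> \<alpha> u \<tau> t)" for \<tau>
  \<comment> \<open>The null set of exceptional starting times depends on the horizon; countably
    many horizons Ts + n reach all later t.\<close>
  have "AE \<tau> in lebesgue_on {0<..<Ts}. \<forall>n. \<forall>t\<in>{\<tau>..<Ts + real n}. energy_ineq \<nu> \<alpha> u \<tau> t"
  proof (rule AE_all_countable[THEN iffD2], rule allI)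
    fix n
    have "Ts + real n > 0" using Ts(1) by simp
    then have "AE \<tau> in lebesgue_on {0<..<Ts + real n}. \<forall>t\<in>{\<tau>..<Ts + real n}. energy_ineq \<nu> \<alpha> u \<tau> t"
      using w by (simp add: weak_solution_def)
    then show "AE \<tau> in lebesgue_on {0<..<Ts}. \<forall>t\<in>{\<tau>..<Ts + real n}. energy_ineq \<nu> \<alpha> u \<tau> t"
      by (rule AE_lebesgue_on_subset) auto
  qed
  moreover have "AE \<tau> in lebesgue_on {0<..<Ts}. hs (2 * \<alpha>) (fourier (u \<tau>))"
    by (rule weak_solution_AE_hs[OF w[OF Ts(1)] \<alpha>])
  ultimately have aeQ: "AE \<tau> in lebesgue_on {0<..<Ts}. Q \<tau>"
  proof eventually_elim
    case (elim \<tau>)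
    have "energy_ineq \<nu> \<alpha> u \<tau> t" if t: "t \<ge> \<tau>" for t
    proof -
      obtain n where "t - Ts < real n" using reals_Archimedean2 by blast
      then have "t \<in> {\<tau>..<Ts + real n}" using t by auto
      then show ?thesis using elim(1) by blast
    qed
    then show ?case using elim(2) by (simp add: Q_def)
  qed
  have "\<exists>\<tau>\<in>{0<..<Ts}. Q \<tau> \<and> hsum (2 * \<alpha>) (fourier (u \<tau>)) \<le> e"
  proof (rule ccontr)
    assume n: "\<not> ?thesis"
    have W: "weak_solution \<nu> \<alpha> u0 (Ts + 1) u" using Ts(1) by (intro w) simp
    have "AE s in lebesgue_on {0<..<Ts}. e \<le> hsum (2 * \<alpha>) (fourier (u s))"
      using aeQ AE_space
    proof eventually_elim
      case (elim s)
      then have "s \<in> {0<..<Ts}" by simp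
      then show ?case using n elim(1) by force
    qed
    then have i1: "(\<integral>s. e \<partial>lebesgue_on {0<..<Ts}) \<le> (\<integral>s. hsum (2 * \<alpha>) (fourier (u s)) \<partial>lebesgue_on {0<..<Ts})"
      by (intro integral_mono_AE weak_solution_hsum_integrable[OF w[OF Ts(1)] \<alpha>])
         (auto intro!: finite_measure.integrable_const finite_measure_lebesgue_on)
    have i2: "(\<integral>s. e \<partial>lebesgue_on {0<..<Ts}) = e * Ts"
      using Ts(1) by (simp add: measure_restrict_space)
    have "2 * \<nu> * (e * Ts) \<le> 2 * \<nu> * (\<integral>s. hsum (2 * \<alpha>) (fourier (u s)) \<partial>lebesgue_on {0<..<Ts})"
      by (rule mult_left_mono[OF i1[unfolded i2]]) (use \<nu> in simp)
    moreover have "l2sum (fourier (u Ts)) + 2 * \<nu> * (\<integral>s. hsum (2 * \<alpha>) (fourier (u s)) \<partial>lebesgue_on {0<..<Ts}) \<le> l2sum (fourier (u 0))"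
      using Ts(1) W by (intro energy_ineq_modes(1)[OF W \<alpha>]) (auto simp: weak_solution_def)
    moreover have "fourier (u 0) = fourier u0"
      using W Ts(1) by (intro fourier_cong_AE u0 weak_solution_L2[OF W]) (auto simp: weak_solution_def)
    ultimately show False using Ts(2) l2sum_nonneg[of "fourier (u Ts)"] by (simp add: mult.assoc)
  qed
  then show thesis using that unfolding Q_def by auto
qed

theorem theorem2p2:
  fixes \<nu> \<alpha> :: real and u0 :: "real^3 \<Rightarrow> real^3"
  assumes "\<nu> > 0" and "5 / 6 \<le> \<alpha>" and "\<alpha> < 5 / 4"
    and "torus_L2 u0" and "div_free u0" and "zero_average u0"
  shows "\<exists>Tstar>0. \<forall>u. global_weak_solution \<nu> \<alpha> u0 u \<longrightarrow> strong_after \<alpha> Tstar u"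
proof -
  have \<alpha>: "\<alpha> > 0" using assms(2) by simp
  \<comment> \<open>2\<alpha> - 1 < 3/2 means \<alpha> < 5/4, and \<alpha> + (2\<alpha> - 1) \<ge>
    3/2 means \<alpha> \<ge> 5/6.\<close>
  obtain C where C: "C > 0" "trilinear_bounded (\<lambda>p q. p \<noteq> 0 \<and> q \<noteq> 0) \<alpha> (2 * \<alpha> - 1) C"
    using trilinear_bound[of \<alpha> "2 * \<alpha> - 1"] assms(2,3) by auto
  \<comment> \<open>Equality in the smallness condition 16 C e \<le> \<nu>^2, which the iteration
    and the comparison share.\<close>
  define e where "e = \<nu>\<^sup>2 / (16 * C)"
  have e: "e > 0" "16 * C * e \<le> \<nu>\<^sup>2" using C(1) assms(1) by (simp_all add: e_def)
  \<comment> \<open>Depends on the solution through \<open>u0\<close> only. The added 1 makes the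
    energy budget strict, and \<open>Ts\<close> positive even for zero data.\<close>
  define Ts where "Ts = l2sum (fourier u0) / (2 * \<nu> * e) + 1"
  have Ts: "Ts > 0" using l2sum_nonneg[of "fourier u0"] e(1) assms(1) by (simp add: Ts_def add_nonneg_pos)
  have "2 * \<nu> * e * Ts = l2sum (fourier u0) + 2 * \<nu> * e" using e(1) assms(1) by (simp add: Ts_def field_simps)
  then have small: "l2sum (fourier u0) < 2 * \<nu> * e * Ts" using e(1) assms(1) by simp
  have "strong_after \<alpha> Ts u" if g: "global_weak_solution \<nu> \<alpha> u0 u" for u
  proof -
    have w: "weak_solution \<nu> \<alpha> u0 T u" if "T > 0" for T using g that by (simp add: global_weak_solution_def)
    obtain \<tau> where \<tau>: "0 < \<tau>" "\<tau> < Ts" "hs (2 * \<alpha>) (fourier (u \<tau>))" "hsum (2 * \<alpha>) (fourier (u \<tau>)) \<le> e"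
      "\<And>t. t \<ge> \<tau> \<Longrightarrow> energy_ineq \<nu> \<alpha> u \<tau> t"
      using exists_small_time[OF w assms(1) \<alpha> assms(4) e(1) Ts small] by blast
    show ?thesis unfolding strong_after_def
    proof (intro allI impI)
      fix T assume T: "T > Ts"
      \<comment> \<open>The horizon T + 1 keeps the closed interval up to T inside the half-open
        time domain of a weak solution.\<close>
      have T0: "T + 1 > 0" "\<tau> \<le> T" "\<tau> < T" using T Ts \<tau>(2) by auto
      note W = w[OF T0(1)]
      have ms: "mode_solution \<nu> \<alpha> \<tau> T (\<lambda>t. fourier (u t))"
        by (rule weak_solution_mode_solution[OF W assms(1) \<alpha> assms(4) \<tau>(1) T0(2)]) (auto intro: \<tau>(5))
      note reg = mode_regularity[OF C assms(1) T0(3) e ms \<tau>(3,4)]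
      have sub: "{\<tau>..T} \<subseteq> {0..<T + 1}" "{Ts<..<T} \<subseteq> {0..<T + 1}" using \<tau> by auto
      have H: "in_Hs \<alpha> (u t) \<and> Hs_norm \<alpha> (u t) \<le> sqrt (2 powr \<alpha> * (2 * e))" if t: "t \<in> {\<tau>..T}" for t
      proof -
        have tT: "t \<in> {0..<T + 1}" using t sub(1) by blast
        have z: "fourier (u t) 0 = 0" using weak_solution_solenoidal[OF W tT] by (simp add: solenoidal_def)
        have "(\<Sum>k\<in>F. (1 + (norm (freq k))\<^sup>2) powr \<alpha> * (norm (fourier (u t) k))\<^sup>2) \<le> 2 powr \<alpha> * (2 * e)" if "finite F" for F
          by (rule inhomogeneous_sum_le[OF z less_imp_le[OF \<alpha>] that reg(1)[OF that t]])
        from in_Hs_of_bounded_sums(1,2)[OF weak_solution_L2[OF W tT] this]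
        show ?thesis by (simp add: real_le_rsqrt)
      qed
      have "AE t in lebesgue_on {Ts<..<T}. in_Hs \<alpha> (u t) \<and> Hs_norm \<alpha> (u t) \<le> sqrt (2 powr \<alpha> * (2 * e))"
        by (rule AE_I2) (rule H, use \<tau>(2) in auto)
      then have "Linf_Hs Ts T \<alpha> u"
        unfolding Linf_Hs_def using weak_solution_time_measurable[OF W sub(2)] by blast
      moreover have "L2_Hs Ts T (2 * \<alpha>) u"
        by (rule L2_Hs_of_bounded_sums[OF W sub(1), where A="2 * e / \<nu>"]) (use \<tau>(2) \<alpha> reg(2) in auto)
      ultimately show "Linf_Hs Ts T \<alpha> u \<and> L2_Hs Ts T (2 * \<alpha>) u" by blast
    qed
  qed
  then show ?thesis using Ts by blast
qed

end
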